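(* Let $I\subset\mathbb{R}$ be an open interval and let $\mathbf{u}=\mathbf{u}(t,\mathbf{x})\in\mathcal{H}_I$ with Fourier support $S$. Then $\mathbf{u}$ is a solution on $I$ of the Fourier-side Euler system $$\partial_t\mathbf{u}_{\mathbf{n}}+\frac{i}{2}\hat{\mathbb{P}}_{\mathbf{n}}\sum_{\substack{\mathbf{n}_1,\mathbf{n}_2\in S\\ \mathbf{n}_1+\mathbf{n}_2=\mathbf{n}}}\big[(\mathbf{u}_{\mathbf{n}_1}\cdot\mathbf{n}_2)\mathbf{u}_{\mathbf{n}_2}+(\mathbf{u}_{\mathbf{n}_2}\cdot\mathbf{n}_1)\mathbf{u}_{\mathbf{n}_1}\big]=\mathbf{0},\qquad t\in I,\ \mathbf{n}\in\widetilde S:=S\cup[(S+S)\setminus\{\mathbf{0}\}],$$ if and only if $\mathbf{u}$ is independent of time and satisfies one of the following: (i) $S$, the Fourier support of $\mathbf{u}(\mathbf{x})\in\mathcal{H}$, is a subset of a line passing through the origin. (ii) $S$ has two linearly independent points and is a subset of a plane $P$ containing the origin. Moreover, one of the following holds: (a) $\mathbf{u}(\mathbf{x})$ is perpendicular to $P$ everywhere. (b) $\mathbf{u}(\mathbf{x})=\mathbf{u}^\parallel(\mathbf{x})+u^\perp(\mathbf{x})\mathbf{e}^\perp$, where $\mathbf{e}^\perp$ denotes (one of) the unit normal vector to $P$ and $\mathbf{u}^\parallel:\mathbb{R}^3\to\mathbb{R}^3$, $u^\perp:\mathbb{R}^3\to\mathbb{R}$ satisfy the following: - $\mathbf{u}^\parallel\in\mathcal{H}$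 is parallel to $P$ everywhere, and its Fourier support is a subset of a circle on $P$ (with radius $\lambda>0$) centered at the origin and contains at least four points; - $u^\perp(\mathbf{x})=Q(\omega(\mathbf{x}))-\langle Q(\omega)\rangle$, where $\omega(\mathbf{x})$ is the scalar function defined by $\nabla\times\mathbf{u}^\parallel=\lambda\omega\mathbf{e}^\perp$, $Q$ is a polynomial with real coefficients, and $\langle Q(\omega)\rangle$ denotes the zero mode (mean value) of $Q(\omega(\mathbf{x}))$. (iii) $S$ has three linearly independent points and is a subset of a sphere centered at the origin, and $\mathbf{u}(\mathbf{x})$ is a Beltrami flow.
   Context: The dot "$\cdot$" is the $\mathbb{C}$-bilinear dot product on $\mathbb{C}^3$; "$\times$" is the cross product. A set $S\subset\mathbb{R}^3$ is symmetric if $-S=S$. Frequencies are not restricted to a lattice. $\mathcal{H}$ is the set of all real-valued vector fields $\mathbf{u}(\mathbf{x})=\sum_{\mathbf{n}\in S}\mathbf{u}_{\mathbf{n}}e^{i\mathbf{n}\cdot\mathbf{x}}$ on $\mathbb{R}^3$ with $S\subset\mathbb{R}^3\setminus\{\mathbf{0}\}$ finite and symmetric, $\mathbf{u}_{\mathbf{n}}\in\mathbb{C}^3\setminus\{\mathbf{0}\}$, $\mathbf{u}_{-\mathbf{n}}=\overline{\mathbf{u}_{\mathbf{n}}}$, $\mathbf{n}\cdot\mathbf{u}_{\mathbf{n}}=0$ for all $\mathbf{n}\in S$. For an open interval $I\subset\mathbb{R}$, $\mathcal{H}_I$ is the set of all $\mathbf{u}(t,\mathbf{x})=\sum_{\mathbf{n}\in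 S}\mathbf{u}_{\mathbf{n}}(t)e^{i\mathbf{n}\cdot\mathbf{x}}$ on $I\times\mathbb{R}^3$ with $S\subset\mathbb{R}^3\setminus\{\mathbf{0}\}$ finite and symmetric, $\mathbf{u}_{\mathbf{n}}:I\to\mathbb{C}^3$, $\mathbf{u}_{\mathbf{n}}\not\equiv\mathbf{0}$, $\mathbf{u}_{-\mathbf{n}}(t)=\overline{\mathbf{u}_{\mathbf{n}}(t)}$, $\mathbf{n}\cdot\mathbf{u}_{\mathbf{n}}(t)=0$ for all $t\in I$, $\mathbf{n}\in S$. The set $S$ is called the Fourier support of $\mathbf{u}$. Convention: $\mathbf{u}_{\mathbf{n}}=\mathbf{0}$ if $\mathbf{n}\notin S$. Being a solution of the system includes that each $\mathbf{u}_{\mathbf{n}}$ is differentiable in $t$. For $\mathbf{n}\in\mathbb{R}^3\setminus\{\mathbf{0}\}$, $\hat{\mathbb{P}}_{\mathbf{n}}$ is the orthogonal projection in $\mathbb{C}^3$ onto $\{\mathbf{v}\in\mathbb{C}^3:\mathbf{n}\cdot\mathbf{v}=0\}$. The system above is equivalent, after elimination of the pressure, to the incompressible Euler equations $\partial_t\mathbf{u}+(\mathbf{u}\cdot\nabla)\mathbf{u}+\nabla p=\mathbf{0}$, $\nabla\cdot\mathbf{u}=0$ on $I\times\mathbb{R}^3$ for mean-zero fields with finitely many Fourier modes. A field $\mathbf{b}\in\mathcal{H}$ is a Beltrami flow if there is $\lambda\in\mathbb{C}$ with $\nabla\times\mathbf{b}=\lambda\mathbf{b}$. *)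

theory Defs
  imports "HOL-Analysis.Analysis" "HOL-Computational_Algebra.Polynomial"
begin

definition cvec :: "real^3 \<Rightarrow> complex^3" where
  "cvec x = (\<chi> j. complex_of_real (x $ j))"

definition cconj :: "complex^3 \<Rightarrow> complex^3" where
  "cconj v = (\<chi> j. cnj (v $ j))"

(* The complex-bilinear (not Hermitian) dot product. *)
definition cdot :: "complex^3 \<Rightarrow> complex^3 \<Rightarrow> complex" where
  "cdot v w = (\<Sum>j\<in>UNIV. v $ j * w $ j)"

definition wave :: "real^3 \<Rightarrow> real^3 \<Rightarrow> complex" where
  "wave n x = exp (\<i> * complex_of_real (n \<bullet> x))"

(* v is a member of the class H with Fourier support S and coefficients c n (n \<in> S);
   values of c outside S play no role.  Real-valuedness of v is part of its type. *)
definition fourier_expansion ::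
    "(real^3 \<Rightarrow> real^3) \<Rightarrow> (real^3) set \<Rightarrow> (real^3 \<Rightarrow> complex^3) \<Rightarrow> bool" where
  "fourier_expansion v S c \<longleftrightarrow>
     finite S \<and> 0 \<notin> S \<and> uminus ` S = S \<and>
     (\<forall>n\<in>S. c n \<noteq> 0 \<and> c (- n) = cconj (c n) \<and> cdot (cvec n) (c n) = 0) \<and>
     (\<forall>x. cvec (v x) = (\<Sum>n\<in>S. wave n x *s c n))"

definition fourier_support :: "(real^3 \<Rightarrow> real^3) \<Rightarrow> (real^3) set \<Rightarrow> bool" where
  "fourier_support v S \<longleftrightarrow> (\<exists>c. fourier_expansion v S c)"

definition \<H> :: "(real^3 \<Rightarrow> real^3) set" where
  "\<H> = {v. \<exists>S. fourier_support v S}"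

(* u is a member of the class H_I with Fourier support S and coefficients c n t, where
   c n = 0 on I for n \<notin> S.  Coefficients of modes in S may vanish at some times,
   but not identically on I.  Nothing is required outside I. *)
definition fourier_expansion_on ::
    "real set \<Rightarrow> (real \<Rightarrow> real^3 \<Rightarrow> real^3) \<Rightarrow> (real^3) set \<Rightarrow>
     (real^3 \<Rightarrow> real \<Rightarrow> complex^3) \<Rightarrow> bool" where
  "fourier_expansion_on I u S c \<longleftrightarrow>
     finite S \<and> 0 \<notin> S \<and> uminus ` S = S \<and>
     (\<forall>n\<in>S. (\<exists>t\<in>I. c n t \<noteq> 0) \<and>
        (\<forall>t\<in>I. c (- n) t = cconj (c n t) \<and> cdot (cvec n) (c n t) = 0)) \<and>
     (\<forall>n. n \<notin> S \<longrightarrow> (\<forall>t\<in>I. c n t = 0)) \<and>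
     (\<forall>t\<in>I. \<forall>x. cvec (u t x) = (\<Sum>n\<in>S. wave n x *s c n t))"

(* Orthogonal projection onto {w. cdot (cvec n) w = 0}; orthogonality is with respect
   to the Hermitian inner product of complex^3, hence the conjugate. *)
definition leray :: "real^3 \<Rightarrow> complex^3 \<Rightarrow> complex^3" where
  "leray n v = (THE w. cdot (cvec n) w = 0 \<and>
     (\<forall>z. cdot (cvec n) z = 0 \<longrightarrow> cdot (v - w) (cconj z) = 0))"

lemma leray_eq:
  assumes "n \<noteq> 0"
  shows "leray n v = v - (cdot (cvec n) v / complex_of_real (n \<bullet> n)) *s cvec n"
    (is "_ = ?w")
proof -
  have add: "cdot (a - b) d = cdot a d - cdot b d" "cdot d (a - b) = cdot d a - cdot d b"
    "cdot (k *s a) d = k * cdot a d" "cdot d (k *s a) = k * cdot d a" for a b d k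
    by (simp_all add: cdot_def algebra_simps sum_subtractf sum_distrib_left)
  have nn: "cdot (cvec n) (cvec n) = complex_of_real (n \<bullet> n)"
    by (simp add: cdot_def cvec_def inner_vec_def)
  have ncn: "cdot (cvec n) (cconj z) = cnj (cdot (cvec n) z)" for z
    by (simp add: cdot_def cconj_def cvec_def)
  have w0: "cdot (cvec n) ?w = 0"
    using assms by (simp add: add nn)
  have w1: "cdot (v - ?w) (cconj z) = 0" if "cdot (cvec n) z = 0" for z
    using that by (simp add: add ncn)
  show ?thesis
    unfolding leray_def
  proof (rule the_equality)
    show "cdot (cvec n) ?w = 0 \<and>
      (\<forall>z. cdot (cvec n) z = 0 \<longrightarrow> cdot (v - ?w) (cconj z) = 0)"
      using w0 w1 by blast
  next
    fix w
    assume w: "cdot (cvec n) w = 0 \<and>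
      (\<forall>z. cdot (cvec n) z = 0 \<longrightarrow> cdot (v - w) (cconj z) = 0)"
    define d where "d = w - ?w"
    have d0: "cdot (cvec n) d = 0"
      unfolding d_def add(2)[of _ w] using w w0 by simp
    have "cdot (v - ?w) (cconj d) - cdot (v - w) (cconj d) = 0"
      using w w1 d0 by simp
    moreover have "d = (v - ?w) - (v - w)"
      by (simp add: d_def)
    ultimately have dd: "cdot d (cconj d) = 0"
      by (metis add(1))
    have "cdot d (cconj d) = complex_of_real (\<Sum>j\<in>UNIV. (cmod (d $ j))\<^sup>2)"
      by (simp only: cdot_def cconj_def of_real_sum complex_norm_square vec_lambda_beta)
    hence "(\<Sum>j\<in>UNIV. (cmod (d $ j))\<^sup>2) = 0"
      using dd by (metis of_real_eq_0_iff)
    hence "d = 0"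
      by (simp add: sum_nonneg_eq_0_iff vec_eq_iff)
    thus "w = ?w"
      by (simp add: d_def)
  qed
qed

definition euler_solution ::
    "real set \<Rightarrow> (real^3) set \<Rightarrow> (real^3 \<Rightarrow> real \<Rightarrow> complex^3) \<Rightarrow> bool" where
  "euler_solution I S c \<longleftrightarrow>
     (\<forall>n \<in> S \<union> ({n1 + n2 |n1 n2. n1 \<in> S \<and> n2 \<in> S} - {0}). \<forall>t\<in>I.
        c n differentiable (at t) \<and>
        vector_derivative (c n) (at t) +
          (\<i> / 2) *s leray n
            (\<Sum>(n1, n2) \<in> {(n1, n2). n1 \<in> S \<and> n2 \<in> S \<and> n1 + n2 = n}.
               cdot (c n1 t) (cvec n2) *s c n2 t + cdot (c n2 t) (cvec n1) *s c n1 t) = 0)"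

definition partial :: "3 \<Rightarrow> (real^3 \<Rightarrow> real^3) \<Rightarrow> real^3 \<Rightarrow> real^3" where
  "partial j v x = frechet_derivative v (at x) (axis j 1)"

definition curl :: "(real^3 \<Rightarrow> real^3) \<Rightarrow> real^3 \<Rightarrow> real^3" where
  "curl v x = vector
     [partial 2 v x $ 3 - partial 3 v x $ 2,
      partial 3 v x $ 1 - partial 1 v x $ 3,
      partial 1 v x $ 2 - partial 2 v x $ 1]"

definition beltrami :: "(real^3 \<Rightarrow> real^3) \<Rightarrow> bool" where
  "beltrami b \<longleftrightarrow> b \<in> \<H> \<and>
     (\<exists>\<mu>::complex. \<forall>x. cvec (curl b x) = \<mu> *s cvec (b x))"

(* Constant term of a real trigonometric polynomial; it is unique because distinct
   characters wave n are linearly independent. *)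
definition zero_mode :: "(real^3 \<Rightarrow> real) \<Rightarrow> real" where
  "zero_mode f = (THE a. \<exists>T d. finite T \<and> 0 \<notin> T \<and>
     (\<forall>x. complex_of_real (f x) = complex_of_real a + (\<Sum>n\<in>T. d n * wave n x)))"

definition perp_flow :: "(real^3) set \<Rightarrow> (real^3 \<Rightarrow> real^3) \<Rightarrow> bool" where
  "perp_flow P v \<longleftrightarrow> (\<forall>x. \<forall>p\<in>P. orthogonal (v x) p)"

definition planar_circle_flow :: "(real^3) set \<Rightarrow> (real^3 \<Rightarrow> real^3) \<Rightarrow> bool" where
  "planar_circle_flow P v \<longleftrightarrow>
     (\<exists>e vpar vperp. norm e = 1 \<and> (\<forall>p\<in>P. orthogonal e p) \<and>
        (\<forall>x. v x = vpar x + vperp x *\<^sub>R e) \<and>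
        (\<forall>x. vpar x \<in> P) \<and>
        (\<exists>r Spar \<omega> Q. r > 0 \<and>
           fourier_support vpar Spar \<and> Spar \<subseteq> P \<inter> sphere 0 r \<and> card Spar \<ge> 4 \<and>
           (\<forall>x. curl vpar x = (r * \<omega> x) *\<^sub>R e) \<and>
           (\<forall>x. vperp x = poly Q (\<omega> x) - zero_mode (\<lambda>y. poly Q (\<omega> y)))))"

definition has_independent_points :: "nat \<Rightarrow> (real^3) set \<Rightarrow> bool" where
  "has_independent_points k S \<longleftrightarrow> (\<exists>B\<subseteq>S. card B = k \<and> independent B)"

definition case_line :: "(real^3) set \<Rightarrow> bool" where
  "case_line S \<longleftrightarrow> (\<exists>L. subspace L \<and> dim L = 1 \<and> S \<subseteq> L)"

definition case_plane :: "(real^3) set \<Rightarrow> (real^3 \<Rightarrow> real^3) \<Rightarrow> bool" where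
  "case_plane S v \<longleftrightarrow> has_independent_points 2 S \<and>
     (\<exists>P. subspace P \<and> dim P = 2 \<and> S \<subseteq> P \<and> (perp_flow P v \<or> planar_circle_flow P v))"

definition case_sphere :: "(real^3) set \<Rightarrow> (real^3 \<Rightarrow> real^3) \<Rightarrow> bool" where
  "case_sphere S v \<longleftrightarrow> has_independent_points 3 S \<and>
     (\<exists>r>0. S \<subseteq> sphere 0 r) \<and> beltrami v"

end

(* A representation q = a + b with a, b in S that is unique, with q outside S, forces either
   a.u_b = b.u_a = 0 or |a| = |b| together with one linear relation between the directions of u_a
   and u_b.  Such sums come from vertices and edges of the convex hull of S.

   If S spans space, then in the basis of helical vectors the relation along an edge of the hull
   says that the ratio of the two helical components of u is transported by a phase, which is an
   angle that the edge determines.  Let a be of maximal norm.  Around one of the two facets at an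
   edge through a, the total angle is not a multiple of 2 pi, so u_a is purely helical.  Helicity
   with one fixed sign spreads to all frequencies of maximal norm, and then a shorter frequency
   together with some longest one would produce a nonvanishing term outside S.  Hence u is Beltrami.

   If S lies in a plane, u consists of a stream function b, whose equation is {b, Laplace b} = 0,
   and a scalar w that b transports.  Unless supp b lies in a line, it lies in a circle.  Iterating
   {b, .} on w keeps the frequencies inside S; adding an extreme frequency of b repeatedly would
   leave every bounded set.  So the top layer of w consists of multiples k n of points n of supp b
   with coefficients proportional to those of b^k: subtract this power of b and repeat to see that
   w is a polynomial in b.

   A time-dependent solution has, on some subinterval of every interval, coefficients that are each
   identically zero or nowhere zero.  The arguments above apply there and show that the nonlinear
   term vanishes at a dense set of times, hence always. *)
theory Submission
  imports Defs
begin

section \<open>Extreme frequencies\<close>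

text \<open>Inside \<open>S\<close> the equation contains an unknown time derivative, so algebraic
  conditions come only from sums that leave \<open>S\<close>.

  Why 2 pi is never reached around a suitable facet: a helical vector is the square of a spinor, and
  the two helical components acquire opposite phases, so their ratio turns by four times the
  argument of a spinor product. The angle in question must therefore stay below pi / 2. Seen along
  the common edge of two facets, the one whose plane is farther from the origin fits into a
  quadrant, because \<open>S = - S\<close> confines it to the slab of the other one. The argument
  reaches the ends of the common edge, and a longest frequency is always such an end.

  Points of \<open>S\<close> in the interior of an edge spoil the uniqueness of the sum of its ends;
  the relation between the ends is then obtained by starting from both ends.

  In the plane the equation for w is linear once b is steady, and the iterates of the bracket on w
  are its time derivatives up to constants. This is why they cannot leave \<open>S\<close>.

  Coefficients of a solution may vanish at some times, so the set of active frequencies depends on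
  time; hence the passage to subintervals.\<close>

lemma finite_argmax:
  fixes f :: "'a \<Rightarrow> real"
  assumes "finite A" "A \<noteq> {}"
  obtains x where "x \<in> A" "\<And>y. y \<in> A \<Longrightarrow> f y \<le> f x"
proof -
  have "Max (f ` A) \<in> f ` A" using assms by (intro Max_in) auto
  then obtain x where x: "x \<in> A" "Max (f ` A) = f x" by blast
  moreover have "f y \<le> f x" if "y \<in> A" for y
    unfolding x(2)[symmetric] using assms that by (intro Max_ge) auto
  ultimately show thesis using that by blast
qed

text \<open>A ratio test: the functional grows only where \<open>g \<bullet> p > 0\<close>, so the
  level \<open>M\<close> is first reached at the least quotient
  \<open>(M - N \<bullet> p) / (g \<bullet> p)\<close> over these points. Repeated tilts turn a
  supporting plane at a vertex into one through an edge and into one through a facet. The last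
  clause tells when the tilt is a genuine one.\<close>

lemma tilt_to_contact:
  fixes N g :: "'a::real_inner"
  assumes fin: "finite S" and le: "\<And>p. p \<in> S \<Longrightarrow> N \<bullet> p \<le> M"
    and ex: "\<exists>p\<in>S. g \<bullet> p > 0"
  obtains \<tau> q where "\<tau> \<ge> 0" "\<And>p. p \<in> S \<Longrightarrow> (N + \<tau> *\<^sub>R g) \<bullet> p \<le> M"
    "q \<in> S" "g \<bullet> q > 0" "(N + \<tau> *\<^sub>R g) \<bullet> q = M"
    "(\<And>p. p \<in> S \<Longrightarrow> N \<bullet> p = M \<Longrightarrow> g \<bullet> p \<le> 0) \<Longrightarrow> \<tau> > 0"
proof -
  define A where "A = {p\<in>S. g \<bullet> p > 0}"
  define r where "r p = (M - N \<bullet> p) / (g \<bullet> p)" for p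
  have A: "finite A" "A \<noteq> {}" using fin ex by (auto simp: A_def)
  define \<tau> where "\<tau> = Min (r ` A)"
  obtain q where q: "q \<in> A" "\<tau> = r q"
    unfolding \<tau>_def using A Min_in[of "r ` A"] by blast
  have min: "\<tau> \<le> r p" if "p \<in> A" for p
    unfolding \<tau>_def using A that by simp
  have r0: "0 \<le> r p" if "p \<in> A" for p
    using le[of p] that by (auto simp: A_def r_def)
  have \<tau>0: "\<tau> \<ge> 0" using q r0 by simp
  show thesis
  proof (rule that)
    show "\<tau> \<ge> 0" by (rule \<tau>0)
    show "q \<in> S" "g \<bullet> q > 0" using q by (auto simp: A_def)
    then show "(N + \<tau> *\<^sub>R g) \<bullet> q = M"
      using q(2) by (simp add: r_def inner_simps field_simps)
    show "(N + \<tau> *\<^sub>R g) \<bullet> p \<le> M" if "p \<in> S" for p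
    proof (cases "g \<bullet> p > 0")
      case True
      then have "\<tau> \<le> (M - N \<bullet> p) / (g \<bullet> p)" using min[of p] that by (simp add: A_def r_def)
      then show ?thesis using True by (simp add: field_simps inner_simps)
    next
      case False
      then have "\<tau> * (g \<bullet> p) \<le> 0" using \<tau>0 by (simp add: mult_nonneg_nonpos)
      then show ?thesis using le[OF that] by (simp add: inner_simps)
    qed
    show "\<tau> > 0" if *: "\<And>p. p \<in> S \<Longrightarrow> N \<bullet> p = M \<Longrightarrow> g \<bullet> p \<le> 0"
    proof -
      have "q \<in> S" "g \<bullet> q > 0" using q by (auto simp: A_def)
      then have "N \<bullet> q < M" using *[of q] le[of q] by force
      then show ?thesis using q \<open>g \<bullet> q > 0\<close> by (simp add: r_def)
    qed
  qed
qed

text \<open>Strict convexity of the ball. A point of maximal norm is therefore the strict maximum of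
  its own linear functional.\<close>

lemma inner_eq_norm_bound_imp_eq:
  fixes n p :: "'a::real_inner"
  assumes "norm n = R" "norm p \<le> R" "n \<bullet> p \<ge> R\<^sup>2"
  shows "p = n"
proof -
  have "norm p ^ 2 \<le> R ^ 2" using assms by (intro power_mono) auto
  then have "p \<bullet> p \<le> R\<^sup>2" "n \<bullet> n = R\<^sup>2" using assms by (auto simp: dot_square_norm)
  then have "(p - n) \<bullet> (p - n) \<le> 0" using assms(3) by (simp add: inner_simps inner_commute)
  then show ?thesis by (metis inner_eq_zero_iff inner_ge_zero nle_le right_minus_eq)
qed

text \<open>Serves in the plane and in space: there the interaction of two modes carries a weight
  that vanishes when the second frequency has norm \<open>R\<close>, so uniqueness matters only
  among sums whose second summand is short. By contradiction: all extremal sums would be sums of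
  parallel vectors, and this is refuted by passing from one longest point to a neighbouring
  one.\<close>

lemma ball_interior_unique_sum:
  fixes S :: "'a::real_inner set"
  assumes fin: "finite S" and sym: "uminus ` S = S" and z: "0 \<notin> S"
    and ball: "\<And>n. n \<in> S \<Longrightarrow> norm n \<le> R" and V: "n0 \<in> S" "norm n0 = R"
    and B: "p0 \<in> S" "norm p0 < R"
    and line: "\<nexists>w. S \<subseteq> range (\<lambda>t. t *\<^sub>R w)"
  shows "\<exists>n\<in>S. \<exists>p\<in>S. norm n = R \<and> norm p < R \<and> p \<notin> range (\<lambda>t. t *\<^sub>R n) \<and> n + p \<notin> S \<and>
    (\<forall>n'\<in>S. \<forall>p'\<in>S. norm p' < R \<longrightarrow> n' + p' = n + p \<longrightarrow> n' = n \<and> p' = p)"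
proof (rule ccontr)
  assume none: "\<not> ?thesis"
  have H: "p \<in> range (\<lambda>t. t *\<^sub>R n)"
    if "n \<in> S" "norm n = R" "p \<in> S" "norm p < R" "n + p \<notin> S"
      "\<And>n' p'. n' \<in> S \<Longrightarrow> p' \<in> S \<Longrightarrow> norm p' < R \<Longrightarrow> n' + p' = n + p \<Longrightarrow> n' = n \<and> p' = p"
    for n p
  proof (rule ccontr)
    assume "\<not> ?thesis"
    then have "norm n = R \<and> norm p < R \<and> p \<notin> range (\<lambda>t. t *\<^sub>R n) \<and> n + p \<notin> S \<and>
      (\<forall>n'\<in>S. \<forall>p'\<in>S. norm p' < R \<longrightarrow> n' + p' = n + p \<longrightarrow> n' = n \<and> p' = p)"
      using that(2,4,5) by (intro conjI ballI impI; use that(6) in auto)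
    then show False using none that(1,3) by blast
  qed
  have R0: "R > 0" using V z by auto
  define W where "W = {p\<in>S. norm p < R}"
  define V' where "V' = {p\<in>S. norm p = R}"
  have finVW: "finite (V' \<times> W)" "V' \<times> W \<noteq> {}" using fin V B by (auto simp: W_def V'_def)
  \<comment> \<open>The pair with the largest inner product is the natural candidate. It can fail
    only if \<open>p1\<close> lies on the ray of \<open>n1\<close>; a neighbour \<open>q\<close> of
    \<open>n1\<close> will then work with the same \<open>p1\<close>.\<close>
  obtain z where z': "z \<in> V' \<times> W" "\<And>y. y \<in> V' \<times> W \<Longrightarrow> fst y \<bullet> snd y \<le> fst z \<bullet> snd z"
    using finite_argmax[of "V' \<times> W" "\<lambda>z. fst z \<bullet> snd z"] finVW by blast
  define n1 where "n1 = fst z"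
  define p1 where "p1 = snd z"
  define \<mu> where "\<mu> = n1 \<bullet> p1"
  have n1: "n1 \<in> V'" "p1 \<in> W" "\<mu> = n1 \<bullet> p1"
    using z'(1) by (auto simp: n1_def p1_def \<mu>_def)
  have \<mu>: "n \<bullet> p \<le> \<mu>" if "n \<in> V'" "p \<in> W" for n p
    using z'(2)[of "(n,p)"] that by (simp add: n1_def p1_def \<mu>_def)
  have n1S: "n1 \<in> S" "norm n1 = R" "n1 \<noteq> 0" and p1S: "p1 \<in> S" "norm p1 < R"
    using n1 z by (auto simp: V'_def W_def)
  have n1n1: "n1 \<bullet> n1 = R\<^sup>2" using n1S by (simp add: dot_square_norm)
  have "-p1 \<in> W" using p1S sym by (auto simp: W_def)
  then have \<mu>0: "\<mu> \<ge> 0" using \<mu>[OF n1(1), of "-p1"] n1(3) by simp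
  \<comment> \<open>If \<open>f\<close> has the unique maximum \<open>n1\<close> on \<open>S\<close>, then \<open>n1 + p\<close> has only one representation for
    every \<open>p\<close> that is \<open>f\<close>-maximal among the interior points.\<close>
  have ray: "p \<in> range (\<lambda>t. t *\<^sub>R n1)"
    if f: "\<And>n. n \<in> S \<Longrightarrow> n \<noteq> n1 \<Longrightarrow> f \<bullet> n < f \<bullet> n1" and p: "p \<in> W"
      and top: "\<And>p'. p' \<in> W \<Longrightarrow> f \<bullet> p' \<le> f \<bullet> p" and out: "n1 + p \<notin> S" for f p
  proof (rule H)
    show "n1 \<in> S" "norm n1 = R" "p \<in> S" "norm p < R" using n1S p by (auto simp: W_def)
    show "n1 + p \<notin> S" by (rule out)
    fix n' p' assume *: "n' \<in> S" "p' \<in> S" "norm p' < R" "n' + p' = n1 + p"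
    then have e: "f \<bullet> n' + f \<bullet> p' = f \<bullet> n1 + f \<bullet> p" by (metis inner_add_right)
    have "f \<bullet> p' \<le> f \<bullet> p" using top * by (auto simp: W_def)
    then have "n' = n1" using f[OF *(1)] e by fastforce
    then show "n' = n1 \<and> p' = p" using * by simp
  qed
  have strict1: "n1 \<bullet> n < n1 \<bullet> n1" if "n \<in> S" "n \<noteq> n1" for n
    using inner_eq_norm_bound_imp_eq[of n1 R n] ball[OF that(1)] n1S that n1n1 by force
  have top1: "p \<in> range (\<lambda>t. t *\<^sub>R n1)" if "p \<in> W" "n1 \<bullet> p = \<mu>" for p
  proof (rule ray[of n1])
    show "n1 \<bullet> p' \<le> n1 \<bullet> p" if "p' \<in> W" for p' using \<mu> n1 that \<open>n1 \<bullet> p = \<mu>\<close> by simp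
    \<comment> \<open>As \<open>\<mu> \<ge> 0\<close>, the sum is longer than \<open>R\<close> and
      so outside \<open>S\<close>.\<close>
    have "(n1 + p) \<bullet> (n1 + p) > R\<^sup>2"
    proof -
      have "p \<noteq> 0" using that z by (auto simp: W_def)
      then have "p \<bullet> p > 0" by simp
      moreover have "(n1 + p) \<bullet> (n1 + p) = R\<^sup>2 + 2 * \<mu> + p \<bullet> p"
        using that(2) n1n1 by (simp add: inner_simps inner_commute)
      ultimately show ?thesis using \<mu>0 by linarith
    qed
    then have "norm (n1 + p) ^ 2 > R ^ 2" by (simp add: dot_square_norm)
    then have "\<not> norm (n1 + p) \<le> R" by (meson norm_ge_zero power_mono linorder_not_le)
    then show "n1 + p \<notin> S" using ball by blast
  qed (use strict1 that in auto)
  obtain s where s: "p1 = s *\<^sub>R n1" using top1[of p1] n1 by auto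
  have mus: "\<mu> = s * R\<^sup>2" using n1 s n1n1 by simp
  have "s \<noteq> 0" using s p1S z by auto
  moreover have "s \<ge> 0" using \<mu>0 mus R0 by (simp add: zero_le_mult_iff)
  ultimately have s0: "s > 0" by simp
  have s1: "s < 1" using p1S s n1S s0 R0 by auto
  have eq1: "p = p1" if p: "p \<in> W" "n1 \<bullet> p = \<mu>" for p
  proof -
    obtain t where t: "p = t *\<^sub>R n1" using top1[OF p] by auto
    then have "t * R\<^sup>2 = s * R\<^sup>2" using that mus n1n1 by simp
    then show ?thesis using t s R0 by simp
  qed
  obtain p2 where p2: "p2 \<in> S" "p2 \<notin> range (\<lambda>t. t *\<^sub>R n1)" using line by blast
  define g0 where "g0 = p2 - ((n1 \<bullet> p2) / R\<^sup>2) *\<^sub>R n1"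
  have g1: "g0 \<bullet> n1 = 0" using n1n1 R0 by (simp add: g0_def inner_simps inner_commute)
  have "g0 \<noteq> 0" using p2(2) by (auto simp: g0_def)
  moreover have "g0 \<bullet> p2 = g0 \<bullet> g0"
    using g1 by (simp add: g0_def inner_simps inner_commute)
  ultimately have g2: "g0 \<bullet> p2 > 0" by simp
  \<comment> \<open>\<open>g0\<close> is orthogonal to \<open>n1\<close>, so the value at
    \<open>n1\<close> stays \<open>R\<^sup>2\<close> during the tilt, until another point of
    \<open>S\<close> attains it as well.\<close>
  obtain \<tau> q0 where \<tau>: "\<tau> \<ge> 0" "\<And>p. p \<in> S \<Longrightarrow> (n1 + \<tau> *\<^sub>R g0) \<bullet> p \<le> R\<^sup>2"
    "q0 \<in> S" "g0 \<bullet> q0 > 0" "(n1 + \<tau> *\<^sub>R g0) \<bullet> q0 = R\<^sup>2"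
    "(\<And>p. p \<in> S \<Longrightarrow> n1 \<bullet> p = R\<^sup>2 \<Longrightarrow> g0 \<bullet> p \<le> 0) \<Longrightarrow> \<tau> > 0"
  proof (rule tilt_to_contact[of S n1 "R\<^sup>2" g0])
    show "finite S" by (rule fin)
    show "n1 \<bullet> p \<le> R\<^sup>2" if "p \<in> S" for p using strict1[OF that] n1n1 by (cases "p = n1") auto
    show "\<exists>p\<in>S. g0 \<bullet> p > 0" using p2 g2 by blast
  qed blast
  have \<tau>pos: "\<tau> > 0"
  proof (rule \<tau>(6))
    fix p assume "p \<in> S" "n1 \<bullet> p = R\<^sup>2"
    then have "p = n1" using strict1[of p] n1n1 by force
    then show "g0 \<bullet> p \<le> 0" using g1 by simp
  qed
  define f where "f = n1 + \<tau> *\<^sub>R g0"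
  have fn1: "f \<bullet> n1 = R\<^sup>2" using n1n1 g1 by (simp add: f_def inner_simps)
  \<comment> \<open>Before the contact, \<open>n1\<close> is the strict maximum of the tilted
    functional \<open>ft\<close>, so by \<open>ray\<close> its best short point is on the ray of
    \<open>n1\<close> and has value at most \<open>s * R\<^sup>2\<close>. The bound survives the
    limit \<open>\<tau>\<close>.\<close>
  have fW: "f \<bullet> p \<le> s * R\<^sup>2" if p: "p \<in> W" for p
  proof (cases "g0 \<bullet> p > 0")
    case False
    then have "\<tau> * (g0 \<bullet> p) \<le> 0" using \<tau>pos by (simp add: mult_nonneg_nonpos)
    then show ?thesis using \<mu>[OF n1(1) p] mus by (simp add: f_def inner_simps)
  next
    case True
    have "\<tau> \<le> (s * R\<^sup>2 - n1 \<bullet> p) / (g0 \<bullet> p)"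
    proof (rule dense_le_bounded[OF \<tau>pos])
      fix t assume t: "0 < t" "t < \<tau>"
      define ft where "ft = n1 + t *\<^sub>R g0"
      have ft1: "ft \<bullet> n1 = R\<^sup>2" using n1n1 g1 by (simp add: ft_def inner_simps)
      have uniq: "ft \<bullet> n < ft \<bullet> n1" if n: "n \<in> S" "n \<noteq> n1" for n
      proof (cases "g0 \<bullet> n > 0")
        case True
        then have "t * (g0 \<bullet> n) < \<tau> * (g0 \<bullet> n)" using t by simp
        then have "ft \<bullet> n < f \<bullet> n" by (simp add: ft_def f_def inner_simps)
        then show ?thesis using \<tau>(2)[OF n(1)] ft1 by (simp add: f_def)
      next
        case False
        then have "t * (g0 \<bullet> n) \<le> 0" using t by (simp add: mult_nonneg_nonpos)
        then show ?thesis using strict1[OF n] ft1[unfolded ft_def] n1n1 g1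
          unfolding ft_def by (simp add: inner_simps)
      qed
      have finW: "finite W" "W \<noteq> {}" using fin B by (auto simp: W_def)
      obtain p' where p': "p' \<in> W" and p'top: "\<And>x. x \<in> W \<Longrightarrow> ft \<bullet> x \<le> ft \<bullet> p'"
        using finite_argmax[of W "\<lambda>p. ft \<bullet> p"] finW by blast
      have "ft \<bullet> p' \<ge> ft \<bullet> p1" using p'top n1 by simp
      then have ge: "ft \<bullet> p' \<ge> s * R\<^sup>2" using s ft1 by simp
      have out: "n1 + p' \<notin> S"
      proof
        assume "n1 + p' \<in> S"
        then have "ft \<bullet> (n1 + p') \<le> ft \<bullet> n1" using uniq by (cases "n1 + p' = n1") force+
        moreover have "s * R\<^sup>2 > 0" using s0 R0 by simp
        ultimately show False using ge by (simp add: inner_simps)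
      qed
      obtain s' where s': "p' = s' *\<^sub>R n1" using ray[OF uniq p' p'top out] by auto
      have "s' * R\<^sup>2 \<le> s * R\<^sup>2" using \<mu>[OF n1(1) p'] s' mus n1n1 by simp
      then have "ft \<bullet> p' \<le> s * R\<^sup>2" using s' ft1 by simp
      then have "ft \<bullet> p \<le> s * R\<^sup>2" using p'top[OF p] by simp
      then show "t \<le> (s * R\<^sup>2 - n1 \<bullet> p) / (g0 \<bullet> p)"
        using True by (simp add: field_simps ft_def inner_simps)
    qed
    then show ?thesis using True by (simp add: field_simps f_def inner_simps)
  qed
  \<comment> \<open>Among the other contact points, \<open>q\<close> has the largest component along
    \<open>n1\<close>. Exchanging \<open>q\<close> for one of them forces the short summand up to
    the level \<open>\<mu>\<close>, where it can only be \<open>p1\<close>.\<close>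
  define T where "T = {n\<in>S. f \<bullet> n = R\<^sup>2} - {n1}"
  have "q0 \<in> T" using \<tau>(3-5) g1 by (auto simp: T_def f_def)
  moreover have "finite T" using fin by (simp add: T_def)
  ultimately obtain q where q: "q \<in> T" "\<And>x. x \<in> T \<Longrightarrow> n1 \<bullet> x \<le> n1 \<bullet> q"
    using finite_argmax[of T "\<lambda>x. n1 \<bullet> x"] by blast
  have sR: "s * R\<^sup>2 < R\<^sup>2" using s1 R0 by simp
  have qS: "q \<in> S" "f \<bullet> q = R\<^sup>2" "q \<noteq> n1" using q by (auto simp: T_def)
  have "q \<notin> W" using fW[of q] sR qS by auto
  then have qR: "norm q = R" using ball[OF qS(1)] qS by (auto simp: W_def)
  have qV: "q \<in> V'" using qR qS by (simp add: V'_def)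
  have "p1 \<in> range (\<lambda>t. t *\<^sub>R q)"
  proof (rule H)
    show "q \<in> S" "norm q = R" "p1 \<in> S" "norm p1 < R" using qS qR p1S by auto
    show "q + p1 \<notin> S"
    proof
      assume "q + p1 \<in> S"
      then have "f \<bullet> (q + p1) \<le> R\<^sup>2" using \<tau>(2) by (simp add: f_def)
      moreover have "f \<bullet> p1 = s * R\<^sup>2" using s fn1 by simp
      moreover have "s * R\<^sup>2 > 0" using s0 R0 by simp
      ultimately show False using qS by (simp add: inner_simps)
    qed
    fix n' p' assume *: "n' \<in> S" "p' \<in> S" "norm p' < R" "n' + p' = q + p1"
    then have p'W: "p' \<in> W" by (simp add: W_def)
    have "f \<bullet> n' + f \<bullet> p' = f \<bullet> q + f \<bullet> p1" using *(4) by (metis inner_add_right)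
    then have "f \<bullet> n' + f \<bullet> p' = R\<^sup>2 + s * R\<^sup>2" using qS s fn1 by simp
    moreover have "f \<bullet> n' \<le> R\<^sup>2" using \<tau>(2)[OF *(1)] by (simp add: f_def)
    ultimately have fn': "f \<bullet> n' = R\<^sup>2" using fW[OF p'W] by simp
    have e1: "n1 \<bullet> n' + n1 \<bullet> p' = n1 \<bullet> q + \<mu>" using *(4) n1(3) by (metis inner_add_right)
    show "n' = q \<and> p' = p1"
    proof (cases "n' = n1")
      case False
      then have "n' \<in> T" using fn' * by (simp add: T_def)
      then have "n1 \<bullet> p' = \<mu>" using q(2)[of n'] e1 \<mu>[OF n1(1) p'W] by simp
      then have "p' = p1" using eq1 p'W by simp
      then show ?thesis using * by simp
    next
      case True
      \<comment> \<open>Exchanging \<open>q\<close> for \<open>n1\<close> would give a short point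
        whose product with \<open>q\<close> exceeds the maximum \<open>\<mu>\<close>, unless
        \<open>q = n1\<close>.\<close>
      then have "p' = q + p1 - n1" using * by (simp add: algebra_simps)
      then have "p' = q - (1 - s) *\<^sub>R n1" using s by (simp add: algebra_simps)
      then have "q \<bullet> p' = R\<^sup>2 - (1 - s) * (q \<bullet> n1)"
        using qR by (simp add: inner_simps dot_square_norm)
      then have "(1 - s) * R\<^sup>2 \<le> (1 - s) * (q \<bullet> n1)"
        using \<mu>[OF qV p'W] mus by (simp add: algebra_simps)
      then have "q \<bullet> n1 \<ge> R\<^sup>2" using s1 by simp
      then have "n1 = q" using inner_eq_norm_bound_imp_eq[of q R n1] qR n1S by simp
      then show ?thesis using qS by simp
    qed
  qed
  then obtain t where t: "s *\<^sub>R n1 = t *\<^sub>R q" using s by auto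
  then have "norm (s *\<^sub>R n1) = norm (t *\<^sub>R q)" by simp
  then have "\<bar>s\<bar> = \<bar>t\<bar>" using qR n1S R0 by simp
  moreover have "f \<bullet> (s *\<^sub>R n1) = f \<bullet> (t *\<^sub>R q)" using t by simp
  then have "s = t" using fn1 qS R0 by simp
  ultimately have "n1 = q" using t s0 by simp
  then show False using qS by simp
qed

unbundle cross3_syntax

section \<open>Vector algebra\<close>

lemma cdot_linear:
  "cdot (a + b) d = cdot a d + cdot b d" "cdot d (a + b) = cdot d a + cdot d b"
  "cdot (a - b) d = cdot a d - cdot b d" "cdot d (a - b) = cdot d a - cdot d b"
  "cdot (k *s a) d = k * cdot a d" "cdot d (k *s a) = k * cdot d a"
  "cdot (- a) d = - cdot a d" "cdot d (- a) = - cdot d a"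
  "cdot 0 d = 0" "cdot d 0 = 0"
  by (simp_all add: cdot_def algebra_simps sum.distrib sum_subtractf sum_distrib_left sum_negf)

lemma cdot_sum: "cdot (sum f A) d = (\<Sum>x\<in>A. cdot (f x) d)" "cdot d (sum f A) = (\<Sum>x\<in>A. cdot d (f x))"
  by (induction A rule: infinite_finite_induct) (simp_all add: cdot_linear)

lemma cdot_commute: "cdot a b = cdot b a"
  by (simp add: cdot_def mult.commute)

lemma cdot_cconj: "cdot (cconj a) (cconj b) = cnj (cdot a b)"
  by (simp add: cdot_def cconj_def)

lemma cdot_cvec: "cdot (cvec x) (cvec y) = complex_of_real (x \<bullet> y)"
  by (simp add: cdot_def cvec_def inner_vec_def)

lemma cvec_linear:
  "cvec (x + y) = cvec x + cvec y" "cvec (x - y) = cvec x - cvec y" "cvec (- x) = - cvec x"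
  "cvec (r *\<^sub>R x) = complex_of_real r *s cvec x" "cvec 0 = 0"
  by (simp_all add: cvec_def vec_eq_iff)

lemma cvec_eq_iff [simp]: "cvec x = cvec y \<longleftrightarrow> x = y"
  by (simp add: cvec_def vec_eq_iff)

lemma cconj_cvec [simp]: "cconj (cvec x) = cvec x"
  by (simp add: cconj_def cvec_def vec_eq_iff)

lemma cconj_linear:
  "cconj (a + b) = cconj a + cconj b" "cconj (a - b) = cconj a - cconj b"
  "cconj (k *s a) = cnj k *s cconj a" "cconj (cconj a) = a" "cconj 0 = 0"
  by (simp_all add: cconj_def vec_eq_iff)

definition ccross :: "complex^3 \<Rightarrow> complex^3 \<Rightarrow> complex^3" where
  "ccross a b = vector [a$2 * b$3 - a$3 * b$2, a$3 * b$1 - a$1 * b$3, a$1 * b$2 - a$2 * b$1]"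

lemmas ccomp = ccross_def cdot_def cvec_def cconj_def cross3_def sum_3 vec_eq_iff forall_3
  vector_3 vector_smult_component vector_add_component vector_minus_component vector_uminus_component

lemma ccross_linear:
  "ccross (a + b) d = ccross a d + ccross b d" "ccross d (a + b) = ccross d a + ccross d b"
  "ccross (a - b) d = ccross a d - ccross b d" "ccross d (a - b) = ccross d a - ccross d b"
  "ccross (k *s a) d = k *s ccross a d" "ccross d (k *s a) = k *s ccross d a"
  "ccross (- a) d = - ccross a d" "ccross d (- a) = - ccross d a"
  "ccross 0 d = 0" "ccross d 0 = 0"
  by (simp_all add: ccomp algebra_simps)

lemma ccross_skew: "ccross a b = - ccross b a"
  by (simp add: ccomp algebra_simps)

lemma ccross_cvec: "ccross (cvec x) (cvec y) = cvec (x \<times> y)"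
  by (simp add: ccomp)

lemma cconj_ccross: "cconj (ccross a b) = ccross (cconj a) (cconj b)"
  by (simp add: ccomp)

lemma cdot_ccross_self:
  "cdot a (ccross a b) = 0" "cdot b (ccross a b) = 0" "cdot (ccross a b) a = 0" "cdot (ccross a b) b = 0"
  by (simp_all add: ccomp algebra_simps)

lemma cdot_ccross_rotate: "cdot a (ccross b d) = cdot d (ccross a b)"
  by (simp add: ccomp algebra_simps)

lemma ccross_ccross: "ccross a (ccross b d) = cdot a d *s b - cdot a b *s d"
  by (simp add: ccomp algebra_simps)

definition cre :: "complex^3 \<Rightarrow> real^3" where "cre w = (\<chi> j. Re (w $ j))"
definition cim :: "complex^3 \<Rightarrow> real^3" where "cim w = (\<chi> j. Im (w $ j))"

lemma cdot_cvec_left: "cdot (cvec n) w = Complex (n \<bullet> cre w) (n \<bullet> cim w)"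
  by (simp add: complex_eq_iff cre_def cim_def ccomp inner_vec_def)

lemma cvec_zero_iff: "w = 0 \<longleftrightarrow> cre w = 0 \<and> cim w = 0"
  by (auto simp: cre_def cim_def vec_eq_iff complex_eq_iff)

lemma orthogonal_frame_zero:
  assumes "n \<times> m \<noteq> 0" "n \<bullet> p = 0" "m \<bullet> p = 0" "(n \<times> m) \<bullet> p = 0"
  shows "p = 0"
proof -
  have "p \<times> (n \<times> m) = (p \<bullet> m) *\<^sub>R n - (p \<bullet> n) *\<^sub>R m" by (rule Lagrange)
  then have "p \<times> (n \<times> m) = 0" using assms by (simp add: inner_commute)
  then show ?thesis using assms norm_and_cross_eq_0[of p "n \<times> m"] by (simp add: inner_commute)
qed

lemma orthogonal_frame_zero_complex:
  assumes "n \<times> m \<noteq> 0" "cdot (cvec n) w = 0" "cdot (cvec m) w = 0" "cdot (cvec (n \<times> m)) w = 0"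
  shows "w = 0"
  using assms orthogonal_frame_zero[of n m "cre w"] orthogonal_frame_zero[of n m "cim w"]
  by (simp add: cdot_cvec_left cvec_zero_iff Complex_eq_0)

lemma cross_eq_0_iff_parallel:
  assumes "n \<noteq> 0"
  shows "n \<times> p = 0 \<longleftrightarrow> p \<in> range (\<lambda>t. t *\<^sub>R n)"
proof
  assume "n \<times> p = 0"
  then show "p \<in> range (\<lambda>t. t *\<^sub>R n)"
    using assms by (auto simp: cross_eq_0 collinear_lemma)
qed (auto simp: cross_mult_right)

text \<open>Crossing with \<open>n\<close> rotates the plane orthogonal to \<open>n\<close> and only
  rescales a helical \<open>w\<close>, so orthogonality to \<open>v\<close> entails orthogonality to
  \<open>n \<times> v\<close>, which completes a frame. Thus a helical mode pairs nontrivially with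
  every frequency that is not parallel to its own.\<close>

lemma helical_orthogonal_zero:
  assumes hel: "ccross (cvec n) w = (\<i> * complex_of_real (\<sigma> * norm n)) *s w"
    and "\<sigma> \<noteq> 0" "n \<times> v \<noteq> 0" "cdot (cvec v) w = 0"
  shows "w = 0"
proof -
  have n0: "n \<noteq> 0" using assms by auto
  define c where "c = \<sigma> * norm n"
  have c: "c \<noteq> 0" using n0 assms by (simp add: c_def)
  have "cdot (cvec n) (ccross (cvec n) w) = 0" by (simp add: cdot_ccross_self)
  then have nw: "cdot (cvec n) w = 0" using c by (simp add: hel cdot_linear flip: c_def)
  have "cdot (cvec v) (ccross (cvec n) w) = 0" using assms by (simp add: cdot_linear)
  then have "cdot w (ccross (cvec v) (cvec n)) = 0" by (simp add: cdot_ccross_rotate)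
  then have "cdot (cvec (n \<times> v)) w = 0"
    by (metis ccross_cvec ccross_skew cdot_commute cdot_linear(8) neg_equal_0_iff_equal)
  then show ?thesis using orthogonal_frame_zero_complex[of n v w] assms nw by simp
qed

lemma leray_eq_0_iff:
  assumes "n \<noteq> 0"
  shows "leray n v = 0 \<longleftrightarrow> (\<exists>k. v = k *s cvec n)"
proof
  assume "leray n v = 0"
  then show "\<exists>k. v = k *s cvec n" unfolding leray_eq[OF assms] by auto
next
  assume "\<exists>k. v = k *s cvec n"
  then obtain k where k: "v = k *s cvec n" by blast
  then show "leray n v = 0" using assms
    by (simp add: leray_eq cdot_linear cdot_cvec)
qed

lemma cdot_leray:
  assumes "n \<noteq> 0" "n \<bullet> x = 0"
  shows "cdot (cvec x) (leray n v) = cdot (cvec x) v"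
  using assms by (simp add: leray_eq cdot_linear cdot_cvec inner_commute)

text \<open>Three projections decide. The one on \<open>n \<times> m\<close> is the linear relation.
  Those on \<open>n\<close> and on \<open>m\<close> both compute the product of the two pairings,
  and comparing them yields equal norms unless the product is zero. If just one pairing vanished,
  its mode would be orthogonal to a whole frame.\<close>

lemma interaction_dichotomy:
  assumes ind: "n \<times> m \<noteq> 0" and nu: "cdot (cvec n) u = 0" and mv: "cdot (cvec m) v = 0"
    and nz: "u \<noteq> 0" "v \<noteq> 0"
    and eq: "cdot u (cvec m) *s v + cdot v (cvec n) *s u = k *s cvec (n + m)"
  shows "(cdot u (cvec m) = 0 \<and> cdot v (cvec n) = 0) \<or>
    (cdot u (cvec m) \<noteq> 0 \<and> cdot v (cvec n) \<noteq> 0 \<and> norm n = norm m \<and>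
     cdot u (cvec m) * cdot v (cvec (n \<times> m)) + cdot v (cvec n) * cdot u (cvec (n \<times> m)) = 0)"
proof -
  define a where "a = cdot u (cvec m)"
  define b where "b = cdot v (cvec n)"
  let ?e = "n \<times> m"
  have eq': "a *s v + b *s u = k *s cvec (n + m)" using eq by (simp add: a_def b_def)
  have "cdot (a *s v + b *s u) (cvec ?e) = 0"
    unfolding eq' by (simp add: cdot_linear cdot_cvec inner_simps dot_cross_self)
  then have e: "a * cdot v (cvec ?e) + b * cdot u (cvec ?e) = 0" by (simp add: cdot_linear)
  have "cdot (a *s v + b *s u) (cvec n) = k * complex_of_real ((n + m) \<bullet> n)"
    unfolding eq' by (simp add: cdot_linear cdot_cvec)
  then have en: "a * b = k * complex_of_real ((n + m) \<bullet> n)"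
    using nu by (simp add: cdot_linear cdot_commute[of u] b_def)
  have "cdot (a *s v + b *s u) (cvec m) = k * complex_of_real ((n + m) \<bullet> m)"
    unfolding eq' by (simp add: cdot_linear cdot_cvec)
  then have em: "a * b = k * complex_of_real ((n + m) \<bullet> m)"
    using mv by (simp add: cdot_linear cdot_commute[of v] a_def mult.commute)
  have a0: "b = 0" if "a = 0"
  proof (rule ccontr)
    assume "b \<noteq> 0"
    then have "cdot u (cvec ?e) = 0" using e that by simp
    then have "u = 0" using orthogonal_frame_zero_complex[of n m u] ind nu that
      by (simp add: a_def cdot_commute[of u])
    then show False using nz by simp
  qed
  have b0: "a = 0" if "b = 0"
  proof (rule ccontr)
    assume "a \<noteq> 0"
    then have "cdot v (cvec ?e) = 0" using e that by simp
    then have "v = 0" using orthogonal_frame_zero_complex[of n m v] ind mv that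
      by (simp add: b_def cdot_commute[of v])
    then show False using nz by simp
  qed
  show ?thesis
  proof (cases "a = 0")
    case True
    then show ?thesis using a0 by (simp add: a_def b_def)
  next
    case False
    then have "b \<noteq> 0" using b0 by blast
    then have "k \<noteq> 0" using False en by auto
    then have "(n + m) \<bullet> n = (n + m) \<bullet> m" using en em by (simp del: of_real_add)
    then have "n \<bullet> n = m \<bullet> m" by (simp add: inner_simps inner_commute)
    then have "norm n = norm m" by (simp add: norm_eq_sqrt_inner)
    then show ?thesis using False \<open>b \<noteq> 0\<close> e by (simp add: a_def b_def)
  qed
qed

section \<open>The nonlinear term\<close>

definition euler_sum :: "(real^3) set \<Rightarrow> (real^3 \<Rightarrow> complex^3) \<Rightarrow> real^3 \<Rightarrow> complex^3" where
  "euler_sum S U q = (\<Sum>(n1, n2) \<in> {(n1, n2). n1 \<in> S \<and> n2 \<in> S \<and> n1 + n2 = q}.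
     cdot (U n1) (cvec n2) *s U n2 + cdot (U n2) (cvec n1) *s U n1)"

lemma sum_over_pairs:
  fixes f :: "'a::ab_group_add \<Rightarrow> 'a \<Rightarrow> 'b::comm_monoid_add"
  assumes "finite S"
  shows "(\<Sum>(n1, n2) \<in> {(n1, n2). n1 \<in> S \<and> n2 \<in> S \<and> n1 + n2 = q}. f n1 n2) =
    (\<Sum>n\<in>S. if q - n \<in> S then f n (q - n) else 0)"
proof -
  have "(\<Sum>n\<in>S. if q - n \<in> S then f n (q - n) else 0) = (\<Sum>n\<in>{n\<in>S. q - n \<in> S}. f n (q - n))"
    using assms by (simp add: sum.inter_filter)
  also have "\<dots> = (\<Sum>(n1, n2) \<in> {(n1, n2). n1 \<in> S \<and> n2 \<in> S \<and> n1 + n2 = q}. f n1 n2)"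
    by (rule sum.reindex_bij_witness[where i = fst and j = "\<lambda>n. (n, q - n)"]) (auto simp: algebra_simps)
  finally show ?thesis by simp
qed

lemma sum_over_pairs_swap:
  fixes f :: "'a::ab_group_add \<Rightarrow> 'a \<Rightarrow> 'b::comm_monoid_add"
  shows "(\<Sum>(n1, n2) \<in> {(n1, n2). n1 \<in> S \<and> n2 \<in> S \<and> n1 + n2 = q}. f n1 n2) =
    (\<Sum>(n1, n2) \<in> {(n1, n2). n1 \<in> S \<and> n2 \<in> S \<and> n1 + n2 = q}. f n2 n1)"
  by (rule sum.reindex_bij_witness[where i = "\<lambda>(a,b). (b,a)" and j = "\<lambda>(a,b). (b,a)"]) (auto simp: algebra_simps)

text \<open>Convective form: the symmetrised sum is twice either half, and since \<open>U n\<close>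
  is orthogonal to \<open>n\<close>, the factor \<open>q - n\<close> in the pairing may be replaced
  by \<open>q\<close>. Extension of \<open>U\<close> by zero removes the side condition
  \<open>q - n \<in> S\<close>.\<close>

lemma euler_sum_eq:
  assumes "finite S" and U0: "\<And>n. n \<notin> S \<Longrightarrow> U n = 0"
    and div: "\<And>n. n \<in> S \<Longrightarrow> cdot (cvec n) (U n) = 0"
  shows "euler_sum S U q = 2 *s (\<Sum>n\<in>S. cdot (U n) (cvec q) *s U (q - n))"
proof -
  have "euler_sum S U q = (\<Sum>(n1, n2) \<in> {(n1, n2). n1 \<in> S \<and> n2 \<in> S \<and> n1 + n2 = q}. cdot (U n1) (cvec n2) *s U n2)
    + (\<Sum>(n1, n2) \<in> {(n1, n2). n1 \<in> S \<and> n2 \<in> S \<and> n1 + n2 = q}. cdot (U n2) (cvec n1) *s U n1)"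
    unfolding euler_sum_def by (simp add: case_prod_unfold sum.distrib)
  also have "\<dots> = 2 *s (\<Sum>(n1, n2) \<in> {(n1, n2). n1 \<in> S \<and> n2 \<in> S \<and> n1 + n2 = q}. cdot (U n1) (cvec n2) *s U n2)"
    by (subst (2) sum_over_pairs_swap) (simp add: vec_eq_iff)
  also have "(\<Sum>(n1, n2) \<in> {(n1, n2). n1 \<in> S \<and> n2 \<in> S \<and> n1 + n2 = q}. cdot (U n1) (cvec n2) *s U n2)
    = (\<Sum>n\<in>S. if q - n \<in> S then cdot (U n) (cvec (q - n)) *s U (q - n) else 0)"
    by (rule sum_over_pairs[OF assms(1)])
  also have "\<dots> = (\<Sum>n\<in>S. cdot (U n) (cvec q) *s U (q - n))"
    using U0 div by (intro sum.cong) (auto simp: cvec_linear cdot_linear cdot_commute[of "U _"])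
  finally show ?thesis .
qed

lemma euler_sum_pair:
  assumes "a \<in> S" "b \<in> S" "a \<noteq> b"
    and "\<And>n m. n \<in> S \<Longrightarrow> m \<in> S \<Longrightarrow> n + m = a + b \<Longrightarrow> n = a \<or> n = b"
  shows "euler_sum S U (a + b) = 2 *s (cdot (U a) (cvec b) *s U b + cdot (U b) (cvec a) *s U a)"
proof -
  have "{(n1, n2). n1 \<in> S \<and> n2 \<in> S \<and> n1 + n2 = a + b} = {(a,b), (b,a)}"
    using assms by (auto simp: algebra_simps) (metis add.commute add_left_cancel)+
  then show ?thesis using assms(3) by (simp add: euler_sum_def vec_eq_iff)
qed

text \<open>Fourier form of (u . grad) u = grad |u|^2 / 2 - u x curl u. A multiple of u may be
  subtracted from the curl because u x u = 0, so modes with eigenvalue \<open>\<mu>\<close> drop out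
  of the sum, and the gradient is invisible to the projection.\<close>

lemma euler_sum_ccross:
  assumes fin: "finite S" and U0: "\<And>n. n \<notin> S \<Longrightarrow> U n = 0"
    and div: "\<And>n. n \<in> S \<Longrightarrow> cdot (cvec n) (U n) = 0"
  shows "\<exists>k. euler_sum S U q =
    k *s cvec q - 2 *s (\<Sum>n\<in>S. ccross (U n) (ccross (cvec (q - n)) (U (q - n)) - \<mu> *s U (q - n)))"
proof -
  let ?P = "{(n1, n2). n1 \<in> S \<and> n2 \<in> S \<and> n1 + n2 = q}"
  have sw: "(\<Sum>n\<in>S. f n (q - n)) = (\<Sum>n\<in>S. f (q - n) n)"
    if f: "\<And>n. n \<notin> S \<Longrightarrow> (\<forall>m. f n m = (0::complex^3) \<and> f m n = 0)" for f
  proof -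
    have "(\<Sum>n\<in>S. f n (q - n)) = (\<Sum>n\<in>S. if q - n \<in> S then f n (q - n) else 0)"
      using f by (intro sum.cong) auto
    also have "\<dots> = (\<Sum>n\<in>S. if q - n \<in> S then f (q - n) n else 0)"
      using sum_over_pairs[OF fin, where q = q and f = f]
        sum_over_pairs[OF fin, where q = q and f = "\<lambda>a b. f b a"]
        sum_over_pairs_swap[where S = S and q = q and f = f] by simp
    also have "\<dots> = (\<Sum>n\<in>S. f (q - n) n)"
      using f by (intro sum.cong) auto
    finally show ?thesis .
  qed
  have "(\<Sum>n\<in>S. ccross (U n) (U (q - n))) = (\<Sum>n\<in>S. ccross (U (q - n)) (U n))"
    by (rule sw) (simp add: U0 ccross_linear)
  also have "\<dots> = - (\<Sum>n\<in>S. ccross (U n) (U (q - n)))"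
    by (subst ccross_skew) (simp add: sum_negf)
  finally have c0: "(\<Sum>n\<in>S. ccross (U n) (U (q - n))) = 0"
    by (simp add: vec_eq_iff)
  define G where "G = (\<Sum>n\<in>S. cdot (U n) (U (q - n)) *s cvec (q - n))"
  have "G = (\<Sum>n\<in>S. cdot (U (q - n)) (U n) *s cvec n)"
    unfolding G_def by (rule sw) (simp add: U0 cdot_linear)
  then have "G + G = (\<Sum>n\<in>S. cdot (U n) (U (q - n)) *s cvec (q - n)) + (\<Sum>n\<in>S. cdot (U (q - n)) (U n) *s cvec n)"
    unfolding G_def by simp
  also have "\<dots> = (\<Sum>n\<in>S. cdot (U n) (U (q - n))) *s cvec q"
    by (simp add: sum.distrib[symmetric] vec.scale_sum_left cdot_commute[of "U (q - _)"]
        flip: vec.scale_right_distrib cvec_linear)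
  finally have GG: "2 *s G = (\<Sum>n\<in>S. cdot (U n) (U (q - n))) *s cvec q"
    by (simp add: vec_eq_iff)
  have "cdot (U n) (cvec q) *s U (q - n) = cdot (U n) (U (q - n)) *s cvec (q - n)
      - ccross (U n) (ccross (cvec (q - n)) (U (q - n)) - \<mu> *s U (q - n)) - \<mu> *s ccross (U n) (U (q - n))"
    if "n \<in> S" for n
  proof -
    have "cdot (U n) (cvec q) = cdot (U n) (cvec (q - n))"
      using div[OF that] by (simp add: cvec_linear cdot_linear cdot_commute[of "U n"])
    then show ?thesis by (simp add: ccross_linear ccross_ccross vec_eq_iff algebra_simps)
  qed
  then have "(\<Sum>n\<in>S. cdot (U n) (cvec q) *s U (q - n)) =
     G - (\<Sum>n\<in>S. ccross (U n) (ccross (cvec (q - n)) (U (q - n)) - \<mu> *s U (q - n)))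
      - \<mu> *s (\<Sum>n\<in>S. ccross (U n) (U (q - n)))"
    by (simp add: sum_subtractf G_def vec.scale_sum_right)
  then have "euler_sum S U q = 2 *s (G - (\<Sum>n\<in>S. ccross (U n) (ccross (cvec (q - n)) (U (q - n)) - \<mu> *s U (q - n))))"
    using euler_sum_eq[of S U q, OF fin U0 div] c0 by simp
  then have "euler_sum S U q = (\<Sum>n\<in>S. cdot (U n) (U (q - n))) *s cvec q
     - 2 *s (\<Sum>n\<in>S. ccross (U n) (ccross (cvec (q - n)) (U (q - n)) - \<mu> *s U (q - n)))"
    unfolding GG[symmetric] by (simp add: vec_eq_iff algebra_simps)
  then show ?thesis by blast
qed

section \<open>Independence of characters\<close>

lemma wave_add: "wave n (x + y) = wave n x * wave n y"
  by (simp add: wave_def inner_simps exp_add[symmetric] algebra_simps)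

lemma wave_0 [simp]: "wave n 0 = 1" "wave 0 x = 1"
  by (simp_all add: wave_def)

lemma wave_mult: "wave n x * wave m x = wave (n + m) x"
  by (simp add: wave_def inner_simps exp_add[symmetric] algebra_simps)

lemma wave_separate:
  assumes "n \<noteq> m"
  shows "\<exists>y. wave n y \<noteq> wave m y"
proof
  define y where "y = (pi / ((n - m) \<bullet> (n - m))) *\<^sub>R (n - m)"
  have "(n - m) \<bullet> y = pi" using assms by (simp add: y_def)
  then have "n \<bullet> y = m \<bullet> y + pi" by (simp add: inner_simps)
  then have "wave n y = - wave m y"
    by (simp add: wave_def algebra_simps exp_add)
  then show "wave n y \<noteq> wave m y" by (simp add: wave_def)
qed

text \<open>Artin's argument: subtract \<open>wave m y\<close> times the relation at
  \<open>x\<close> from the relation at \<open>x + y\<close>. This eliminates \<open>m\<close>,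
  while \<open>n\<close> survives for a \<open>y\<close> that separates the two characters.\<close>

lemma wave_independent:
  assumes "finite T" "\<And>x. (\<Sum>n\<in>T. d n * wave n x) = 0" "n \<in> T"
  shows "d n = 0"
  using assms
proof (induction T arbitrary: d n rule: finite_induct)
  case (insert m T)
  have T0: "d n = 0" if n: "n \<in> T" for n
  proof -
    obtain y where y: "wave n y \<noteq> wave m y" using wave_separate[of n m] insert n by auto
    have "(\<Sum>n\<in>T. (d n * (wave n y - wave m y)) * wave n x) = 0" for x
    proof -
      have "(\<Sum>n\<in>insert m T. d n * wave n (x + y)) - wave m y * (\<Sum>n\<in>insert m T. d n * wave n x) = 0"
        using insert.prems(1) by simp
      then show ?thesis
        using insert.hyps by (simp add: wave_add sum_distrib_left sum_subtractf[symmetric] algebra_simps)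
    qed
    then have "d n * (wave n y - wave m y) = 0" using insert.IH[of "\<lambda>n. d n * (wave n y - wave m y)" n] n by blast
    then show ?thesis using y by simp
  qed
  have "(\<Sum>n\<in>insert m T. d n * wave n 0) = 0" using insert.prems(1) by blast
  then have "d m = 0" using T0 insert.hyps by simp
  then show ?case using T0 insert.prems by blast
qed simp

lemma wave_independent_vec:
  fixes c :: "real^3 \<Rightarrow> complex^3"
  assumes "finite T" "\<And>x. (\<Sum>n\<in>T. wave n x *s c n) = 0" "n \<in> T"
  shows "c n = 0"
proof -
  have "c n $ j = 0" for j
  proof (rule wave_independent[OF assms(1) _ assms(3), of "\<lambda>n. c n $ j"])
    fix x show "(\<Sum>n\<in>T. c n $ j * wave n x) = 0"
      using arg_cong[OF assms(2)[of x], of "\<lambda>v. v $ j"] by (simp add: sum_component mult.commute)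
  qed
  then show ?thesis by (simp add: vec_eq_iff)
qed

section \<open>Transport by a planar stream function\<close>

text \<open>Oriented area in the plane with normal \<open>e\<close>; for vectors of that plane it
  vanishes exactly when they are parallel.\<close>

definition cr :: "real^3 \<Rightarrow> real^3 \<Rightarrow> real^3 \<Rightarrow> real" where
  "cr e n p = e \<bullet> (n \<times> p)"

lemma cr_linear:
  "cr e (n + m) p = cr e n p + cr e m p" "cr e p (n + m) = cr e p n + cr e p m"
  "cr e (n - m) p = cr e n p - cr e m p" "cr e p (n - m) = cr e p n - cr e p m"
  "cr e (t *\<^sub>R n) p = t * cr e n p" "cr e p (t *\<^sub>R n) = t * cr e p n"
  "cr e n n = 0" "cr e 0 p = 0" "cr e p 0 = 0"
  by (simp_all add: cr_def cross_add_left cross_add_right Cross3.left_diff_distrib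
      Cross3.right_diff_distrib cross_mult_left cross_mult_right inner_simps)

lemma cr_skew: "cr e n p = - cr e p n"
  unfolding cr_def by (subst cross_skew) simp

lemma planar_cross:
  assumes "norm e = 1" "e \<bullet> n = 0" "e \<bullet> p = 0"
  shows "n \<times> p = cr e n p *\<^sub>R e"
proof -
  have "e \<times> (n \<times> p) = (e \<bullet> p) *\<^sub>R n - (e \<bullet> n) *\<^sub>R p" by (rule Lagrange)
  then have "e \<times> (n \<times> p) = 0" using assms by simp
  moreover have "e \<noteq> 0" using assms by auto
  ultimately obtain t where "n \<times> p = t *\<^sub>R e" using cross_eq_0_iff_parallel by blast
  moreover have "e \<bullet> e = 1" using assms by (simp add: dot_square_norm)
  ultimately show ?thesis by (simp add: cr_def)
qed

lemma cr_eq_0_imp_parallel: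
  assumes "norm e = 1" "e \<bullet> n = 0" "e \<bullet> p = 0" "n \<noteq> 0" "cr e n p = 0"
  obtains t where "p = t *\<^sub>R n"
proof -
  have "n \<times> p = 0" using planar_cross[of e n p] assms by simp
  then show thesis using cross_eq_0_iff_parallel[of n p] assms that by blast
qed

text \<open>Fourier coefficients of the Poisson bracket of \<open>b\<close> and \<open>g\<close> up
  to a constant: \<open>cr e n q\<close> equals \<open>cr e n (q - n)\<close>, the area spanned by
  the two interacting frequencies. It describes transport of \<open>g\<close> by the flow with
  stream function \<open>b\<close>.\<close>

definition bracket :: "real^3 \<Rightarrow> (real^3) set \<Rightarrow> (real^3 \<Rightarrow> complex) \<Rightarrow> (real^3 \<Rightarrow> complex) \<Rightarrow> real^3 \<Rightarrow> complex" where
  "bracket e S b g q = (\<Sum>n\<in>S. complex_of_real (cr e n q) * b n * g (q - n))"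

text \<open>Multiplication by the trigonometric polynomial with coefficients \<open>b\<close>. Its
  iterates on \<open>delta\<close>, the constant function 1, are the coefficients of the powers of
  that polynomial.\<close>

definition mulop :: "(real^3) set \<Rightarrow> (real^3 \<Rightarrow> complex) \<Rightarrow> (real^3 \<Rightarrow> complex) \<Rightarrow> real^3 \<Rightarrow> complex" where
  "mulop S b g q = (\<Sum>n\<in>S. b n * g (q - n))"

definition delta :: "real^3 \<Rightarrow> complex" where "delta q = (if q = 0 then 1 else 0)"

lemma bracket_nonzero:
  assumes "bracket e S b g q \<noteq> 0"
  obtains n where "n \<in> S" "g (q - n) \<noteq> 0"
proof (rule ccontr)
  assume "\<not> thesis"
  then have "g (q - n) = 0" if "n \<in> S" for n
    using that \<open>\<And>n. n \<in> S \<Longrightarrow> g (q - n) \<noteq> 0 \<Longrightarrow> thesis\<close> by blast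
  then have "bracket e S b g q = 0" unfolding bracket_def by (intro sum.neutral) simp
  then show False using assms by simp
qed

lemma bracket_diff: "bracket e S b (\<lambda>q. g q - a * h q) = (\<lambda>q. bracket e S b g q - a * bracket e S b h q)"
  by (rule ext) (simp add: bracket_def algebra_simps sum_subtractf sum_distrib_left)

lemma bracket_zero: "bracket e S b (\<lambda>q. 0) = (\<lambda>q. 0)"
  by (rule ext) (simp add: bracket_def)

lemma bracket_delta: "bracket e S b delta = (\<lambda>q. 0)"
  by (rule ext) (auto simp: bracket_def delta_def cr_linear intro!: sum.neutral)

text \<open>Product rule {b, b g} = b {b, g}: the extra term is {b, b} g, which cancels under the
  exchange of the two copies of \<open>b\<close>.\<close>

lemma bracket_mulop:
  assumes "finite S"
  shows "bracket e S b (mulop S b g) = mulop S b (bracket e S b g)"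
proof (rule ext)
  fix q
  define F where "F n m = b n * b m * g (q - n - m)" for n m
  have F: "F n m = F m n" for n m by (simp add: F_def algebra_simps)
  have "bracket e S b (mulop S b g) q = (\<Sum>n\<in>S. \<Sum>m\<in>S. complex_of_real (cr e n q) * F n m)"
    by (simp add: bracket_def mulop_def F_def sum_distrib_left algebra_simps)
  moreover have "mulop S b (bracket e S b g) q = (\<Sum>m\<in>S. \<Sum>n\<in>S. complex_of_real (cr e n (q - m)) * F m n)"
    by (simp add: bracket_def mulop_def F_def sum_distrib_left algebra_simps)
  moreover have "(\<Sum>m\<in>S. \<Sum>n\<in>S. complex_of_real (cr e n (q - m)) * F m n)
    = (\<Sum>n\<in>S. \<Sum>m\<in>S. complex_of_real (cr e n q) * F n m) - (\<Sum>n\<in>S. \<Sum>m\<in>S. complex_of_real (cr e n m) * F n m)"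
    by (subst sum.swap) (simp add: F cr_linear algebra_simps sum_subtractf)
  moreover have "(\<Sum>n\<in>S. \<Sum>m\<in>S. complex_of_real (cr e n m) * F n m) = - (\<Sum>n\<in>S. \<Sum>m\<in>S. complex_of_real (cr e n m) * F n m)"
  proof -
    have "(\<Sum>n\<in>S. \<Sum>m\<in>S. complex_of_real (cr e n m) * F n m) = (\<Sum>m\<in>S. \<Sum>n\<in>S. complex_of_real (cr e n m) * F n m)"
      by (rule sum.swap)
    also have "\<dots> = (\<Sum>m\<in>S. \<Sum>n\<in>S. - (complex_of_real (cr e m n) * F m n))"
      by (intro sum.cong refl) (subst cr_skew, simp add: F)
    finally show ?thesis by (simp add: sum_negf)
  qed
  ultimately show "bracket e S b (mulop S b g) q = mulop S b (bracket e S b g) q" by simp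
qed

lemma bracket_mulop_power:
  assumes "finite S"
  shows "bracket e S b ((mulop S b ^^ k) delta) = (\<lambda>q. 0)"
proof (induction k)
  case (Suc k)
  have "mulop S b (\<lambda>q. 0) = (\<lambda>q. 0)" by (rule ext) (simp add: mulop_def)
  then show ?case using Suc by (simp add: bracket_mulop[OF assms])
qed (simp add: bracket_delta)

lemma finite_support_convolution:
  fixes g h :: "real^3 \<Rightarrow> complex"
  assumes "finite S" "finite {q. g q \<noteq> 0}" and h: "\<And>q. h q = (\<Sum>n\<in>S. a n q * g (q - n))"
  shows "finite {q. h q \<noteq> 0}"
proof (rule finite_subset)
  show "{q. h q \<noteq> 0} \<subseteq> (\<lambda>(n, p). n + p) ` Sigma S (\<lambda>_. {q. g q \<noteq> 0})"
  proof
    fix q assume "q \<in> {q. h q \<noteq> 0}"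
    then obtain n where "n \<in> S" "a n q * g (q - n) \<noteq> 0" unfolding h by (auto elim: sum.not_neutral_contains_not_neutral)
    then show "q \<in> (\<lambda>(n, p). n + p) ` Sigma S (\<lambda>_. {q. g q \<noteq> 0})"
      by (intro image_eqI[of _ _ "(n, q - n)"]) auto
  qed
qed (use assms in auto)

lemma finite_support_bracket:
  assumes "finite S" "finite {q. g q \<noteq> 0}"
  shows "finite {q. bracket e S b g q \<noteq> 0}"
  by (rule finite_support_convolution[OF assms, where a = "\<lambda>n q. complex_of_real (cr e n q) * b n"])
     (simp add: bracket_def)

lemma finite_support_mulop_power:
  assumes "finite S"
  shows "finite {q. (mulop S b ^^ k) delta q \<noteq> 0}"
proof (induction k)
  case 0
  show ?case by (simp add: delta_def)
next
  case (Suc k)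
  show ?case using finite_support_convolution[OF assms Suc, where a = "\<lambda>n q. b n"]
    by (simp add: mulop_def)
qed

text \<open>All that remains of the time evolution in the algebra below: for a steady
  \<open>b\<close> the iterates are time derivatives of \<open>w\<close> up to constants, so their
  frequencies stay in a fixed finite set.\<close>

definition orbit_bounded :: "real^3 \<Rightarrow> (real^3) set \<Rightarrow> (real^3 \<Rightarrow> complex) \<Rightarrow> (real^3 \<Rightarrow> complex) \<Rightarrow> bool" where
  "orbit_bounded e S b g \<longleftrightarrow> (\<exists>B. \<forall>j q. (bracket e S b ^^ j) g q \<noteq> 0 \<longrightarrow> norm q \<le> B)"

lemma orbit_bounded_bracket: "orbit_bounded e S b g \<Longrightarrow> orbit_bounded e S b (bracket e S b g)"
  unfolding orbit_bounded_def by (metis comp_apply funpow_Suc_right)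

lemma orbit_bounded_diff:
  assumes "orbit_bounded e S b g" "bracket e S b h = (\<lambda>q. 0)" "finite {q. h q \<noteq> 0}"
  shows "orbit_bounded e S b (\<lambda>q. g q - a * h q)"
proof -
  obtain B where B: "\<And>j q. (bracket e S b ^^ j) g q \<noteq> 0 \<Longrightarrow> norm q \<le> B"
    using assms(1) unfolding orbit_bounded_def by blast
  obtain C where C: "\<And>q. h q \<noteq> 0 \<Longrightarrow> norm q \<le> C"
  proof -
    have "bounded {q. h q \<noteq> 0}" using assms(3) by (rule finite_imp_bounded)
    then show thesis using that by (auto simp: bounded_iff)
  qed
  have "(bracket e S b ^^ Suc j) (\<lambda>q. g q - a * h q) = (bracket e S b ^^ Suc j) g" for j
    by (simp add: funpow_Suc_right bracket_diff assms(2) del: funpow.simps)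
  then have "norm q \<le> max B C" if "(bracket e S b ^^ j) (\<lambda>q. g q - a * h q) q \<noteq> 0" for j q
    using that B[of j q] B[of 0 q] C[of q] by (cases j) (force simp del: funpow.simps(2))+
  then show ?thesis unfolding orbit_bounded_def by blast
qed

text \<open>Adding the strict maximum \<open>n1\<close> of \<open>f\<close> on \<open>S\<close> moves the top of the support
  of \<open>g\<close>, so a nonparallel top escapes to infinity under iteration.\<close>

lemma orbit_top_parallel:
  assumes fin: "finite S" and n1: "n1 \<in> S" "b n1 \<noteq> 0"
    and f: "\<And>n. n \<in> S \<Longrightarrow> n \<noteq> n1 \<Longrightarrow> f \<bullet> n < f \<bullet> n1"
    and m: "g m \<noteq> 0" and top: "\<And>p. g p \<noteq> 0 \<Longrightarrow> f \<bullet> p \<le> f \<bullet> m"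
    and orb: "orbit_bounded e S b g"
  shows "cr e n1 m = 0"
proof (rule ccontr)
  assume cr: "cr e n1 m \<noteq> 0"
  let ?L = "bracket e S b"
  have main: "(?L ^^ j) g (m + real j *\<^sub>R n1) \<noteq> 0 \<and>
      (\<forall>p. (?L ^^ j) g p \<noteq> 0 \<longrightarrow> f \<bullet> p \<le> f \<bullet> (m + real j *\<^sub>R n1))" for j
  proof (induction j)
    case 0
    then show ?case using m top by simp
  next
    case (Suc j)
    let ?g = "(?L ^^ j) g" let ?m = "m + real j *\<^sub>R n1"
    have e: "m + real (Suc j) *\<^sub>R n1 = n1 + ?m" by (simp add: algebra_simps)
    have "?L ?g (n1 + ?m) = (\<Sum>n\<in>S. if n = n1 then complex_of_real (cr e n1 (n1 + ?m)) * b n1 * ?g ?m else 0)"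
      unfolding bracket_def[of e S b ?g]
    proof (rule sum.cong[OF refl])
      fix n assume n: "n \<in> S"
      show "complex_of_real (cr e n (n1 + ?m)) * b n * ?g (n1 + ?m - n) =
        (if n = n1 then complex_of_real (cr e n1 (n1 + ?m)) * b n1 * ?g ?m else 0)"
      proof (cases "n = n1")
        case False
        then have "f \<bullet> (n1 + ?m - n) > f \<bullet> ?m" using f[OF n] by (simp add: inner_simps)
        then have "?g (n1 + ?m - n) = 0" using Suc by (meson linorder_not_le)
        then show ?thesis using False by simp
      qed (simp add: algebra_simps)
    qed
    also have "\<dots> = complex_of_real (cr e n1 m) * b n1 * ?g ?m"
      using fin n1 by (simp add: cr_linear)
    finally have "?L ?g (n1 + ?m) \<noteq> 0" using cr n1 Suc by simp
    moreover have "f \<bullet> p \<le> f \<bullet> (n1 + ?m)" if "?L ?g p \<noteq> 0" for p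
    proof -
      obtain n where n: "n \<in> S" "?g (p - n) \<noteq> 0"
        using bracket_nonzero[OF \<open>?L ?g p \<noteq> 0\<close>] by blast
      then have "f \<bullet> (p - n) \<le> f \<bullet> ?m" using Suc by blast
      moreover have "f \<bullet> n \<le> f \<bullet> n1" using f[OF n(1)] by (cases "n = n1") auto
      ultimately show ?thesis by (simp add: inner_simps)
    qed
    ultimately show ?case unfolding e by simp
  qed
  obtain B where B: "\<And>j q. (?L ^^ j) g q \<noteq> 0 \<Longrightarrow> norm q \<le> B"
    using orb unfolding orbit_bounded_def by blast
  have n10: "norm n1 > 0" using cr by (auto simp: cr_linear)
  obtain j :: nat where j: "(B + norm m) / norm n1 < real j" using reals_Archimedean2 by blast
  have "norm (m + real j *\<^sub>R n1) \<le> B" using main B by blast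
  moreover have "norm (real j *\<^sub>R n1) \<le> norm (m + real j *\<^sub>R n1) + norm m"
    by (metis add.commute add_diff_cancel_left' norm_triangle_ineq4)
  ultimately have "real j * norm n1 \<le> B + norm m" by simp
  then show False using j n10 by (simp add: field_simps)
qed

lemma affine_le_limit:
  fixes a b :: real
  assumes "\<And>t. 0 < t \<Longrightarrow> t < 1 \<Longrightarrow> a + t * b \<le> 0"
  shows "a + b \<le> 0"
proof (rule ccontr)
  assume "\<not> a + b \<le> 0"
  then have ab: "a + b > 0" by simp
  define d where "d = min (1/2) ((a + b) / (2 * (\<bar>b\<bar> + 1)))"
  have d: "0 < d" "d < 1" "d \<le> (a + b) / (2 * (\<bar>b\<bar> + 1))" using ab by (auto simp: d_def)
  have "a + (1 - d) * b \<le> 0" using assms[of "1 - d"] d by simp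
  then have "a + b \<le> d * b" by (simp add: algebra_simps)
  also have "\<dots> \<le> d * (\<bar>b\<bar> + 1)" using d by (intro mult_left_mono) auto
  also have "\<dots> \<le> (a + b) / 2"
    using d(3) by (simp add: field_simps)
  finally show False using ab by simp
qed

definition stream_poly :: "(real^3) set \<Rightarrow> (real^3 \<Rightarrow> complex) \<Rightarrow> (real^3 \<Rightarrow> complex) \<Rightarrow> bool" where
  "stream_poly S b g \<longleftrightarrow> (\<exists>a K. \<forall>q. g q = (\<Sum>k<K. a k * (mulop S b ^^ k) delta q))"

lemma stream_poly_zero: "(\<And>q. g q = 0) \<Longrightarrow> stream_poly S b g"
  unfolding stream_poly_def by (rule exI[of _ "\<lambda>_. 0"], rule exI[of _ 0]) simp

lemma stream_poly_add:
  assumes "stream_poly S b (\<lambda>q. g q - w * (mulop S b ^^ l) delta q)"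
  shows "stream_poly S b g"
proof -
  obtain a K where aK: "\<And>q. g q - w * (mulop S b ^^ l) delta q = (\<Sum>k<K. a k * (mulop S b ^^ k) delta q)"
    using assms unfolding stream_poly_def by blast
  define K' where "K' = max K (Suc l)"
  define a' where "a' k = (if k < K then a k else 0) + (if k = l then w else 0)" for k
  have "g q = (\<Sum>k<K'. a' k * (mulop S b ^^ k) delta q)" for q
  proof -
    have "(\<Sum>k<K'. a' k * (mulop S b ^^ k) delta q) =
      (\<Sum>k<K'. if k < K then a k * (mulop S b ^^ k) delta q else 0) +
      (\<Sum>k<K'. if k = l then w * (mulop S b ^^ k) delta q else 0)"
      unfolding sum.distrib[symmetric] by (rule sum.cong) (auto simp: a'_def algebra_simps)
    also have "(\<Sum>k<K'. if k < K then a k * (mulop S b ^^ k) delta q else 0) = (\<Sum>k<K. a k * (mulop S b ^^ k) delta q)"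
      by (rule sum.mono_neutral_cong_right) (auto simp: K'_def)
    also have "(\<Sum>k<K'. if k = l then w * (mulop S b ^^ k) delta q else 0) = w * (mulop S b ^^ l) delta q"
      by (simp add: K'_def)
    finally show ?thesis using aK[of q] by (simp add: algebra_simps)
  qed
  then show ?thesis unfolding stream_poly_def by blast
qed

lemma stream_poly_imp_bracket_0:
  assumes "finite S" "stream_poly S b g"
  shows "bracket e S b g q = 0"
proof -
  obtain a K where g: "\<And>q. g q = (\<Sum>k<K. a k * (mulop S b ^^ k) delta q)"
    using assms unfolding stream_poly_def by blast
  have "bracket e S b g q = (\<Sum>n\<in>S. \<Sum>k<K. a k * (complex_of_real (cr e n q) * b n * (mulop S b ^^ k) delta (q - n)))"
    unfolding bracket_def g by (simp add: sum_distrib_left algebra_simps)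
  also have "\<dots> = (\<Sum>k<K. a k * bracket e S b ((mulop S b ^^ k) delta) q)"
    by (subst sum.swap) (simp add: bracket_def sum_distrib_left)
  finally show ?thesis by (simp add: bracket_mulop_power[OF assms(1)])
qed

section \<open>Stream functions with frequencies on a circle\<close>

locale circle_stream =
  fixes e :: "real^3" and S :: "(real^3) set" and b :: "real^3 \<Rightarrow> complex" and r :: real
  assumes fin: "finite S" and e1: "norm e = 1" and r0: "r > 0" and sym: "uminus ` S = S"
    and plane: "n \<in> S \<Longrightarrow> e \<bullet> n = 0" and circle: "n \<in> S \<Longrightarrow> norm n = r"
    and b0: "n \<in> S \<Longrightarrow> b n \<noteq> 0"
    and spans: "\<exists>n\<in>S. \<exists>m\<in>S. cr e n m \<noteq> 0"
begin

text \<open>The class on which the reduction works: closed under the bracket and under subtraction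
  of multiples of powers of \<open>b\<close>.\<close>

definition adm :: "(real^3 \<Rightarrow> complex) \<Rightarrow> bool" where
  "adm g \<longleftrightarrow> finite {q. g q \<noteq> 0} \<and> (\<forall>q. g q \<noteq> 0 \<longrightarrow> e \<bullet> q = 0) \<and> orbit_bounded e S b g"

lemma sq: "n \<in> S \<Longrightarrow> n \<bullet> n = r\<^sup>2" and nz: "n \<in> S \<Longrightarrow> n \<noteq> 0"
  using circle[of n] r0 by (auto simp: dot_square_norm)

lemma strict: "n \<in> S \<Longrightarrow> norm p \<le> r \<Longrightarrow> p \<noteq> n \<Longrightarrow> n \<bullet> p < r\<^sup>2"
  using inner_eq_norm_bound_imp_eq[of n r p] circle by force

lemma minus_mem: "n \<in> S \<Longrightarrow> - n \<in> S"
  using sym by blast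

lemma cr_parallel:
  assumes "n \<in> S" "e \<bullet> p = 0" "cr e n p = 0"
  obtains t where "p = t *\<^sub>R n"
  using cr_eq_0_imp_parallel[OF e1 plane[OF assms(1)] assms(2) nz[OF assms(1)] assms(3)] that by blast

lemma exists_nonparallel:
  assumes "n \<in> S"
  obtains m where "m \<in> S" "cr e n m \<noteq> 0"
proof (rule ccontr)
  assume "\<not> thesis"
  then have z: "cr e n m = 0" if "m \<in> S" for m using \<open>\<And>m. m \<in> S \<Longrightarrow> cr e n m \<noteq> 0 \<Longrightarrow> thesis\<close> that by blast
  obtain x y where xy: "x \<in> S" "y \<in> S" "cr e x y \<noteq> 0" using spans by blast
  obtain s where "x = s *\<^sub>R n" using cr_parallel[OF assms plane[OF xy(1)] z[OF xy(1)]] by blast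
  moreover obtain t where "y = t *\<^sub>R n" using cr_parallel[OF assms plane[OF xy(2)] z[OF xy(2)]] by blast
  ultimately have "x = s *\<^sub>R n" "y = t *\<^sub>R n" by auto
  then show False using xy by (simp add: cr_linear)
qed

lemma adm_bracket: "adm g \<Longrightarrow> adm (bracket e S b g)"
  unfolding adm_def
proof (intro conjI allI impI; elim conjE)
  fix q assume *: "\<forall>q. g q \<noteq> 0 \<longrightarrow> e \<bullet> q = 0" "bracket e S b g q \<noteq> 0"
  obtain n where "n \<in> S" "g (q - n) \<noteq> 0" using bracket_nonzero[OF *(2)] by blast
  then show "e \<bullet> q = 0" using * plane[of n] by (auto simp: inner_simps)
qed (auto intro: finite_support_bracket[OF fin] orbit_bounded_bracket)

lemma ray_top:
  assumes g: "adm g" "g p0 \<noteq> 0" and n: "n \<in> S"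
    and f: "\<And>x. x \<in> S \<Longrightarrow> x \<noteq> n \<Longrightarrow> f \<bullet> x < f \<bullet> n"
  obtains t where "g (t *\<^sub>R n) \<noteq> 0" "\<And>p. g p \<noteq> 0 \<Longrightarrow> f \<bullet> p \<le> t * (f \<bullet> n)"
proof -
  obtain m where m: "g m \<noteq> 0" "\<And>p. g p \<noteq> 0 \<Longrightarrow> f \<bullet> p \<le> f \<bullet> m"
    using finite_argmax[of "{q. g q \<noteq> 0}" "\<lambda>p. f \<bullet> p"] g unfolding adm_def by auto
  have "cr e n m = 0"
    by (rule orbit_top_parallel[where S = S and b = b and f = f and g = g, OF fin n b0[OF n]]) (use f m g in \<open>auto simp: adm_def\<close>)
  then obtain t where t: "m = t *\<^sub>R n" using cr_parallel[OF n, of m] m g unfolding adm_def by blast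
  then show thesis using that[of t] m by auto
qed

text \<open>Neighbouring vertices of the inscribed polygon: both have norm \<open>r\<close>, so
  \<open>n + n'\<close> takes the same value at \<open>n\<close> and \<open>n'\<close>, and it is
  larger there than at any other vertex. For antipodal points this functional would be zero.\<close>

definition adjacent :: "real^3 \<Rightarrow> real^3 \<Rightarrow> bool" where
  "adjacent n n' \<longleftrightarrow> n \<in> S \<and> n' \<in> S \<and> n \<noteq> n' \<and> n' \<noteq> - n \<and>
     (\<forall>x\<in>S. x \<noteq> n \<longrightarrow> x \<noteq> n' \<longrightarrow> (n + n') \<bullet> x < (n + n') \<bullet> n)"

lemma adjacent_pos:
  assumes "adjacent n n'" shows "r\<^sup>2 + n \<bullet> n' > 0" "cr e n n' \<noteq> 0"
proof -
  have *: "n \<in> S" "n' \<in> S" "n \<noteq> n'" "n' \<noteq> - n" using assms by (auto simp: adjacent_def)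
  have "(- n) \<bullet> n' < r\<^sup>2" using strict[OF minus_mem[OF *(1)], of n'] circle * by simp
  then show "r\<^sup>2 + n \<bullet> n' > 0" by simp
  show "cr e n n' \<noteq> 0"
  proof
    assume "cr e n n' = 0"
    then obtain t where t: "n' = t *\<^sub>R n" using cr_parallel[OF *(1) plane[OF *(2)]] by blast
    then have "\<bar>t\<bar> * r = r" using circle[OF *(1)] circle[OF *(2)] by simp
    then have "t = 1 \<or> t = -1" using r0 by auto
    then show False using t * by auto
  qed
qed

text \<open>The functional \<open>n + n'\<close> has two maxima on \<open>S\<close>, so
  \<open>ray_top\<close> does not apply to it. It is the limit of \<open>n + t *\<^sub>R n'\<close>
  for \<open>t < 1\<close>, each with strict maximum \<open>n\<close>. Only finitely many multiples
  of \<open>n\<close> lie in the support of \<open>g\<close>, and the largest of them serves for all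
  \<open>t\<close>.\<close>

lemma ray_bound:
  assumes g: "adm g" "g p0 \<noteq> 0" and adj: "adjacent n n'"
  obtains t where "g (t *\<^sub>R n) \<noteq> 0" "\<And>p. g p \<noteq> 0 \<Longrightarrow> (n + n') \<bullet> p \<le> t * (r\<^sup>2 + n \<bullet> n')"
proof -
  have nn: "n \<in> S" "n' \<in> S" "n \<noteq> n'" "n' \<noteq> - n"
    "\<And>x. x \<in> S \<Longrightarrow> x \<noteq> n \<Longrightarrow> x \<noteq> n' \<Longrightarrow> (n + n') \<bullet> x < (n + n') \<bullet> n"
    using adj unfolding adjacent_def by blast+
  define A where "A = {t. g (t *\<^sub>R n) \<noteq> 0}"
  have "finite A"
  proof (rule finite_imageD)
    show "finite ((\<lambda>t. t *\<^sub>R n) ` A)"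
      by (rule finite_subset[of _ "{q. g q \<noteq> 0}"]) (use g in \<open>auto simp: A_def adm_def\<close>)
    show "inj_on (\<lambda>t. t *\<^sub>R n) A" using nz[OF nn(1)] by (auto simp: inj_on_def)
  qed
  have step: "\<exists>u\<in>A. \<forall>p. g p \<noteq> 0 \<longrightarrow> (n + t *\<^sub>R n') \<bullet> p \<le> u * ((n + t *\<^sub>R n') \<bullet> n)" if t: "0 < t" "t < 1" for t
  proof -
    have "(n + t *\<^sub>R n') \<bullet> x < (n + t *\<^sub>R n') \<bullet> n" if x: "x \<in> S" "x \<noteq> n" for x
    proof (cases "x = n'")
      case True
      have "n' \<bullet> n < r\<^sup>2" using strict[OF nn(2), of n] circle nn by simp
      then have "(1 - t) * (n \<bullet> n') < (1 - t) * r\<^sup>2" using t by (simp add: inner_commute)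
      then show ?thesis using True sq nn by (simp add: inner_simps inner_commute algebra_simps)
    next
      case False
      have "t * ((n + n') \<bullet> x) < t * ((n + n') \<bullet> n)" using nn(5)[OF x False] t by simp
      moreover have "(1 - t) * (n \<bullet> x) < (1 - t) * (n \<bullet> n)"
        using strict[OF nn(1), of x] circle x t sq nn(1) by simp
      ultimately show ?thesis by (simp add: inner_simps algebra_simps)
    qed
    then obtain u where "g (u *\<^sub>R n) \<noteq> 0" "\<And>p. g p \<noteq> 0 \<Longrightarrow> (n + t *\<^sub>R n') \<bullet> p \<le> u * ((n + t *\<^sub>R n') \<bullet> n)"
      using ray_top[OF g nn(1), of "n + t *\<^sub>R n'"] by blast
    then show ?thesis by (auto simp: A_def)
  qed
  have "A \<noteq> {}" using step[of "1/2"] by auto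
  then obtain T where T: "T \<in> A" "\<And>u. u \<in> A \<Longrightarrow> u \<le> T" using finite_argmax[OF \<open>finite A\<close>, of "\<lambda>x. x"] by blast
  show thesis
  proof (rule that[of T])
    show "g (T *\<^sub>R n) \<noteq> 0" using T by (simp add: A_def)
    fix p assume p: "g p \<noteq> 0"
    have "(n \<bullet> p - T * r\<^sup>2) + (n' \<bullet> p - T * (n \<bullet> n')) \<le> 0"
    proof (rule affine_le_limit)
      fix t :: real assume t: "0 < t" "t < 1"
      obtain u where u: "u \<in> A" "(n + t *\<^sub>R n') \<bullet> p \<le> u * ((n + t *\<^sub>R n') \<bullet> n)" using step[OF t] p by blast
      have "t * (r\<^sup>2 + n \<bullet> n') > 0" "(1 - t) * r\<^sup>2 > 0" using t adjacent_pos[OF adj] r0 by simp_all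
      then have "(n + t *\<^sub>R n') \<bullet> n > 0" using sq[OF nn(1)] by (simp add: inner_simps inner_commute algebra_simps)
      then have "u * ((n + t *\<^sub>R n') \<bullet> n) \<le> T * ((n + t *\<^sub>R n') \<bullet> n)" using T(2)[OF u(1)] by simp
      then show "n \<bullet> p - T * r\<^sup>2 + t * (n' \<bullet> p - T * (n \<bullet> n')) \<le> 0"
        using u(2) sq[OF nn(1)] by (simp add: inner_simps inner_commute algebra_simps)
    qed
    then show "(n + n') \<bullet> p \<le> T * (r\<^sup>2 + n \<bullet> n')" by (simp add: inner_simps algebra_simps)
  qed
qed

text \<open>On the top edge of the support, from \<open>s *\<^sub>R n\<close> towards
  \<open>s *\<^sub>R n'\<close>, only \<open>n\<close> and \<open>n'\<close> contribute to the
  bracket, which has to vanish one level higher. This is the two-term recursion of binomial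
  coefficients. With finite support it must stop, which forces \<open>s\<close> to be a natural
  number, and its last term compares the two ends.\<close>

lemma edge_recursion:
  assumes g: "adm g" "g (s *\<^sub>R n) \<noteq> 0" and adj: "adjacent n n'"
    and le1: "\<And>p. g p \<noteq> 0 \<Longrightarrow> n \<bullet> p \<le> s * r\<^sup>2"
    and le: "\<And>p. g p \<noteq> 0 \<Longrightarrow> (n + n') \<bullet> p \<le> s * (r\<^sup>2 + n \<bullet> n')"
  obtains k :: nat where "s = real k" "g (s *\<^sub>R n') * b n ^ k = g (s *\<^sub>R n) * b n' ^ k"
proof -
  let ?L = "bracket e S b"
  define h where "h = r\<^sup>2 + n \<bullet> n'"
  have nn: "n \<in> S" "n' \<in> S" "n \<noteq> n'" "n' \<noteq> - n"
    "\<And>x. x \<in> S \<Longrightarrow> x \<noteq> n \<Longrightarrow> x \<noteq> n' \<Longrightarrow> (n + n') \<bullet> x < (n + n') \<bullet> n"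
    using adj unfolding adjacent_def by blast+
  have h: "(n + n') \<bullet> n = h" "(n + n') \<bullet> n' = h" "h > 0"
    using sq nn adjacent_pos[OF adj] by (simp_all add: h_def inner_simps inner_commute)
  define D where "D = cr e n n'"
  have D: "D \<noteq> 0" "cr e n' n = - D" using adjacent_pos[OF adj] cr_skew[of e n' n] by (simp_all add: D_def)
  have other: "g (q - m) = 0" if "(n + n') \<bullet> q \<ge> (s + 1) * h" "m \<in> S" "m \<noteq> n" "m \<noteq> n'" for q m
  proof (rule ccontr)
    assume "g (q - m) \<noteq> 0"
    then have "(n + n') \<bullet> (q - m) \<le> s * h" using le by (simp add: h_def)
    then show False using nn(5)[of m] that h by (simp add: inner_simps algebra_simps)
  qed
  \<comment> \<open>Otherwise the support of the bracket would contain some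
    \<open>t *\<^sub>R n\<close> with \<open>t \<ge> s + 1\<close>. There the term of
    \<open>n\<close> has the factor \<open>cr e n n\<close>, which is 0, and the term of
    \<open>n'\<close> needs a frequency of \<open>g\<close> too far out in the direction
    \<open>n\<close>.\<close>
  have L0: "?L g q = 0" if q: "(n + n') \<bullet> q = (s + 1) * h" for q
  proof (rule ccontr)
    assume nq: "?L g q \<noteq> 0"
    obtain t where t: "?L g (t *\<^sub>R n) \<noteq> 0" "\<And>p. ?L g p \<noteq> 0 \<Longrightarrow> (n + n') \<bullet> p \<le> t * (r\<^sup>2 + n \<bullet> n')"
      using ray_bound[OF adm_bracket[OF g(1)] nq adj] by blast
    have "(s + 1) * h \<le> t * h" using t(2)[OF nq] q by (simp add: h_def)
    then have ts: "s + 1 \<le> t" using h by simp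
    have "?L g (t *\<^sub>R n) = 0" unfolding bracket_def
    proof (rule sum.neutral, rule ballI)
      fix m assume m: "m \<in> S"
      have tq: "(n + n') \<bullet> (t *\<^sub>R n) \<ge> (s + 1) * h" using ts h by simp
      show "complex_of_real (cr e m (t *\<^sub>R n)) * b m * g (t *\<^sub>R n - m) = 0"
      proof (cases "m = n \<or> m = n'")
        case False
        then show ?thesis using other[OF tq m] by simp
      next
        case True
        have "g (t *\<^sub>R n - n') = 0"
        proof (rule ccontr)
          assume "g (t *\<^sub>R n - n') \<noteq> 0"
          then have "n \<bullet> (t *\<^sub>R n - n') \<le> s * r\<^sup>2" by (rule le1)
          then have "t * r\<^sup>2 - n \<bullet> n' \<le> s * r\<^sup>2" using sq nn by (simp add: inner_simps)
          moreover have "n \<bullet> n' < r\<^sup>2" using strict[OF nn(1), of n'] circle nn by simp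
          moreover have "(s + 1) * r\<^sup>2 \<le> t * r\<^sup>2" using ts by (simp add: mult_right_mono)
          ultimately show False by (simp add: algebra_simps)
        qed
        then show ?thesis using True by (auto simp: cr_linear)
      qed
    qed
    then show False using t by simp
  qed
  define c where "c j = g (s *\<^sub>R n + real j *\<^sub>R (n' - n))" for j :: nat
  have c0: "c 0 \<noteq> 0" using g by (simp add: c_def)
  have rec: "of_nat (Suc j) * b n * c (Suc j) = complex_of_real (s - real j) * b n' * c j" for j
  proof -
    \<comment> \<open>\<open>Q\<close> is one level up; it is reached by \<open>n\<close> from the
      point with index \<open>Suc j\<close> and by \<open>n'\<close> from the point with index
      \<open>j\<close>.\<close>
    define Q where "Q = (s + 1) *\<^sub>R n + real (Suc j) *\<^sub>R (n' - n)"
    have Qh: "(n + n') \<bullet> Q = (s + 1) * h"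
    proof -
      have "(n + n') \<bullet> Q = (s + 1) * ((n + n') \<bullet> n) + real (Suc j) * ((n + n') \<bullet> n' - (n + n') \<bullet> n)"
        unfolding Q_def by (simp only: inner_simps algebra_simps)
      then show ?thesis by (simp add: h)
    qed
    have e1': "Q - n = s *\<^sub>R n + real (Suc j) *\<^sub>R (n' - n)" "Q - n' = s *\<^sub>R n + real j *\<^sub>R (n' - n)"
      by (simp_all add: Q_def algebra_simps)
    have crs: "cr e n Q = real (Suc j) * D" "cr e n' Q = - ((s - real j) * D)"
      by (simp_all add: Q_def cr_linear D_def[symmetric] D(2) algebra_simps)
    have "?L g Q = (\<Sum>m\<in>{n,n'}. complex_of_real (cr e m Q) * b m * g (Q - m))"
      unfolding bracket_def by (rule sum.mono_neutral_right) (use fin nn other[of Q] Qh in auto)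
    also have "\<dots> = complex_of_real (cr e n Q) * b n * c (Suc j) + complex_of_real (cr e n' Q) * b n' * c j"
      using nn by (simp add: c_def e1')
    finally have "complex_of_real D * (of_nat (Suc j) * b n * c (Suc j) - complex_of_real (s - real j) * b n' * c j) = 0"
      using L0[OF Qh] by (simp add: crs algebra_simps)
    then show ?thesis using D by simp
  qed
  have "\<exists>j. c j = 0"
  proof (rule ccontr)
    assume "\<nexists>j. c j = 0"
    then have "range (\<lambda>j. s *\<^sub>R n + real j *\<^sub>R (n' - n)) \<subseteq> {q. g q \<noteq> 0}" by (auto simp: c_def)
    moreover have "inj (\<lambda>j::nat. s *\<^sub>R n + real j *\<^sub>R (n' - n))" using nn by (auto simp: inj_on_def)
    ultimately show False using g infinite_UNIV_nat finite_imageD finite_subset unfolding adm_def by metis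
  qed
  define j where "j = (LEAST j. c j = 0)"
  have cj: "c j = 0" unfolding j_def using \<open>\<exists>j. c j = 0\<close> by (rule LeastI_ex)
  obtain k where k: "j = Suc k" using cj c0 by (cases j) auto
  have "c k \<noteq> 0" using not_less_Least[of k "\<lambda>j. c j = 0"] k j_def by auto
  moreover have "complex_of_real (s - real k) * b n' * c k = 0" using rec[of k] cj k by simp
  ultimately have "complex_of_real (s - real k) = 0" using b0[OF nn(2)] by simp
  then have sk: "s = real k" unfolding of_real_eq_0_iff by simp
  have "c i * b n ^ i = of_nat (k choose i) * b n' ^ i * c 0" if "i \<le> k" for i
    using that
  proof (induction i)
    case (Suc i)
    have "of_nat (Suc i) * (c (Suc i) * b n ^ Suc i) = (of_nat (Suc i) * b n * c (Suc i)) * b n ^ i" by simp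
    also have "\<dots> = of_nat (k - i) * b n' * (c i * b n ^ i)"
      using rec[of i] Suc.prems sk by (simp add: of_nat_diff)
    also have "\<dots> = of_nat ((k - i) * (k choose i)) * b n' ^ Suc i * c 0"
      using Suc by simp
    also have "(k - i) * (k choose i) = Suc i * (k choose Suc i)"
    proof -
      have "Suc (i + (k - Suc i)) = k" "Suc (k - Suc i) = k - i" using Suc.prems by auto
      then show ?thesis using Suc_times_binomial_add[of i "k - Suc i"] by metis
    qed
    finally have "of_nat (Suc i) * (c (Suc i) * b n ^ Suc i) = of_nat (Suc i) * (of_nat (k choose Suc i) * b n' ^ Suc i * c 0)"
      by (simp only: of_nat_mult mult.assoc)
    then show ?case by (metis mult_cancel_left nat.distinct(1) of_nat_eq_0_iff)
  qed simp
  from this[of k] have "c k * b n ^ k = b n' ^ k * c 0" by simp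
  moreover have "c k = g (s *\<^sub>R n')" by (simp add: c_def sk algebra_simps)
  ultimately have "g (s *\<^sub>R n') * b n ^ k = g (s *\<^sub>R n) * b n' ^ k" by (simp add: c_def mult.commute)
  then show thesis using that sk by blast
qed

end

lemma plane_parseval:
  fixes e f d x :: "real^3"
  assumes "norm e = 1" "e \<bullet> f = 0" "e \<bullet> d = 0" "e \<bullet> x = 0" "f \<bullet> d = 0" "f \<noteq> 0" "d \<noteq> 0"
  shows "(f \<bullet> x)\<^sup>2 * (d \<bullet> d) + (d \<bullet> x)\<^sup>2 * (f \<bullet> f) = (f \<bullet> f) * (d \<bullet> d) * (x \<bullet> x)"
proof -
  have fd: "f \<times> d \<noteq> 0" using assms norm_and_cross_eq_0[of f d] by auto
  define y where "y = ((f \<bullet> f) * (d \<bullet> d)) *\<^sub>R x - ((d \<bullet> d) * (f \<bullet> x)) *\<^sub>R f - ((f \<bullet> f) * (d \<bullet> x)) *\<^sub>R d"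
  have "y = 0"
  proof (rule orthogonal_frame_zero[OF fd])
    show "f \<bullet> y = 0" "d \<bullet> y = 0" using assms by (simp_all add: y_def inner_simps inner_commute)
    have "e \<bullet> y = 0" using assms by (simp add: y_def inner_simps)
    then show "(f \<times> d) \<bullet> y = 0" using planar_cross[of e f d] assms by simp
  qed
  then have "x \<bullet> y = 0" by simp
  then show ?thesis by (simp add: y_def inner_simps inner_commute power2_eq_square algebra_simps)
qed

context circle_stream
begin

text \<open>Beyond the chord from \<open>n\<close> to \<open>n'\<close> the circle consists of the
  short arc, so \<open>x\<close> is closer to \<open>n\<close> than \<open>n'\<close> is. In the
  orthogonal frame \<open>n + n'\<close>, \<open>n' - n\<close> the equation of the circle turns the
  lower bound for the first coordinate into an upper bound for the second.\<close>

lemma arc_closer: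
  assumes n: "n \<in> S" "n' \<in> S" "n \<noteq> n'" "n' \<noteq> - n" and x: "x \<in> S" "x \<noteq> n'"
    and f: "(n + n') \<bullet> x \<ge> (n + n') \<bullet> n"
  shows "n \<bullet> x > n \<bullet> n'"
proof -
  define f' where "f' = n + n'"
  define d where "d = n' - n"
  have nn: "n \<bullet> n = r\<^sup>2" "n' \<bullet> n' = r\<^sup>2" "x \<bullet> x = r\<^sup>2" using sq n x by auto
  define c where "c = n \<bullet> n'"
  have f'0: "f' \<noteq> 0" "d \<noteq> 0" using n by (auto simp: f'_def d_def add_eq_0_iff)
  have ff: "f' \<bullet> f' = 2 * (r\<^sup>2 + c)" "d \<bullet> d = 2 * (r\<^sup>2 - c)" "f' \<bullet> d = 0"
    using nn by (simp_all add: f'_def d_def c_def inner_simps inner_commute)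
  have pos: "r\<^sup>2 + c > 0" "r\<^sup>2 - c > 0"
    using ff f'0 by (metis inner_gt_zero_iff zero_less_mult_iff zero_less_numeral not_numeral_less_zero)+
  define A where "A = f' \<bullet> x"
  define B where "B = d \<bullet> x"
  have "A\<^sup>2 * (2 * (r\<^sup>2 - c)) + B\<^sup>2 * (2 * (r\<^sup>2 + c)) = 2 * (r\<^sup>2 + c) * (2 * (r\<^sup>2 - c)) * r\<^sup>2"
    using plane_parseval[OF e1, of f' d x] plane n x f'0 ff nn
    by (simp add: A_def B_def f'_def d_def inner_simps add.commute)
  then have P: "A\<^sup>2 * (r\<^sup>2 - c) + B\<^sup>2 * (r\<^sup>2 + c) = 2 * (r\<^sup>2 + c) * (r\<^sup>2 - c) * r\<^sup>2" by (simp add: algebra_simps)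
  have A: "A \<ge> r\<^sup>2 + c" using f nn by (simp add: A_def f'_def c_def inner_simps inner_commute)
  then have "(r\<^sup>2 + c)\<^sup>2 \<le> A\<^sup>2" using pos by (intro power_mono) auto
  then have "(r\<^sup>2 + c)\<^sup>2 * (r\<^sup>2 - c) \<le> A\<^sup>2 * (r\<^sup>2 - c)" using pos by simp
  then have "B\<^sup>2 * (r\<^sup>2 + c) \<le> (r\<^sup>2 - c)\<^sup>2 * (r\<^sup>2 + c)" using P by (simp add: power2_eq_square algebra_simps)
  then have "B\<^sup>2 \<le> (r\<^sup>2 - c)\<^sup>2" using pos by simp
  then have B: "B \<le> r\<^sup>2 - c" using pos by (simp add: abs_le_square_iff[symmetric])
  have AB: "n \<bullet> x = (A - B) / 2" "n' \<bullet> x = (A + B) / 2"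
    by (simp_all add: A_def B_def f'_def d_def inner_simps)
  then have ge: "n \<bullet> x \<ge> c" using A B by simp
  moreover have "n \<bullet> x \<noteq> c"
  proof
    assume "n \<bullet> x = c"
    then have "A = r\<^sup>2 + c" "B = r\<^sup>2 - c" using AB A B by auto
    then have "n' \<bullet> x = r\<^sup>2" using AB by simp
    then show False using strict[OF n(2), of x] circle x by simp
  qed
  ultimately show ?thesis by (simp add: c_def)
qed

text \<open>Connectedness of the polygon: a closest pair between \<open>Z\<close> and its complement
  is adjacent, since a vertex on the arc between the two would form a closer pair with one of them.
  Hence a property that passes along edges holds at every vertex.\<close>

lemma adjacent_exists:
  assumes Z: "Z \<subseteq> S" "Z \<noteq> {}" "Z \<noteq> S"
  obtains n n' where "n \<in> Z" "n' \<in> S - Z" "adjacent n n'"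
proof -
  have "finite (Sigma Z (\<lambda>_. S - Z))" "Sigma Z (\<lambda>_. S - Z) \<noteq> {}"
    using Z fin finite_subset[OF Z(1) fin] by auto
  then obtain z where z: "z \<in> Sigma Z (\<lambda>_. S - Z)"
    "\<And>y. y \<in> Sigma Z (\<lambda>_. S - Z) \<Longrightarrow> fst y \<bullet> snd y \<le> fst z \<bullet> snd z"
    using finite_argmax[of "Sigma Z (\<lambda>_. S - Z)" "\<lambda>y. fst y \<bullet> snd y"] by blast
  obtain n n' where nn: "z = (n, n')" "n \<in> Z" "n' \<in> S - Z" using z(1) by auto
  have max: "x \<bullet> y \<le> n \<bullet> n'" if "x \<in> Z" "y \<in> S - Z" for x y using z(2)[of "(x,y)"] that nn by simp
  have nS: "n \<in> S" "n' \<in> S" "n \<noteq> n'" using nn Z by auto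
  \<comment> \<open>An antipodal pair has the least possible product \<open>- r\<^sup>2\<close>; a
    nonparallel \<open>x\<close> does better with \<open>n\<close> or with \<open>n'\<close>,
    whichever is on the other side.\<close>
  have anti: "n' \<noteq> - n"
  proof
    assume a: "n' = - n"
    then have c: "n \<bullet> n' = - r\<^sup>2" using sq nS by simp
    obtain x where x: "x \<in> S" "cr e n x \<noteq> 0" using exists_nonparallel[OF nS(1)] by blast
    then have xn: "x \<noteq> n" "x \<noteq> - n" using cr_linear(5)[of e "-1" n n] by (auto simp: cr_linear cr_def)
    show False
    proof (cases "x \<in> Z")
      case True
      have "n \<bullet> x < r\<^sup>2" "(-n) \<bullet> (-x) < r\<^sup>2"
        using strict[OF nS(1), of x] circle x xn by auto
      then have "x \<bullet> n' > - r\<^sup>2" using a by (simp add: inner_commute)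
      then show False using max[OF True nn(3)] c by simp
    next
      case False
      have "(-n) \<bullet> x < r\<^sup>2" using strict[OF minus_mem[OF nS(1)], of x] circle x xn by simp
      then show False using max[OF nn(2), of x] False x c by simp
    qed
  qed
  have "adjacent n n'" unfolding adjacent_def
  proof (intro conjI ballI impI)
    fix x assume x: "x \<in> S" "x \<noteq> n" "x \<noteq> n'"
    show "(n + n') \<bullet> x < (n + n') \<bullet> n"
    proof (rule ccontr)
      assume "\<not> ?thesis"
      then have f: "(n + n') \<bullet> x \<ge> (n + n') \<bullet> n" by simp
      have f2: "(n' + n) \<bullet> x \<ge> (n' + n) \<bullet> n'"
        using f sq nS by (simp add: inner_simps inner_commute)
      show False
      proof (cases "x \<in> Z")
        case True
        have "n' \<noteq> n" "n \<noteq> - n'" using nS(3) anti by auto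
        then have "n' \<bullet> x > n' \<bullet> n" using arc_closer[OF nS(2,1) _ _ x(1,2) f2] by blast
        then show False using max[OF True nn(3)] by (simp add: inner_commute)
      next
        case False
        have "n \<bullet> x > n \<bullet> n'" using arc_closer[OF nS anti x(1,3) f] .
        then show False using max[OF nn(2), of x] False x by simp
      qed
    qed
  qed (use nS anti in auto)
  then show thesis using that nn by blast
qed

lemma mulop_power_support:
  assumes "(mulop S b ^^ k) delta q \<noteq> 0"
  shows "norm q \<le> real k * r \<and> e \<bullet> q = 0"
  using assms
proof (induction k arbitrary: q)
  case 0
  then show ?case by (auto simp: delta_def split: if_splits)
next
  case (Suc k)
  obtain n where n: "n \<in> S" "(mulop S b ^^ k) delta (q - n) \<noteq> 0"
  proof (rule ccontr)
    assume "\<not> thesis"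
    then have "(mulop S b ^^ k) delta (q - n) = 0" if "n \<in> S" for n using that \<open>\<And>n. n \<in> S \<Longrightarrow> _ n \<Longrightarrow> thesis\<close> by blast
    then have "(mulop S b ^^ Suc k) delta q = 0" by (simp add: mulop_def[of S b "(mulop S b ^^ k) delta"])
    then show False using Suc by simp
  qed
  have "norm q \<le> norm (q - n) + norm n" using norm_triangle_ineq[of "q - n" n] by simp
  then show ?case using Suc.IH[OF n(2)] circle[OF n(1)] plane[OF n(1)] by (simp add: algebra_simps inner_simps)
qed

text \<open>\<open>real k *\<^sub>R n\<close> is extreme in the disc of radius \<open>k * r\<close>,
  so it is a sum of \<open>k\<close> points of the circle only as n + ... + n.\<close>

lemma mulop_power_top:
  assumes "n \<in> S"
  shows "(mulop S b ^^ k) delta (real k *\<^sub>R n) = b n ^ k"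
proof (induction k)
  case (Suc k)
  have "(mulop S b ^^ Suc k) delta (real (Suc k) *\<^sub>R n) = (\<Sum>m\<in>S. b m * (mulop S b ^^ k) delta (real (Suc k) *\<^sub>R n - m))"
    by (simp add: mulop_def[of S b "(mulop S b ^^ k) delta"])
  also have "\<dots> = (\<Sum>m\<in>{n}. b m * (mulop S b ^^ k) delta (real (Suc k) *\<^sub>R n - m))"
  proof (rule sum.mono_neutral_right)
    show "\<forall>m\<in>S - {n}. b m * (mulop S b ^^ k) delta (real (Suc k) *\<^sub>R n - m) = 0"
    proof
      fix m assume m: "m \<in> S - {n}"
      have "n \<bullet> (real (Suc k) *\<^sub>R n - m) > real k * r * r"
        using strict[OF assms, of m] circle m sq[OF assms] by (simp add: inner_simps power2_eq_square algebra_simps)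
      moreover have "n \<bullet> (real (Suc k) *\<^sub>R n - m) \<le> r * norm (real (Suc k) *\<^sub>R n - m)"
        using norm_cauchy_schwarz[of n] circle[OF assms] by metis
      ultimately have "real k * r * r < r * norm (real (Suc k) *\<^sub>R n - m)" by simp
      then have "\<not> norm (real (Suc k) *\<^sub>R n - m) \<le> real k * r" using r0 by (simp add: mult.commute)
      then show "b m * (mulop S b ^^ k) delta (real (Suc k) *\<^sub>R n - m) = 0"
        using mulop_power_support by fastforce
    qed
  qed (use assms fin in auto)
  also have "\<dots> = b n ^ Suc k" using Suc by (simp add: algebra_simps)
  finally show ?case .
qed (simp add: delta_def)

lemma plane_zero:
  assumes "\<And>n. n \<in> S \<Longrightarrow> n \<bullet> p = 0" "e \<bullet> p = 0"
  shows "p = 0"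
proof -
  obtain n m where nm: "n \<in> S" "m \<in> S" "cr e n m \<noteq> 0" using spans by blast
  then have "n \<times> m \<noteq> 0" by (auto simp: cr_def)
  then show ?thesis using orthogonal_frame_zero[of n m p] assms nm planar_cross[OF e1 plane plane, of n m] by simp
qed

text \<open>The extreme frequencies of \<open>g\<close> are \<open>real k *\<^sub>R n\<close> for
  \<open>n\<close> in \<open>S\<close>. Along polygon edges \<open>edge_recursion\<close> keeps the
  ratio of the coefficient of \<open>g\<close> there to \<open>b n ^ k\<close> constant, so one
  multiple of the k-th power of \<open>b\<close> cancels all of them together.\<close>

lemma top_layer_removal:
  assumes g: "adm g" and p0: "g p0 \<noteq> 0" "p0 \<noteq> 0"
  obtains k a where "\<And>n p. n \<in> S \<Longrightarrow> g p \<noteq> 0 \<Longrightarrow> n \<bullet> p \<le> real k * r\<^sup>2"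
    "\<exists>n\<in>S. g (real k *\<^sub>R n) \<noteq> 0"
    "\<And>n p. n \<in> S \<Longrightarrow> g p - a * (mulop S b ^^ k) delta p \<noteq> 0 \<Longrightarrow> n \<bullet> p < real k * r\<^sup>2"
proof -
  have ep0: "e \<bullet> p0 = 0" using g p0 unfolding adm_def by blast
  define G where "G = {p. g p \<noteq> 0}"
  have "S \<noteq> {}" using spans by blast
  then have "finite (Sigma S (\<lambda>_. G))" "Sigma S (\<lambda>_. G) \<noteq> {}"
    using fin g p0 by (auto simp: G_def adm_def)
  then obtain z where z: "z \<in> Sigma S (\<lambda>_. G)"
    "\<And>y. y \<in> Sigma S (\<lambda>_. G) \<Longrightarrow> fst y \<bullet> snd y \<le> fst z \<bullet> snd z"
    using finite_argmax[of "Sigma S (\<lambda>_. G)" "\<lambda>y. fst y \<bullet> snd y"] by blast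
  obtain n1 m where nm: "z = (n1, m)" "n1 \<in> S" "g m \<noteq> 0" using z(1) by (auto simp: G_def)
  have max: "n \<bullet> p \<le> n1 \<bullet> m" if "n \<in> S" "g p \<noteq> 0" for n p
    using z(2)[of "(n,p)"] that nm by (simp add: G_def)
  have strictn: "n \<bullet> x < n \<bullet> n" if "n \<in> S" "x \<in> S" "x \<noteq> n" for n x
    using strict[OF that(1), of x] circle that sq by simp
  have "cr e n1 m = 0"
    by (rule orbit_top_parallel[where S = S and b = b and f = n1 and g = g, OF fin nm(2) b0[OF nm(2)]])
      (use strictn nm max g in \<open>auto simp: adm_def\<close>)
  then obtain s where s: "m = s *\<^sub>R n1" using cr_parallel[OF nm(2), of m] g nm unfolding adm_def by blast
  have max': "n \<bullet> p \<le> s * r\<^sup>2" if "n \<in> S" "g p \<noteq> 0" for n p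
    using max[OF that] s sq[OF nm(2)] by simp
  have "s > 0"
  proof (rule ccontr)
    assume "\<not> s > 0"
    then have "s * r\<^sup>2 \<le> 0" by (simp add: mult_nonpos_nonneg)
    then have le: "n \<bullet> p0 \<le> 0" if "n \<in> S" for n using max'[OF that p0(1)] by simp
    have "n \<bullet> p0 = 0" if "n \<in> S" for n using le[OF that] le[OF minus_mem[OF that]] by simp
    then show False using plane_zero ep0 p0 by blast
  qed
  have g0: "adm g" "g (s *\<^sub>R n1) \<noteq> 0" using g nm s by auto
  have edge: "\<exists>k::nat. s = real k \<and> g (s *\<^sub>R n') * b n ^ k = g (s *\<^sub>R n) * b n' ^ k"
    if gn: "g (s *\<^sub>R n) \<noteq> 0" and adj: "adjacent n n'" for n n'
  proof -
    have n: "n \<in> S" using adj by (simp add: adjacent_def)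
    obtain t where t: "g (t *\<^sub>R n) \<noteq> 0" "\<And>p. g p \<noteq> 0 \<Longrightarrow> (n + n') \<bullet> p \<le> t * (r\<^sup>2 + n \<bullet> n')"
      using ray_bound[OF g gn adj] by blast
    have "t * r\<^sup>2 \<le> s * r\<^sup>2" using max'[OF n t(1)] sq[OF n] by simp
    then have "t \<le> s" using r0 by simp
    then have "t * (r\<^sup>2 + n \<bullet> n') \<le> s * (r\<^sup>2 + n \<bullet> n')" using adjacent_pos[OF adj] by simp
    then have "(n + n') \<bullet> p \<le> s * (r\<^sup>2 + n \<bullet> n')" if "g p \<noteq> 0" for p using t(2)[OF that] by simp
    then show ?thesis using edge_recursion[OF g gn adj max'[OF n]] by metis
  qed
  have "{n1} \<noteq> S" using spans by (auto simp: cr_linear)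
  then obtain n' where n': "adjacent n1 n'" using adjacent_exists[of "{n1}"] nm by auto
  obtain k where k: "s = real k" using edge[OF g0(2) n'] by blast
  define a where "a = g (s *\<^sub>R n1) / b n1 ^ k"
  define Z where "Z = {n\<in>S. g (s *\<^sub>R n) = a * b n ^ k}"
  have "Z = S"
  proof (rule ccontr)
    assume "Z \<noteq> S"
    moreover have "n1 \<in> Z" using nm b0 by (simp add: Z_def a_def)
    moreover have "Z \<subseteq> S" by (auto simp: Z_def)
    ultimately obtain n n' where nn: "n \<in> Z" "n' \<in> S - Z" "adjacent n n'" using adjacent_exists[of Z] by blast
    have gn: "g (s *\<^sub>R n) = a * b n ^ k" "n \<in> S" using nn by (auto simp: Z_def)
    have "a \<noteq> 0" using g0 b0[OF nm(2)] by (simp add: a_def)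
    then have "g (s *\<^sub>R n) \<noteq> 0" using gn b0 by simp
    then have "g (s *\<^sub>R n') * b n ^ k = g (s *\<^sub>R n) * b n' ^ k" using edge[OF _ nn(3)] k by auto
    then have "g (s *\<^sub>R n') = a * b n' ^ k" using gn b0[OF gn(2)] by (simp add: field_simps)
    then show False using nn by (simp add: Z_def)
  qed
  show thesis
  proof (rule that[of k a])
    show "n \<bullet> p \<le> real k * r\<^sup>2" if "n \<in> S" "g p \<noteq> 0" for n p using max'[OF that] k by simp
    show "\<exists>n\<in>S. g (real k *\<^sub>R n) \<noteq> 0" using g0 nm k by blast
    fix n p assume n: "n \<in> S" and ne: "g p - a * (mulop S b ^^ k) delta p \<noteq> 0"
    \<comment> \<open>Both functions reach the extreme level in the direction \<open>n\<close> only
      at \<open>real k *\<^sub>R n\<close>: the power of \<open>b\<close> by the equality case of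
      Cauchy-Schwarz, \<open>g\<close> because its top has to be parallel to \<open>n\<close>. At
      that point the coefficients cancel.\<close>
    have M: "n \<bullet> p \<le> real k * r\<^sup>2 \<and> (n \<bullet> p = real k * r\<^sup>2 \<longrightarrow> p = real k *\<^sub>R n)"
      if "(mulop S b ^^ k) delta p \<noteq> 0"
    proof -
      have np: "norm p \<le> real k * r" using mulop_power_support[OF that] by simp
      have "n \<bullet> p \<le> norm n * norm p" by (rule norm_cauchy_schwarz)
      also have "\<dots> \<le> r * (real k * r)" using np circle[OF n] r0 by simp
      finally have "n \<bullet> p \<le> real k * r\<^sup>2" by (simp add: power2_eq_square algebra_simps)
      moreover have "p = real k *\<^sub>R n" if "n \<bullet> p = real k * r\<^sup>2"
      proof (rule inner_eq_norm_bound_imp_eq[of _ "real k * r"])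
        show "norm (real k *\<^sub>R n) = real k * r" using circle[OF n] by simp
        show "(real k * r)\<^sup>2 \<le> real k *\<^sub>R n \<bullet> p" using that by (simp add: power2_eq_square algebra_simps)
      qed (rule np)
      ultimately show ?thesis by blast
    qed
    have G: "n \<bullet> p \<le> real k * r\<^sup>2 \<and> (n \<bullet> p = real k * r\<^sup>2 \<longrightarrow> p = real k *\<^sub>R n)" if gp: "g p \<noteq> 0"
    proof (intro conjI impI)
      show "n \<bullet> p \<le> real k * r\<^sup>2" using max'[OF n gp] k by simp
      assume eq: "n \<bullet> p = real k * r\<^sup>2"
      have "cr e n p = 0"
        by (rule orbit_top_parallel[where S = S and b = b and f = n and g = g, OF fin n b0[OF n]])
          (use strictn n max' g gp eq k in \<open>auto simp: adm_def\<close>)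
      then obtain t where t: "p = t *\<^sub>R n" using cr_parallel[OF n, of p] g gp unfolding adm_def by blast
      then have "t * r\<^sup>2 = real k * r\<^sup>2" using eq sq[OF n] by simp
      then show "p = real k *\<^sub>R n" using t r0 by simp
    qed
    have "n \<bullet> p \<le> real k * r\<^sup>2 \<and> (n \<bullet> p = real k * r\<^sup>2 \<longrightarrow> p = real k *\<^sub>R n)"
      using ne M G by force
    moreover have "p \<noteq> real k *\<^sub>R n"
    proof
      assume "p = real k *\<^sub>R n"
      moreover have "n \<in> Z" using \<open>Z = S\<close> n by simp
      ultimately show False using ne mulop_power_top[OF n, of k] k by (simp add: Z_def)
    qed
    ultimately show "n \<bullet> p < real k * r\<^sup>2" by linarith
  qed
qed

text \<open>Induction on an integer bound for the extreme level, which each removal lowers strictly.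
  Bound 0 leaves nothing, as it applies to \<open>n\<close> and to \<open>- n\<close>; a function
  supported at 0 is a constant.\<close>

theorem orbit_bounded_imp_stream_poly:
  assumes "adm g"
  shows "stream_poly S b g"
proof -
  have main: "stream_poly S b g" if "adm g" "\<And>n p. n \<in> S \<Longrightarrow> g p \<noteq> 0 \<Longrightarrow> n \<bullet> p < real K * r\<^sup>2" for K g
    using that
  proof (induction K arbitrary: g)
    case 0
    obtain n where n: "n \<in> S" using spans by blast
    have "g p = 0" for p
      using 0(2)[OF n, of p] 0(2)[OF minus_mem[OF n], of p] by fastforce
    then show ?case by (rule stream_poly_zero)
  next
    case (Suc K)
    show ?case
    proof (cases "\<exists>p0. g p0 \<noteq> 0 \<and> p0 \<noteq> 0")
      case False
      show ?thesis
        by (rule stream_poly_add[where l = 0 and w = "g 0"], rule stream_poly_zero)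
          (use False in \<open>auto simp: delta_def\<close>)
    next
      case True
      then obtain p0 where "g p0 \<noteq> 0" "p0 \<noteq> 0" by blast
      from top_layer_removal[OF Suc.prems(1) this]
      obtain k a where k: "\<exists>n\<in>S. g (real k *\<^sub>R n) \<noteq> 0"
        "\<And>n p. n \<in> S \<Longrightarrow> g p - a * (mulop S b ^^ k) delta p \<noteq> 0 \<Longrightarrow> n \<bullet> p < real k * r\<^sup>2" by metis
      then obtain n where n: "n \<in> S" "g (real k *\<^sub>R n) \<noteq> 0" by blast
      have "real k * r\<^sup>2 < real (Suc K) * r\<^sup>2" using Suc.prems(2)[OF n] sq[OF n(1)] by simp
      then have "real k < real (Suc K)" using r0 by (simp add: mult_less_cancel_right)
      then have kK: "real k * r\<^sup>2 \<le> real K * r\<^sup>2" by (intro mult_right_mono) auto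
      have fs: "finite {q. (mulop S b ^^ k) delta q \<noteq> 0}" by (rule finite_support_mulop_power[OF fin])
      have "adm (\<lambda>q. g q - a * (mulop S b ^^ k) delta q)" unfolding adm_def
      proof (intro conjI allI impI)
        show "finite {q. g q - a * (mulop S b ^^ k) delta q \<noteq> 0}"
          by (rule finite_subset[of _ "{q. g q \<noteq> 0} \<union> {q. (mulop S b ^^ k) delta q \<noteq> 0}"])
            (use fs Suc.prems in \<open>auto simp: adm_def\<close>)
        show "e \<bullet> q = 0" if "g q - a * (mulop S b ^^ k) delta q \<noteq> 0" for q
          using that mulop_power_support[of k q] Suc.prems(1) unfolding adm_def by force
        show "orbit_bounded e S b (\<lambda>q. g q - a * (mulop S b ^^ k) delta q)"
          by (rule orbit_bounded_diff[OF _ bracket_mulop_power[OF fin] fs]) (use Suc.prems in \<open>simp add: adm_def\<close>)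
      qed
      moreover have "n \<bullet> p < real K * r\<^sup>2" if "n \<in> S" "g p - a * (mulop S b ^^ k) delta p \<noteq> 0" for n p
        using k(2)[OF that] kK by linarith
      ultimately have "stream_poly S b (\<lambda>q. g q - a * (mulop S b ^^ k) delta q)" by (rule Suc.IH)
      then show ?thesis by (rule stream_poly_add)
    qed
  qed
  have "bounded {q. g q \<noteq> 0}" using assms finite_imp_bounded unfolding adm_def by blast
  then obtain B where B: "\<And>q. g q \<noteq> 0 \<Longrightarrow> norm q \<le> B" by (auto simp: bounded_iff)
  obtain K :: nat where K: "B / r < real K" using reals_Archimedean2 by blast
  have "n \<bullet> p < real K * r\<^sup>2" if "n \<in> S" "g p \<noteq> 0" for n p
  proof -
    have "n \<bullet> p \<le> r * norm p" using norm_cauchy_schwarz[of n p] circle[OF that(1)] by simp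
    also have "\<dots> \<le> r * B" using B[OF that(2)] r0 by simp
    also have "\<dots> < r * (real K * r)" using K r0 by (simp add: field_simps)
    finally show ?thesis by (simp add: power2_eq_square algebra_simps)
  qed
  then show ?thesis using main assms by blast
qed

end

text \<open>Here \<open>S\<close> has no extent across its line. The functional \<open>f\<close>
  therefore combines \<open>h\<close>, which measures the height over the line and vanishes on
  \<open>S\<close>, with a small multiple of \<open>n0\<close>, which makes the maximum on
  \<open>S\<close> strict. A top of \<open>g\<close> is parallel to \<open>n0\<close>, thus of
  height 0, although \<open>p\<close> lies higher.\<close>

lemma shear_orbit_parallel:
  assumes fin: "finite S" and e1: "norm e = 1" and S0: "n0 \<in> S" "n0 \<noteq> 0" and sym: "uminus ` S = S"
    and line: "\<And>n. n \<in> S \<Longrightarrow> n \<in> range (\<lambda>t. t *\<^sub>R n0)" and b0: "\<And>n. n \<in> S \<Longrightarrow> b n \<noteq> 0"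
    and n0e: "e \<bullet> n0 = 0"
    and g: "finite {q. g q \<noteq> 0}" "\<And>q. g q \<noteq> 0 \<Longrightarrow> e \<bullet> q = 0" "orbit_bounded e S b g" and gp: "g p \<noteq> 0"
  shows "cr e n0 p = 0"
proof (rule ccontr)
  assume cp: "cr e n0 p \<noteq> 0"
  obtain n1 where n1: "n1 \<in> S" "\<And>n. n \<in> S \<Longrightarrow> n0 \<bullet> n \<le> n0 \<bullet> n1"
    using finite_argmax[OF fin, of "\<lambda>n. n0 \<bullet> n"] S0 by blast
  obtain t1 where t1: "n1 = t1 *\<^sub>R n0" using line n1 by blast
  have n00: "n0 \<bullet> n0 > 0" using S0 by simp
  have "n0 \<bullet> n0 \<le> n0 \<bullet> n1" using n1 S0 by blast
  then have "1 * (n0 \<bullet> n0) \<le> t1 * (n0 \<bullet> n0)" using t1 by simp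
  then have "1 \<le> t1" using n00 by (rule mult_right_le_imp_le)
  then have "t1 > 0" by simp
  have strict: "n0 \<bullet> n < n0 \<bullet> n1" if n: "n \<in> S" "n \<noteq> n1" for n
  proof -
    obtain t where t: "n = t *\<^sub>R n0" using line n by blast
    then have "t \<noteq> t1" using n t1 by auto
    then have "n0 \<bullet> n \<noteq> n0 \<bullet> n1" using t t1 n00 by simp
    then show ?thesis using n1(2)[OF n(1)] by simp
  qed
  define h where "h = (if cr e n0 p > 0 then 1 else -1) *\<^sub>R (e \<times> n0)"
  have hx: "h \<bullet> x = (if cr e n0 p > 0 then 1 else -1) * cr e n0 x" for x
    unfolding h_def cr_def by (simp add: cross3_simps)
  have hp: "h \<bullet> p > 0" using cp by (simp add: hx)
  have hn: "h \<bullet> n = 0" if "n \<in> S" for n using line[OF that] by (auto simp: hx cr_linear)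
  define C where "C = Max ((\<lambda>m. \<bar>n0 \<bullet> (m - p)\<bar>) ` {q. g q \<noteq> 0})"
  have C: "\<bar>n0 \<bullet> (m - p)\<bar> \<le> C" if "g m \<noteq> 0" for m unfolding C_def using g that by (intro Max_ge) auto
  have C0: "C \<ge> 0" using C[OF gp] by simp
  \<comment> \<open>So small that the spread \<open>C\<close> of the support along \<open>n0\<close>
    cannot make up for the height of \<open>p\<close>.\<close>
  define d where "d = (h \<bullet> p) / (C + 1)"
  have d: "d > 0" "d * C < h \<bullet> p" using hp C0 by (auto simp: d_def field_simps)
  define f where "f = h + d *\<^sub>R n0"
  obtain m where m: "g m \<noteq> 0" "\<And>q. g q \<noteq> 0 \<Longrightarrow> f \<bullet> q \<le> f \<bullet> m"
    using finite_argmax[OF g(1), of "\<lambda>q. f \<bullet> q"] gp by auto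
  have "cr e n1 m = 0"
  proof (rule orbit_top_parallel[where S = S and b = b and f = f and g = g, OF fin n1(1) b0[OF n1(1)] _ m g(3)])
    fix n assume "n \<in> S" "n \<noteq> n1"
    then show "f \<bullet> n < f \<bullet> n1" using strict[of n] hn n1(1) d by (simp add: f_def inner_simps)
  qed
  then have "cr e n0 m = 0" using t1 \<open>t1 > 0\<close> by (simp add: cr_linear)
  then have "h \<bullet> m = 0" by (simp add: hx)
  then have "h \<bullet> p + d * (n0 \<bullet> p) \<le> d * (n0 \<bullet> m)" using m(2)[OF gp] by (simp add: f_def inner_simps)
  then have "h \<bullet> p \<le> d * (n0 \<bullet> (m - p))" by (simp add: inner_simps algebra_simps)
  also have "\<dots> \<le> d * C" using C[OF m(1)] d by simp
  finally show False using d by simp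
qed

text \<open>With \<open>R\<close> the largest norm, subtracting \<open>R\<^sup>2\<close> times {b,
  b} = 0 from the vorticity equation leaves only terms whose second frequency is shorter than
  \<open>R\<close>. A sum that is unique among those isolates one nonzero term.\<close>

lemma planar_support_circle:
  assumes fin: "finite S" and e1: "norm e = 1" and z: "0 \<notin> S" and sym: "uminus ` S = S"
    and plane: "\<And>n. n \<in> S \<Longrightarrow> e \<bullet> n = 0" and b0: "\<And>n. n \<in> S \<Longrightarrow> b n \<noteq> 0"
    and bout: "\<And>n. n \<notin> S \<Longrightarrow> b n = 0"
    and line: "\<nexists>w. S \<subseteq> range (\<lambda>t. t *\<^sub>R w)"
    and eq: "\<And>q. q \<notin> S \<Longrightarrow> (\<Sum>n\<in>S. complex_of_real (cr e n q) * b n * (b (q - n) * complex_of_real ((norm (q - n))\<^sup>2))) = 0"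
  obtains r where "r > 0" "\<And>n. n \<in> S \<Longrightarrow> norm n = r"
proof -
  have "S \<noteq> {}" using line by auto
  then obtain n0 where n0: "n0 \<in> S" "\<And>n. n \<in> S \<Longrightarrow> norm n \<le> norm n0"
    using finite_argmax[OF fin, of norm] by blast
  define R where "R = norm n0"
  have "R > 0" using n0 z by (auto simp: R_def)
  have nle: "norm n \<le> R" if "n \<in> S" for n using n0(2)[OF that] by (simp add: R_def)
  have n0R: "norm n0 = R" by (simp add: R_def)
  have "norm n = R" if n: "n \<in> S" for n
  proof (rule ccontr)
    assume "norm n \<noteq> R"
    then have nR: "norm n < R" using n0(2)[OF n] by (simp add: R_def)
    have "\<exists>m\<in>S. \<exists>p\<in>S. norm m = R \<and> norm p < R \<and> p \<notin> range (\<lambda>t. t *\<^sub>R m) \<and> m + p \<notin> S \<and>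
      (\<forall>n'\<in>S. \<forall>p'\<in>S. norm p' < R \<longrightarrow> n' + p' = m + p \<longrightarrow> n' = m \<and> p' = p)"
      by (rule ball_interior_unique_sum[OF fin sym z nle n0(1) n0R n nR line])
    then obtain m p where mp: "m \<in> S" "norm m = R" "p \<in> S" "norm p < R"
      "p \<notin> range (\<lambda>t. t *\<^sub>R m)" "m + p \<notin> S"
      "\<And>n' p'. n' \<in> S \<Longrightarrow> p' \<in> S \<Longrightarrow> norm p' < R \<Longrightarrow> n' + p' = m + p \<Longrightarrow> n' = m \<and> p' = p"
      by blast
    let ?q = "m + p"
    have m0: "m \<noteq> 0" using mp z by auto
    have "(\<Sum>n\<in>S. complex_of_real (cr e n ?q) * b n * (b (?q - n) * complex_of_real (R\<^sup>2))) =
       complex_of_real (R\<^sup>2) * bracket e S b b ?q"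
      by (simp add: bracket_def sum_distrib_left algebra_simps)
    also have "bracket e S b b ?q = bracket e S b (mulop S b delta) ?q"
    proof -
      have "mulop S b delta x = b x" for x
      proof -
        have "mulop S b delta x = (\<Sum>n\<in>S. if n = x then b x else 0)"
          unfolding mulop_def by (rule sum.cong) (auto simp: delta_def)
        then show ?thesis using fin bout by auto
      qed
      then show ?thesis by (simp add: bracket_def)
    qed
    also have "\<dots> = 0" using bracket_mulop_power[OF fin, of e b 1] by simp
    finally have "(\<Sum>n\<in>S. complex_of_real (cr e n ?q) * b n * (b (?q - n) * complex_of_real (R\<^sup>2))) = 0" by simp
    then have "(\<Sum>n\<in>S. complex_of_real (cr e n ?q) * b n * (b (?q - n) * (complex_of_real ((norm (?q - n))\<^sup>2) - complex_of_real (R\<^sup>2)))) = 0"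
      using eq[OF mp(6)] by (simp add: right_diff_distrib sum_subtractf)
    also have "(\<Sum>n\<in>S. complex_of_real (cr e n ?q) * b n * (b (?q - n) * (complex_of_real ((norm (?q - n))\<^sup>2) - complex_of_real (R\<^sup>2))))
      = (\<Sum>n\<in>{m}. complex_of_real (cr e n ?q) * b n * (b (?q - n) * (complex_of_real ((norm (?q - n))\<^sup>2) - complex_of_real (R\<^sup>2))))"
    proof (rule sum.mono_neutral_right)
      show "\<forall>n\<in>S - {m}. complex_of_real (cr e n ?q) * b n * (b (?q - n) * (complex_of_real ((norm (?q - n))\<^sup>2) - complex_of_real (R\<^sup>2))) = 0"
      proof
        fix n assume n: "n \<in> S - {m}"
        have "b (?q - n) = 0 \<or> norm (?q - n) = R"
        proof (rule ccontr)
          assume *: "\<not> ?thesis"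
          then have "?q - n \<in> S" using bout by blast
          moreover from this have "norm (?q - n) < R" using * n0(2)[of "?q - n"] by (simp add: R_def)
          ultimately have "n = m" using mp(7)[of n "?q - n"] n by simp
          then show False using n by simp
        qed
        then show "complex_of_real (cr e n ?q) * b n * (b (?q - n) * (complex_of_real ((norm (?q - n))\<^sup>2) - complex_of_real (R\<^sup>2))) = 0"
          by auto
      qed
    qed (use fin mp in auto)
    finally have "complex_of_real (cr e m p) * b m * (b p * (complex_of_real ((norm p)\<^sup>2) - complex_of_real (R\<^sup>2))) = 0"
      by (simp add: cr_linear)
    moreover have "complex_of_real ((norm p)\<^sup>2) - complex_of_real (R\<^sup>2) \<noteq> 0"
    proof -
      have "(norm p)\<^sup>2 \<noteq> R\<^sup>2" using mp(4) power_strict_mono[of "norm p" R 2] by auto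
      then show ?thesis by (metis eq_iff_diff_eq_0 of_real_eq_iff)
    qed
    ultimately have "cr e m p = 0" using b0 mp by simp
    then show False using cr_eq_0_imp_parallel[OF e1 plane[OF mp(1)] plane[OF mp(3)] m0] mp(5) by blast
  qed
  then show thesis using that \<open>R > 0\<close> by blast
qed

section \<open>Chains of polygon edges and adjacent facets\<close>

text \<open>A walk up one side of the convex hull of the points \<open>(X, Y)\<close>, from the
  lowest to the highest row. \<open>X - m * Y\<close> is constant along an edge, and
  \<open>step\<close> carries \<open>Q\<close> from the lower to the upper end of such an edge.
  Replacing \<open>X\<close> by its negative gives the other side.\<close>

lemma hull_chain:
  fixes X Y :: "'a \<Rightarrow> real"
  assumes fin: "finite F" and v0: "v0 \<in> F" and bot: "\<And>p. p \<in> F \<Longrightarrow> Y v0 \<le> Y p"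
    and right: "\<And>p. p \<in> F \<Longrightarrow> Y p = Y v0 \<Longrightarrow> X p \<le> X v0" and Q0: "Q v0"
    and step: "\<And>v v' m. v \<in> F \<Longrightarrow> v' \<in> F \<Longrightarrow> Y v < Y v' \<Longrightarrow>
      (\<And>p. p \<in> F \<Longrightarrow> X p - m * Y p \<le> X v - m * Y v) \<Longrightarrow> X v' - m * Y v' = X v - m * Y v \<Longrightarrow>
      (\<And>p. p \<in> F \<Longrightarrow> X p - m * Y p = X v - m * Y v \<Longrightarrow> Y v \<le> Y p \<and> Y p \<le> Y v') \<Longrightarrow> Q v \<Longrightarrow> Q v'"
  shows "\<exists>t\<in>F. (\<forall>p\<in>F. Y p \<le> Y t) \<and> (\<forall>p\<in>F. Y p = Y t \<longrightarrow> X p \<le> X t) \<and> Q t"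
proof -
  \<comment> \<open>\<open>v\<close> is the upper end of the contact set of some supporting line, so
    the next edge of the chain starts at \<open>v\<close>.\<close>
  define I where "I v \<longleftrightarrow> v \<in> F \<and> Q v \<and> (\<exists>m. (\<forall>p\<in>F. X p - m * Y p \<le> X v - m * Y v) \<and>
    (\<forall>p\<in>F. Y v < Y p \<longrightarrow> X p - m * Y p < X v - m * Y v))" for v
  have slope: "\<exists>m. (\<forall>p\<in>F. Y v < Y p \<longrightarrow> X p - m * Y p \<le> X v - m * Y v) \<and>
      (\<exists>p\<in>F. Y v < Y p \<and> X p - m * Y p = X v - m * Y v)" if v: "\<exists>p\<in>F. Y v < Y p" for v
  proof -
    obtain p where p: "p \<in> {p\<in>F. Y v < Y p}"
      "\<And>q. q \<in> {p\<in>F. Y v < Y p} \<Longrightarrow> (X q - X v) / (Y q - Y v) \<le> (X p - X v) / (Y p - Y v)"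
      using finite_argmax[of "{p\<in>F. Y v < Y p}" "\<lambda>q. (X q - X v) / (Y q - Y v)"] fin v by auto
    define m where "m = (X p - X v) / (Y p - Y v)"
    have "X q - m * Y q \<le> X v - m * Y v" if "q \<in> F" "Y v < Y q" for q
    proof -
      have "(X q - X v) / (Y q - Y v) \<le> m" using p(2)[of q] that by (simp add: m_def)
      then have "X q - X v \<le> m * (Y q - Y v)" using that by (simp add: pos_divide_le_eq)
      then show ?thesis by (simp add: algebra_simps)
    qed
    moreover have "X p - X v = m * (Y p - Y v)" using p(1) by (simp add: m_def)
    then have "X p - m * Y p = X v - m * Y v" by (simp add: algebra_simps)
    ultimately show ?thesis using p(1) by blast
  qed
  have "I v0"
  proof (cases "\<exists>p\<in>F. Y v0 < Y p")
    case False
    have Y: "Y p = Y v0" if "p \<in> F" for p using bot[OF that] False that by fastforce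
    have "\<forall>p\<in>F. X p - 0 * Y p \<le> X v0 - 0 * Y v0" using right Y by simp
    then show ?thesis using v0 Q0 False unfolding I_def by blast
  next
    case True
    then obtain m where m: "\<And>p. p \<in> F \<Longrightarrow> Y v0 < Y p \<Longrightarrow> X p - m * Y p \<le> X v0 - m * Y v0"
      using slope by blast
    \<comment> \<open>Raising the parameter by 1 beyond the contact slope makes the inequality
      strict above \<open>v0\<close>.\<close>
    have s: "X p - (m + 1) * Y p < X v0 - (m + 1) * Y v0" if "p \<in> F" "Y v0 < Y p" for p
      using m[OF that] that by (simp add: algebra_simps)
    have "X p - (m + 1) * Y p \<le> X v0 - (m + 1) * Y v0" if "p \<in> F" for p
      using s[OF that] bot[OF that] right[OF that] by (cases "Y v0 < Y p") auto
    then show ?thesis using v0 Q0 s unfolding I_def by blast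
  qed
  moreover have "finite {v. I v}" using fin by (auto simp: I_def intro: finite_subset[of _ F])
  ultimately obtain t where t: "I t" "\<And>v. I v \<Longrightarrow> Y v \<le> Y t" using finite_argmax[of "{v. I v}" Y] by auto
  obtain m0 where m0: "\<And>p. p \<in> F \<Longrightarrow> X p - m0 * Y p \<le> X t - m0 * Y t"
    "\<And>p. p \<in> F \<Longrightarrow> Y t < Y p \<Longrightarrow> X p - m0 * Y p < X t - m0 * Y t" and tF: "t \<in> F" "Q t"
    using t(1) unfolding I_def by blast
  have top: "Y p \<le> Y t" if "p \<in> F" for p
  proof (rule ccontr)
    assume "\<not> Y p \<le> Y t"
    then have "\<exists>p\<in>F. Y t < Y p" using that by force
    then obtain m p where m: "\<And>p. p \<in> F \<Longrightarrow> Y t < Y p \<Longrightarrow> X p - m * Y p \<le> X t - m * Y t"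
      and p: "p \<in> F" "Y t < Y p" "X p - m * Y p = X t - m * Y t" using slope by blast
    \<comment> \<open>The parameter decreases along the chain; this is what keeps points below
      \<open>t\<close> off the new supporting line.\<close>
    have "(m0 - m) * (Y p - Y t) > 0" using m0(2)[OF p(1,2)] p(3) by (simp add: algebra_simps)
    then have mm: "m < m0" using p by (simp add: zero_less_mult_iff)
    have low: "X q - m * Y q \<le> X t - m * Y t \<and> (X q - m * Y q = X t - m * Y t \<longrightarrow> Y q = Y t)"
      if q: "q \<in> F" "Y q \<le> Y t" for q
    proof -
      have "(m0 - m) * (Y q - Y t) \<le> 0" using mm q by (simp add: mult_nonneg_nonpos)
      moreover have "(m0 - m) * (Y q - Y t) = 0 \<longrightarrow> Y q = Y t" using mm by simp
      moreover have "X q - m * Y q = (X q - m0 * Y q) + (m0 - m) * (Y q - Y t) + (m0 - m) * Y t"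
        "X t - m * Y t = (X t - m0 * Y t) + (m0 - m) * Y t" by (simp_all add: algebra_simps)
      ultimately show ?thesis using m0(1)[OF q(1)] by linarith
    qed
    have all: "X q - m * Y q \<le> X t - m * Y t" if "q \<in> F" for q
      using m[OF that] low[OF that] by (cases "Y t < Y q") auto
    define T where "T = {q\<in>F. X q - m * Y q = X t - m * Y t}"
    have "finite T" "T \<noteq> {}" using fin p by (auto simp: T_def)
    then obtain v where v: "v \<in> T" "\<And>q. q \<in> T \<Longrightarrow> Y q \<le> Y v" using finite_argmax[of T Y] by blast
    have Ytv: "Y t < Y v" using v(2)[of p] p by (simp add: T_def)
    have "Q v"
    proof (rule step[OF tF(1) _ Ytv all _ _ tF(2)])
      show "v \<in> F" "X v - m * Y v = X t - m * Y t" using v by (auto simp: T_def)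
      show "Y t \<le> Y q \<and> Y q \<le> Y v" if "q \<in> F" "X q - m * Y q = X t - m * Y t" for q
        using low[OF that(1)] v(2)[of q] that by (force simp: T_def)
    qed
    moreover have "X q - m * Y q < X v - m * Y v" if "q \<in> F" "Y v < Y q" for q
      using all[OF that(1)] v(2)[of q] v(1) that by (force simp: T_def)
    moreover have "v \<in> F" "X v - m * Y v = X t - m * Y t" using v by (auto simp: T_def)
    ultimately have "I v" unfolding I_def using all by (intro conjI exI[of _ m] ballI impI) auto
    then show False using t(2) Ytv by force
  qed
  have "X p \<le> X t" if "p \<in> F" "Y p = Y t" for p using m0(1)[OF that(1)] that by simp
  then show ?thesis using top tF by blast
qed

lemma spans_imp_positive:
  fixes S :: "'a::real_inner set"
  assumes "span S = UNIV" "uminus ` S = S" "g \<noteq> 0"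
  obtains p where "p \<in> S" "g \<bullet> p > 0"
proof (rule ccontr)
  assume "\<not> thesis"
  then have le: "g \<bullet> p \<le> 0" if "p \<in> S" for p using \<open>\<And>p. p \<in> S \<Longrightarrow> g \<bullet> p > 0 \<Longrightarrow> thesis\<close> that by force
  have "g \<bullet> p = 0" if "p \<in> S" for p
  proof -
    have "- p \<in> S" using assms(2) that by blast
    then show ?thesis using le[OF that] le[of "- p"] by simp
  qed
  then have "orthogonal g g" using orthogonal_to_span[of g S g] assms(1) by (auto simp: orthogonal_def)
  then have "g \<bullet> g = 0" by (simp add: orthogonal_def)
  then show False using assms(3) by simp
qed

text \<open>Supporting planes are normalised to level 1. The plane through the longest point
  \<open>a\<close> orthogonal to it touches \<open>S\<close> only there. One tilt makes it contain
  an edge at \<open>a\<close>, a turn about this edge gives the facet \<open>M\<close>; a tilt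
  inside \<open>M\<close> finds its other edge at \<open>a\<close>, and the turn about that edge
  gives \<open>N\<close>.\<close>

lemma adjacent_facets:
  fixes S :: "(real^3) set"
  assumes fin: "finite S" and sym: "uminus ` S = S" and sp: "span S = UNIV"
    and a: "a \<in> S" and R: "\<And>n. n \<in> S \<Longrightarrow> norm n \<le> norm a"
  obtains M N b c d where "\<And>p. p \<in> S \<Longrightarrow> M \<bullet> p \<le> 1" "\<And>p. p \<in> S \<Longrightarrow> N \<bullet> p \<le> 1"
    "b \<in> S" "c \<in> S" "d \<in> S" "a \<noteq> b" "M \<bullet> a = 1" "N \<bullet> a = 1" "M \<bullet> b = 1" "N \<bullet> b = 1"
    "M \<bullet> c = 1" "N \<bullet> c < 1" "M \<bullet> d < 1" "N \<bullet> d = 1"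
proof -
  have a0: "a \<noteq> 0"
  proof
    assume "a = 0"
    then have "S \<subseteq> {0}" using R by fastforce
    then have "span S \<subseteq> {0}" by (simp add: span_minimal)
    then show False using sp by (metis UNIV_I axis_eq_0_iff singletonD subsetD zero_neq_one)
  qed
  define N0 where "N0 = (1 / (a \<bullet> a)) *\<^sub>R a"
  have aa: "a \<bullet> a > 0" using a0 by simp
  have N0a: "N0 \<bullet> a = 1" using aa by (simp add: N0_def)
  have N0: "N0 \<bullet> p < 1" if "p \<in> S" "p \<noteq> a" for p
  proof -
    have "a \<bullet> p < (norm a)\<^sup>2" using inner_eq_norm_bound_imp_eq[of a "norm a" p] R[OF that(1)] that(2) by force
    then show ?thesis using aa by (simp add: N0_def power2_norm_eq_inner)
  qed
  have N0le: "N0 \<bullet> p \<le> 1" if "p \<in> S" for p using N0[OF that] N0a by (cases "p = a") auto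
  obtain g1 where g1: "g1 \<noteq> 0" "g1 \<bullet> a = 0"
  proof -
    have "\<exists>x. x \<noteq> 0 \<and> orthogonal a x"
      using orthogonal_to_vector_exists[of a] by auto
    then show thesis using that by (auto simp: orthogonal_def inner_commute)
  qed
  obtain p1 where p1: "p1 \<in> S" "g1 \<bullet> p1 > 0" using spans_imp_positive[OF sp sym g1(1)] by blast
  obtain t1 q where t1: "\<And>p. p \<in> S \<Longrightarrow> (N0 + t1 *\<^sub>R g1) \<bullet> p \<le> 1" "q \<in> S" "g1 \<bullet> q > 0"
    "(N0 + t1 *\<^sub>R g1) \<bullet> q = 1"
    using tilt_to_contact[OF fin N0le, of g1] p1 by metis
  define N1 where "N1 = N0 + t1 *\<^sub>R g1"
  have N1a: "N1 \<bullet> a = 1" using N0a g1 by (simp add: N1_def inner_simps)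
  have qa: "q \<noteq> a" using t1 g1 by auto
  define g2 where "g2 = a \<times> q"
  have g2: "g2 \<bullet> a = 0" "g2 \<bullet> q = 0" by (simp_all add: g2_def dot_cross_self)
  have "g2 \<noteq> 0"
  proof
    assume "g2 = 0"
    then obtain t where t: "q = t *\<^sub>R a" using cross_eq_0_iff_parallel[OF a0, of q] by (auto simp: g2_def)
    have "N1 \<bullet> q = 1" using t1 by (simp add: N1_def)
    then show False using t N1a qa by simp
  qed
  then obtain p2 where p2: "p2 \<in> S" "g2 \<bullet> p2 > 0" using spans_imp_positive[OF sp sym] by blast
  have N1le: "N1 \<bullet> p \<le> 1" if "p \<in> S" for p using t1(1)[OF that] by (simp add: N1_def)
  obtain t2 c where t2: "\<And>p. p \<in> S \<Longrightarrow> (N1 + t2 *\<^sub>R g2) \<bullet> p \<le> 1" "c \<in> S" "g2 \<bullet> c > 0"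
    "(N1 + t2 *\<^sub>R g2) \<bullet> c = 1"
    using tilt_to_contact[OF fin N1le, of g2] p2 by metis
  define M where "M = N1 + t2 *\<^sub>R g2"
  have M: "M \<bullet> a = 1" "M \<bullet> q = 1" "M \<bullet> c = 1" "\<And>p. p \<in> S \<Longrightarrow> M \<bullet> p \<le> 1"
    using t1 t2 N1a g2 by (auto simp: M_def N1_def inner_simps)
  define F where "F = {p\<in>S. M \<bullet> p = 1}"
  have finF: "finite F" using fin by (simp add: F_def)
  have g0: "(N0 - M) \<bullet> p \<le> 0" if "p \<in> F" for p using N0le that by (simp add: F_def inner_simps)
  have cF: "c \<in> F" using t2 M by (simp add: F_def)
  \<comment> \<open>On the face \<open>F\<close> the functional \<open>N0 - M\<close> is zero at
    \<open>a\<close> and negative elsewhere. As \<open>g2\<close> vanishes at \<open>a\<close> and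
    \<open>q\<close>, the tilt leads to an edge of the face at \<open>a\<close> other than the one
    to \<open>q\<close>.\<close>
  obtain t3 b where t3: "t3 \<ge> 0" "\<And>p. p \<in> F \<Longrightarrow> (N0 - M + t3 *\<^sub>R g2) \<bullet> p \<le> 0" "b \<in> F" "g2 \<bullet> b > 0"
    "(N0 - M + t3 *\<^sub>R g2) \<bullet> b = 0"
    using tilt_to_contact[OF finF g0, of g2] cF t2(3) by metis
  define g where "g = N0 - M + t3 *\<^sub>R g2"
  have ga: "g \<bullet> a = 0" using N0a M g2 by (simp add: g_def inner_simps)
  have ba: "a \<noteq> b" using t3 g2 by auto
  have gq: "g \<bullet> q < 0" using N0[OF t1(2) qa] M g2 by (simp add: g_def inner_simps)
  have "- q \<in> S" using sym t1 by blast
  then have ex: "\<exists>p\<in>S. g \<bullet> p > 0" using gq by (intro bexI[of _ "- q"]) auto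
  obtain t4 d where t4: "\<And>p. p \<in> S \<Longrightarrow> (M + t4 *\<^sub>R g) \<bullet> p \<le> 1" "d \<in> S" "g \<bullet> d > 0"
    "(M + t4 *\<^sub>R g) \<bullet> d = 1" "(\<And>p. p \<in> S \<Longrightarrow> M \<bullet> p = 1 \<Longrightarrow> g \<bullet> p \<le> 0) \<Longrightarrow> t4 > 0"
    using tilt_to_contact[OF fin M(4) ex] by metis
  have t40: "t4 > 0" by (rule t4(5)) (use t3 in \<open>auto simp: F_def g_def\<close>)
  define N where "N = M + t4 *\<^sub>R g"
  show thesis
  \<comment> \<open>The far end \<open>q\<close> of the first edge is the required point of
    \<open>M\<close> off \<open>N\<close>.\<close>
  proof (rule that[of M N b q d])
    show "M \<bullet> p \<le> 1" "N \<bullet> p \<le> 1" if "p \<in> S" for p using M(4)[OF that] t4(1)[OF that] by (auto simp: N_def)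
    show "b \<in> S" "q \<in> S" "d \<in> S" "a \<noteq> b" "M \<bullet> a = 1" "M \<bullet> q = 1" "M \<bullet> b = 1" "N \<bullet> d = 1"
      using t3 t1 t4 ba M by (auto simp: F_def N_def)
    show "N \<bullet> a = 1" using M ga by (simp add: N_def inner_simps)
    have "g \<bullet> b = 0" using t3 by (simp add: g_def)
    then show "N \<bullet> b = 1" using t3 by (simp add: N_def inner_simps F_def)
    have "t4 * (g \<bullet> q) < 0" using gq t40 by (simp add: mult_pos_neg)
    then show "N \<bullet> q < 1" using M by (simp add: N_def inner_simps)
    have "t4 * (g \<bullet> d) > 0" using t4 t40 by simp
    then show "M \<bullet> d < 1" using t4(4) by (simp add: N_def inner_simps)
  qed
qed

section \<open>Angles of parallel transport\<close>

text \<open>Hermitian product of the spinors \<open>(s, z)\<close> and \<open>(s', z')\<close>; its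
  argument is the angle of parallel transport between the corresponding directions.\<close>

definition link :: "real \<Rightarrow> complex \<Rightarrow> real \<Rightarrow> complex \<Rightarrow> complex" where
  "link s z s' z' = complex_of_real (s * s') + cnj z * z'"

definition quadrant :: "complex \<Rightarrow> bool" where
  "quadrant z \<longleftrightarrow> Re z \<ge> 0 \<and> Im z \<ge> 0 \<and> z \<noteq> 0"

lemma Re_link: "s > 0 \<Longrightarrow> s' > 0 \<Longrightarrow> quadrant z \<Longrightarrow> quadrant z' \<Longrightarrow> Re (link s z s' z') > 0"
  by (simp add: link_def quadrant_def add_pos_nonneg)

lemma Arg_quadrant: "quadrant z \<Longrightarrow> 0 \<le> Arg z \<and> Arg z \<le> pi / 2"
  using Arg_Re_nonneg[of z] Arg_less_0[of z] by (auto simp: quadrant_def)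

lemma Arg_link_swap:
  assumes "s > 0" "s' > 0" "quadrant z" "quadrant z'"
  shows "Arg (link s' z' s z) = - Arg (link s z s' z')"
proof -
  have "link s' z' s z = cnj (link s z s' z')" by (simp add: link_def mult.commute)
  moreover have "Arg (link s z s' z') = 0" if "link s z s' z' \<in> \<real>"
    using that Re_link[OF assms] by (simp add: Arg_eq_0)
  ultimately show ?thesis by (simp add: Arg_cnj)
qed

text \<open>\<open>cnj z * z'\<close> has argument \<open>Arg z' - Arg z\<close>; adding the
  positive number \<open>s * s'\<close> pulls it towards 0 but not past 0.\<close>

lemma Arg_link_bounds:
  assumes s: "s > 0" "s' > 0" and z: "quadrant z" "quadrant z'" and le: "Arg z \<le> Arg z'"
  shows "0 \<le> Arg (link s z s' z')" "Arg (link s z s' z') \<le> Arg z' - Arg z"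
    "Arg z < Arg z' \<Longrightarrow> Arg (link s z s' z') < Arg z' - Arg z"
proof -
  define d where "d = Arg z' - Arg z"
  define w where "w = link s z s' z'"
  define l where "l = Arg w"
  have Re: "Re w > 0" using Re_link s z by (simp add: w_def)
  have d: "0 \<le> d" "d \<le> pi / 2" using le Arg_quadrant[OF z(1)] Arg_quadrant[OF z(2)] by (auto simp: d_def)
  have z0: "z \<noteq> 0" "z' \<noteq> 0" using z by (auto simp: quadrant_def)
  have zz: "cnj z * z' = complex_of_real (cmod z * cmod z') * cis d"
  proof -
    have "z = complex_of_real (cmod z) * cis (Arg z)" "z' = complex_of_real (cmod z') * cis (Arg z')"
      using rcis_cmod_Arg[of z] rcis_cmod_Arg[of z'] by (simp_all add: rcis_def)
    then have "cnj z * z' = (complex_of_real (cmod z) * cnj (cis (Arg z))) * (complex_of_real (cmod z') * cis (Arg z'))"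
      by (metis complex_cnj_complex_of_real complex_cnj_mult)
    also have "\<dots> = complex_of_real (cmod z * cmod z') * (cis (- Arg z) * cis (Arg z'))"
      by (simp add: cis_cnj)
    also have "\<dots> = complex_of_real (cmod z * cmod z') * cis d" by (simp add: cis_mult d_def)
    finally show ?thesis .
  qed
  have sd: "0 \<le> sin d" using d pi_gt_zero by (intro sin_ge_zero) auto
  have "Im w \<ge> 0" using zz sd by (simp add: w_def link_def)
  then show l0: "0 \<le> Arg (link s z s' z')" using Arg_less_0[of w] by (simp add: w_def)
  have lpi: "l < pi / 2" using Re Arg_Re_pos[of w] by (auto simp: l_def)
  have l0': "0 \<le> l" using l0 by (simp add: l_def w_def)
  \<comment> \<open>After rotation by \<open>- d\<close> the second summand of \<open>w\<close> is
    real, so the imaginary part comes from \<open>s * s'\<close> alone and its sign compares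
    \<open>l\<close> with \<open>d\<close>.\<close>
  have "w = complex_of_real (cmod w) * cis l" using rcis_cmod_Arg[of w] by (simp add: rcis_def l_def)
  then have "w * cis (- d) = complex_of_real (cmod w) * cis (l - d)" by (metis cis_mult mult.assoc uminus_add_conv_diff add.commute)
  then have "Im (w * cis (- d)) = cmod w * sin (l - d)" by simp
  moreover have "w * cis (- d) = complex_of_real (s * s') * cis (- d) + complex_of_real (cmod z * cmod z')"
    by (simp add: w_def link_def zz distrib_right mult.assoc cis_mult)
  then have "Im (w * cis (- d)) = - (s * s' * sin d)" by simp
  ultimately have key: "cmod w * sin (l - d) = - (s * s' * sin d)" by simp
  have w0: "cmod w > 0" using Re by auto
  have "l \<le> d"
  proof (rule ccontr)
    assume "\<not> l \<le> d"
    then have "sin (l - d) > 0" using lpi d by (intro sin_gt_zero) auto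
    then have "cmod w * sin (l - d) > 0" using w0 by simp
    moreover have "s * s' * sin d \<ge> 0" using s sd by simp
    ultimately show False using key by simp
  qed
  then show "Arg (link s z s' z') \<le> Arg z' - Arg z" by (simp add: l_def w_def d_def)
  show "Arg (link s z s' z') < Arg z' - Arg z" if "Arg z < Arg z'"
  proof -
    have "sin d > 0" using that d by (intro sin_gt_zero) (auto simp: d_def)
    then have "s * s' * sin d > 0" using s by simp
    then have "l \<noteq> d" using key by auto
    then show ?thesis using \<open>l \<le> d\<close> by (simp add: l_def w_def d_def)
  qed
qed

text \<open>The imaginary part of the product of the three links is a positive multiple of the
  determinant of the three points, so the sign of the holonomy is the orientation of the triangle.\<close>

lemma Arg_link_triangle:
  assumes s: "s1 > 0" "s2 > 0" "s3 > 0" and z: "quadrant z1" "quadrant z2" "quadrant z3"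
    and x: "s1\<^sup>2 - (cmod z1)\<^sup>2 = 2 * s1 * x1" "s2\<^sup>2 - (cmod z2)\<^sup>2 = 2 * s2 * x2" "s3\<^sup>2 - (cmod z3)\<^sup>2 = 2 * s3 * x3"
    and det: "x3 * Im (cnj z1 * z2) + x1 * Im (cnj z2 * z3) + x2 * Im (cnj z3 * z1) = D"
  shows "D \<ge> 0 \<Longrightarrow> Arg (link s1 z1 s2 z2) + Arg (link s2 z2 s3 z3) + Arg (link s3 z3 s1 z1) \<ge> 0"
    "D > 0 \<Longrightarrow> Arg (link s1 z1 s2 z2) + Arg (link s2 z2 s3 z3) + Arg (link s3 z3 s1 z1) > 0"
proof -
  define w1 where "w1 = link s1 z1 s2 z2"
  define w2 where "w2 = link s2 z2 s3 z3"
  define w3 where "w3 = link s3 z3 s1 z1"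
  define t where "t = Arg w1 + Arg w2 + Arg w3"
  have Re: "Re w1 > 0" "Re w2 > 0" "Re w3 > 0" using Re_link s z by (auto simp: w1_def w2_def w3_def)
  have c: "cmod w1 > 0" "cmod w2 > 0" "cmod w3 > 0" using Re by auto
  have "w1 * w2 * w3 = complex_of_real (cmod w1 * cmod w2 * cmod w3) * cis t"
  proof -
    have e: "w = complex_of_real (cmod w) * cis (Arg w)" for w using rcis_cmod_Arg[of w] by (simp add: rcis_def)
    have "w1 * w2 * w3 = (complex_of_real (cmod w1) * cis (Arg w1)) * (complex_of_real (cmod w2) * cis (Arg w2)) *
      (complex_of_real (cmod w3) * cis (Arg w3))" using e by metis
    also have "\<dots> = complex_of_real (cmod w1 * cmod w2 * cmod w3) * (cis (Arg w1) * cis (Arg w2) * cis (Arg w3))" by simp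
    also have "cis (Arg w1) * cis (Arg w2) * cis (Arg w3) = cis t" by (simp add: cis_mult t_def)
    finally show ?thesis .
  qed
  then have im1: "Im (w1 * w2 * w3) = cmod w1 * cmod w2 * cmod w3 * sin t" by simp
  have im2: "Im (w1 * w2 * w3) = 2 * s1 * s2 * s3 * D"
  proof -
    have "Im (w1 * w2 * w3) = s1 * s2 * (s3\<^sup>2 - (cmod z3)\<^sup>2) * Im (cnj z1 * z2) + s2 * s3 * (s1\<^sup>2 - (cmod z1)\<^sup>2) * Im (cnj z2 * z3)
      + s3 * s1 * (s2\<^sup>2 - (cmod z2)\<^sup>2) * Im (cnj z3 * z1)"
      unfolding w1_def w2_def w3_def link_def cmod_power2
      by (simp add: algebra_simps power2_eq_square)
    then show ?thesis unfolding x det[symmetric] by (simp add: algebra_simps)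
  qed
  have b12: "(Arg z1 \<le> Arg z2 \<longrightarrow> 0 \<le> Arg w1 \<and> Arg w1 \<le> Arg z2 - Arg z1) \<and>
     (Arg z2 \<le> Arg z1 \<longrightarrow> Arg z2 - Arg z1 \<le> Arg w1 \<and> Arg w1 \<le> 0)"
    using Arg_link_bounds[OF s(1,2) z(1,2)] Arg_link_bounds[OF s(2,1) z(2,1)] Arg_link_swap[OF s(1,2) z(1,2)]
    by (auto simp: w1_def)
  have b23: "(Arg z2 \<le> Arg z3 \<longrightarrow> 0 \<le> Arg w2 \<and> Arg w2 \<le> Arg z3 - Arg z2) \<and>
     (Arg z3 \<le> Arg z2 \<longrightarrow> Arg z3 - Arg z2 \<le> Arg w2 \<and> Arg w2 \<le> 0)"
    using Arg_link_bounds[OF s(2,3) z(2,3)] Arg_link_bounds[OF s(3,2) z(3,2)] Arg_link_swap[OF s(2,3) z(2,3)]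
    by (auto simp: w2_def)
  have b31: "(Arg z3 \<le> Arg z1 \<longrightarrow> 0 \<le> Arg w3 \<and> Arg w3 \<le> Arg z1 - Arg z3) \<and>
     (Arg z1 \<le> Arg z3 \<longrightarrow> Arg z1 - Arg z3 \<le> Arg w3 \<and> Arg w3 \<le> 0)"
    using Arg_link_bounds[OF s(3,1) z(3,1)] Arg_link_bounds[OF s(1,3) z(1,3)] Arg_link_swap[OF s(3,1) z(3,1)]
    by (auto simp: w3_def)
  note q = Arg_quadrant[OF z(1)] Arg_quadrant[OF z(2)] Arg_quadrant[OF z(3)]
  \<comment> \<open>Around a closed triple, the increases of the argument add up to at most its
    spread, and so do the decreases. All three arguments lie in a quarter turn, hence the sign of
    \<open>sin t\<close> is that of \<open>t\<close>.\<close>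
  have "\<bar>t\<bar> \<le> pi / 2" using b12 b23 b31 q unfolding t_def by (smt (verit))
  then have tpi: "- pi < t" "t < pi" using pi_gt_zero by linarith+
  have P: "cmod w1 * cmod w2 * cmod w3 > 0" using c by simp
  have key: "cmod w1 * cmod w2 * cmod w3 * sin t = 2 * s1 * s2 * s3 * D" using im1 im2 by simp
  have neg: "sin t < 0" if "t < 0" using sin_gt_zero[of "- t"] that tpi by simp
  have t0: "t \<ge> 0" if "D \<ge> 0"
  proof (rule ccontr)
    assume "\<not> t \<ge> 0"
    then have "cmod w1 * cmod w2 * cmod w3 * sin t < 0" using neg P by (simp add: mult_pos_neg)
    moreover have "2 * s1 * s2 * s3 * D \<ge> 0" using s that by simp
    ultimately show False using key by simp
  qed
  then show "D \<ge> 0 \<Longrightarrow> Arg (link s1 z1 s2 z2) + Arg (link s2 z2 s3 z3) + Arg (link s3 z3 s1 z1) \<ge> 0"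
    by (simp add: t_def w1_def w2_def w3_def)
  have "t > 0" if "D > 0"
  proof (rule ccontr)
    assume "\<not> t > 0"
    then have "t = 0" using t0 that by simp
    then have "2 * s1 * s2 * s3 * D = 0" using key by simp
    then show False using s that by simp
  qed
  then show "D > 0 \<Longrightarrow> Arg (link s1 z1 s2 z2) + Arg (link s2 z2 s3 z3) + Arg (link s3 z3 s1 z1) > 0"
    by (simp add: t_def w1_def w2_def w3_def)
qed

section \<open>Parallel transport of Fourier coefficients along edges\<close>

text \<open>Coefficients frozen at one time. Off \<open>S\<close> a solution has no time derivative,
  so there the equation is purely algebraic.\<close>

locale euler_support =
  fixes S :: "(real^3) set" and U :: "real^3 \<Rightarrow> complex^3"
  assumes fin: "finite S" and sym: "uminus ` S = S" and zero: "0 \<notin> S" and sp: "span S = UNIV"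
    and U0: "n \<notin> S \<Longrightarrow> U n = 0" and Unz: "n \<in> S \<Longrightarrow> U n \<noteq> 0"
    and div: "n \<in> S \<Longrightarrow> cdot (cvec n) (U n) = 0"
    and eq: "q \<notin> S \<Longrightarrow> q \<noteq> 0 \<Longrightarrow> leray q (euler_sum S U q) = 0"
begin

definition linked :: "real^3 \<Rightarrow> real^3 \<Rightarrow> bool" where
  "linked n m \<longleftrightarrow> (cdot (U n) (cvec m) = 0 \<and> cdot (U m) (cvec n) = 0) \<or>
    (norm n = norm m \<and>
     cdot (U n) (cvec m) * cdot (U m) (cvec (n \<times> m)) + cdot (U m) (cvec n) * cdot (U n) (cvec (n \<times> m)) = 0)"

lemma pair_dichotomy:
  assumes ab: "a \<in> S" "b \<in> S" "a \<times> b \<noteq> 0" "a + b \<notin> S"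
    and e: "euler_sum S U (a + b) = 2 *s (cdot (U a) (cvec b) *s U b + cdot (U b) (cvec a) *s U a)"
  shows "linked a b" "cdot (U a) (cvec b) = 0 \<longleftrightarrow> cdot (U b) (cvec a) = 0"
    "cdot (U a) (cvec b) \<noteq> 0 \<Longrightarrow> norm a = norm b"
proof -
  have q0: "a + b \<noteq> 0"
  proof
    assume "a + b = 0"
    then have "b = - a" by (simp add: eq_neg_iff_add_eq_0 add.commute)
    then show False using ab by simp
  qed
  then obtain k where "euler_sum S U (a + b) = k *s cvec (a + b)"
    using eq[OF ab(4) q0] leray_eq_0_iff by blast
  then have "2 *s (cdot (U a) (cvec b) *s U b + cdot (U b) (cvec a) *s U a) = k *s cvec (a + b)" using e by simp
  then have "(1/2::complex) *s (2 *s (cdot (U a) (cvec b) *s U b + cdot (U b) (cvec a) *s U a)) = (1/2) *s (k *s cvec (a + b))" by simp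
  then have "cdot (U a) (cvec b) *s U b + cdot (U b) (cvec a) *s U a = (k / 2) *s cvec (a + b)" by (simp add: vec.scale_scale)
  note D = interaction_dichotomy[OF ab(3) div[OF ab(1)] div[OF ab(2)] Unz[OF ab(1)] Unz[OF ab(2)] this]
  show "linked a b" using D unfolding linked_def by blast
  show "cdot (U a) (cvec b) = 0 \<longleftrightarrow> cdot (U b) (cvec a) = 0" using D by blast
  show "cdot (U a) (cvec b) \<noteq> 0 \<Longrightarrow> norm a = norm b" using D by blast
qed

text \<open>Abstracts the points of \<open>S\<close> on an edge of the hull: a sum of two of them is
  outside \<open>S\<close> and comes from no other pairs. Points between \<open>a\<close> and
  \<open>b\<close> are allowed, and then \<open>a + b\<close> may have further representations, so
  that \<open>pair_dichotomy\<close> does not apply to \<open>a\<close> and \<open>b\<close> at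
  once.\<close>

definition edge_set :: "(real^3) set \<Rightarrow> real^3 \<Rightarrow> real^3 \<Rightarrow> bool" where
  "edge_set T a b \<longleftrightarrow> T \<subseteq> S \<and> a \<in> T \<and> b \<in> T \<and> a \<times> b \<noteq> 0 \<and>
     (\<forall>p\<in>T. \<exists>t. 0 \<le> t \<and> t \<le> 1 \<and> p = a + t *\<^sub>R (b - a)) \<and>
     (\<forall>n\<in>S. \<forall>m\<in>S. \<forall>p\<in>T. \<forall>p'\<in>T. n + m = p + p' \<longrightarrow> n \<in> T \<and> m \<in> T) \<and>
     (\<forall>p\<in>T. \<forall>p'\<in>T. p + p' \<notin> S)"

lemma edge_set_swap: "edge_set T a b \<Longrightarrow> edge_set T b a"
proof -
  assume e: "edge_set T a b"
  have "\<forall>p\<in>T. \<exists>t. 0 \<le> t \<and> t \<le> 1 \<and> p = b + t *\<^sub>R (a - b)"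
  proof
    fix p assume p: "p \<in> T"
    have "\<forall>p\<in>T. \<exists>t. 0 \<le> t \<and> t \<le> 1 \<and> p = a + t *\<^sub>R (b - a)" using e unfolding edge_set_def by (elim conjE)
    then obtain t where "0 \<le> t" "t \<le> 1" "p = a + t *\<^sub>R (b - a)" using p by blast
    then show "\<exists>t. 0 \<le> t \<and> t \<le> 1 \<and> p = b + t *\<^sub>R (a - b)" by (intro exI[of _ "1 - t"]) (simp add: algebra_simps)
  qed
  moreover have "b \<times> a \<noteq> 0" using e cross_skew[of a b] by (auto simp: edge_set_def)
  ultimately show ?thesis using e unfolding edge_set_def by (elim conjE, intro conjI) assumption+
qed

lemma edge_setD:
  assumes "edge_set T a b"
  shows "T \<subseteq> S" "a \<in> T" "b \<in> T" "a \<times> b \<noteq> 0"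
    "p \<in> T \<Longrightarrow> \<exists>t. 0 \<le> t \<and> t \<le> 1 \<and> p = a + t *\<^sub>R (b - a)"
    "n \<in> S \<Longrightarrow> m \<in> S \<Longrightarrow> p \<in> T \<Longrightarrow> p' \<in> T \<Longrightarrow> n + m = p + p' \<Longrightarrow> n \<in> T \<and> m \<in> T"
    "p \<in> T \<Longrightarrow> p' \<in> T \<Longrightarrow> p + p' \<notin> S"
proof -
  have c: "\<forall>n\<in>S. \<forall>m\<in>S. \<forall>p\<in>T. \<forall>p'\<in>T. n + m = p + p' \<longrightarrow> n \<in> T \<and> m \<in> T"
    using assms unfolding edge_set_def by (elim conjE)
  then show "n \<in> S \<Longrightarrow> m \<in> S \<Longrightarrow> p \<in> T \<Longrightarrow> p' \<in> T \<Longrightarrow> n + m = p + p' \<Longrightarrow> n \<in> T \<and> m \<in> T" by blast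
qed (use assms in \<open>simp_all add: edge_set_def\<close>)

text \<open>Orthogonality to the edge spreads from \<open>a\<close>. Let \<open>j\<close> be the
  nearest point that violates it: any other representation of \<open>a + j\<close> uses points
  nearer to \<open>a\<close>, whose interaction vanishes. So the pair \<open>a\<close>,
  \<open>j\<close> is isolated, and the dichotomy passes the zero pairing from \<open>U a\<close> to
  \<open>U j\<close>.\<close>

lemma edge_perp:
  assumes e: "edge_set T a b" and perp: "cdot (U a) (cvec (b - a)) = 0" and p: "p \<in> T"
  shows "cdot (U p) (cvec (b - a)) = 0"
proof (rule ccontr)
  assume np: "cdot (U p) (cvec (b - a)) \<noteq> 0"
  let ?d = "b - a"
  note T = edge_setD(1-4)[OF e] and par = edge_setD(5)[OF e] and cl = edge_setD(6)[OF e] and out = edge_setD(7)[OF e]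
  have d0: "?d \<noteq> 0" using T by auto
  \<comment> \<open>Position on the edge, 0 at \<open>a\<close> and 1 at \<open>b\<close>, written
    as a projection so that positions add when points add.\<close>
  define tt where "tt p = ((p - a) \<bullet> ?d) / (?d \<bullet> ?d)" for p
  have tt: "p = a + tt p *\<^sub>R ?d" "0 \<le> tt p" if pT: "p \<in> T" for p
  proof -
    obtain t where t: "0 \<le> t" "p = a + t *\<^sub>R ?d" using par[OF pT] by blast
    have "tt p = t" using d0 by (simp add: tt_def t(2))
    then show "p = a + tt p *\<^sub>R ?d" "0 \<le> tt p" using t by auto
  qed
  have inj: "p = p'" if "p \<in> T" "p' \<in> T" "tt p = tt p'" for p p' using tt(1)[OF that(1)] tt(1)[OF that(2)] that(3) by metis
  have dot: "cdot (U p) (cvec p') = complex_of_real (tt p' - tt p) * cdot (U p) (cvec ?d)" if "p \<in> T" "p' \<in> T" for p p'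
  proof -
    have "p' - p = (a + tt p' *\<^sub>R ?d) - (a + tt p *\<^sub>R ?d)"
      by (rule arg_cong2[of _ _ _ _ "(-)", OF tt(1)[OF that(2)] tt(1)[OF that(1)]])
    then have "p' = p + (tt p' - tt p) *\<^sub>R ?d" by (simp add: algebra_simps)
    then have "cdot (U p) (cvec p') = cdot (U p) (cvec p) + complex_of_real (tt p' - tt p) * cdot (U p) (cvec ?d)"
      by (metis cdot_linear(2,6) cvec_linear(1,4))
    then show ?thesis using div[of p] T that by (auto simp: cdot_commute)
  qed
  define N where "N = {p\<in>T. cdot (U p) (cvec ?d) \<noteq> 0}"
  have "finite N" "N \<noteq> {}" using finite_subset[OF T(1) fin] p np by (auto simp: N_def)
  then obtain j where j: "j \<in> N" "\<And>x. x \<in> N \<Longrightarrow> - tt x \<le> - tt j" using finite_argmax[of N "\<lambda>x. - tt x"] by blast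
  have jT: "j \<in> T" and jn: "cdot (U j) (cvec ?d) \<noteq> 0" using j by (auto simp: N_def)
  have ja: "j \<noteq> a" using jn perp by auto
  have tta: "tt a = 0" by (simp add: tt_def)
  have ttj: "tt j > 0" using tt(2)[OF jT] inj[OF jT T(2)] ja tta by fastforce
  have low: "cdot (U x) (cvec ?d) = 0" if "x \<in> T" "tt x < tt j" for x using j(2)[of x] that by (force simp: N_def)
  let ?P = "{(n1, n2). n1 \<in> S \<and> n2 \<in> S \<and> n1 + n2 = a + j}"
  let ?f = "\<lambda>(n1, n2). cdot (U n1) (cvec n2) *s U n2 + cdot (U n2) (cvec n1) *s U n1"
  have "euler_sum S U (a + j) = sum ?f {(a, j), (j, a)}" unfolding euler_sum_def
  proof (rule sum.mono_neutral_right)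
    have "?P \<subseteq> Sigma S (\<lambda>_. S)" by auto
    then show "finite ?P" using fin by (meson finite_SigmaI finite_subset)
    show "{(a, j), (j, a)} \<subseteq> ?P" using T jT by (auto simp: add.commute)
    show "\<forall>i\<in>?P - {(a, j), (j, a)}. ?f i = 0"
    proof
      fix i assume i: "i \<in> ?P - {(a, j), (j, a)}"
      obtain x y where xy: "i = (x, y)" by fastforce
      have s: "x \<in> S" "y \<in> S" "x + y = a + j" "x \<noteq> a" "y \<noteq> a" using i xy by (auto simp: algebra_simps)
      then have xT: "x \<in> T" "y \<in> T" using cl[OF s(1,2) T(2) jT] by auto
      have "(x - a) + (y - a) = j - a" using s(3) by (simp add: algebra_simps)
      then have "tt x + tt y = tt j" unfolding tt_def by (metis add_divide_distrib inner_add_left)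
      moreover have "tt x > 0" "tt y > 0" using tt(2) xT inj[OF _ T(2)] s tta by fastforce+
      ultimately have "cdot (U x) (cvec ?d) = 0" "cdot (U y) (cvec ?d) = 0" using low xT by auto
      then show "?f i = 0" using xy dot xT by simp
    qed
  qed
  also have "\<dots> = 2 *s (cdot (U a) (cvec j) *s U j + cdot (U j) (cvec a) *s U a)"
    using ja by (simp add: vec_eq_iff)
  finally have e: "euler_sum S U (a + j) = 2 *s (cdot (U a) (cvec j) *s U j + cdot (U j) (cvec a) *s U a)" .
  have "a \<times> j = tt j *\<^sub>R (a \<times> b)"
    by (subst tt(1)[OF jT]) (simp add: cross_add_right cross_mult_right Cross3.right_diff_distrib)
  then have aj: "a \<times> j \<noteq> 0" using ttj T by simp
  have "cdot (U a) (cvec j) = 0" using dot[OF T(2) jT] perp by simp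
  then have "cdot (U j) (cvec a) = 0" using pair_dichotomy(2)[OF _ _ aj out[OF T(2) jT] e] T jT by auto
  then show False using dot[OF jT T(2)] tta ttj jn by simp
qed

text \<open>The point of \<open>T\<close> next to \<open>a\<close> forms with \<open>a\<close> a sum
  of unique representation, as positions on the edge add. A nonzero pairing then forces equal
  norms.\<close>

lemma edge_first:
  assumes e: "edge_set T a b" and nperp: "cdot (U a) (cvec (b - a)) \<noteq> 0"
  obtains t where "0 < t" "t \<le> 1" "norm (a + t *\<^sub>R (b - a)) = norm a" "linked a (a + t *\<^sub>R (b - a))"
proof -
  let ?d = "b - a"
  note T = edge_setD(1-4)[OF e] and par = edge_setD(5)[OF e] and cl = edge_setD(6)[OF e] and out = edge_setD(7)[OF e]
  have d0: "?d \<noteq> 0" using T by auto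
  define A where "A = {t. 0 < t \<and> a + t *\<^sub>R ?d \<in> T}"
  have inj: "inj (\<lambda>t. a + t *\<^sub>R ?d)" using d0 by (auto simp: inj_on_def)
  have "finite ((\<lambda>t. a + t *\<^sub>R ?d) ` A)"
    by (rule finite_subset[OF _ finite_subset[OF T(1) fin]]) (auto simp: A_def)
  then have "finite A" using inj by (meson finite_imageD inj_on_subset subset_UNIV)
  moreover have "1 \<in> A" using T by (simp add: A_def)
  ultimately obtain t where t: "t \<in> A" "\<And>x. x \<in> A \<Longrightarrow> - x \<le> - t" using finite_argmax[of A "\<lambda>x. - x"] by blast
  let ?p = "a + t *\<^sub>R ?d"
  have t0: "0 < t" and pT: "?p \<in> T" using t by (auto simp: A_def)
  have t1: "t \<le> 1" using t(2)[of 1] \<open>1 \<in> A\<close> by simp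
  have ap: "a \<noteq> ?p" using t0 d0 by simp
  have cr: "a \<times> ?p = t *\<^sub>R (a \<times> b)" by (simp add: cross_add_right cross_mult_right Cross3.right_diff_distrib)
  then have cr0: "a \<times> ?p \<noteq> 0" using t0 T by simp
  have "euler_sum S U (a + ?p) = 2 *s (cdot (U a) (cvec ?p) *s U ?p + cdot (U ?p) (cvec a) *s U a)"
  proof (rule euler_sum_pair)
    show "a \<in> S" "?p \<in> S" "a \<noteq> ?p" using T pT ap by auto
    fix n m assume nm: "n \<in> S" "m \<in> S" "n + m = a + ?p"
    then have "n \<in> T" "m \<in> T" using cl[OF nm(1,2) T(2) pT] by auto
    then obtain x y where x: "0 \<le> x" "n = a + x *\<^sub>R ?d" and y: "0 \<le> y" "m = a + y *\<^sub>R ?d" using par by blast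
    have "(x + y) *\<^sub>R ?d = t *\<^sub>R ?d" using nm(3) x y by (simp add: algebra_simps)
    then have xy: "x + y = t" using d0 by simp
    have "x = 0 \<or> y = 0"
    proof (rule ccontr)
      assume "\<not> ?thesis"
      then have "x \<in> A" "y \<in> A" using x y \<open>n \<in> T\<close> \<open>m \<in> T\<close> by (auto simp: A_def)
      then have "t \<le> x" "t \<le> y" using t(2)[of x] t(2)[of y] by auto
      then show False using xy t0 by simp
    qed
    then show "n = a \<or> n = ?p" using x y xy by auto
  qed
  note D = pair_dichotomy[OF _ _ cr0 out[OF T(2) pT] this]
  have "cdot (U a) (cvec ?p) = complex_of_real t * cdot (U a) (cvec ?d)"
    using div[of a] T by (auto simp: cvec_linear cdot_linear cdot_commute)
  then have "cdot (U a) (cvec ?p) \<noteq> 0" using t0 nperp by simp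
  then have "norm a = norm ?p" using D(3) T pT by auto
  moreover have "linked a ?p" using D(1) T pT by auto
  ultimately show thesis using that[of t] t0 t1 by simp
qed

text \<open>If neither end is orthogonal to the edge, the point next to \<open>a\<close> is the
  second intersection of the line with the sphere through \<open>a\<close>, and likewise for
  \<open>b\<close>. Both chords have the same midpoint, so their parameters satisfy
  \<open>t + t' = 2\<close>; each is at most 1, hence the neighbour of \<open>a\<close> is
  \<open>b\<close> itself.\<close>

lemma edge_linked:
  assumes e: "edge_set T a b"
  shows "linked a b"
proof (cases "cdot (U a) (cvec (b - a)) = 0 \<or> cdot (U b) (cvec (b - a)) = 0")
  case True
  note T = edge_setD(1-3)[OF e]
  have m: "cdot (U p) (cvec (a - b)) = - cdot (U p) (cvec (b - a))" for p
    by (metis cdot_linear(8) cvec_linear(3) minus_diff_eq)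
  have "cdot (U a) (cvec (b - a)) = 0 \<and> cdot (U b) (cvec (b - a)) = 0"
    using edge_perp[OF e _ T(3)] edge_perp[OF edge_set_swap[OF e] _ T(2)] True m by auto
  moreover have "cdot (U a) (cvec a) = 0" "cdot (U b) (cvec b) = 0" using div T by (auto simp: cdot_commute)
  ultimately show ?thesis by (auto simp: linked_def cvec_linear cdot_linear)
next
  case False
  let ?d = "b - a"
  have d0: "?d \<noteq> 0" using False by (auto simp: cvec_linear cdot_linear)
  have m: "cdot (U p) (cvec (a - b)) = - cdot (U p) (cvec (b - a))" for p
    by (metis cdot_linear(8) cvec_linear(3) minus_diff_eq)
  obtain t where t: "0 < t" "t \<le> 1" "norm (a + t *\<^sub>R ?d) = norm a" "linked a (a + t *\<^sub>R ?d)"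
    using edge_first[OF e] False by blast
  obtain t' where t': "0 < t'" "t' \<le> 1" "norm (b + t' *\<^sub>R (a - b)) = norm b"
    using edge_first[OF edge_set_swap[OF e]] False m by (metis neg_equal_0_iff_equal)
  have "(a + t *\<^sub>R ?d) \<bullet> (a + t *\<^sub>R ?d) = a \<bullet> a" using t(3) by (simp add: dot_square_norm)
  then have "t * (2 * (a \<bullet> ?d) + t * (?d \<bullet> ?d)) = 0" by (simp add: inner_simps inner_commute algebra_simps)
  then have 1: "2 * (a \<bullet> ?d) + t * (?d \<bullet> ?d) = 0" using t by simp
  have "(b + t' *\<^sub>R (a - b)) \<bullet> (b + t' *\<^sub>R (a - b)) = b \<bullet> b" using t'(3) by (simp add: dot_square_norm)
  then have "t' * (t' * (?d \<bullet> ?d) - 2 * (b \<bullet> ?d)) = 0" by (simp add: inner_simps inner_commute algebra_simps)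
  then have 2: "t' * (?d \<bullet> ?d) - 2 * (b \<bullet> ?d) = 0" using t' by simp
  have "b \<bullet> ?d = a \<bullet> ?d + ?d \<bullet> ?d" by (simp add: inner_simps)
  then have "(t + t') * (?d \<bullet> ?d) = 2 * (?d \<bullet> ?d)" using 1 2 by (simp add: algebra_simps)
  then have "t + t' = 2" using d0 by simp
  then have "t = 1" using t t' by simp
  then show ?thesis using t by simp
qed

end

section \<open>Helical vectors in spinor coordinates\<close>

locale oriented_frame =
  fixes k i1 i2 :: "real^3"
  assumes norms: "norm i1 = 1" "norm i2 = 1" and orth: "i1 \<bullet> i2 = 0" and kdef: "k = i1 \<times> i2"
begin

lemma dots: "i1 \<bullet> i1 = 1" "i2 \<bullet> i2 = 1" "i1 \<bullet> i2 = 0" "i2 \<bullet> i1 = 0" "k \<bullet> i1 = 0" "k \<bullet> i2 = 0" "i1 \<bullet> k = 0" "i2 \<bullet> k = 0" "k \<bullet> k = 1"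
proof -
  show "i1 \<bullet> i1 = 1" "i2 \<bullet> i2 = 1" "i1 \<bullet> i2 = 0" "i2 \<bullet> i1 = 0" using norms orth by (simp_all add: dot_square_norm inner_commute)
  show "k \<bullet> i1 = 0" "k \<bullet> i2 = 0" "i1 \<bullet> k = 0" "i2 \<bullet> k = 0" by (simp_all add: kdef dot_cross_self)
  have "(norm k)\<^sup>2 = 1" using norm_cross_dot[of i1 i2] norms orth by (simp add: kdef)
  then show "k \<bullet> k = 1" by (simp add: dot_square_norm)
qed

lemma crosses: "i1 \<times> i2 = k" "i2 \<times> i1 = - k" "i2 \<times> k = i1" "k \<times> i2 = - i1" "k \<times> i1 = i2" "i1 \<times> k = - i2"
proof -
  show 1: "i1 \<times> i2 = k" by (simp add: kdef)
  show "i2 \<times> i1 = - k" using cross_skew[of i2 i1] 1 by simp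
  show 2: "i2 \<times> k = i1" unfolding kdef by (subst Lagrange) (use dots in simp)
  show "k \<times> i2 = - i1" using cross_skew[of k i2] 2 by simp
  have "i1 \<times> k = - i2" unfolding kdef by (subst Lagrange) (use dots in simp)
  then show "i1 \<times> k = - i2" "k \<times> i1 = i2" using cross_skew[of k i1] by simp_all
qed

definition xx :: "real^3 \<Rightarrow> real" where "xx n = n \<bullet> k"
definition nu :: "real^3 \<Rightarrow> complex" where "nu n = Complex (n \<bullet> i1) (n \<bullet> i2)"
definition ss :: "real^3 \<Rightarrow> real" where "ss n = norm n + n \<bullet> k"

text \<open>The isotropic vector orthogonal to \<open>n\<close>; in terms of the spinor \<open>z = nu n / ss n\<close>
  (stereographic projection from \<open>- k\<close>) it is proportional to the square of \<open>(1, z)\<close>.\<close>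

definition hv :: "real^3 \<Rightarrow> complex^3" where
  "hv n = (of_real (ss n) * nu n) *s cvec k + ((nu n ^ 2 - of_real (ss n) ^ 2) / 2) *s cvec i1 +
     (- \<i> * (nu n ^ 2 + of_real (ss n) ^ 2) / 2) *s cvec i2"

lemma expand: "n = xx n *\<^sub>R k + (n \<bullet> i1) *\<^sub>R i1 + (n \<bullet> i2) *\<^sub>R i2"
proof -
  define w where "w = n - (xx n *\<^sub>R k + (n \<bullet> i1) *\<^sub>R i1 + (n \<bullet> i2) *\<^sub>R i2)"
  have "w = 0"
  proof (rule orthogonal_frame_zero[of i1 i2])
    show "i1 \<times> i2 \<noteq> 0" using dots crosses by auto
    show "i1 \<bullet> w = 0" "i2 \<bullet> w = 0" "(i1 \<times> i2) \<bullet> w = 0"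
      unfolding crosses w_def by (simp_all add: inner_simps dots xx_def inner_commute)
  qed
  then show ?thesis by (simp add: w_def)
qed

lemma norm_expand: "(norm n)\<^sup>2 = (xx n)\<^sup>2 + (cmod (nu n))\<^sup>2"
proof -
  have "n \<bullet> n = n \<bullet> (xx n *\<^sub>R k + (n \<bullet> i1) *\<^sub>R i1 + (n \<bullet> i2) *\<^sub>R i2)" using expand[of n] by simp
  then have "(norm n)\<^sup>2 = (xx n)\<^sup>2 + ((n \<bullet> i1)\<^sup>2 + (n \<bullet> i2)\<^sup>2)"
    by (simp add: dot_square_norm inner_simps xx_def power2_eq_square)
  then show ?thesis by (simp add: cmod_power2 nu_def)
qed

lemma ss_identities:
  "(ss n)\<^sup>2 - (cmod (nu n))\<^sup>2 = 2 * ss n * xx n" "(ss n)\<^sup>2 + (cmod (nu n))\<^sup>2 = 2 * ss n * norm n"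
  using norm_expand[of n] by (simp_all add: ss_def xx_def power2_eq_square algebra_simps)

lemma ss_pos: assumes "nu n \<noteq> 0" shows "ss n > 0"
proof -
  have "(xx n)\<^sup>2 < (norm n)\<^sup>2" using norm_expand[of n] assms by simp
  then have "\<bar>xx n\<bar> < norm n" by (metis norm_ge_zero power2_abs power_less_imp_less_base)
  then show ?thesis by (simp add: ss_def xx_def)
qed

text \<open>The first factor is the skew product of the two spinors, the second the conjugate of
  their \<open>link\<close>. This factorisation is the reason for the quadratic form of
  \<open>hv\<close>.\<close>

lemma cdot_hv: "2 * of_real (ss m) * cdot (hv n) (cvec m) =
   (nu n * of_real (ss m) - of_real (ss n) * nu m) * (of_real (ss n * ss m) + nu n * cnj (nu m))"
proof -
  have m: "complex_of_real (m \<bullet> i1) = (nu m + cnj (nu m)) / 2" "complex_of_real (m \<bullet> i2) = (nu m - cnj (nu m)) / (2 * \<i>)"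
    by (simp_all add: nu_def complex_eq_iff)
  have "cdot (hv n) (cvec m) = of_real (ss n) * nu n * of_real (xx m) + ((nu n ^ 2 - of_real (ss n) ^ 2) / 2) * of_real (m \<bullet> i1) +
     (- \<i> * (nu n ^ 2 + of_real (ss n) ^ 2) / 2) * of_real (m \<bullet> i2)"
    by (simp add: hv_def cdot_linear cdot_cvec xx_def inner_commute)
  also have "\<dots> = of_real (ss n) * nu n * of_real (xx m) + (nu n ^ 2 * cnj (nu m) - of_real (ss n) ^ 2 * nu m) / 2"
    unfolding m by (simp add: field_simps power2_eq_square)
  finally have e: "cdot (hv n) (cvec m) = of_real (ss n) * nu n * of_real (xx m) + (nu n ^ 2 * cnj (nu m) - of_real (ss n) ^ 2 * nu m) / 2" .
  have "2 * of_real (ss m) * cdot (hv n) (cvec m) = of_real (ss n) * nu n * of_real (2 * ss m * xx m)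
     + of_real (ss m) * (nu n ^ 2 * cnj (nu m) - of_real (ss n) ^ 2 * nu m)"
    unfolding e by (simp add: field_simps)
  also have "complex_of_real (2 * ss m * xx m) = of_real (ss m) ^ 2 - nu m * cnj (nu m)"
    unfolding ss_identities(1)[symmetric] by (simp add: complex_norm_square[symmetric])
  finally show ?thesis by (simp add: algebra_simps power2_eq_square)
qed

lemma hv_orth: assumes "nu n \<noteq> 0" shows "cdot (cvec n) (hv n) = 0"
  using cdot_hv[of n n] ss_pos[OF assms] by (simp add: cdot_commute mult.commute)

text \<open>Multiplied by \<open>2 * ss n\<close>, both the norm and the height of \<open>n\<close>
  become polynomials in the spinor, and the claim becomes a polynomial identity in each
  coordinate.\<close>

lemma hv_helical: "ccross (cvec n) (hv n) = (- \<i> * of_real (norm n)) *s hv n"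
proof (cases "ss n = 0")
  case True
  then have "nu n = 0" using ss_identities(2)[of n] by simp
  then show ?thesis using True by (simp add: hv_def ccross_linear vec_eq_iff)
next
  case False
  have m: "complex_of_real (n \<bullet> i1) = (nu n + cnj (nu n)) / 2" "complex_of_real (n \<bullet> i2) = (nu n - cnj (nu n)) / (2 * \<i>)"
    by (simp_all add: nu_def complex_eq_iff)
  have N: "2 * complex_of_real (ss n) * of_real (norm n) = of_real (ss n) ^ 2 + nu n * cnj (nu n)"
    "2 * complex_of_real (ss n) * of_real (xx n) = of_real (ss n) ^ 2 - nu n * cnj (nu n)"
    using arg_cong[OF ss_identities(1)[of n], of complex_of_real] arg_cong[OF ss_identities(2)[of n], of complex_of_real]
    by (simp_all add: complex_norm_square[symmetric])
  let ?x = "complex_of_real (xx n)" and ?a = "complex_of_real (n \<bullet> i1)" and ?b = "complex_of_real (n \<bullet> i2)"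
  let ?h0 = "of_real (ss n) * nu n" and ?h1 = "(nu n ^ 2 - of_real (ss n) ^ 2) / 2" and ?h2 = "- \<i> * (nu n ^ 2 + of_real (ss n) ^ 2) / 2"
  have cn: "cvec n = ?x *s cvec k + ?a *s cvec i1 + ?b *s cvec i2"
    by (subst expand[of n]) (simp add: cvec_linear)
  have X: "ccross (cvec n) (hv n) = (?a * ?h2 - ?b * ?h1) *s cvec k + (?b * ?h0 - ?x * ?h2) *s cvec i1 + (?x * ?h1 - ?a * ?h0) *s cvec i2"
    unfolding cn hv_def by (simp add: ccross_linear ccross_cvec crosses cvec_linear vec_eq_iff algebra_simps)
  have c0: "?a * ?h2 - ?b * ?h1 = (- \<i> * of_real (norm n)) * ?h0"
  proof -
    have "2 * (?a * ?h2 - ?b * ?h1) = - \<i> * (2 * complex_of_real (ss n) * of_real (norm n)) * nu n"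
      unfolding m N by (simp add: field_simps power2_eq_square)
    also have "\<dots> = 2 * ((- \<i> * of_real (norm n)) * ?h0)" by (simp add: algebra_simps)
    finally show ?thesis by (rule mult_left_cancel[THEN iffD1, rotated]) simp
  qed
  have c1: "?b * ?h0 - ?x * ?h2 = (- \<i> * of_real (norm n)) * ?h1"
  proof -
    have "2 * of_real (ss n) * (?b * ?h0 - ?x * ?h2) = 2 * of_real (ss n) * (?b * ?h0) - (2 * complex_of_real (ss n) * of_real (xx n)) * ?h2"
      by (simp add: algebra_simps)
    also have "\<dots> = - \<i> * (2 * complex_of_real (ss n) * of_real (norm n)) * ?h1"
      unfolding m N by (simp add: field_simps power2_eq_square power4_eq_xxxx)
    also have "\<dots> = 2 * of_real (ss n) * ((- \<i> * of_real (norm n)) * ?h1)" by simp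
    finally show ?thesis by (rule mult_left_cancel[THEN iffD1, rotated]) (use False in simp)
  qed
  have c2: "?x * ?h1 - ?a * ?h0 = (- \<i> * of_real (norm n)) * ?h2"
  proof -
    have "2 * of_real (ss n) * (?x * ?h1 - ?a * ?h0) = (2 * complex_of_real (ss n) * of_real (xx n)) * ?h1 - 2 * of_real (ss n) * (?a * ?h0)"
      by (simp add: algebra_simps)
    also have "\<dots> = - \<i> * (2 * complex_of_real (ss n) * of_real (norm n)) * ?h2"
      unfolding m N by (simp add: field_simps power2_eq_square power4_eq_xxxx)
    also have "\<dots> = 2 * of_real (ss n) * ((- \<i> * of_real (norm n)) * ?h2)" by simp
    finally show ?thesis by (rule mult_left_cancel[THEN iffD1, rotated]) (use False in simp)
  qed
  show ?thesis unfolding X c0 c1 c2 unfolding hv_def by (simp only: vec.scale_right_distrib vec.scale_scale)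
qed

lemma hv_hv: "cdot (hv n) (hv n) = 0"
  by (simp add: hv_def cdot_linear cdot_cvec dots field_simps power2_eq_square)

definition GG :: "real^3 \<Rightarrow> real" where "GG n = ((cmod (nu n))\<^sup>2 + (ss n)\<^sup>2)\<^sup>2 / 2"

lemma hv_cconj: "cdot (hv n) (cconj (hv n)) = of_real (GG n)"
proof -
  have "cdot (hv n) (cconj (hv n)) = (nu n * cnj (nu n) + of_real (ss n) ^ 2)\<^sup>2 / 2"
    by (simp add: hv_def cconj_linear cdot_linear cdot_cvec dots field_simps power2_eq_square)
  also have "\<dots> = of_real (GG n)"
    by (simp add: GG_def complex_norm_square[symmetric])
  finally show ?thesis .
qed

definition P :: "complex^3 \<Rightarrow> real^3 \<Rightarrow> complex" where "P u n = cdot u (hv n)"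
definition P' :: "complex^3 \<Rightarrow> real^3 \<Rightarrow> complex" where "P' u n = cdot u (cconj (hv n))"

lemma GG_pos: "nu n \<noteq> 0 \<Longrightarrow> GG n > 0"
  by (simp add: GG_def add_pos_nonneg)

text \<open>\<open>hv n\<close> and its conjugate are isotropic and span the plane orthogonal to
  \<open>n\<close>. Pairing with one of them therefore reads off the coefficient of the other, which
  is why \<open>P'\<close> accompanies \<open>hv n\<close>.\<close>

lemma decompose:
  assumes n: "nu n \<noteq> 0" and u: "cdot (cvec n) u = 0"
  shows "of_real (GG n) *s u = P' u n *s hv n + P u n *s cconj (hv n)"
proof -
  let ?h = "hv n" and ?g = "cconj (hv n)"
  have n0: "n \<noteq> 0" using n by (auto simp: nu_def complex_eq_iff)
  define w where "w = of_real (GG n) *s u - (P' u n *s ?h + P u n *s ?g)"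
  have ng: "cdot (cvec n) ?g = 0" using cdot_cconj[of "cvec n" ?h] hv_orth[OF n] by simp
  have gg: "cdot ?g ?g = 0" using cdot_cconj[of ?h ?h] hv_hv by simp
  have w: "cdot (cvec n) w = 0" "cdot w ?h = 0" "cdot w ?g = 0"
    unfolding w_def using u hv_orth[OF n] ng hv_cconj[of n] hv_hv[of n] gg
    by (simp_all add: cdot_linear P_def P'_def cdot_commute[of ?g ?h] cdot_commute[of ?h u] cdot_commute[of ?g u])
  have "ccross w (ccross ?h ?g) = 0" using w by (simp add: ccross_ccross)
  moreover have "ccross (cvec n) (ccross ?h ?g) = 0" using hv_orth[OF n] ng by (simp add: ccross_ccross)
  then have "ccross (cvec n) (ccross (cvec n) (ccross ?h ?g)) = 0" by (simp add: ccross_linear)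
  then have par: "of_real (n \<bullet> n) *s ccross ?h ?g = cdot (cvec n) (ccross ?h ?g) *s cvec n"
    by (simp add: ccross_ccross[of _ "cvec n"] cdot_cvec)
  have c: "cdot (cvec n) (ccross ?h ?g) = - \<i> * of_real (norm n) * of_real (GG n)"
    using cdot_ccross_rotate[of "cvec n" ?h ?g] hv_helical[of n] hv_cconj[of n]
    by (simp add: cdot_linear cdot_commute[of ?g ?h])
  ultimately have "ccross w (cdot (cvec n) (ccross ?h ?g) *s cvec n) = 0"
    by (metis ccross_linear(6) vec.scale_zero_right par)
  then have "(- \<i> * of_real (norm n) * of_real (GG n)) *s ccross w (cvec n) = 0"
    unfolding c by (simp add: ccross_linear)
  then have "ccross w (cvec n) = 0" using n0 GG_pos[OF n] by simp
  then have "ccross (cvec n) (ccross w (cvec n)) = 0" by (simp add: ccross_linear)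
  then have "of_real (n \<bullet> n) *s w = 0" using w by (simp add: ccross_ccross cdot_cvec)
  then have "w = 0" using n0 by simp
  then show ?thesis by (simp add: w_def)
qed

text \<open>By \<open>cdot_hv\<close> the pairings of the helical vectors with the other frequency
  differ from \<open>link\<close> and its conjugate by a spinor skew product, whose squared modulus
  cancels. So \<open>P / P'\<close> is multiplied by the square of \<open>link\<close> over the
  square of its conjugate: a phase of four times the argument.\<close>

lemma transport:
  assumes n: "nu n \<noteq> 0" "nu m \<noteq> 0" and ind: "n \<times> m \<noteq> 0"
    and u: "cdot (cvec n) u = 0" and v: "cdot (cvec m) v = 0"
    and lk: "(cdot u (cvec m) = 0 \<and> cdot v (cvec n) = 0) \<or>
    (norm n = norm m \<and> cdot u (cvec m) * cdot v (cvec (n \<times> m)) + cdot v (cvec n) * cdot u (cvec (n \<times> m)) = 0)"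
  shows "P' u n * P v m * (cnj (link (ss n) (nu n) (ss m) (nu m)))\<^sup>2 = P u n * P' v m * (link (ss n) (nu n) (ss m) (nu m))\<^sup>2"
proof -
  define b1 where "b1 = cdot (hv n) (cvec m)"
  define b2 where "b2 = cdot (hv m) (cvec n)"
  define A1 B1 A2 B2 where "A1 = P' u n" and "B1 = P u n" and "A2 = P' v m" and "B2 = P v m"
  define G H where "G = complex_of_real (GG n)" and "H = complex_of_real (GG m)"
  have G0: "G \<noteq> 0" "H \<noteq> 0" using GG_pos n by (auto simp: G_def H_def) (metis less_irrefl)+
  have cb: "cdot (cconj (hv n)) (cvec m) = cnj b1" "cdot (cconj (hv m)) (cvec n) = cnj b2"
    using cdot_cconj[of "hv n" "cvec m"] cdot_cconj[of "hv m" "cvec n"] by (simp_all add: b1_def b2_def)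
  have e1: "cdot (hv n) (cvec (n \<times> m)) = \<i> * of_real (norm n) * b1"
  proof -
    have "cdot (hv n) (ccross (cvec n) (cvec m)) = cdot (cvec m) (ccross (hv n) (cvec n))" by (rule cdot_ccross_rotate)
    also have "\<dots> = - cdot (cvec m) (ccross (cvec n) (hv n))" by (subst ccross_skew) (simp add: cdot_linear)
    also have "\<dots> = \<i> * of_real (norm n) * b1" by (simp add: hv_helical cdot_linear b1_def cdot_commute)
    finally show ?thesis by (simp add: ccross_cvec)
  qed
  have e2: "cdot (hv m) (cvec (n \<times> m)) = - \<i> * of_real (norm m) * b2"
  proof -
    have "cdot (hv m) (ccross (cvec n) (cvec m)) = cdot (cvec n) (ccross (cvec m) (hv m))" by (rule cdot_ccross_rotate[symmetric])
    also have "\<dots> = - \<i> * of_real (norm m) * b2" by (simp add: hv_helical cdot_linear b2_def cdot_commute)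
    finally show ?thesis by (simp add: ccross_cvec)
  qed
  have ce: "cdot (cconj (hv n)) (cvec (n \<times> m)) = - \<i> * of_real (norm n) * cnj b1"
     "cdot (cconj (hv m)) (cvec (n \<times> m)) = \<i> * of_real (norm m) * cnj b2"
    using cdot_cconj[of "hv n" "cvec (n \<times> m)"] cdot_cconj[of "hv m" "cvec (n \<times> m)"] by (simp_all add: e1 e2)
  have U: "G *s u = A1 *s hv n + B1 *s cconj (hv n)" "H *s v = A2 *s hv m + B2 *s cconj (hv m)"
    using decompose[OF n(1) u] decompose[OF n(2) v] by (simp_all add: A1_def B1_def A2_def B2_def G_def H_def)
  have "cdot (G *s u) (cvec m) = A1 * b1 + B1 * cnj b1" unfolding U by (simp add: cdot_linear cb flip: b1_def)
  then have um: "G * cdot u (cvec m) = A1 * b1 + B1 * cnj b1" by (simp add: cdot_linear)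
  have "cdot (H *s v) (cvec n) = A2 * b2 + B2 * cnj b2" unfolding U by (simp add: cdot_linear cb flip: b2_def)
  then have vn: "H * cdot v (cvec n) = A2 * b2 + B2 * cnj b2" by (simp add: cdot_linear)
  have "cdot (G *s u) (cvec (n \<times> m)) = \<i> * of_real (norm n) * (A1 * b1 - B1 * cnj b1)"
    unfolding U by (simp add: cdot_linear e1 ce algebra_simps)
  then have ue: "G * cdot u (cvec (n \<times> m)) = \<i> * of_real (norm n) * (A1 * b1 - B1 * cnj b1)" by (simp add: cdot_linear)
  have "cdot (H *s v) (cvec (n \<times> m)) = \<i> * of_real (norm m) * (B2 * cnj b2 - A2 * b2)"
    unfolding U by (simp add: cdot_linear e2 ce algebra_simps)
  then have ve: "H * cdot v (cvec (n \<times> m)) = \<i> * of_real (norm m) * (B2 * cnj b2 - A2 * b2)" by (simp add: cdot_linear)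
  have key: "A1 * B2 * (b1 * cnj b2) = B1 * A2 * (cnj b1 * b2)"
    using lk
  proof
    assume "cdot u (cvec m) = 0 \<and> cdot v (cvec n) = 0"
    then have "A1 * b1 = - (B1 * cnj b1)" "B2 * cnj b2 = - (A2 * b2)" using um vn
      by (simp_all add: eq_neg_iff_add_eq_0 add.commute)
    then have "(A1 * b1) * (B2 * cnj b2) = (B1 * cnj b1) * (A2 * b2)" by simp
    then show ?thesis by (simp add: algebra_simps)
  next
    assume l: "norm n = norm m \<and> cdot u (cvec m) * cdot v (cvec (n \<times> m)) + cdot v (cvec n) * cdot u (cvec (n \<times> m)) = 0"
    have n0: "norm n \<noteq> 0" using ind by auto
    have "(G * cdot u (cvec m)) * (H * cdot v (cvec (n \<times> m))) + (H * cdot v (cvec n)) * (G * cdot u (cvec (n \<times> m)))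
       = G * H * (cdot u (cvec m) * cdot v (cvec (n \<times> m)) + cdot v (cvec n) * cdot u (cvec (n \<times> m)))"
      by (simp add: algebra_simps)
    then have "(A1 * b1 + B1 * cnj b1) * (\<i> * of_real (norm m) * (B2 * cnj b2 - A2 * b2)) +
       (A2 * b2 + B2 * cnj b2) * (\<i> * of_real (norm n) * (A1 * b1 - B1 * cnj b1)) = 0"
      using l unfolding um vn ue ve by simp
    \<comment> \<open>Equal norms make the products of equal helicities cancel; the mixed ones
      remain, each twice.\<close>
    then have "(2 * \<i> * of_real (norm n)) * (A1 * B2 * (b1 * cnj b2) - B1 * A2 * (cnj b1 * b2)) = 0"
      using l by (simp add: algebra_simps)
    then show ?thesis using n0 by simp
  qed
  define w where "w = nu n * of_real (ss m) - of_real (ss n) * nu m"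
  define l where "l = link (ss n) (nu n) (ss m) (nu m)"
  have b1: "2 * of_real (ss m) * b1 = w * cnj l" using cdot_hv[of m n]
    by (simp add: b1_def w_def l_def link_def algebra_simps)
  have b2: "2 * of_real (ss n) * b2 = - w * l" using cdot_hv[of n m]
    by (simp add: b2_def w_def l_def link_def algebra_simps)
  have s0: "ss n > 0" "ss m > 0" using ss_pos n by auto
  have h0: "hv n \<noteq> 0"
  proof
    assume "hv n = 0"
    then have "GG n = 0" using hv_cconj[of n] by (simp add: cdot_linear)
    then show False using GG_pos[OF n(1)] by simp
  qed
  have "b1 \<noteq> 0"
  proof
    assume "b1 = 0"
    then have "hv n = 0" using helical_orthogonal_zero[of n "hv n" "-1" m] hv_helical[of n] ind
      by (simp add: b1_def cdot_commute)
    then show False using h0 by simp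
  qed
  then have w0: "w \<noteq> 0" using b1 s0 by auto
  have cb2: "2 * of_real (ss n) * cnj b2 = - cnj w * cnj l" using arg_cong[OF b2, of cnj] by simp
  have cb1: "2 * of_real (ss m) * cnj b1 = cnj w * l" using arg_cong[OF b1, of cnj] by simp
  have "(2 * of_real (ss m)) * (2 * of_real (ss n)) * (A1 * B2 * (b1 * cnj b2))
     = A1 * B2 * ((2 * of_real (ss m) * b1) * (2 * of_real (ss n) * cnj b2))" by simp
  also have "\<dots> = - (w * cnj w) * (A1 * B2 * (cnj l)\<^sup>2)" unfolding b1 cb2 by (simp add: power2_eq_square)
  finally have L: "(2 * of_real (ss m)) * (2 * of_real (ss n)) * (A1 * B2 * (b1 * cnj b2)) = - (w * cnj w) * (A1 * B2 * (cnj l)\<^sup>2)" .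
  have "(2 * of_real (ss m)) * (2 * of_real (ss n)) * (B1 * A2 * (cnj b1 * b2))
     = B1 * A2 * ((2 * of_real (ss m) * cnj b1) * (2 * of_real (ss n) * b2))" by simp
  also have "\<dots> = - (w * cnj w) * (B1 * A2 * l\<^sup>2)" unfolding cb1 b2 by (simp add: power2_eq_square)
  finally have L': "(2 * of_real (ss m)) * (2 * of_real (ss n)) * (B1 * A2 * (cnj b1 * b2)) = - (w * cnj w) * (B1 * A2 * l\<^sup>2)" .
  have "- (w * cnj w) * (A1 * B2 * (cnj l)\<^sup>2) = - (w * cnj w) * (B1 * A2 * l\<^sup>2)"
    by (rule trans[OF L[unfolded key, symmetric] L'])
  then have "A1 * B2 * (cnj l)\<^sup>2 = B1 * A2 * l\<^sup>2" using w0 by simp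
  then show ?thesis by (simp add: A1_def B1_def A2_def B2_def l_def)
qed

end

section \<open>Holonomy around a facet\<close>

lemma Arg_quadrant_mono:
  assumes z: "quadrant z" "quadrant z'"
  shows "Im (cnj z * z') \<ge> 0 \<Longrightarrow> Arg z \<le> Arg z'" "Im (cnj z * z') > 0 \<Longrightarrow> Arg z < Arg z'"
proof -
  have z0: "cmod z > 0" "cmod z' > 0" using z by (auto simp: quadrant_def)
  define d where "d = Arg z' - Arg z"
  have d: "- pi / 2 \<le> d" "d \<le> pi / 2" using Arg_quadrant[OF z(1)] Arg_quadrant[OF z(2)] by (auto simp: d_def)
  have "z = complex_of_real (cmod z) * cis (Arg z)" "z' = complex_of_real (cmod z') * cis (Arg z')"
    using rcis_cmod_Arg[of z] rcis_cmod_Arg[of z'] by (simp_all add: rcis_def)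
  then have "cnj z * z' = (complex_of_real (cmod z) * cnj (cis (Arg z))) * (complex_of_real (cmod z') * cis (Arg z'))"
    by (metis complex_cnj_complex_of_real complex_cnj_mult)
  also have "\<dots> = complex_of_real (cmod z * cmod z') * (cis (- Arg z) * cis (Arg z'))"
    by (simp add: cis_cnj)
  also have "\<dots> = complex_of_real (cmod z * cmod z') * cis d" by (simp add: cis_mult d_def)
  finally have im: "Im (cnj z * z') = cmod z * cmod z' * sin d" by simp
  have neg: "sin d < 0" if "d < 0" using sin_gt_zero[of "- d"] that d pi_gt_zero by simp
  have "d \<ge> 0" if "Im (cnj z * z') \<ge> 0"
  proof (rule ccontr)
    assume "\<not> d \<ge> 0"
    then have "cmod z * cmod z' * sin d < 0" using neg z0 by (simp add: mult_pos_neg)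
    then show False using im that by simp
  qed
  moreover have "d \<noteq> 0" if "Im (cnj z * z') > 0" using im that by auto
  ultimately show "Im (cnj z * z') \<ge> 0 \<Longrightarrow> Arg z \<le> Arg z'" "Im (cnj z * z') > 0 \<Longrightarrow> Arg z < Arg z'"
    unfolding d_def by force+
qed

lemma cis_eq_1_range:
  assumes "cis x = 1" "0 < x" "x < 2 * pi"
  shows False
proof -
  have "cos x = 1" using assms(1) by (metis Re_complex_of_real cis.sel(1) of_real_1)
  then obtain n :: int where n: "x = real_of_int n * 2 * pi" using cos_one_2pi_int by blast
  have "0 < n" using assms n by (simp add: zero_less_mult_iff)
  then have "1 * (2 * pi) \<le> real_of_int n * (2 * pi)" by (intro mult_right_mono) auto
  then show False using assms n by simp
qed

context euler_support
begin

lemma linked_swap: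
  assumes "linked n m"
  shows "linked m n"
proof -
  let ?X = "cdot (U n) (cvec m) * cdot (U m) (cvec (n \<times> m)) + cdot (U m) (cvec n) * cdot (U n) (cvec (n \<times> m))"
  let ?Y = "cdot (U m) (cvec n) * cdot (U n) (cvec (m \<times> n)) + cdot (U n) (cvec m) * cdot (U m) (cvec (m \<times> n))"
  have "cvec (m \<times> n) = - cvec (n \<times> m)" by (subst cross_skew) (simp add: cvec_linear)
  then have "?Y = - ?X" by (simp add: cdot_linear)
  then have "?X = 0 \<Longrightarrow> ?Y = 0" by (simp only: minus_zero)
  then show ?thesis using assms unfolding linked_def by metis
qed

text \<open>\<open>M\<close> exposes a face of the hull, \<open>g\<close> an edge of this face, and
  \<open>h\<close> is the coordinate along the edge; \<open>ind\<close> says that the three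
  determine a point.\<close>

lemma edge_setI:
  assumes M: "\<And>p. p \<in> S \<Longrightarrow> M \<bullet> p \<le> 1"
    and v: "v \<in> S" "v' \<in> S" "M \<bullet> v = 1" "M \<bullet> v' = 1"
    and g: "\<And>p. p \<in> S \<Longrightarrow> M \<bullet> p = 1 \<Longrightarrow> g \<bullet> p \<le> g \<bullet> v" and gv: "g \<bullet> v' = g \<bullet> v"
    and h: "h \<bullet> v < h \<bullet> v'"
    and hb: "\<And>p. p \<in> S \<Longrightarrow> M \<bullet> p = 1 \<Longrightarrow> g \<bullet> p = g \<bullet> v \<Longrightarrow> h \<bullet> v \<le> h \<bullet> p \<and> h \<bullet> p \<le> h \<bullet> v'"
    and ind: "\<And>w. M \<bullet> w = 0 \<Longrightarrow> g \<bullet> w = 0 \<Longrightarrow> h \<bullet> w = 0 \<Longrightarrow> w = 0"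
  shows "linked v v'" "v \<times> v' \<noteq> 0"
proof -
  define T where "T = {p\<in>S. M \<bullet> p = 1 \<and> g \<bullet> p = g \<bullet> v}"
  have v0: "v \<noteq> 0" using v by auto
  show vv: "v \<times> v' \<noteq> 0"
  proof
    assume "v \<times> v' = 0"
    then obtain t where "v' = t *\<^sub>R v" using cross_eq_0_iff_parallel[OF v0] by blast
    then show False using v h by simp
  qed
  have "edge_set T v v'" unfolding edge_set_def
  proof (intro conjI)
    show "T \<subseteq> S" "v \<in> T" "v' \<in> T" using v gv by (auto simp: T_def)
    show "v \<times> v' \<noteq> 0" by (rule vv)
    show "\<forall>p\<in>T. \<exists>t. 0 \<le> t \<and> t \<le> 1 \<and> p = v + t *\<^sub>R (v' - v)"
    proof
      fix p assume p: "p \<in> T"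
      define t where "t = (h \<bullet> p - h \<bullet> v) / (h \<bullet> v' - h \<bullet> v)"
      have hp: "h \<bullet> v \<le> h \<bullet> p" "h \<bullet> p \<le> h \<bullet> v'" using hb[of p] p by (auto simp: T_def)
      have t: "0 \<le> t" "t \<le> 1" "t * (h \<bullet> v' - h \<bullet> v) = h \<bullet> p - h \<bullet> v" using hp h by (auto simp: t_def)
      have "p - (v + t *\<^sub>R (v' - v)) = 0"
      proof (rule ind)
        show "M \<bullet> (p - (v + t *\<^sub>R (v' - v))) = 0" "g \<bullet> (p - (v + t *\<^sub>R (v' - v))) = 0"
          using p v gv by (simp_all add: T_def inner_simps)
        show "h \<bullet> (p - (v + t *\<^sub>R (v' - v))) = 0" using t(3) by (simp add: inner_simps)
      qed
      then show "\<exists>t. 0 \<le> t \<and> t \<le> 1 \<and> p = v + t *\<^sub>R (v' - v)" using t by auto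
    qed
    show "\<forall>n\<in>S. \<forall>m\<in>S. \<forall>p\<in>T. \<forall>p'\<in>T. n + m = p + p' \<longrightarrow> n \<in> T \<and> m \<in> T"
    proof (intro ballI impI)
      fix n m p p' assume *: "n \<in> S" "m \<in> S" "p \<in> T" "p' \<in> T" "n + m = p + p'"
      have "M \<bullet> n + M \<bullet> m = M \<bullet> p + M \<bullet> p'" using *(5) by (metis inner_add_right)
      then have Mn: "M \<bullet> n = 1" "M \<bullet> m = 1" using M[OF *(1)] M[OF *(2)] * by (auto simp: T_def)
      have "g \<bullet> n + g \<bullet> m = g \<bullet> p + g \<bullet> p'" using *(5) by (metis inner_add_right)
      then have "g \<bullet> n = g \<bullet> v" "g \<bullet> m = g \<bullet> v" using g[OF *(1) Mn(1)] g[OF *(2) Mn(2)] * by (auto simp: T_def)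
      then show "n \<in> T \<and> m \<in> T" using * Mn by (simp add: T_def)
    qed
    show "\<forall>p\<in>T. \<forall>p'\<in>T. p + p' \<notin> S"
    proof (intro ballI notI)
      fix p p' assume "p \<in> T" "p' \<in> T" "p + p' \<in> S"
      then show False using M[of "p + p'"] by (simp add: T_def inner_simps)
    qed
  qed
  then show "linked v v'" by (rule edge_linked)
qed

text \<open>If an end of the common edge had both helicities, their ratio could be followed from
  this edge along both sides of the facet \<open>M\<close> up to its top. The two results agree
  there, yet they differ by a phase strictly between 0 and \<open>2 * pi\<close>. The hypothesis
  \<open>norm M \<le> norm N\<close> selects the facet whose plane is farther from the
  origin.\<close>

lemma facet_helical:
  assumes M: "\<And>p. p \<in> S \<Longrightarrow> M \<bullet> p \<le> 1" and N: "\<And>p. p \<in> S \<Longrightarrow> N \<bullet> p \<le> 1"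
    and a: "a \<in> S" "M \<bullet> a = 1" "N \<bullet> a = 1" and b: "b \<in> S" "M \<bullet> b = 1" "N \<bullet> b = 1" "a \<noteq> b"
    and c: "c \<in> S" "M \<bullet> c = 1" "N \<bullet> c < 1" and MN: "norm M \<le> norm N"
    and R: "\<And>n. n \<in> S \<Longrightarrow> norm n \<le> norm a"
  shows "\<exists>\<sigma>\<in>{1, -1}. ccross (cvec a) (U a) = (\<i> * of_real (\<sigma> * norm a)) *s U a"
proof -
  define dl where "dl = M - N"
  have dl0: "dl \<noteq> 0" using c by (auto simp: dl_def)
  \<comment> \<open>\<open>i2\<close> points across the facet, away from the common edge;
    \<open>k\<close> will be parallel to that edge, and \<open>i1\<close> is the direction of the
    rest of \<open>M\<close>. Thus \<open>nu\<close> views the facet along its edge, and the edge is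
    the row of height \<open>Y = 0\<close>.\<close>
  define i2 where "i2 = (1 / norm dl) *\<^sub>R dl"
  define j1 where "j1 = M - (M \<bullet> i2) *\<^sub>R i2"
  have i22: "i2 \<bullet> i2 = 1" using dl0 by (simp add: i2_def dot_square_norm power2_eq_square)
  have j10: "j1 \<noteq> 0"
  proof
    assume "j1 = 0"
    then have Mi: "M = (M \<bullet> i2) *\<^sub>R i2" by (simp add: j1_def)
    have "i2 \<bullet> a = 0" using a by (simp add: i2_def dl_def inner_simps)
    then have "M \<bullet> a = 0" by (subst Mi) simp
    then show False using a by simp
  qed
  define i1 where "i1 = (1 / norm j1) *\<^sub>R j1"
  define k where "k = i1 \<times> i2"
  have j12: "j1 \<bullet> i2 = 0" using i22 by (simp add: j1_def inner_simps)
  interpret oriented_frame k i1 i2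
  proof unfold_locales
    show "norm i1 = 1" "norm i2 = 1" using dl0 j10 by (simp_all add: i1_def i2_def)
    show "i1 \<bullet> i2 = 0" using j12 by (simp add: i1_def)
    show "k = i1 \<times> i2" by (rule k_def)
  qed
  define m1 where "m1 = M \<bullet> i1"
  define m2 where "m2 = M \<bullet> i2"
  have Mj: "M \<bullet> j1 = j1 \<bullet> j1" using j12 by (simp add: j1_def inner_simps inner_commute)
  have m1: "m1 > 0" using j10 by (simp add: m1_def i1_def Mj)
  have Mk: "M \<bullet> k = 0"
  proof -
    have "M = j1 + m2 *\<^sub>R i2" by (simp add: j1_def m2_def)
    moreover have "j1 \<bullet> k = 0"
    proof -
      have "j1 = norm j1 *\<^sub>R i1" using j10 by (simp add: i1_def)
      then show ?thesis by (metis dots(7) inner_scaleR_left mult_zero_right)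
    qed
    ultimately show ?thesis by (simp add: inner_simps dots)
  qed
  have Mexp: "M \<bullet> p = m1 * (p \<bullet> i1) + m2 * (p \<bullet> i2)" for p
  proof -
    have "M \<bullet> p = M \<bullet> (xx p *\<^sub>R k + (p \<bullet> i1) *\<^sub>R i1 + (p \<bullet> i2) *\<^sub>R i2)" using expand[of p] by simp
    then show ?thesis by (simp add: inner_simps Mk m1_def m2_def)
  qed
  define F where "F = {p\<in>S. M \<bullet> p = 1}"
  have FS: "p \<in> S" "M \<bullet> p = 1" if "p \<in> F" for p using that by (auto simp: F_def)
  have finF: "finite F" using fin by (simp add: F_def)
  define Y where "Y p = p \<bullet> i2" for p
  have Yeq: "Y p = (1 - N \<bullet> p) / norm dl" if "p \<in> F" for p
    using FS[OF that] by (simp add: Y_def i2_def dl_def inner_simps inner_commute)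
  have ndl: "norm dl > 0" using dl0 by simp
  have Y0: "Y p \<ge> 0" if "p \<in> F" for p using Yeq[OF that] N[OF FS(1)[OF that]] ndl by simp
  have Ya: "Y a = 0" "Y b = 0" "Y c > 0" and abcF: "a \<in> F" "b \<in> F" "c \<in> F"
    using a b c Yeq ndl by (auto simp: F_def)
  have i1p: "m1 * (p \<bullet> i1) = 1 - m2 * Y p" if "p \<in> F" for p using Mexp[of p] FS[OF that] by (simp add: Y_def)
  \<comment> \<open>Symmetry of \<open>S\<close> gives \<open>N \<bullet> p \<ge> -1\<close>, so the
    height is at most \<open>2 / norm dl\<close>, and \<open>norm M \<le> norm N\<close> amounts to
    \<open>2 * m2 \<le> norm dl\<close>. Together they keep \<open>p \<bullet> i1\<close>
    nonnegative.\<close>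
  have quad: "quadrant (nu p)" if p: "p \<in> F" for p
  proof -
    have "- p \<in> S" using sym FS(1)[OF p] by blast
    then have "1 - N \<bullet> p \<le> 2" using N[of "- p"] by simp
    then have y2: "Y p \<le> 2 / norm dl" using Yeq[OF p] ndl by (simp add: divide_right_mono)
    have "m2 * Y p \<le> 1"
    proof (cases "m2 \<ge> 0")
      case False
      then show ?thesis using Y0[OF p] mult_nonpos_nonneg[of m2 "Y p"] by simp
    next
      case True
      have "M \<bullet> M \<le> N \<bullet> N" using MN by (simp add: dot_square_norm power_mono)
      then have "2 * (M \<bullet> dl) \<le> dl \<bullet> dl" by (simp add: dl_def inner_simps inner_commute)
      then have "2 * (m2 * norm dl) \<le> (norm dl)\<^sup>2" using ndl by (simp add: m2_def i2_def dot_square_norm)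
      then have "2 * m2 \<le> norm dl" using ndl by (simp add: power2_eq_square)
      then have "m2 * (2 / norm dl) \<le> 1" using ndl by (simp add: field_simps)
      moreover have "m2 * Y p \<le> m2 * (2 / norm dl)" using y2 True by (rule mult_left_mono)
      ultimately show ?thesis by simp
    qed
    then have "m1 * (p \<bullet> i1) \<ge> 0" using i1p[OF p] by simp
    then have "p \<bullet> i1 \<ge> 0" using m1 by (simp add: zero_le_mult_iff)
    moreover have "nu p \<noteq> 0"
    proof
      assume "nu p = 0"
      then have "p \<bullet> i1 = 0" "Y p = 0" by (simp_all add: nu_def Y_def complex_eq_iff)
      then show False using i1p[OF p] by simp
    qed
    ultimately show ?thesis using Y0[OF p] by (simp add: quadrant_def nu_def Y_def)
  qed
  have nu0: "nu p \<noteq> 0" if "p \<in> F" for p using quad[OF that] by (simp add: quadrant_def)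
  have s0: "ss p > 0" if "p \<in> F" for p using ss_pos nu0 that by blast
  have Imc: "m1 * Im (cnj (nu p) * nu q) = Y q - Y p" if "p \<in> F" "q \<in> F" for p q
  proof -
    have "m1 * Im (cnj (nu p) * nu q) = (m1 * (p \<bullet> i1)) * Y q - (m1 * (q \<bullet> i1)) * Y p"
      by (simp add: nu_def Y_def algebra_simps)
    also have "\<dots> = Y q - Y p" unfolding i1p[OF that(1)] i1p[OF that(2)] by (simp add: algebra_simps)
    finally show ?thesis .
  qed
  define ph where "ph p = Arg (nu p)" for p
  have ph_mono: "ph p \<le> ph q" if "p \<in> F" "q \<in> F" "Y p \<le> Y q" for p q
  proof -
    have "m1 * Im (cnj (nu p) * nu q) \<ge> 0" using Imc that by simp
    then have "Im (cnj (nu p) * nu q) \<ge> 0" using m1 by (simp only: zero_le_mult_iff) auto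
    then show ?thesis unfolding ph_def using Arg_quadrant_mono(1)[OF quad quad] that by blast
  qed
  have ph_strict: "ph p < ph q" if "p \<in> F" "q \<in> F" "Y p < Y q" for p q
  proof -
    have "m1 * Im (cnj (nu p) * nu q) > 0" using Imc that by simp
    then have "Im (cnj (nu p) * nu q) > 0" using m1 by (simp only: zero_less_mult_iff) auto
    then show ?thesis unfolding ph_def using Arg_quadrant_mono(2)[OF quad quad] that by blast
  qed
  have ph0: "0 \<le> ph p" "ph p \<le> pi / 2" if "p \<in> F" for p using Arg_quadrant[OF quad[OF that]] by (auto simp: ph_def)
  define lk where "lk p q = link (ss p) (nu p) (ss q) (nu q)" for p q
  define Th where "Th p q = Arg (lk p q)" for p q
  have F1: "Th q p = - Th p q" if "p \<in> F" "q \<in> F" for p q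
    unfolding Th_def lk_def using Arg_link_swap s0 quad that by blast
  have F2: "0 \<le> Th p q" "Th p q \<le> ph q - ph p" "Y p < Y q \<Longrightarrow> Th p q < ph q - ph p" if "p \<in> F" "q \<in> F" "Y p \<le> Y q" for p q
    using Arg_link_bounds[OF s0[OF that(1)] s0[OF that(2)] quad[OF that(1)] quad[OF that(2)]]
      ph_mono[OF that] ph_strict[OF that(1,2)] unfolding Th_def lk_def ph_def by auto
  have Th0: "Th p q = 0" if "p \<in> F" "q \<in> F" "Y p = Y q" for p q
    using F2(1,2)[OF that(1,2)] F2(1,2)[OF that(2,1)] F1[OF that(1,2)] that(3) by auto
  \<comment> \<open>Twice the oriented area of a triangle of the facet in the coordinates
    \<open>(xx, Y)\<close>, which decides the sign of its holonomy.\<close>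
  define D where "D p q r = xx r * (Y q - Y p) + xx p * (Y r - Y q) + xx q * (Y p - Y r)" for p q r
  have F3: "D p q r \<ge> 0 \<Longrightarrow> Th p q + Th q r + Th r p \<ge> 0" "D p q r > 0 \<Longrightarrow> Th p q + Th q r + Th r p > 0"
    if pqr: "p \<in> F" "q \<in> F" "r \<in> F" for p q r
  proof -
    define D' where "D' = xx r * Im (cnj (nu p) * nu q) + xx p * Im (cnj (nu q) * nu r) + xx q * Im (cnj (nu r) * nu p)"
    have DD: "m1 * D' = D p q r"
    proof -
      have "m1 * D' = xx r * (m1 * Im (cnj (nu p) * nu q)) + xx p * (m1 * Im (cnj (nu q) * nu r)) + xx q * (m1 * Im (cnj (nu r) * nu p))"
        unfolding D'_def by (simp only: algebra_simps)
      then show ?thesis unfolding D_def Imc[OF pqr(1,2)] Imc[OF pqr(2,3)] Imc[OF pqr(3,1)] .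
    qed
    note T = Arg_link_triangle[OF s0[OF pqr(1)] s0[OF pqr(2)] s0[OF pqr(3)] quad[OF pqr(1)] quad[OF pqr(2)] quad[OF pqr(3)]
      ss_identities(1)[of p] ss_identities(1)[of q] ss_identities(1)[of r] D'_def[symmetric]]
    show "Th p q + Th q r + Th r p \<ge> 0" if "D p q r \<ge> 0"
    proof -
      have "D' \<ge> 0" using DD that m1 by (metis zero_le_mult_iff linorder_not_le less_imp_le)
      then show ?thesis using T(1) by (simp add: Th_def lk_def)
    qed
    show "Th p q + Th q r + Th r p > 0" if "D p q r > 0"
    proof -
      have "D' > 0" using DD that m1 by (metis zero_less_mult_iff less_asym)
      then show ?thesis using T(2) by (simp add: Th_def lk_def)
    qed
  qed
  have divF: "cdot (cvec p) (U p) = 0" if "p \<in> F" for p using div FS that by blast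
  define Pp where "Pp p = P (U p) p" for p
  define Pm where "Pm p = P' (U p) p" for p
  have nz: "\<not> (Pp p = 0 \<and> Pm p = 0)" if "p \<in> F" for p
    using decompose[OF nu0[OF that] divF[OF that]] Unz[OF FS(1)[OF that]] GG_pos[OF nu0[OF that]] by (auto simp: Pp_def Pm_def)
  define good where "good p \<longleftrightarrow> Pp p \<noteq> 0 \<and> Pm p \<noteq> 0" for p
  \<comment> \<open>\<open>good\<close> says that both helicities are present, and
    \<open>rho\<close> is their ratio; each edge multiplies it by the phase
    \<open>4 * Th\<close>.\<close>
  define rho where "rho p = Pp p / Pm p" for p
  have tr: "good q \<and> rho q = rho p * cis (4 * Th p q)"
    if pq: "p \<in> F" "q \<in> F" "linked p q" "p \<times> q \<noteq> 0" "good p" for p q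
  proof -
    define l where "l = lk p q"
    have l: "Re l > 0" unfolding l_def lk_def using Re_link s0 quad pq by blast
    then have l0: "l \<noteq> 0" by auto
    have T: "Pm p * Pp q * (cnj l)\<^sup>2 = Pp p * Pm q * l\<^sup>2"
      using transport[OF nu0[OF pq(1)] nu0[OF pq(2)] pq(4) divF[OF pq(1)] divF[OF pq(2)]] pq(3)
      unfolding linked_def l_def lk_def Pp_def Pm_def by blast
    have g: "Pp p \<noteq> 0" "Pm p \<noteq> 0" using pq(5) by (auto simp: good_def)
    have gq: "Pp q \<noteq> 0" "Pm q \<noteq> 0" using T g l0 nz[OF pq(2)] by auto
    have "l = complex_of_real (cmod l) * cis (Arg l)" using rcis_cmod_Arg[of l] by (simp add: rcis_def)
    then have "l\<^sup>2 = complex_of_real (cmod l) ^ 2 * cis (2 * Arg l)"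
      by (metis Complex.DeMoivre of_nat_numeral power_mult_distrib)
    moreover have "(cnj l)\<^sup>2 = complex_of_real (cmod l) ^ 2 * cis (- (2 * Arg l))"
      using arg_cong[OF calculation, of cnj] by (simp add: cis_cnj)
    ultimately have "l\<^sup>2 = (cnj l)\<^sup>2 * cis (4 * Arg l)" by (simp add: cis_mult)
    then have "(Pm p * Pp q) * (cnj l)\<^sup>2 = (Pp p * Pm q * cis (4 * Arg l)) * (cnj l)\<^sup>2" using T by (simp add: algebra_simps)
    then have "Pm p * Pp q = Pp p * Pm q * cis (4 * Arg l)" using l0 by simp
    then have "rho q = rho p * cis (4 * Th p q)" using g gq by (simp add: rho_def Th_def l_def field_simps)
    then show ?thesis using gq by (simp add: good_def)
  qed
  have ind1: "w = 0" if "M \<bullet> w = 0" "xx w = 0" "Y w = 0" for w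
  proof -
    have "w \<bullet> i1 = 0" using Mexp[of w] that m1 by (simp add: Y_def)
    then show ?thesis using expand[of w] that by (simp add: Y_def)
  qed
  \<comment> \<open>\<open>e\<close> selects the row, 1 for the top and -1 for the bottom one; in
    \<open>slanted\<close> it selects the right or the left side.\<close>
  have horizontal: "linked p q \<and> p \<times> q \<noteq> 0"
    if pq: "p \<in> F" "q \<in> F" "xx p < xx q" and e: "e \<noteq> 0" and Ye: "\<And>x. x \<in> F \<Longrightarrow> e * Y x \<le> e * Y p" "Y q = Y p"
      and Xb: "\<And>x. x \<in> F \<Longrightarrow> Y x = Y p \<Longrightarrow> xx p \<le> xx x \<and> xx x \<le> xx q" for p q e
  proof -
    note E = edge_setI[of M p q "e *\<^sub>R i2" k, OF M FS(1)[OF pq(1)] FS(1)[OF pq(2)] FS(2)[OF pq(1)] FS(2)[OF pq(2)]]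
    have 1: "e *\<^sub>R i2 \<bullet> x \<le> e *\<^sub>R i2 \<bullet> p" if "x \<in> S" "M \<bullet> x = 1" for x
      using Ye(1)[of x] that by (simp add: F_def Y_def inner_commute)
    have 2: "e *\<^sub>R i2 \<bullet> q = e *\<^sub>R i2 \<bullet> p" using Ye(2) by (simp add: Y_def inner_commute)
    have 3: "k \<bullet> p < k \<bullet> q" using pq by (simp add: xx_def inner_commute)
    have 4: "k \<bullet> p \<le> k \<bullet> x \<and> k \<bullet> x \<le> k \<bullet> q" if "x \<in> S" "M \<bullet> x = 1" "e *\<^sub>R i2 \<bullet> x = e *\<^sub>R i2 \<bullet> p" for x
      using Xb[of x] that e by (simp add: F_def Y_def xx_def inner_commute)
    have 5: "w = 0" if "M \<bullet> w = 0" "e *\<^sub>R i2 \<bullet> w = 0" "k \<bullet> w = 0" for w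
      using ind1[of w] that e by (simp add: Y_def xx_def inner_commute)
    show ?thesis using E[OF _ 1 2 3 4 5] by blast
  qed
  have slanted: "linked p q \<and> p \<times> q \<noteq> 0"
    if pq: "p \<in> F" "q \<in> F" "Y p < Y q" and e: "e \<noteq> 0" and top: "\<And>x. x \<in> F \<Longrightarrow> e * xx x - m * Y x \<le> e * xx p - m * Y p"
      "e * xx q - m * Y q = e * xx p - m * Y p"
      and Xb: "\<And>x. x \<in> F \<Longrightarrow> e * xx x - m * Y x = e * xx p - m * Y p \<Longrightarrow> Y p \<le> Y x \<and> Y x \<le> Y q" for p q e m
  proof -
    let ?g = "e *\<^sub>R k - m *\<^sub>R i2"
    note E = edge_setI[of M p q ?g i2, OF M FS(1)[OF pq(1)] FS(1)[OF pq(2)] FS(2)[OF pq(1)] FS(2)[OF pq(2)]]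
    have g: "?g \<bullet> x = e * xx x - m * Y x" for x by (simp add: inner_simps xx_def Y_def inner_commute)
    have 1: "?g \<bullet> x \<le> ?g \<bullet> p" if "x \<in> S" "M \<bullet> x = 1" for x
      using top(1)[of x] that by (simp add: F_def g)
    have 2: "?g \<bullet> q = ?g \<bullet> p" using top(2) by (simp add: g)
    have 3: "i2 \<bullet> p < i2 \<bullet> q" using pq by (simp add: Y_def inner_commute)
    have 4: "i2 \<bullet> p \<le> i2 \<bullet> x \<and> i2 \<bullet> x \<le> i2 \<bullet> q" if "x \<in> S" "M \<bullet> x = 1" "?g \<bullet> x = ?g \<bullet> p" for x
      using Xb[of x] that by (simp add: F_def g) (simp add: Y_def inner_commute)
    have 5: "w = 0" if "M \<bullet> w = 0" "?g \<bullet> w = 0" "i2 \<bullet> w = 0" for w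
    proof -
      have "Y w = 0" using that by (simp add: Y_def inner_commute)
      then have "xx w = 0" using that(2) e unfolding g by simp
      then show ?thesis using ind1[of w] that \<open>Y w = 0\<close> by blast
    qed
    show ?thesis using E[OF _ 1 2 3 4 5] by blast
  qed
  define B where "B = {p\<in>F. Y p = 0}"
  have Bf: "finite B" "B \<noteq> {}" using finF abcF Ya by (auto simp: B_def)
  obtain r where r: "r \<in> B" "\<And>x. x \<in> B \<Longrightarrow> xx x \<le> xx r" using finite_argmax[OF Bf, of xx] by blast
  obtain l where l: "l \<in> B" "\<And>x. x \<in> B \<Longrightarrow> - xx x \<le> - xx l" using finite_argmax[OF Bf, of "\<lambda>x. - xx x"] by blast
  have rlF: "r \<in> F" "l \<in> F" "Y r = 0" "Y l = 0" using r l by (auto simp: B_def)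
  have abB: "a \<in> B" "b \<in> B" using abcF Ya by (auto simp: B_def)
  have injB: "x = y" if "x \<in> B" "y \<in> B" "xx x = xx y" for x y
  proof -
    have "x - y = 0" using that FS by (intro ind1) (auto simp: B_def inner_simps xx_def Y_def)
    then show ?thesis by simp
  qed
  have lr: "xx l < xx r"
  proof -
    have "xx a \<noteq> xx b" using injB abB b by blast
    then show ?thesis using r(2)[OF abB(1)] r(2)[OF abB(2)] l(2)[OF abB(1)] l(2)[OF abB(2)] by linarith
  qed
  have lrL: "linked l r \<and> l \<times> r \<noteq> 0"
  proof (rule horizontal[where e = "-1"])
    show "xx l \<le> xx x \<and> xx x \<le> xx r" if "x \<in> F" "Y x = Y l" for x
      using r(2)[of x] l(2)[of x] that rlF by (auto simp: B_def)
  qed (use rlF lr Y0 in auto)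
  have notgood: "\<not> good l"
  proof
    assume gl: "good l"
    have gr: "good r" "rho r = rho l" using tr[OF rlF(2,1) _ _ gl] lrL Th0[OF rlF(2,1)] rlF by auto
    \<comment> \<open>\<open>w\<close> is the accumulated angle. On the left side it stays below
      \<open>ph v\<close>, hence below \<open>pi / 2\<close>, and exceeds the direct transport from
      \<open>r\<close> to \<open>v\<close> by the orientation of the triangles at \<open>r\<close>.
      On the right side the orientation is opposite and the angle is at most the direct one. Strict
      inequalities hold as soon as the bottom row is left.\<close>
    define QL where "QL v \<longleftrightarrow> good v \<and> (\<exists>w. 0 \<le> w \<and> w \<le> ph v \<and> (Y l < Y v \<longrightarrow> w < ph v) \<and> rho v = rho l * cis (4 * w) \<and>
      0 \<le> w + Th v r \<and> (Y l < Y v \<longrightarrow> 0 < w + Th v r))" for v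
    define QR where "QR v \<longleftrightarrow> good v \<and> (\<exists>w. 0 \<le> w \<and> rho v = rho r * cis (4 * w) \<and> w + Th v r \<le> 0)" for v
    have "\<exists>t\<in>F. (\<forall>p\<in>F. Y p \<le> Y t) \<and> (\<forall>p\<in>F. Y p = Y t \<longrightarrow> - xx p \<le> - xx t) \<and> QL t"
    proof (rule hull_chain[where F = F and ?v0.0 = l])
      show "finite F" "l \<in> F" by (rule finF, rule rlF)
      show "Y l \<le> Y p" if "p \<in> F" for p using Y0[OF that] rlF by simp
      show "- xx p \<le> - xx l" if "p \<in> F" "Y p = Y l" for p using l(2)[of p] that rlF by (simp add: B_def)
      show "QL l" unfolding QL_def using gl ph0 rlF Th0[of l r] by (intro conjI exI[of _ 0]) auto
      fix v v' m assume v: "v \<in> F" "v' \<in> F" "Y v < Y v'"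
        and top: "\<And>p. p \<in> F \<Longrightarrow> - xx p - m * Y p \<le> - xx v - m * Y v" "- xx v' - m * Y v' = - xx v - m * Y v"
        and T: "\<And>p. p \<in> F \<Longrightarrow> - xx p - m * Y p = - xx v - m * Y v \<Longrightarrow> Y v \<le> Y p \<and> Y p \<le> Y v'"
        and Q: "QL v"
      obtain w where w: "good v" "0 \<le> w" "w \<le> ph v" "rho v = rho l * cis (4 * w)"
        "0 \<le> w + Th v r" "Y l < Y v \<Longrightarrow> 0 < w + Th v r" using Q unfolding QL_def by blast
      have "linked v v' \<and> v \<times> v' \<noteq> 0" by (rule slanted[where e = "-1" and m = m]) (use v top T in auto)
      then have g: "good v'" "rho v' = rho v * cis (4 * Th v v')" using tr[OF v(1,2) _ _ w(1)] by auto
      have D: "D r v v' = (Y v' - Y v) * ((- xx v - m * Y v) - (- xx r - m * Y r))"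
      proof -
        have x: "xx v' = xx v - m * (Y v' - Y v)" using top(2) by (simp add: algebra_simps)
        show ?thesis unfolding D_def x by (simp add: algebra_simps)
      qed
      have tri: "Th r v + Th v v' + Th v' r \<ge> 0"
        by (rule F3(1)[OF rlF(1) v(1,2)]) (use D top(1)[OF rlF(1)] v(3) in simp)
      \<comment> \<open>The first triangle is nondegenerate because \<open>l\<close> is strictly to
        the left of \<open>r\<close>; strictness originates here.\<close>
      have tri': "Th r v + Th v v' + Th v' r > 0" if "\<not> Y l < Y v"
      proof (rule F3(2)[OF rlF(1) v(1,2)])
        have "Y v = 0" using that rlF Y0[OF v(1)] by simp
        then have "xx v \<le> xx l" using top(1)[OF rlF(2)] rlF by simp
        then have "xx v < xx r" using lr by simp
        then have "(- xx v - m * Y v) - (- xx r - m * Y r) > 0" using \<open>Y v = 0\<close> rlF by simp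
        then show "0 < D r v v'" unfolding D using v(3) by simp
      qed
      have th: "0 \<le> Th v v'" "Th v v' < ph v' - ph v" using F2[OF v(1,2)] v(3) by auto
      have rv: "Th r v = - Th v r" using F1[OF v(1) rlF(1)] .
      have e1: "w + Th v v' + Th v' r = (w + Th v r) + (Th r v + Th v v' + Th v' r)" using rv by simp
      have pos: "0 < w + Th v v' + Th v' r" unfolding e1 using w(5,6) tri tri' by (cases "Y l < Y v") (auto simp del: e1)
      have rh: "rho v' = rho l * cis (4 * (w + Th v v'))"
        using g w(4) by (simp add: distrib_left cis_mult[symmetric])
      show "QL v'" unfolding QL_def
        by (intro conjI exI[of _ "w + Th v v'"]) (use g(1) w(2,3) th pos rh in auto)
    qed
    then obtain tl where tl: "tl \<in> F" "\<And>p. p \<in> F \<Longrightarrow> Y p \<le> Y tl" "\<And>p. p \<in> F \<Longrightarrow> Y p = Y tl \<Longrightarrow> xx tl \<le> xx p" "QL tl" by auto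
    have "\<exists>t\<in>F. (\<forall>p\<in>F. Y p \<le> Y t) \<and> (\<forall>p\<in>F. Y p = Y t \<longrightarrow> xx p \<le> xx t) \<and> QR t"
    proof (rule hull_chain[where F = F and ?v0.0 = r])
      show "finite F" "r \<in> F" by (rule finF, rule rlF)
      show "Y r \<le> Y p" if "p \<in> F" for p using Y0[OF that] rlF by simp
      show "xx p \<le> xx r" if "p \<in> F" "Y p = Y r" for p using r(2)[of p] that rlF by (simp add: B_def)
      show "QR r" unfolding QR_def using gr ph0 rlF Th0[of r r] by (intro conjI exI[of _ 0]) auto
      fix v v' m assume v: "v \<in> F" "v' \<in> F" "Y v < Y v'"
        and top: "\<And>p. p \<in> F \<Longrightarrow> xx p - m * Y p \<le> xx v - m * Y v" "xx v' - m * Y v' = xx v - m * Y v"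
        and T: "\<And>p. p \<in> F \<Longrightarrow> xx p - m * Y p = xx v - m * Y v \<Longrightarrow> Y v \<le> Y p \<and> Y p \<le> Y v'"
        and Q: "QR v"
      obtain w where w: "good v" "0 \<le> w" "rho v = rho r * cis (4 * w)" "w + Th v r \<le> 0" using Q unfolding QR_def by blast
      have "linked v v' \<and> v \<times> v' \<noteq> 0" by (rule slanted[where e = 1 and m = m]) (use v top T in auto)
      then have g: "good v'" "rho v' = rho v * cis (4 * Th v v')" using tr[OF v(1,2) _ _ w(1)] by auto
      have D: "D r v' v = (Y v' - Y v) * ((xx v - m * Y v) - (xx r - m * Y r))"
      proof -
        have x: "xx v' = xx v + m * (Y v' - Y v)" using top(2) by (simp add: algebra_simps)
        show ?thesis unfolding D_def x by (simp add: algebra_simps)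
      qed
      have tri: "Th r v' + Th v' v + Th v r \<ge> 0"
        by (rule F3(1)[OF rlF(1) v(2,1)]) (use D top(1)[OF rlF(1)] v(3) in simp)
      have th: "0 \<le> Th v v'" using F2(1)[OF v(1,2)] v(3) by auto
      have rv: "Th r v' = - Th v' r" "Th v' v = - Th v v'" using F1[OF v(2) rlF(1)] F1[OF v(1,2)] by auto
      have neg: "w + Th v v' + Th v' r \<le> 0" using tri rv w(4) by simp
      have rh: "rho v' = rho r * cis (4 * (w + Th v v'))"
        using g w(3) by (simp add: distrib_left cis_mult[symmetric])
      show "QR v'" unfolding QR_def
        by (intro conjI exI[of _ "w + Th v v'"]) (use g(1) w(2) th neg rh in auto)
    qed
    then obtain t where t: "t \<in> F" "\<And>p. p \<in> F \<Longrightarrow> Y p \<le> Y t" "\<And>p. p \<in> F \<Longrightarrow> Y p = Y t \<Longrightarrow> xx p \<le> xx t" "QR t" by auto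
    have Yt: "Y t = Y tl" using t(2)[OF tl(1)] tl(2)[OF t(1)] by simp
    have Ypos: "Y tl > 0" using tl(2)[OF abcF(3)] Ya by simp
    obtain w where w: "good tl" "w < ph tl" "rho tl = rho l * cis (4 * w)" "0 < w + Th tl r"
      using tl(4) Ypos rlF unfolding QL_def by auto
    obtain w' where w': "good t" "0 \<le> w'" "rho t = rho r * cis (4 * w')" "w' + Th t r \<le> 0" using t(4) unfolding QR_def by blast
    \<comment> \<open>The top row is a single point or an edge parallel to \<open>k\<close>, and
      along the latter the transport angle is 0.\<close>
    have same: "rho t = rho tl"
    proof (cases "xx tl < xx t")
      case True
      have "linked tl t \<and> tl \<times> t \<noteq> 0"
        by (rule horizontal[where e = 1]) (use tl t True Yt in auto)
      then show ?thesis using tr[OF tl(1) t(1) _ _ w(1)] Th0[OF tl(1) t(1)] Yt by auto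
    next
      case False
      then have "xx t = xx tl" using t(3)[OF tl(1)] Yt by simp
      then have "t - tl = 0" using Yt FS[OF t(1)] FS[OF tl(1)] by (intro ind1) (auto simp: inner_simps xx_def Y_def)
      then show ?thesis by simp
    qed
    have "D r tl t = (Y tl - Y r) * (xx t - xx tl)" unfolding D_def Yt by (simp add: algebra_simps)
    moreover have "xx tl \<le> xx t" using t(3)[OF tl(1)] Yt by simp
    ultimately have "D r tl t \<ge> 0" using Ypos rlF by simp
    then have "Th r tl + Th tl t + Th t r \<ge> 0" by (rule F3(1)[OF rlF(1) tl(1) t(1)])
    then have "Th t r \<ge> Th tl r" using Th0[OF tl(1) t(1)] Yt F1[OF tl(1) rlF(1)] by simp
    then have ww: "w' < w" using w(4) w'(4) by simp
    have rl0: "rho l \<noteq> 0" using gl by (simp add: good_def rho_def)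
    have "rho l * cis (4 * w) = rho l * cis (4 * w')" using same w(3) w'(3) gr by metis
    then have "cis (4 * w) = cis (4 * w')" using rl0 by simp
    then have "cis (4 * (w - w')) = 1" by (metis cis_divide cis_neq_zero divide_self_if right_diff_distrib)
    \<comment> \<open>Here the quadrant pays off: \<open>w < ph tl \<le> pi / 2\<close> and
      \<open>w' \<ge> 0\<close>.\<close>
    moreover have "4 * (w - w') < 2 * pi" using w(2) w'(2) ph0(2)[OF tl(1)] by simp
    ultimately show False using cis_eq_1_range ww by force
  qed
  then have notgoodr: "\<not> good r"
  proof (rule contrapos_nn)
    assume gr: "good r"
    have "linked r l" using lrL linked_swap by blast
    moreover have "r \<times> l \<noteq> 0" using lrL cross_skew[of r l] by auto
    ultimately show "good l" using tr[OF rlF(1,2) _ _ gr] by blast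
  qed
  \<comment> \<open>A longest frequency is an extreme point of the hull, so it is not in the
    interior of the edge.\<close>
  have "a = l \<or> a = r"
  proof (rule ccontr)
    assume "\<not> ?thesis"
    then have ne: "l \<noteq> a" "r \<noteq> a" by auto
    define t where "t = (xx a - xx l) / (xx r - xx l)"
    have xa: "xx l \<le> xx a" "xx a \<le> xx r" using r(2)[OF abB(1)] l(2)[OF abB(1)] by auto
    have t: "0 \<le> t" "t \<le> 1" "t * (xx r - xx l) = xx a - xx l" using xa lr by (auto simp: t_def)
    have "a - ((1 - t) *\<^sub>R l + t *\<^sub>R r) = 0"
    proof (rule ind1)
      show "M \<bullet> (a - ((1 - t) *\<^sub>R l + t *\<^sub>R r)) = 0" using FS abcF rlF by (simp add: inner_simps)
      show "Y (a - ((1 - t) *\<^sub>R l + t *\<^sub>R r)) = 0" using Ya rlF by (simp add: Y_def inner_simps)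
      show "xx (a - ((1 - t) *\<^sub>R l + t *\<^sub>R r)) = 0" using t(3) by (simp add: xx_def inner_simps algebra_simps)
    qed
    then have aeq: "a = (1 - t) *\<^sub>R l + t *\<^sub>R r" by simp
    have la: "a \<bullet> l < (norm a)\<^sup>2" "a \<bullet> r < (norm a)\<^sup>2"
      using inner_eq_norm_bound_imp_eq[of a "norm a"] R FS rlF ne by (metis linorder_not_le)+
    have "a \<bullet> a = (1 - t) * (a \<bullet> l) + t * (a \<bullet> r)" by (subst (2) aeq) (simp add: inner_simps)
    moreover have "(1 - t) * (a \<bullet> l) + t * (a \<bullet> r) < (norm a)\<^sup>2"
    proof (cases "t = 0")
      case True then show ?thesis using la by simp
    next
      case False
      then have "t * (a \<bullet> r) < t * (norm a)\<^sup>2" using t la by simp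
      moreover have "(1 - t) * (a \<bullet> l) \<le> (1 - t) * (norm a)\<^sup>2" using t la by (intro mult_left_mono) auto
      ultimately show ?thesis by (simp add: algebra_simps)
    qed
    ultimately show False by (simp add: dot_square_norm)
  qed
  then have "\<not> good a" using notgood notgoodr by blast
  then consider "Pp a = 0" | "Pm a = 0" by (auto simp: good_def)
  then show ?thesis
  proof cases
    case 1
    have "of_real (GG a) *s U a = Pm a *s hv a" using decompose[OF nu0[OF abcF(1)] divF[OF abcF(1)]] 1 by (simp add: Pp_def Pm_def)
    then have "(1 / complex_of_real (GG a)) *s (of_real (GG a) *s U a) = (1 / complex_of_real (GG a)) *s (Pm a *s hv a)" by simp
    then have Ua: "U a = (Pm a / of_real (GG a)) *s hv a" using GG_pos[OF nu0[OF abcF(1)]] by (simp add: vec.scale_scale)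
    have "ccross (cvec a) (U a) = (\<i> * of_real (- 1 * norm a)) *s U a"
      unfolding Ua by (simp add: ccross_linear hv_helical vec.scale_scale mult.commute)
    then show ?thesis by blast
  next
    case 2
    have "of_real (GG a) *s U a = Pp a *s cconj (hv a)" using decompose[OF nu0[OF abcF(1)] divF[OF abcF(1)]] 2 by (simp add: Pp_def Pm_def)
    then have "(1 / complex_of_real (GG a)) *s (of_real (GG a) *s U a) = (1 / complex_of_real (GG a)) *s (Pp a *s cconj (hv a))" by simp
    then have Ua: "U a = (Pp a / of_real (GG a)) *s cconj (hv a)" using GG_pos[OF nu0[OF abcF(1)]] by (simp add: vec.scale_scale)
    have "ccross (cvec a) (cconj (hv a)) = (\<i> * of_real (norm a)) *s cconj (hv a)"
      using arg_cong[OF hv_helical[of a], of cconj] by (simp only: cconj_ccross cconj_linear cconj_cvec) simp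
    then have "ccross (cvec a) (U a) = (\<i> * of_real (1 * norm a)) *s U a"
      unfolding Ua by (simp add: ccross_linear vec.scale_scale mult.commute)
    then show ?thesis by blast
  qed
qed

end

section \<open>Spreading of one helicity and equality of all norms\<close>

context euler_support
begin

definition helical :: "real \<Rightarrow> real^3 \<Rightarrow> bool" where
  "helical \<sigma> n \<longleftrightarrow> ccross (cvec n) (U n) = (\<i> * of_real (\<sigma> * norm n)) *s U n"

lemma helical_dot_nonzero:
  assumes "n \<in> S" "helical \<sigma> n" "\<sigma> \<noteq> 0" "n \<times> p \<noteq> 0"
  shows "cdot (U n) (cvec p) \<noteq> 0"
  using helical_orthogonal_zero[of n "U n" \<sigma> p] assms Unz by (auto simp: helical_def cdot_commute)

lemma not_parallel:
  assumes "a \<noteq> 0"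
  obtains p where "p \<in> S" "a \<times> p \<noteq> 0"
proof (rule ccontr)
  assume "\<not> thesis"
  then have z: "a \<times> p = 0" if "p \<in> S" for p using \<open>\<And>p. p \<in> S \<Longrightarrow> a \<times> p \<noteq> 0 \<Longrightarrow> thesis\<close> that by blast
  obtain g where g: "g \<noteq> 0" "orthogonal a g" using orthogonal_to_vector_exists[of a] by auto
  obtain p where p: "p \<in> S" "g \<bullet> p > 0" using spans_imp_positive[OF sp sym g(1)] by blast
  then obtain t where "p = t *\<^sub>R a" using z[OF p(1)] cross_eq_0_iff_parallel[OF assms] by blast
  then show False using p g by (simp add: orthogonal_def inner_commute)
qed

text \<open>Among the contact points of a functional tilted towards \<open>g\<close>, the one with
  the largest component along \<open>a\<close> has a unique sum with \<open>a\<close>. Helicity of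
  \<open>a\<close> makes the pairing nonzero, so \<open>q\<close> has the same norm, and the linear
  relation between the two modes then excludes opposite signs.\<close>

lemma helical_neighbour:
  assumes R: "\<And>n. n \<in> S \<Longrightarrow> norm n \<le> R" and hel: "\<And>n. n \<in> S \<Longrightarrow> norm n = R \<Longrightarrow> \<exists>\<sigma>\<in>{1,-1}. helical \<sigma> n"
    and a: "a \<in> S" "norm a = R" "helical \<sigma> a" "\<sigma> \<in> {1, -1}" and g: "g \<times> a \<noteq> 0" and p: "p \<in> S" "g \<bullet> p > g \<bullet> a"
  obtains q where "q \<in> S" "norm q = R" "helical \<sigma> q" "g \<bullet> q > g \<bullet> a"
proof -
  have R0: "R > 0" using a zero by auto
  have strict: "a \<bullet> n < a \<bullet> a" if "n \<in> S" "n \<noteq> a" for n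
    using inner_eq_norm_bound_imp_eq[of a R n] R[OF that(1)] a that by (force simp: dot_square_norm)
  \<comment> \<open>\<open>g\<close> need not be orthogonal to \<open>a\<close>, so the level at
    \<open>a\<close> moves during the tilt; shifting all points by \<open>a\<close> fixes it at
    0.\<close>
  obtain \<tau> q0 where \<tau>: "\<tau> \<ge> 0" "\<And>x. x \<in> (\<lambda>n. n - a) ` S \<Longrightarrow> (a + \<tau> *\<^sub>R g) \<bullet> x \<le> 0"
    "q0 \<in> (\<lambda>n. n - a) ` S" "g \<bullet> q0 > 0" "(a + \<tau> *\<^sub>R g) \<bullet> q0 = 0"
  proof (rule tilt_to_contact[of "(\<lambda>n. n - a) ` S" a 0 g])
    show "finite ((\<lambda>n. n - a) ` S)" using fin by simp
    show "a \<bullet> x \<le> 0" if x: "x \<in> (\<lambda>n. n - a) ` S" for x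
    proof -
      obtain n where "n \<in> S" "x = n - a" using x by blast
      then show ?thesis using strict[of n] by (cases "n = a") (auto simp: inner_simps)
    qed
    show "\<exists>p\<in>(\<lambda>n. n - a) ` S. 0 < g \<bullet> p" using p by (auto simp: inner_simps intro!: bexI[of _ p])
  qed blast
  define f where "f = a + \<tau> *\<^sub>R g"
  have fle: "f \<bullet> n \<le> f \<bullet> a" if "n \<in> S" for n using \<tau>(2)[of "n - a"] that by (auto simp: f_def[symmetric] inner_simps)
  obtain q1 where q1: "q1 \<in> S" "q0 = q1 - a" using \<tau>(3) by blast
  have q1f: "f \<bullet> q1 = f \<bullet> a" "q1 \<noteq> a" using \<tau>(4,5) q1 by (auto simp: f_def[symmetric] inner_simps)
  have "\<tau> \<noteq> 0"
  proof
    assume "\<tau> = 0"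
    then show False using q1f strict[OF q1(1)] by (simp add: f_def)
  qed
  then have \<tau>0: "\<tau> > 0" using \<tau>(1) by simp
  have "f \<times> a = \<tau> *\<^sub>R (g \<times> a)" by (simp add: f_def cross_add_left cross_mult_left)
  then have "f \<noteq> 0" using g \<tau>0 by auto
  then obtain x where "x \<in> S" "f \<bullet> x > 0" using spans_imp_positive[OF sp sym] by blast
  then have fa: "f \<bullet> a > 0" using fle[of x] by simp
  define T where "T = {n\<in>S. f \<bullet> n = f \<bullet> a} - {a}"
  have "finite T" "T \<noteq> {}" using fin q1 q1f by (auto simp: T_def)
  then obtain q where q: "q \<in> T" "\<And>n. n \<in> T \<Longrightarrow> a \<bullet> n \<le> a \<bullet> q" using finite_argmax[of T "\<lambda>n. a \<bullet> n"] by blast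
  have qS: "q \<in> S" "f \<bullet> q = f \<bullet> a" "q \<noteq> a" using q by (auto simp: T_def)
  have a0: "a \<noteq> 0" using a zero by auto
  have aq: "a \<times> q \<noteq> 0"
  proof
    assume "a \<times> q = 0"
    then obtain t where "q = t *\<^sub>R a" using cross_eq_0_iff_parallel[OF a0] by blast
    then show False using qS fa by simp
  qed
  have out: "a + q \<notin> S" using fle[of "a + q"] qS fa by (auto simp: inner_simps)
  have E: "euler_sum S U (a + q) = 2 *s (cdot (U a) (cvec q) *s U q + cdot (U q) (cvec a) *s U a)"
  proof (rule euler_sum_pair)
    show "a \<in> S" "q \<in> S" "a \<noteq> q" using a qS by auto
    fix n m assume nm: "n \<in> S" "m \<in> S" "n + m = a + q"
    have "f \<bullet> n + f \<bullet> m = f \<bullet> a + f \<bullet> q" using nm(3) by (metis inner_add_right)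
    then have fnm: "f \<bullet> n = f \<bullet> a" "f \<bullet> m = f \<bullet> a" using fle[OF nm(1)] fle[OF nm(2)] qS by auto
    have anm: "a \<bullet> n + a \<bullet> m = a \<bullet> a + a \<bullet> q" using nm(3) by (metis inner_add_right)
    have "n = a \<or> m = a"
    proof (rule ccontr)
      assume "\<not> ?thesis"
      then have "a \<bullet> n \<le> a \<bullet> q" "a \<bullet> m \<le> a \<bullet> q" using q(2) fnm nm by (auto simp: T_def)
      then show False using anm strict[OF qS(1,3)] by simp
    qed
    then show "n = a \<or> n = q" using nm(3) by auto
  qed
  have Uq: "cdot (U a) (cvec q) \<noteq> 0" using helical_dot_nonzero[OF a(1,3) _ aq] a(4) by auto
  then have Ua: "cdot (U q) (cvec a) \<noteq> 0" using pair_dichotomy(2)[OF a(1) qS(1) aq out E] by simp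
  have nq: "norm q = R" using pair_dichotomy(3)[OF a(1) qS(1) aq out E Uq] a(2) by simp
  obtain \<sigma>' where s': "\<sigma>' \<in> {1,-1}" "helical \<sigma>' q" using hel[OF qS(1) nq] by blast
  have e1: "cdot (U a) (cvec (a \<times> q)) = - (\<i> * of_real (\<sigma> * R)) * cdot (U a) (cvec q)"
  proof -
    have "cdot (U a) (ccross (cvec a) (cvec q)) = cdot (cvec q) (ccross (U a) (cvec a))" by (rule cdot_ccross_rotate)
    also have "\<dots> = - cdot (cvec q) (ccross (cvec a) (U a))" by (subst ccross_skew) (simp add: cdot_linear)
    also have "\<dots> = - (\<i> * of_real (\<sigma> * R)) * cdot (U a) (cvec q)"
      using a by (simp add: helical_def cdot_linear cdot_commute)
    finally show ?thesis by (simp add: ccross_cvec)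
  qed
  have e2: "cdot (U q) (cvec (a \<times> q)) = (\<i> * of_real (\<sigma>' * R)) * cdot (U q) (cvec a)"
  proof -
    have "cdot (U q) (ccross (cvec a) (cvec q)) = cdot (cvec a) (ccross (cvec q) (U q))" by (rule cdot_ccross_rotate[symmetric])
    also have "\<dots> = (\<i> * of_real (\<sigma>' * R)) * cdot (U q) (cvec a)" using s' nq by (simp add: helical_def cdot_linear cdot_commute)
    finally show ?thesis by (simp add: ccross_cvec)
  qed
  have "cdot (U a) (cvec q) * cdot (U q) (cvec (a \<times> q)) + cdot (U q) (cvec a) * cdot (U a) (cvec (a \<times> q)) = 0"
    using pair_dichotomy(1)[OF a(1) qS(1) aq out E] Uq unfolding linked_def by auto
  then have "(\<i> * of_real R * of_real (\<sigma>' - \<sigma>)) * (cdot (U a) (cvec q) * cdot (U q) (cvec a)) = 0"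
    unfolding e1 e2 by (simp add: algebra_simps)
  then have "complex_of_real (\<sigma>' - \<sigma>) = 0" using Uq Ua R0 by simp
  then have "\<sigma>' = \<sigma>" unfolding of_real_eq_0_iff by simp
  moreover have "g \<bullet> q > g \<bullet> a"
  proof -
    have "\<tau> * (g \<bullet> q - g \<bullet> a) = a \<bullet> a - a \<bullet> q" using qS(2) by (simp add: f_def inner_simps algebra_simps)
    then have "\<tau> * (g \<bullet> q - g \<bullet> a) > 0" using strict[OF qS(1,3)] by simp
    then show ?thesis using \<tau>0 by (simp add: zero_less_mult_iff)
  qed
  ultimately show thesis using that qS nq s' by blast
qed

theorem beltrami_sphere:
  "\<exists>r>0. \<exists>\<sigma>\<in>{1,-1}. \<forall>n\<in>S. norm n = r \<and> ccross (cvec n) (U n) = (\<i> * of_real (\<sigma> * r)) *s U n"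
proof -
  have "S \<noteq> {}"
  proof
    assume "S = {}"
    then have "(UNIV :: (real^3) set) = {0}" using sp by simp
    then show False by (metis UNIV_I axis_eq_0_iff singletonD zero_neq_one)
  qed
  then obtain a0 where a0: "a0 \<in> S" "\<And>n. n \<in> S \<Longrightarrow> norm n \<le> norm a0" using finite_argmax[OF fin, of norm] by blast
  define R where "R = norm a0"
  have R: "norm n \<le> R" if "n \<in> S" for n using a0 that by (simp add: R_def)
  have R0: "R > 0" using a0 zero by (auto simp: R_def)
  have hel: "\<exists>\<sigma>\<in>{1,-1}. helical \<sigma> a" if a: "a \<in> S" "norm a = R" for a
  proof -
    have Ra: "norm n \<le> norm a" if "n \<in> S" for n using R that a by simp
    show ?thesis
    proof (rule adjacent_facets[OF fin sym sp a(1) Ra])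
      fix M N b c d :: "real^3"
      assume MN: "\<And>p. p \<in> S \<Longrightarrow> M \<bullet> p \<le> 1" "\<And>p. p \<in> S \<Longrightarrow> N \<bullet> p \<le> 1"
      "b \<in> S" "c \<in> S" "d \<in> S" "a \<noteq> b" "M \<bullet> a = 1" "N \<bullet> a = 1" "M \<bullet> b = 1" "N \<bullet> b = 1"
      "M \<bullet> c = 1" "N \<bullet> c < 1" "M \<bullet> d < 1" "N \<bullet> d = 1"
    show ?thesis
    proof (cases "norm M \<le> norm N")
      case True
      show ?thesis using facet_helical[OF MN(1,2) a(1) MN(7,8) MN(3,9,10,6) MN(4,11,12) True Ra] by (simp add: helical_def)
    next
      case False
      then have "norm N \<le> norm M" by simp
      then show ?thesis using facet_helical[OF MN(2,1) a(1) MN(8,7) MN(3,10,9,6) MN(5,14,13) _ Ra] by (simp add: helical_def)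
    qed
    qed
  qed
  obtain \<sigma> where s: "\<sigma> \<in> {1,-1}" "helical \<sigma> a0" using hel[OF a0(1)] by (auto simp: R_def)
  have same: "helical \<sigma> v" if v: "v \<in> S" "norm v = R" for v
  proof -
    define V where "V = {n\<in>S. norm n = R \<and> helical \<sigma> n}"
    have "finite V" "V \<noteq> {}" using fin a0 s by (auto simp: V_def R_def)
    \<comment> \<open>Among the longest frequencies of sign \<open>\<sigma>\<close>, take one as far
      as possible in the direction \<open>v\<close>; if it is not \<open>v\<close>, a neighbour goes
      farther.\<close>
    then obtain a where a: "a \<in> V" "\<And>n. n \<in> V \<Longrightarrow> v \<bullet> n \<le> v \<bullet> a" using finite_argmax[of V "\<lambda>n. v \<bullet> n"] by blast
    have aS: "a \<in> S" "norm a = R" "helical \<sigma> a" using a by (auto simp: V_def)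
    have a0': "a \<noteq> 0" using aS zero by auto
    have "a = v"
    proof (rule ccontr)
      assume av: "a \<noteq> v"
      show False
      proof (cases "v \<times> a = 0")
        case False
        have va: "v \<bullet> a < v \<bullet> v" using inner_eq_norm_bound_imp_eq[of v R a] v aS av by (force simp: dot_square_norm)
        show False
        proof (rule helical_neighbour[OF R hel aS s(1) False v(1) va])
          fix q assume "q \<in> S" "norm q = R" "helical \<sigma> q" "v \<bullet> a < v \<bullet> q"
          then show False using a(2)[of q] by (simp add: V_def)
        qed
      next
        case True
        have v0: "v \<noteq> 0" using v zero by auto
        obtain t where t: "a = t *\<^sub>R v" using True cross_eq_0_iff_parallel[OF v0] by blast
        then have "\<bar>t\<bar> * R = R" using v aS by simp
        then have "\<bar>t\<bar> = 1" using R0 by simp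
        moreover have "t \<noteq> 1" using t av by auto
        ultimately have "t = -1" by arith
        then have am: "a = - v" using t by simp
        \<comment> \<open>From \<open>a = - v\<close> the direction \<open>v\<close> gives no tilt.
          A transverse direction \<open>p\<close> is used instead: every longest frequency other
          than \<open>a\<close> is already farther along \<open>v\<close>.\<close>
        obtain p0 where p0: "p0 \<in> S" "a \<times> p0 \<noteq> 0" using not_parallel[OF a0'] by blast
        obtain p where p: "p \<in> S" "a \<times> p \<noteq> 0" "p \<bullet> a \<le> 0"
        proof (cases "p0 \<bullet> a \<le> 0")
          case False
          then have "- p0 \<in> S" "(- p0) \<bullet> a \<le> 0" using sym p0 by auto
          then show thesis using that[of "- p0"] p0 by auto
        qed (use that p0 in blast)
        have pa: "p \<times> a \<noteq> 0" using p(2) cross_skew[of p a] by auto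
        have "p \<noteq> 0" using p zero by auto
        then have "p \<bullet> p > 0" by simp
        then have pp: "p \<bullet> a < p \<bullet> p" using p(3) by (rule le_less_trans[rotated])
        show False
        proof (rule helical_neighbour[OF R hel aS s(1) pa p(1) pp])
          fix q assume q: "q \<in> S" "norm q = R" "helical \<sigma> q" "p \<bullet> a < p \<bullet> q"
          then have "q \<noteq> a" by auto
          then have "a \<bullet> q < R\<^sup>2" using inner_eq_norm_bound_imp_eq[of a R q] aS q by force
          then have "v \<bullet> q > v \<bullet> a" using am v by (simp add: dot_square_norm)
          then show False using a(2)[of q] q by (simp add: V_def)
        qed
      qed
    qed
    then show ?thesis using aS by simp
  qed
  have all: "norm p = R" if p0: "p \<in> S" for p
  proof (rule ccontr)
    assume "norm p \<noteq> R"
    then have pR: "norm p < R" using R[OF p0] by simp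
    have line: "\<nexists>w. S \<subseteq> range (\<lambda>t. t *\<^sub>R w)"
    proof
      assume "\<exists>w. S \<subseteq> range (\<lambda>t. t *\<^sub>R w)"
      then obtain w where w: "S \<subseteq> range (\<lambda>t. t *\<^sub>R w)" by blast
      have "w \<noteq> 0" using w a0 zero by auto
      then obtain p where "p \<in> S" "w \<times> p \<noteq> 0" using not_parallel by blast
      then show False using w by (auto simp: cross_mult_right)
    qed
    have "\<exists>n\<in>S. \<exists>p\<in>S. norm n = R \<and> norm p < R \<and> p \<notin> range (\<lambda>t. t *\<^sub>R n) \<and> n + p \<notin> S \<and>
      (\<forall>n'\<in>S. \<forall>p'\<in>S. norm p' < R \<longrightarrow> n' + p' = n + p \<longrightarrow> n' = n \<and> p' = p)"
      by (rule ball_interior_unique_sum[OF fin sym zero R a0(1) _ p0 pR line]) (auto simp: R_def)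
    then obtain n p where np: "n \<in> S" "p \<in> S" "norm n = R" "norm p < R" "p \<notin> range (\<lambda>t. t *\<^sub>R n)" "n + p \<notin> S"
      "\<And>n' p'. n' \<in> S \<Longrightarrow> p' \<in> S \<Longrightarrow> norm p' < R \<Longrightarrow> n' + p' = n + p \<Longrightarrow> n' = n \<and> p' = p" by blast
    \<comment> \<open>\<open>ph\<close> is the defect of helicity. It vanishes on all longest
      frequencies, so in the cross product form of the nonlinear term only the sum
      \<open>n + p\<close> is left.\<close>
    define \<mu> where "\<mu> = \<i> * complex_of_real (\<sigma> * R)"
    define ph where "ph x = ccross (cvec x) (U x) - \<mu> *s U x" for x
    define q where "q = n + p"
    have n0: "n \<noteq> 0" using np zero by auto
    have nxp: "n \<times> p \<noteq> 0" using np(5) cross_eq_0_iff_parallel[OF n0] by blast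
    have "q \<noteq> 0"
    proof
      assume "q = 0"
      then have "p = - n" by (simp add: q_def eq_neg_iff_add_eq_0 add.commute)
      then show False using nxp by simp
    qed
    obtain k where k: "euler_sum S U q = k *s cvec q - 2 *s (\<Sum>n\<in>S. ccross (U n) (ph (q - n)))"
      using euler_sum_ccross[OF fin U0 div, of q \<mu>] unfolding ph_def by blast
    have "(\<Sum>n\<in>S. ccross (U n) (ph (q - n))) = (\<Sum>m\<in>{n}. ccross (U m) (ph (q - m)))"
    proof (rule sum.mono_neutral_right)
      show "\<forall>m\<in>S - {n}. ccross (U m) (ph (q - m)) = 0"
      proof
        fix m assume m: "m \<in> S - {n}"
        have "ph (q - m) = 0"
        proof (cases "q - m \<in> S")
          case False
          then show ?thesis by (simp add: ph_def U0 ccross_linear)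
        next
          case True
          have "\<not> norm (q - m) < R" using np(7)[of m "q - m"] m True by (auto simp: q_def)
          then have "norm (q - m) = R" using R[OF True] by simp
          then show ?thesis using same[OF True] by (simp add: ph_def helical_def \<mu>_def)
        qed
        then show "ccross (U m) (ph (q - m)) = 0" by (simp add: ccross_linear)
      qed
    qed (use fin np in auto)
    also have "\<dots> = ccross (U n) (ph p)" by (simp add: q_def)
    finally have e1: "euler_sum S U q = k *s cvec q - 2 *s ccross (U n) (ph p)" using k by simp
    obtain k' where k': "euler_sum S U q = k' *s cvec q"
      using eq[of q] np(6) \<open>q \<noteq> 0\<close> leray_eq_0_iff unfolding q_def by blast
    define c where "c = (k - k') / 2"
    have c: "ccross (U n) (ph p) = c *s cvec q"
    proof -
      have "2 *s ccross (U n) (ph p) = (k - k') *s cvec q" using e1 k' by (simp add: vec_eq_iff algebra_simps)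
      then have "(1/2::complex) *s (2 *s ccross (U n) (ph p)) = (1/2) *s ((k - k') *s cvec q)" by simp
      then show ?thesis by (simp add: vec.scale_scale c_def vec.scale_left_diff_distrib diff_divide_distrib)
    qed
    have s0: "\<sigma> \<noteq> 0" using s by auto
    have Unp: "cdot (U n) (cvec p) \<noteq> 0" using helical_dot_nonzero[OF np(1) same[OF np(1,3)] s0 nxp] .
    \<comment> \<open>A cross product with \<open>U n\<close> is orthogonal to \<open>U n\<close>,
      whereas \<open>q\<close> is not; hence \<open>c = 0\<close>. Crossing with \<open>p\<close>
      then isolates \<open>ph p\<close>, with the nonzero pairing of \<open>U n\<close> and
      \<open>p\<close> as its factor.\<close>
    have "cdot (U n) (c *s cvec q) = 0" unfolding c[symmetric] by (simp add: cdot_ccross_self)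
    then have "c * cdot (U n) (cvec p) = 0" using div[OF np(1)] by (simp add: q_def cvec_linear cdot_linear cdot_commute[of "U n" "cvec n"])
    then have "ccross (U n) (ph p) = 0" using Unp c by simp
    then have "ccross (cvec p) (ccross (U n) (ph p)) = 0" by (simp add: ccross_linear)
    moreover have "cdot (cvec p) (ph p) = 0" using div[OF np(2)] by (simp add: ph_def cdot_linear cdot_ccross_self)
    ultimately have "cdot (cvec p) (U n) *s ph p = 0" by (simp add: ccross_ccross)
    then have "ph p = 0" using Unp by (simp add: cdot_commute)
    then have h: "ccross (cvec p) (U p) = \<mu> *s U p" by (simp add: ph_def)
    \<comment> \<open>Crossing twice with \<open>p\<close> multiplies by minus the square of
      \<open>norm p\<close>, so the eigenvalue \<open>\<mu>\<close> determines this norm.\<close>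
    have "ccross (cvec p) (ccross (cvec p) (U p)) = (\<mu> * \<mu>) *s U p" unfolding h by (simp add: ccross_linear h vec.scale_scale)
    moreover have "ccross (cvec p) (ccross (cvec p) (U p)) = - (of_real (p \<bullet> p)) *s U p"
      using div[OF np(2)] by (simp add: ccross_ccross cdot_cvec)
    ultimately have "(\<mu> * \<mu>) *s U p = - (of_real (p \<bullet> p)) *s U p" by (rule trans[OF HOL.sym])
    then have "(\<mu> * \<mu> + of_real (p \<bullet> p)) *s U p = 0" by (simp add: vec.scale_left_distrib)
    then have "\<mu> * \<mu> + of_real (p \<bullet> p) = 0 \<or> U p = 0" by (simp only: vec.scale_eq_0_iff)
    then have "\<mu> * \<mu> + of_real (p \<bullet> p) = 0" using Unz[OF np(2)] by blast
    moreover have "\<mu> * \<mu> = - of_real (R\<^sup>2)" using s by (auto simp: \<mu>_def power2_eq_square complex_eq_iff)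
    ultimately have "complex_of_real (p \<bullet> p - R\<^sup>2) = 0" by simp
    then have "p \<bullet> p = R\<^sup>2" unfolding of_real_eq_0_iff by simp
    then have "(norm p)\<^sup>2 = R\<^sup>2" by (simp add: dot_square_norm)
    then have "norm p = R" using R0 by (simp add: power2_eq_iff_nonneg)
    then show False using np by simp
  qed
  show ?thesis using R0 s(1) same all unfolding helical_def by (intro exI[of _ R] conjI bexI[of _ \<sigma>]) auto
qed

end

section \<open>Sufficient conditions for a vanishing nonlinear term\<close>

lemma beltrami_stationary:
  assumes fin: "finite S" and U0: "\<And>n. n \<notin> S \<Longrightarrow> U n = 0"
    and div: "\<And>n. n \<in> S \<Longrightarrow> cdot (cvec n) (U n) = 0"
    and bel: "\<And>n. n \<in> S \<Longrightarrow> ccross (cvec n) (U n) = \<mu> *s U n" and q: "q \<noteq> 0"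
  shows "leray q (euler_sum S U q) = 0"
proof -
  obtain k where k: "euler_sum S U q = k *s cvec q - 2 *s (\<Sum>n\<in>S. ccross (U n) (ccross (cvec (q - n)) (U (q - n)) - \<mu> *s U (q - n)))"
    using euler_sum_ccross[OF fin U0 div, of q \<mu>] by blast
  have "ccross (cvec x) (U x) - \<mu> *s U x = 0" for x using bel[of x] U0[of x] by (cases "x \<in> S") (auto simp: ccross_linear)
  then have "euler_sum S U q = k *s cvec q" using k by (simp add: ccross_linear)
  then show ?thesis using leray_eq_0_iff[OF q] by blast
qed

lemma perpendicular_stationary:
  assumes fin: "finite S" and U0: "\<And>n. n \<notin> S \<Longrightarrow> U n = 0"
    and div: "\<And>n. n \<in> S \<Longrightarrow> cdot (cvec n) (U n) = 0"
    and perp: "\<And>n m. n \<in> S \<Longrightarrow> m \<in> S \<Longrightarrow> cdot (U n) (cvec m) = 0" and q: "q \<noteq> 0"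
  shows "leray q (euler_sum S U q) = 0"
proof -
  have "cdot (U n1) (cvec n2) *s U n2 + cdot (U n2) (cvec n1) *s U n1 = 0" if "n1 \<in> S" "n2 \<in> S" for n1 n2
    using perp that by simp
  then have "euler_sum S U q = 0" unfolding euler_sum_def by (intro sum.neutral) auto
  moreover have "0 = 0 *s cvec q" by simp
  ultimately have "euler_sum S U q = 0 *s cvec q" by (simp only:)
  then show ?thesis using leray_eq_0_iff[OF q] by blast
qed

section \<open>Planar supports\<close>

definition perp_part :: "real^3 \<Rightarrow> (real^3 \<Rightarrow> complex^3) \<Rightarrow> real^3 \<Rightarrow> complex" where
  "perp_part e U n = cdot (cvec e) (U n)"

text \<open>Coefficient of the stream function up to the factor \<open>\<i>\<close>; it is
  normalised so that the planar part of \<open>U n\<close> is this number times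
  \<open>e \<times> n\<close>. For real fields it turns into minus its conjugate at
  \<open>- n\<close>.\<close>

definition par_part :: "real^3 \<Rightarrow> (real^3 \<Rightarrow> complex^3) \<Rightarrow> real^3 \<Rightarrow> complex" where
  "par_part e U n = cdot (cvec (e \<times> n)) (U n) / of_real (n \<bullet> n)"

lemma cross_e:
  assumes "norm e = 1" "e \<bullet> n = 0"
  shows "n \<times> (e \<times> n) = (n \<bullet> n) *\<^sub>R e" "(e \<times> n) \<bullet> (e \<times> p) = n \<bullet> p"
    "(e \<times> n) \<bullet> q = cr e n q"
proof -
  have ee: "e \<bullet> e = 1" using assms by (simp add: dot_square_norm)
  show "n \<times> (e \<times> n) = (n \<bullet> n) *\<^sub>R e" using assms by (subst Lagrange) (simp add: inner_commute)
  show t: "(e \<times> n) \<bullet> q = cr e n q" for q by (simp add: cr_def cross3_simps)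
  have "(e \<times> n) \<bullet> (e \<times> p) = (e \<bullet> e) * (n \<bullet> p) - (e \<bullet> p) * (n \<bullet> e)" by (simp add: cross3_simps)
  then show "(e \<times> n) \<bullet> (e \<times> p) = n \<bullet> p" using ee assms by (simp add: inner_commute)
qed

lemma planar_frame:
  assumes "norm e = 1" "e \<bullet> n = 0" "n \<noteq> 0" "cdot (cvec n) w = 0" "cdot (cvec e) w = 0" "cdot (cvec (e \<times> n)) w = 0"
  shows "w = 0"
proof (rule orthogonal_frame_zero_complex[of n "e \<times> n"])
  have "e \<noteq> 0" using assms by auto
  then show "n \<times> (e \<times> n) \<noteq> 0" using cross_e[OF assms(1,2)] assms(3) by simp
  show "cdot (cvec (n \<times> (e \<times> n))) w = 0" using cross_e(1)[OF assms(1,2)] assms(5) by (simp add: cvec_linear cdot_linear)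
qed (use assms in auto)

locale planar_support =
  fixes S :: "(real^3) set" and U :: "real^3 \<Rightarrow> complex^3" and e :: "real^3"
  assumes fin: "finite S" and sym: "uminus ` S = S" and zero: "0 \<notin> S" and e1: "norm e = 1"
    and plane: "n \<in> S \<Longrightarrow> e \<bullet> n = 0"
    and U0: "n \<notin> S \<Longrightarrow> U n = 0"
    and div: "n \<in> S \<Longrightarrow> cdot (cvec n) (U n) = 0"
begin

abbreviation "w \<equiv> perp_part e U"
abbreviation "b \<equiv> par_part e U"

lemma parts_outside: "n \<notin> S \<Longrightarrow> w n = 0" "n \<notin> S \<Longrightarrow> b n = 0"
  by (simp_all add: perp_part_def par_part_def U0 cdot_linear)

lemma decomposition:
  assumes "n \<in> S"
  shows "U n = w n *s cvec e + b n *s cvec (e \<times> n)"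
proof -
  have n: "n \<noteq> 0" "e \<bullet> n = 0" using assms zero plane by auto
  define d where "d = U n - (w n *s cvec e + b n *s cvec (e \<times> n))"
  have ee: "e \<bullet> e = 1" using e1 by (simp add: dot_square_norm)
  have "d = 0"
  proof (rule planar_frame[OF e1 n(2,1)])
    show "cdot (cvec n) d = 0" using div[OF assms] n by (simp add: d_def cdot_linear cdot_cvec dot_cross_self inner_commute)
    show "cdot (cvec e) d = 0" using ee by (simp add: d_def cdot_linear cdot_cvec dot_cross_self perp_part_def)
    have "(e \<times> n) \<bullet> (e \<times> n) = n \<bullet> n" by (rule cross_e[OF e1 n(2)])
    then show "cdot (cvec (e \<times> n)) d = 0" using n by (simp add: d_def cdot_linear cdot_cvec dot_cross_self par_part_def)
  qed
  then show ?thesis by (simp add: d_def)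
qed

lemma dot_in_plane:
  assumes "n \<in> S" "e \<bullet> q = 0"
  shows "cdot (U n) (cvec q) = b n * of_real (cr e n q)"
  using cross_e(3)[OF e1 plane[OF assms(1)], of q] assms
  by (subst decomposition[OF assms(1)]) (simp add: cdot_linear cdot_cvec)

lemma euler_sum_planar:
  assumes "e \<bullet> q = 0"
  shows "euler_sum S U q = 2 *s (\<Sum>n\<in>S. (b n * of_real (cr e n q)) *s U (q - n))"
  using euler_sum_eq[OF fin U0 div] dot_in_plane assms by simp

lemma euler_sum_off_plane:
  assumes "e \<bullet> q \<noteq> 0"
  shows "euler_sum S U q = 0"
proof -
  have "U (q - n) = 0" if "n \<in> S" for n using U0[of "q - n"] plane[of "q - n"] plane[OF that] assms by (auto simp: inner_simps)
  then show ?thesis using euler_sum_eq[OF fin U0 div] by simp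
qed

lemma leray_perp:
  assumes q: "q \<noteq> 0" "e \<bullet> q = 0"
  shows "cdot (cvec e) (leray q (euler_sum S U q)) = 2 * bracket e S b w q"
proof -
  have "cdot (cvec e) (leray q (euler_sum S U q)) = cdot (cvec e) (euler_sum S U q)"
    using q by (intro cdot_leray) (auto simp: inner_commute)
  also have "\<dots> = 2 * bracket e S b w q"
    unfolding euler_sum_planar[OF q(2)]
    by (simp add: cdot_linear cdot_sum bracket_def perp_part_def algebra_simps)
  finally show ?thesis .
qed

text \<open>The vorticity equation. In \<open>q \<bullet> (q - n)\<close> the part
  \<open>n \<bullet> (q - n)\<close> is symmetric in the two frequencies, while the area factor is
  antisymmetric, so only the Laplacian weight of the second frequency is left.\<close>

lemma leray_par:
  assumes q: "q \<noteq> 0" "e \<bullet> q = 0"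
  shows "cdot (cvec (e \<times> q)) (leray q (euler_sum S U q)) = 2 * bracket e S b (\<lambda>p. b p * of_real (p \<bullet> p)) q"
proof -
  have dot: "cdot (cvec (e \<times> q)) (U p) = b p * of_real (q \<bullet> p)" for p
  proof (cases "p \<in> S")
    case True
    have "(e \<times> q) \<bullet> (e \<times> p) = q \<bullet> p" by (rule cross_e[OF e1 q(2)])
    then show ?thesis by (subst decomposition[OF True]) (simp add: cdot_linear cdot_cvec dot_cross_self)
  qed (simp add: U0 parts_outside cdot_linear)
  have "cdot (cvec (e \<times> q)) (leray q (euler_sum S U q)) = cdot (cvec (e \<times> q)) (euler_sum S U q)"
    using q by (intro cdot_leray) (auto simp: dot_cross_self)
  also have "\<dots> = 2 * (\<Sum>n\<in>S. of_real (cr e n q) * b n * (b (q - n) * of_real (q \<bullet> (q - n))))"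
    unfolding euler_sum_planar[OF q(2)] by (simp add: cdot_linear cdot_sum dot algebra_simps)
  also have "(\<Sum>n\<in>S. of_real (cr e n q) * b n * (b (q - n) * of_real (q \<bullet> (q - n))))
    = bracket e S b (\<lambda>p. b p * of_real (p \<bullet> p)) q + (\<Sum>n\<in>S. of_real (cr e n q) * b n * b (q - n) * of_real (n \<bullet> (q - n)))"
    unfolding bracket_def sum.distrib[symmetric]
    by (rule sum.cong) (simp_all add: inner_simps algebra_simps)
  also have "(\<Sum>n\<in>S. of_real (cr e n q) * b n * b (q - n) * of_real (n \<bullet> (q - n))) = 0"
  proof -
    let ?f = "\<lambda>n m. of_real (cr e n q) * b n * b m * complex_of_real (n \<bullet> m)"
    let ?P = "{(n1, n2). n1 \<in> S \<and> n2 \<in> S \<and> n1 + n2 = q}"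
    have A: "(\<Sum>n\<in>S. ?f n (q - n)) = (\<Sum>(n1, n2)\<in>?P. ?f n1 n2)"
      unfolding sum_over_pairs[OF fin] by (rule sum.cong) (auto simp: parts_outside)
    have "(\<Sum>(n1, n2)\<in>?P. ?f n1 n2) = (\<Sum>(n1, n2)\<in>?P. ?f n2 n1)" by (rule sum_over_pairs_swap)
    also have "\<dots> = (\<Sum>(n1, n2)\<in>?P. - ?f n1 n2)"
    proof (rule sum.cong[OF refl])
      fix x assume x: "x \<in> ?P"
      then obtain n m where nm: "x = (n, m)" "n + m = q" by auto
      have "cr e m q = - cr e n q" using cr_skew[of e m n] unfolding nm(2)[symmetric] by (simp add: cr_linear)
      then show "(case x of (n1, n2) \<Rightarrow> ?f n2 n1) = (case x of (n1, n2) \<Rightarrow> - ?f n1 n2)"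
        unfolding nm(1) by (simp add: inner_commute algebra_simps)
    qed
    also have "\<dots> = - (\<Sum>(n1, n2)\<in>?P. ?f n1 n2)" by (simp add: case_prod_unfold sum_negf)
    finally have "(\<Sum>(n1, n2)\<in>?P. ?f n1 n2) = 0" by simp
    then show ?thesis using A by simp
  qed
  finally show ?thesis by simp
qed

lemma planar_stationary:
  assumes "\<And>q. bracket e S b w q = 0" "\<And>q. bracket e S b (\<lambda>p. b p * of_real (p \<bullet> p)) q = 0" "q \<noteq> 0"
  shows "leray q (euler_sum S U q) = 0"
proof (cases "e \<bullet> q = 0")
  case True
  have "cdot (cvec q) (leray q (euler_sum S U q)) = 0"
    using assms(3) by (simp add: leray_eq cdot_linear cdot_cvec)
  then show ?thesis using planar_frame[OF e1 True assms(3)] leray_perp[OF assms(3) True] leray_par[OF assms(3) True] assms(1,2) by simp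
next
  case False
  then show ?thesis using euler_sum_off_plane leray_eq_0_iff[OF assms(3)] by (metis vec.scale_zero_left)
qed

end

section \<open>Vanishing brackets on a line and on a circle\<close>

lemma bracket_support:
  assumes "finite S" "T \<subseteq> S" "\<And>n. n \<in> S - T \<Longrightarrow> b n = 0"
  shows "bracket e S b g = bracket e T b g"
  by (rule ext) (unfold bracket_def, rule sum.mono_neutral_right, use assms in auto)

text \<open>On a circle the Laplacian multiplies by a constant, and {b, b} = 0.\<close>

lemma bracket_circle:
  assumes "finite T" and b0: "\<And>n. n \<notin> T \<Longrightarrow> b n = 0" and r: "\<And>n. n \<in> T \<Longrightarrow> norm n = r"
  shows "bracket e T b (\<lambda>p. b p * of_real (p \<bullet> p)) q = 0"
proof -
  have "mulop T b delta x = b x" for x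
  proof -
    have "mulop T b delta x = (\<Sum>n\<in>T. if n = x then b x else 0)"
      unfolding mulop_def by (rule sum.cong) (auto simp: delta_def)
    then show ?thesis using assms by auto
  qed
  then have "(mulop T b ^^ 1) delta = b" by auto
  then have "bracket e T b b q = 0" using bracket_mulop_power[OF assms(1), of e b 1] by simp
  moreover have "(\<lambda>p. b p * complex_of_real (p \<bullet> p)) = (\<lambda>p. of_real (r\<^sup>2) * b p)"
  proof
    fix p show "b p * complex_of_real (p \<bullet> p) = of_real (r\<^sup>2) * b p"
      using r[of p] b0[of p] by (cases "p \<in> T") (auto simp: dot_square_norm)
  qed
  moreover have "bracket e T b (\<lambda>p. of_real (r\<^sup>2) * b p) q = of_real (r\<^sup>2) * bracket e T b b q"
    unfolding bracket_def sum_distrib_left by (rule sum.cong) (simp_all add: algebra_simps)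
  ultimately show ?thesis by simp
qed

lemma bracket_line:
  assumes "T \<subseteq> range (\<lambda>t. t *\<^sub>R n0)" "\<And>p. g p \<noteq> 0 \<Longrightarrow> cr e n0 p = 0"
  shows "bracket e T b g q = 0"
  unfolding bracket_def
proof (rule sum.neutral, rule ballI)
  fix n assume "n \<in> T"
  then obtain t where t: "n = t *\<^sub>R n0" using assms by blast
  have "cr e n q = cr e n (q - n)" by (simp add: cr_linear)
  also have "\<dots> = t * cr e n0 (q - n)" unfolding t by (simp add: cr_linear)
  finally show "of_real (cr e n q) * b n * g (q - n) = 0" using assms(2)[of "q - n"] by auto
qed

lemma planar_shape:
  assumes fin: "finite T" and sym: "uminus ` T = T" and zero: "0 \<notin> T" and e1: "norm e = 1"
    and plane: "\<And>n. n \<in> T \<Longrightarrow> e \<bullet> n = 0" and b: "\<And>n. b n \<noteq> 0 \<longleftrightarrow> n \<in> T"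
    and J: "\<And>q. q \<notin> T \<Longrightarrow> bracket e T b (\<lambda>p. b p * of_real (p \<bullet> p)) q = 0"
  shows "(\<exists>n0. T \<subseteq> range (\<lambda>t. t *\<^sub>R n0) \<and> (T \<noteq> {} \<longrightarrow> n0 \<in> T)) \<or> (\<exists>r. circle_stream e T b r)"
proof (cases "\<exists>n0. T \<subseteq> range (\<lambda>t. t *\<^sub>R n0)")
  case True
  then obtain n0 where n0: "T \<subseteq> range (\<lambda>t. t *\<^sub>R n0)" by blast
  show ?thesis
  proof (cases "T = {}")
    case False
    then obtain n1 where n1: "n1 \<in> T" by blast
    then obtain t1 where t1: "n1 = t1 *\<^sub>R n0" using n0 by blast
    moreover have "n1 \<noteq> 0" using n1 zero by auto
    ultimately have "t1 \<noteq> 0" by auto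
    have "T \<subseteq> range (\<lambda>t. t *\<^sub>R n1)"
    proof
      fix n assume "n \<in> T"
      then obtain t where "n = t *\<^sub>R n0" using n0 by blast
      then have "n = (t / t1) *\<^sub>R n1" using t1 \<open>t1 \<noteq> 0\<close> by simp
      then show "n \<in> range (\<lambda>t. t *\<^sub>R n1)" by blast
    qed
    then show ?thesis using n1 by blast
  qed simp
next
  case False
  obtain r where r: "r > 0" "\<And>n. n \<in> T \<Longrightarrow> norm n = r"
  proof (rule planar_support_circle[OF fin e1 zero sym plane, of b])
    show "b n \<noteq> 0" if "n \<in> T" for n using b that by blast
    show "b n = 0" if "n \<notin> T" for n using b that by blast
    show "\<nexists>w. T \<subseteq> range (\<lambda>t. t *\<^sub>R w)" by (rule False)
    show "(\<Sum>n\<in>T. complex_of_real (cr e n q) * b n * (b (q - n) * complex_of_real ((norm (q - n))\<^sup>2))) = 0"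
      if "q \<notin> T" for q using J[OF that] by (simp add: bracket_def power2_norm_eq_inner)
  qed blast+
  have "circle_stream e T b r"
  proof unfold_locales
    show "\<exists>n\<in>T. \<exists>m\<in>T. cr e n m \<noteq> 0"
    proof -
      obtain n where n: "n \<in> T" using False by auto
      obtain m where m: "m \<in> T" "m \<notin> range (\<lambda>t. t *\<^sub>R n)" using False by blast
      have "n \<noteq> 0" using n zero by auto
      then have "cr e n m \<noteq> 0" using cr_eq_0_imp_parallel[OF e1 plane[OF n] plane[OF m(1)]] m(2) by blast
      then show ?thesis using n m by blast
    qed
  qed (use fin e1 r sym plane b in auto)
  then show ?thesis by blast
qed

text \<open>On a line, bounded orbits allow only frequencies of \<open>g\<close> parallel to it, and
  each area factor is zero. On a circle \<open>g\<close> is a polynomial in \<open>b\<close>, which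
  commutes with \<open>b\<close>.\<close>

lemma orbit_bounded_imp_bracket_0:
  assumes fin: "finite T" and sym: "uminus ` T = T" and zero: "0 \<notin> T" and e1: "norm e = 1"
    and plane: "\<And>n. n \<in> T \<Longrightarrow> e \<bullet> n = 0" and b: "\<And>n. b n \<noteq> 0 \<longleftrightarrow> n \<in> T"
    and J: "\<And>q. q \<notin> T \<Longrightarrow> bracket e T b (\<lambda>p. b p * of_real (p \<bullet> p)) q = 0"
    and g: "finite {q. g q \<noteq> 0}" "\<And>q. g q \<noteq> 0 \<Longrightarrow> e \<bullet> q = 0" "orbit_bounded e T b g"
  shows "bracket e T b g q = 0"
proof -
  consider n0 where "T \<subseteq> range (\<lambda>t. t *\<^sub>R n0)" "T \<noteq> {} \<longrightarrow> n0 \<in> T" | r where "circle_stream e T b r"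
    using planar_shape[where e = e and T = T and b = b] assms(1-7) by blast
  then show ?thesis
  proof cases
    case 1
    show ?thesis
    proof (cases "T = {}")
      case False
      then have n0: "n0 \<in> T" "n0 \<noteq> 0" using 1 zero by auto
      have "cr e n0 p = 0" if "g p \<noteq> 0" for p
        by (rule shear_orbit_parallel[where S = T and b = b and g = g, OF fin e1 n0 sym _ _ plane[OF n0(1)] g that])
          (use 1 b in auto)
      then show ?thesis using bracket_line 1(1) by blast
    qed (simp add: bracket_def)
  next
    case 2
    then interpret circle_stream e T b r .
    have "stream_poly T b g" using orbit_bounded_imp_stream_poly g by (simp add: adm_def)
    then show ?thesis using stream_poly_imp_bracket_0[OF fin] by blast
  qed
qed

section \<open>Time dependence\<close>

text \<open>One function at a time: if it is not identically zero on the current interval,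
  continuity provides a smaller one on which it has no zero. Alternatives settled earlier survive
  the restriction.\<close>

lemma shrink_interval:
  fixes F :: "'i \<Rightarrow> real \<Rightarrow> 'b::real_normed_vector"
  assumes "finite A" "l < u" "\<And>h. h \<in> A \<Longrightarrow> continuous_on {l<..<u} (F h)"
  shows "\<exists>l' u'. l \<le> l' \<and> l' < u' \<and> u' \<le> u \<and>
    (\<forall>h\<in>A. (\<forall>t\<in>{l'<..<u'}. F h t = 0) \<or> (\<forall>t\<in>{l'<..<u'}. F h t \<noteq> 0))"
  using assms
proof (induction A rule: finite_induct)
  case empty
  then show ?case by auto
next
  case (insert h A)
  then obtain l' u' where lu: "l \<le> l'" "l' < u'" "u' \<le> u"
    and A: "\<forall>h\<in>A. (\<forall>t\<in>{l'<..<u'}. F h t = 0) \<or> (\<forall>t\<in>{l'<..<u'}. F h t \<noteq> 0)" by auto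
  show ?case
  proof (cases "\<forall>t\<in>{l'<..<u'}. F h t = 0")
    case True
    then show ?thesis using lu A by blast
  next
    case False
    then obtain t0 where t0: "t0 \<in> {l'<..<u'}" "F h t0 \<noteq> 0" by blast
    have "continuous_on {l'<..<u'} (F h)"
      using insert.prems(2)[of h] by (rule continuous_on_subset) (use lu in auto)
    then have "open ({l'<..<u'} \<inter> F h -` (- {0}))" by (rule continuous_open_preimage) auto
    moreover have "t0 \<in> {l'<..<u'} \<inter> F h -` (- {0})" using t0 by auto
    ultimately obtain d where d: "d > 0" "ball t0 d \<subseteq> {l'<..<u'} \<inter> F h -` (- {0})" by (rule openE)
    have sub: "{t0 - d<..<t0 + d} \<subseteq> {l'<..<u'}" and nz: "\<forall>t\<in>{t0 - d<..<t0 + d}. F h t \<noteq> 0"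
      using d(2) by (auto simp: ball_eq_greaterThanLessThan)
    have "l' \<le> t0 - d" "t0 + d \<le> u'" using sub d(1) by (auto simp: greaterThanLessThan_subseteq_greaterThanLessThan)
    moreover have "\<forall>h\<in>A. (\<forall>t\<in>{t0 - d<..<t0 + d}. F h t = 0) \<or> (\<forall>t\<in>{t0 - d<..<t0 + d}. F h t \<noteq> 0)"
      using A sub by blast
    ultimately show ?thesis using lu d(1) nz by (intro exI[of _ "t0 - d"] exI[of _ "t0 + d"]) auto
  qed
qed

lemma bounded_linear_cdot: "bounded_linear (cdot a)"
proof -
  have "linear (cdot a)"
    by (rule linearI) (simp_all add: cdot_def algebra_simps sum.distrib scaleR_sum_right)
  then show ?thesis by (simp add: linear_conv_bounded_linear)
qed

lemma has_vector_derivative_locally_zero: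
  assumes "(f has_vector_derivative D) (at t)" "open J" "t \<in> J" "\<And>s. s \<in> J \<Longrightarrow> f s = 0"
  shows "D = 0"
proof -
  have "((\<lambda>s. 0) has_vector_derivative D) (at t)"
    using assms by (rule has_vector_derivative_transform_within_open)
  moreover have "((\<lambda>s. 0) has_vector_derivative 0) (at t)" by (rule has_vector_derivative_const)
  ultimately show ?thesis by (rule vector_derivative_unique_at)
qed

text \<open>The equation is stated for every nonzero \<open>q\<close>, since both sides vanish
  outside \<open>S\<close> and its sums. In this form it passes to subintervals and to the smaller
  support found there.\<close>

definition euler_flow :: "real set \<Rightarrow> (real^3) set \<Rightarrow> (real^3 \<Rightarrow> real \<Rightarrow> complex^3) \<Rightarrow> bool" where
  "euler_flow J S c \<longleftrightarrow> finite S \<and> uminus ` S = S \<and> 0 \<notin> S \<and>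
     (\<forall>n t. t \<in> J \<longrightarrow> n \<notin> S \<longrightarrow> c n t = 0) \<and>
     (\<forall>n\<in>S. \<forall>t\<in>J. cdot (cvec n) (c n t) = 0 \<and> c (- n) t = cconj (c n t)) \<and>
     (\<forall>q t. q \<noteq> 0 \<longrightarrow> t \<in> J \<longrightarrow>
        (c q has_vector_derivative (- (\<i> / 2)) *s leray q (euler_sum S (\<lambda>n. c n t) q)) (at t))"

lemma euler_flowD:
  assumes "euler_flow J S c"
  shows "finite S" "uminus ` S = S" "0 \<notin> S"
    "t \<in> J \<Longrightarrow> n \<notin> S \<Longrightarrow> c n t = 0"
    "t \<in> J \<Longrightarrow> n \<in> S \<Longrightarrow> cdot (cvec n) (c n t) = 0"
    "t \<in> J \<Longrightarrow> n \<in> S \<Longrightarrow> c (- n) t = cconj (c n t)"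
    "t \<in> J \<Longrightarrow> q \<noteq> 0 \<Longrightarrow> (c q has_vector_derivative (- (\<i> / 2)) *s leray q (euler_sum S (\<lambda>n. c n t) q)) (at t)"
  using assms unfolding euler_flow_def by auto

lemma euler_sum_support:
  assumes "finite S" "T \<subseteq> S" "\<And>n. n \<notin> T \<Longrightarrow> U n = 0" "\<And>n. n \<in> S \<Longrightarrow> cdot (cvec n) (U n) = 0"
  shows "euler_sum S U q = euler_sum T U q"
proof -
  have "euler_sum S U q = 2 *s (\<Sum>n\<in>S. cdot (U n) (cvec q) *s U (q - n))"
    by (rule euler_sum_eq) (use assms in auto)
  also have "(\<Sum>n\<in>S. cdot (U n) (cvec q) *s U (q - n)) = (\<Sum>n\<in>T. cdot (U n) (cvec q) *s U (q - n))"
    by (rule sum.mono_neutral_right) (use assms in \<open>auto simp: cdot_linear\<close>)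
  also have "2 *s \<dots> = euler_sum T U q"
    by (rule euler_sum_eq[symmetric]) (use assms finite_subset in auto)
  finally show ?thesis .
qed

lemma cconj_eq_0 [simp]: "cconj v = 0 \<longleftrightarrow> v = 0"
  by (simp add: cconj_def vec_eq_iff)

lemma euler_flow_restrict:
  assumes F: "euler_flow J S c" and J: "J' \<subseteq> J" "J' \<noteq> {}"
    and dich: "\<And>n. n \<in> S \<Longrightarrow> (\<forall>t\<in>J'. c n t = 0) \<or> (\<forall>t\<in>J'. c n t \<noteq> 0)"
  shows "euler_flow J' {n\<in>S. \<forall>t\<in>J'. c n t \<noteq> 0} c"
proof -
  let ?T = "{n\<in>S. \<forall>t\<in>J'. c n t \<noteq> 0}"
  note E = euler_flowD[OF F]
  have out: "c n t = 0" if "t \<in> J'" "n \<notin> ?T" for n t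
    using dich[of n] that E(4)[of t n] J by (cases "n \<in> S") auto
  have neg: "- n \<in> ?T" if n: "n \<in> ?T" for n
  proof -
    have "- n \<in> S" using E(2) n by blast
    moreover have "c (- n) t \<noteq> 0" if "t \<in> J'" for t using E(6)[of t n] n that J by auto
    ultimately show ?thesis by blast
  qed
  have sym: "uminus ` ?T = ?T"
  proof
    show "uminus ` ?T \<subseteq> ?T" using neg by blast
    show "?T \<subseteq> uminus ` ?T"
    proof
      fix n assume "n \<in> ?T"
      then have "- n \<in> ?T" by (rule neg)
      then have "- (- n) \<in> uminus ` ?T" by (rule imageI)
      then show "n \<in> uminus ` ?T" by simp
    qed
  qed
  have es: "euler_sum S (\<lambda>n. c n t) q = euler_sum ?T (\<lambda>n. c n t) q" if "t \<in> J'" for t q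
  proof (rule euler_sum_support[OF E(1)])
    show "c n t = 0" if "n \<notin> ?T" for n using out[OF \<open>t \<in> J'\<close> that] .
    show "cdot (cvec n) (c n t) = 0" if "n \<in> S" for n using E(5)[of t n] \<open>t \<in> J'\<close> that J by blast
  qed blast
  show ?thesis unfolding euler_flow_def
  proof (intro conjI allI impI ballI)
    show "finite ?T" using E(1) by simp
    show "uminus ` ?T = ?T" by (rule sym)
    show "0 \<notin> ?T" using E(3) by simp
    show "c n t = 0" if "t \<in> J'" "n \<notin> ?T" for n t using out that .
    show "cdot (cvec n) (c n t) = 0" "c (- n) t = cconj (c n t)" if "n \<in> ?T" "t \<in> J'" for n t
      using E(5,6)[of t n] that J by auto
    show "(c q has_vector_derivative (- (\<i> / 2)) *s leray q (euler_sum ?T (\<lambda>n. c n t) q)) (at t)"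
      if "q \<noteq> 0" "t \<in> J'" for q t using E(7)[of t q] that J es[OF that(2)] by auto
  qed
qed

text \<open>The equation of the stream function does not contain \<open>w\<close>. Where the support
  of \<open>b\<close> is constant, \<open>b\<close> turns out to be steady, so \<open>w\<close>
  obeys a linear equation with a constant operator \<open>L\<close>, and the iterates of
  \<open>L\<close> on \<open>w\<close> are its time derivatives up to constants.\<close>

lemma planar_flow_stationary:
  assumes F: "euler_flow {l<..<u} S c" and lu: "l < u" and e1: "norm e = 1" and pl: "\<And>n. n \<in> S \<Longrightarrow> e \<bullet> n = 0"
  shows "\<exists>t\<in>{l<..<u}. \<forall>q. q \<noteq> 0 \<longrightarrow> leray q (euler_sum S (\<lambda>n. c n t) q) = 0"
proof -
  note E = euler_flowD[OF F]
  have PS: "planar_support S (\<lambda>n. c n t) e" if "t \<in> {l<..<u}" for t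
    by unfold_locales (use E that e1 pl in auto)
  define b where "b t = par_part e (\<lambda>n. c n t)" for t
  define w where "w t = perp_part e (\<lambda>n. c n t)" for t
  have bw0: "b t n = 0" "w t n = 0" if "t \<in> {l<..<u}" "n \<notin> S" for t n
    using planar_support.parts_outside[OF PS] that by (auto simp: b_def w_def)
  have off: "bracket e S (b t) g q = 0" if "t \<in> {l<..<u}" "q = 0 \<or> e \<bullet> q \<noteq> 0" "\<And>n. n \<notin> S \<Longrightarrow> g n = 0" for t g q
    unfolding bracket_def
  proof (rule sum.neutral, rule ballI)
    fix n assume n: "n \<in> S"
    show "of_real (cr e n q) * b t n * g (q - n) = 0"
    proof (cases "q = 0")
      case False
      then have "e \<bullet> (q - n) \<noteq> 0" using that(2) pl[OF n] by (simp add: inner_simps)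
      then have "g (q - n) = 0" using pl that(3) by blast
      then show ?thesis by simp
    qed (simp add: cr_linear)
  qed
  have db: "((\<lambda>s. b s q) has_vector_derivative - \<i> * bracket e S (b t) (\<lambda>p. b t p * of_real (p \<bullet> p)) q / of_real (q \<bullet> q)) (at t)"
    if "t \<in> {l<..<u}" "q \<noteq> 0" "e \<bullet> q = 0" for t q
  proof -
    have "((\<lambda>s. cdot (cvec (e \<times> q)) (c q s)) has_vector_derivative
       cdot (cvec (e \<times> q)) ((- (\<i> / 2)) *s leray q (euler_sum S (\<lambda>n. c n t) q))) (at t)"
      by (rule bounded_linear.has_vector_derivative[OF bounded_linear_cdot E(7)[OF that(1,2)]])
    also have "cdot (cvec (e \<times> q)) ((- (\<i> / 2)) *s leray q (euler_sum S (\<lambda>n. c n t) q))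
       = - \<i> * bracket e S (b t) (\<lambda>p. b t p * of_real (p \<bullet> p)) q"
      using planar_support.leray_par[OF PS[OF that(1)] that(2,3)] by (simp add: cdot_linear b_def)
    finally have "((\<lambda>s. cdot (cvec (e \<times> q)) (c q s)) has_vector_derivative
       - \<i> * bracket e S (b t) (\<lambda>p. b t p * of_real (p \<bullet> p)) q) (at t)" .
    then show ?thesis unfolding b_def par_part_def divide_inverse by (rule has_vector_derivative_mult_left)
  qed
  have dw: "((\<lambda>s. w s q) has_vector_derivative - \<i> * bracket e S (b t) (w t) q) (at t)"
    if t: "t \<in> {l<..<u}" for t q
  proof (cases "q = 0 \<or> e \<bullet> q \<noteq> 0")
    case True
    have z: "w s q = 0" if "s \<in> {l<..<u}" for s using True bw0[OF that, of q] E(3) pl[of q] by auto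
    have "((\<lambda>s. 0) has_vector_derivative (0::complex)) (at t)" by (rule has_vector_derivative_const)
    then have "((\<lambda>s. w s q) has_vector_derivative 0) (at t)"
      by (rule has_vector_derivative_transform_within_open[of _ _ _ "{l<..<u}"]) (use t z in auto)
    moreover have "bracket e S (b t) (w t) q = 0" using off[OF t True, of "w t"] bw0[OF t] by blast
    ultimately show ?thesis by simp
  next
    case False
    then have q: "q \<noteq> 0" "e \<bullet> q = 0" by auto
    have "((\<lambda>s. cdot (cvec e) (c q s)) has_vector_derivative
       cdot (cvec e) ((- (\<i> / 2)) *s leray q (euler_sum S (\<lambda>n. c n t) q))) (at t)"
      by (rule bounded_linear.has_vector_derivative[OF bounded_linear_cdot E(7)[OF t q(1)]])
    also have "cdot (cvec e) ((- (\<i> / 2)) *s leray q (euler_sum S (\<lambda>n. c n t) q)) = - \<i> * bracket e S (b t) (w t) q"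
      using planar_support.leray_perp[OF PS[OF t] q] by (simp add: cdot_linear b_def w_def)
    finally show ?thesis by (simp add: w_def perp_part_def)
  qed
  \<comment> \<open>Even a coefficient \<open>c n\<close> without zeros may have a planar part with
    zeros, so the interval is shrunk with respect to \<open>b\<close>.\<close>
  have "continuous_on {l<..<u} (\<lambda>t. b t n)" if "n \<in> S" for n
  proof (rule continuous_at_imp_continuous_on, rule ballI)
    fix t assume "t \<in> {l<..<u}"
    moreover have "n \<noteq> 0" using that E(3) by auto
    ultimately show "isCont (\<lambda>t. b t n) t" by (rule has_vector_derivative_continuous[OF db[OF _ _ pl[OF that]]])
  qed
  then obtain l' u' where lu': "l \<le> l'" "l' < u'" "u' \<le> u"
    and dich: "\<And>n. n \<in> S \<Longrightarrow> (\<forall>t\<in>{l'<..<u'}. b t n = 0) \<or> (\<forall>t\<in>{l'<..<u'}. b t n \<noteq> 0)"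
    using shrink_interval[OF E(1) lu, of "\<lambda>n t. b t n"] by blast
  define J where "J = {l'<..<u'}"
  have J: "J \<subseteq> {l<..<u}" "open J" "convex J" using lu' by (auto simp: J_def)
  define t0 where "t0 = (l' + u') / 2"
  have t0: "t0 \<in> J" using lu' by (simp add: J_def t0_def)
  define T where "T = {n\<in>S. b t0 n \<noteq> 0}"
  have Tall: "b t n \<noteq> 0 \<longleftrightarrow> n \<in> T" if "t \<in> J" for t n
  proof (cases "n \<in> S")
    case True
    then show ?thesis using dich[OF True] that t0 by (auto simp: T_def J_def)
  next
    case False
    then show ?thesis using bw0 J that by (auto simp: T_def)
  qed
  have TS: "T \<subseteq> S" "finite T" using E(1) by (auto simp: T_def)
  have negT: "- n \<in> T" if n: "n \<in> T" for n
  proof -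
    have nS: "n \<in> S" "- n \<in> S" using TS n E(2) by auto
    have "b t0 (- n) = - cnj (b t0 n)"
      using E(6)[of t0 n] nS t0 J cdot_cconj[of "cvec (e \<times> n)" "c n t0"]
      by (simp add: b_def par_part_def cvec_linear cdot_linear subset_iff)
    then show ?thesis using n nS by (simp add: T_def)
  qed
  have symT: "uminus ` T = T"
  proof
    show "uminus ` T \<subseteq> T" using negT by blast
    show "T \<subseteq> uminus ` T"
    proof
      fix n assume "n \<in> T"
      then have "- (- n) \<in> uminus ` T" using negT by blast
      then show "n \<in> uminus ` T" by simp
    qed
  qed
  have zT: "0 \<notin> T" using E(3) TS by auto
  have bT: "bracket e S (b t) = bracket e T (b t)" if "t \<in> J" for t
    by (rule ext, rule bracket_support[OF E(1) TS(1)]) (use Tall[OF that] in blast)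
  \<comment> \<open>Off \<open>T\<close> the coefficient of \<open>b\<close> is zero throughout
    \<open>J\<close>, hence so is its derivative, which is the bracket up to a nonzero
    factor.\<close>
  have Jout: "bracket e T (b t) (\<lambda>p. b t p * of_real (p \<bullet> p)) q = 0" if t: "t \<in> J" and q: "q \<notin> T" for t q
  proof (cases "q = 0 \<or> e \<bullet> q \<noteq> 0")
    case True
    then show ?thesis using off[of t q "\<lambda>p. b t p * of_real (p \<bullet> p)"] bT[OF t] bw0 t J by auto
  next
    case False
    then have q0: "q \<noteq> 0" "e \<bullet> q = 0" by auto
    have "- \<i> * bracket e S (b t) (\<lambda>p. b t p * of_real (p \<bullet> p)) q / of_real (q \<bullet> q) = 0"
      by (rule has_vector_derivative_locally_zero[OF db J(2) t]) (use t q q0 J Tall in auto)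
    then show ?thesis using bT[OF t] q0 by simp
  qed
  have plT: "e \<bullet> n = 0" if "n \<in> T" for n using TS pl that by blast
  have Jall: "bracket e T (b t) (\<lambda>p. b t p * of_real (p \<bullet> p)) q = 0" if t: "t \<in> J" for t q
  proof -
    consider n0 where "T \<subseteq> range (\<lambda>t. t *\<^sub>R n0)" | r where "circle_stream e T (b t) r"
      using planar_shape[OF TS(2) symT zT e1 plT Tall[OF t] Jout[OF t]] by blast
    then show ?thesis
    proof cases
      case 1
      show ?thesis
      proof (rule bracket_line[OF 1])
        fix p assume "b t p * complex_of_real (p \<bullet> p) \<noteq> 0"
        then have "p \<in> T" using Tall[OF t] by auto
        then show "cr e n0 p = 0" using 1 by (auto simp: cr_linear)
      qed
    next
      case 2
      then interpret circle_stream e T "b t" r .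
      show ?thesis by (rule bracket_circle[OF TS(2) _ circle]) (use Tall[OF t] in blast)
    qed
  qed
  have bconst: "b t n = b t0 n" if t: "t \<in> J" for t n
  proof (cases "n \<in> S")
    case True
    then have n: "n \<noteq> 0" "e \<bullet> n = 0" using E(3) pl by auto
    have "((\<lambda>s. b s n) has_vector_derivative 0) (at s within J)" if "s \<in> J" for s
    proof -
      have "bracket e S (b s) (\<lambda>p. b s p * of_real (p \<bullet> p)) n = 0" using bT[OF that] Jall[OF that] by simp
      moreover have "s \<in> {l<..<u}" using that J by blast
      ultimately have "((\<lambda>s. b s n) has_vector_derivative 0) (at s)" using db[of s n] n by simp
      then show ?thesis by (rule has_vector_derivative_at_within)
    qed
    then show ?thesis using has_vector_derivative_zero_constant[OF J(3), of "\<lambda>s. b s n"] t t0 by metis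
  next
    case False
    then show ?thesis using bw0 t t0 J by (metis subsetD)
  qed
  define L where "L = bracket e T (b t0)"
  have L: "L g q = (\<Sum>n\<in>T. of_real (cr e n q) * b t0 n * g (q - n))" for g q
    by (simp add: L_def bracket_def)
  have Ls: "(L ^^ Suc m) g q = (\<Sum>n\<in>T. of_real (cr e n q) * b t0 n * (L ^^ m) g (q - n))" for m g q
    by (simp add: L[of "(L ^^ m) g"])
  have bfun: "b t = b t0" if "t \<in> J" for t using bconst[OF that] by blast
  have dorb: "((\<lambda>s. (L ^^ j) (w s) q) has_vector_derivative - \<i> * (L ^^ Suc j) (w t) q) (at t)" if t: "t \<in> J" for t j q
  proof (induction j arbitrary: q)
    case 0
    show ?case using dw[of t q] t J bT[OF t] bfun[OF t] by (auto simp: L_def subset_iff)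
  next
    case (Suc j)
    have "((\<lambda>s. \<Sum>n\<in>T. of_real (cr e n q) * b t0 n * (L ^^ j) (w s) (q - n)) has_vector_derivative
      (\<Sum>n\<in>T. of_real (cr e n q) * b t0 n * (- \<i> * (L ^^ Suc j) (w t) (q - n)))) (at t)"
      by (intro has_vector_derivative_sum has_vector_derivative_mult_right Suc)
    moreover have "(\<Sum>n\<in>T. of_real (cr e n q) * b t0 n * (- \<i> * (L ^^ Suc j) (w t) (q - n))) = - \<i> * (L ^^ Suc (Suc j)) (w t) q"
      unfolding Ls[of "Suc j"] sum_distrib_left by (rule sum.cong) (simp_all only: mult_ac)
    moreover have "(\<Sum>n\<in>T. of_real (cr e n q) * b t0 n * (L ^^ j) (w s) (q - n)) = (L ^^ Suc j) (w s) q" for s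
      by (simp only: Ls)
    ultimately show ?case by simp
  qed
  \<comment> \<open>Each iterate is, up to a constant, the derivative of the previous one, which
    vanishes at \<open>q\<close> during all of \<open>J\<close>.\<close>
  have zero: "(L ^^ j) (w t) q = 0" if "t \<in> J" "q \<notin> S" for t j q
    using that
  proof (induction j arbitrary: t)
    case 0
    then show ?case using bw0 J by auto
  next
    case (Suc j)
    have "- \<i> * (L ^^ Suc j) (w t) q = 0"
      by (rule has_vector_derivative_locally_zero[OF dorb J(2)]) (use Suc in auto)
    then show ?case by simp
  qed
  have "bounded S" using E(1) by (rule finite_imp_bounded)
  then obtain B where B: "\<And>n. n \<in> S \<Longrightarrow> norm n \<le> B" by (auto simp: bounded_iff)
  have orb: "orbit_bounded e T (b t0) (w t0)" unfolding orbit_bounded_def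
    using zero[OF t0] B unfolding L_def by blast
  have "bracket e T (b t0) (w t0) q = 0" for q
  proof (rule orbit_bounded_imp_bracket_0[OF TS(2) symT zT e1 plT Tall[OF t0] Jout[OF t0] _ _ orb])
    have "w t0 q = 0" if "q \<notin> S" for q using bw0 t0 J that by blast
    then have "{q. w t0 q \<noteq> 0} \<subseteq> S" by blast
    then show "finite {q. w t0 q \<noteq> 0}" "\<And>q. w t0 q \<noteq> 0 \<Longrightarrow> e \<bullet> q = 0" using E(1) finite_subset pl by auto
  qed
  then have "bracket e S (b t0) (w t0) q = 0" "bracket e S (b t0) (\<lambda>p. b t0 p * of_real (p \<bullet> p)) q = 0" for q
    using bT[OF t0] Jall[OF t0] by auto
  then have "leray q (euler_sum S (\<lambda>n. c n t0) q) = 0" if "q \<noteq> 0" for q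
    using planar_support.planar_stationary[OF PS[of t0] _ _ that] t0 J unfolding b_def w_def by blast
  then show ?thesis using t0 J by blast
qed

text \<open>On a subinterval where the active frequencies form a constant set \<open>T\<close>, the
  equation off \<open>T\<close> has no time derivative. It is the span of \<open>T\<close>, possibly
  smaller than that of \<open>S\<close>, that decides between the spatial and the planar
  argument.\<close>

lemma flow_stationary_somewhere:
  assumes F: "euler_flow {l<..<u} S c" and lu: "l < u"
  shows "\<exists>t\<in>{l<..<u}. \<forall>q. q \<noteq> 0 \<longrightarrow> leray q (euler_sum S (\<lambda>n. c n t) q) = 0"
proof -
  note E = euler_flowD[OF F]
  have "continuous_on {l<..<u} (c n)" if "n \<in> S" for n
  proof (rule continuous_at_imp_continuous_on, rule ballI)
    fix t assume "t \<in> {l<..<u}"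
    moreover have "n \<noteq> 0" using that E(3) by auto
    ultimately show "isCont (c n) t" by (rule has_vector_derivative_continuous[OF E(7)])
  qed
  then obtain l' u' where lu': "l \<le> l'" "l' < u'" "u' \<le> u"
    and dich: "\<And>n. n \<in> S \<Longrightarrow> (\<forall>t\<in>{l'<..<u'}. c n t = 0) \<or> (\<forall>t\<in>{l'<..<u'}. c n t \<noteq> 0)"
    using shrink_interval[OF E(1) lu, of c] by blast
  define J where "J = {l'<..<u'}"
  define T where "T = {n\<in>S. \<forall>t\<in>J. c n t \<noteq> 0}"
  have J: "J \<subseteq> {l<..<u}" using lu' by (auto simp: J_def)
  define t0 where "t0 = (l' + u') / 2"
  have t0: "t0 \<in> J" using lu' by (simp add: J_def t0_def)
  have G: "euler_flow J T c" unfolding T_def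
    by (rule euler_flow_restrict[OF F J]) (use t0 dich in \<open>auto simp: J_def\<close>)
  note E' = euler_flowD[OF G]
  have es: "euler_sum S (\<lambda>n. c n t) q = euler_sum T (\<lambda>n. c n t) q" if "t \<in> J" for t q
  proof (rule euler_sum_support[OF E(1)])
    show "T \<subseteq> S" by (auto simp: T_def)
    show "c n t = 0" if "n \<notin> T" for n using E'(4)[OF \<open>t \<in> J\<close> that] .
    show "cdot (cvec n) (c n t) = 0" if "n \<in> S" for n using E(5)[of t n] \<open>t \<in> J\<close> that J by blast
  qed
  have "\<exists>t\<in>J. \<forall>q. q \<noteq> 0 \<longrightarrow> leray q (euler_sum T (\<lambda>n. c n t) q) = 0"
  proof (cases "span T = UNIV")
    case True
    have "euler_support T (\<lambda>n. c n t0)"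
    proof unfold_locales
      fix q assume q: "q \<notin> T" "q \<noteq> 0"
      have "(- (\<i> / 2)) *s leray q (euler_sum T (\<lambda>n. c n t0) q) = 0"
        by (rule has_vector_derivative_locally_zero[OF E'(7)[OF t0 q(2)], of J]) (use t0 E'(4)[OF _ q(1)] in \<open>simp_all add: J_def\<close>)
      then show "leray q (euler_sum T (\<lambda>n. c n t0) q) = 0" by simp
    next
      show "c n t0 = 0" if "n \<notin> T" for n using E'(4)[OF t0 that] .
      show "c n t0 \<noteq> 0" if "n \<in> T" for n using that t0 by (simp add: T_def)
      show "cdot (cvec n) (c n t0) = 0" if "n \<in> T" for n using E'(5)[OF t0 that] .
    qed (fact E'(1) E'(2) E'(3) True)+
    then interpret euler_support T "\<lambda>n. c n t0" .
    obtain r \<sigma> where rs: "\<forall>n\<in>T. norm n = r \<and> ccross (cvec n) (c n t0) = (\<i> * of_real (\<sigma> * r)) *s c n t0"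
      using beltrami_sphere by (elim exE conjE bexE)
    then have "leray q (euler_sum T (\<lambda>n. c n t0) q) = 0" if "q \<noteq> 0" for q
      by (intro beltrami_stationary[OF fin U0 div _ that, of "\<i> * of_real (\<sigma> * r)"]) auto
    then show ?thesis using t0 by blast
  next
    case False
    then obtain a where a: "a \<noteq> 0" "\<And>x. x \<in> span T \<Longrightarrow> a \<bullet> x = 0" using span_not_UNIV_orthogonal[of T] by blast
    define e where "e = (1 / norm a) *\<^sub>R a"
    have "norm e = 1" "\<And>n. n \<in> T \<Longrightarrow> e \<bullet> n = 0" using a span_base by (auto simp: e_def)
    then show ?thesis using planar_flow_stationary[of l' u' T c e] G lu' by (simp add: J_def)
  qed
  then obtain t where t: "t \<in> J" "\<And>q. q \<noteq> 0 \<Longrightarrow> leray q (euler_sum T (\<lambda>n. c n t) q) = 0" by blast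
  have "t \<in> {l<..<u}" using t(1) J by blast
  moreover have "\<forall>q. q \<noteq> 0 \<longrightarrow> leray q (euler_sum S (\<lambda>n. c n t) q) = 0" using t es by simp
  ultimately show ?thesis by blast
qed

lemma flow_stationary:
  assumes F: "euler_flow I S c" and I: "open I" and t: "t \<in> I" and q: "q \<noteq> 0"
  shows "leray q (euler_sum S (\<lambda>n. c n t) q) = 0"
proof (rule ccontr)
  assume nz: "leray q (euler_sum S (\<lambda>n. c n t) q) \<noteq> 0"
  note E = euler_flowD[OF F]
  have cc: "continuous_on I (\<lambda>s. c n s $ j)" for n j
  proof (cases "n = 0")
    case True
    show ?thesis by (rule continuous_on_eq[of _ "\<lambda>s. 0"]) (use True E(3,4) in auto)
  next
    case False
    have "continuous_on I (c n)"
    proof (rule continuous_at_imp_continuous_on, rule ballI)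
      fix t assume "t \<in> I"
      then show "isCont (c n) t" by (rule has_vector_derivative_continuous[OF E(7)[OF _ False]])
    qed
    then show ?thesis by (rule continuous_on_component)
  qed
  have cd: "continuous_on I (\<lambda>s. cdot (c n s) x)" for n x
    unfolding cdot_def by (intro continuous_on_sum continuous_on_mult cc continuous_on_const)
  let ?X = "\<lambda>s. euler_sum S (\<lambda>n. c n s) q"
  let ?P = "{(n1, n2). n1 \<in> S \<and> n2 \<in> S \<and> n1 + n2 = q}"
  have es: "continuous_on I (\<lambda>s. ?X s $ j)" for j
  proof -
    have "?X s $ j = (\<Sum>x\<in>?P. cdot (c (fst x) s) (cvec (snd x)) * c (snd x) s $ j + cdot (c (snd x) s) (cvec (fst x)) * c (fst x) s $ j)" for s
      by (simp add: euler_sum_def sum_component case_prod_unfold)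
    moreover have "continuous_on I (\<lambda>s. \<Sum>x\<in>?P. cdot (c (fst x) s) (cvec (snd x)) * c (snd x) s $ j + cdot (c (snd x) s) (cvec (fst x)) * c (fst x) s $ j)"
      by (intro continuous_on_sum continuous_on_add continuous_on_mult cc cd)
    ultimately show ?thesis by simp
  qed
  have "continuous_on I (\<lambda>s. leray q (?X s) $ j)" for j
  proof -
    have "leray q (?X s) $ j = ?X s $ j - ((\<Sum>i\<in>UNIV. cvec q $ i * ?X s $ i) * inverse (complex_of_real (q \<bullet> q))) * cvec q $ j" for s
      by (simp add: leray_eq[OF q] cdot_def divide_inverse)
    moreover have "continuous_on I (\<lambda>s. ?X s $ j - ((\<Sum>i\<in>UNIV. cvec q $ i * ?X s $ i) * inverse (complex_of_real (q \<bullet> q))) * cvec q $ j)"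
      by (intro continuous_on_diff continuous_on_sum continuous_on_mult es continuous_on_const)
    ultimately show ?thesis by simp
  qed
  then have "continuous_on I (\<lambda>s. \<chi> j. leray q (?X s) $ j)" by (rule continuous_on_vec_lambda)
  then have "continuous_on I (\<lambda>s. leray q (?X s))" by simp
  then have "open (I \<inter> (\<lambda>s. leray q (euler_sum S (\<lambda>n. c n s) q)) -` (- {0}))"
    using I by (intro continuous_open_preimage) auto
  moreover have "t \<in> I \<inter> (\<lambda>s. leray q (euler_sum S (\<lambda>n. c n s) q)) -` (- {0})" using nz t by auto
  ultimately obtain d where d: "d > 0" "ball t d \<subseteq> I \<inter> (\<lambda>s. leray q (euler_sum S (\<lambda>n. c n s) q)) -` (- {0})" by (rule openE)
  have sub: "{t - d<..<t + d} \<subseteq> I" using d(2) by (auto simp: ball_eq_greaterThanLessThan)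
  have "euler_flow {t - d<..<t + d} S c" using E sub unfolding euler_flow_def by (intro conjI allI impI ballI) (auto simp del: greaterThanLessThan_iff)
  then obtain s where "s \<in> {t - d<..<t + d}" "leray q (euler_sum S (\<lambda>n. c n s) q) = 0"
    using flow_stationary_somewhere[of "t - d" "t + d" S c] d(1) q by auto
  then show False using d(2) by (auto simp: ball_eq_greaterThanLessThan)
qed

lemma flow_constant:
  assumes F: "euler_flow I S c" and I: "open I" "is_interval I" and t: "s \<in> I" "t \<in> I"
  shows "c q s = c q t"
proof (cases "q = 0")
  case True
  then show ?thesis using euler_flowD(3,4)[OF F] t by metis
next
  case False
  have "convex I" using I(2) by (rule is_interval_convex)
  moreover have "(c q has_vector_derivative 0) (at x within I)" if "x \<in> I" for x
    using euler_flowD(7)[OF F that False] flow_stationary[OF F I(1) that False]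
    by (simp add: has_vector_derivative_at_within)
  ultimately show ?thesis using has_vector_derivative_zero_constant[of I "c q"] t by metis
qed

lemma euler_flow_of_solution:
  assumes I: "open I" and fe: "fourier_expansion_on I u S c" and sol: "euler_solution I S c"
  shows "euler_flow I S c"
proof -
  have S: "finite S" "0 \<notin> S" "uminus ` S = S" and out: "\<And>n t. n \<notin> S \<Longrightarrow> t \<in> I \<Longrightarrow> c n t = 0"
    and cc: "\<And>n t. n \<in> S \<Longrightarrow> t \<in> I \<Longrightarrow> c (- n) t = cconj (c n t) \<and> cdot (cvec n) (c n t) = 0"
    using fe unfolding fourier_expansion_on_def by auto
  show ?thesis unfolding euler_flow_def
  proof (intro conjI allI impI ballI)
    fix q t assume q: "q \<noteq> (0::real^3)" and t: "t \<in> I"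
    show "(c q has_vector_derivative (- (\<i> / 2)) *s leray q (euler_sum S (\<lambda>n. c n t) q)) (at t)"
    proof (cases "q \<in> S \<union> ({n1 + n2 |n1 n2. n1 \<in> S \<and> n2 \<in> S} - {0})")
      case True
      then have d: "c q differentiable (at t)" and eq: "vector_derivative (c q) (at t) +
          (\<i> / 2) *s leray q (euler_sum S (\<lambda>n. c n t) q) = 0"
        using sol t unfolding euler_solution_def euler_sum_def by blast+
      have "vector_derivative (c q) (at t) = (- (\<i> / 2)) *s leray q (euler_sum S (\<lambda>n. c n t) q)"
        using eq by (simp add: eq_neg_iff_add_eq_0)
      then show ?thesis using d vector_derivative_works by metis
    next
      case False
      then have "{(n1, n2). n1 \<in> S \<and> n2 \<in> S \<and> n1 + n2 = q} = {}" using q by auto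
      then have "euler_sum S (\<lambda>n. c n t) q = 0" unfolding euler_sum_def by (simp only: sum.empty)
      then have "leray q (euler_sum S (\<lambda>n. c n t) q) = 0" by (simp add: leray_eq[OF q] cdot_linear)
      moreover have "(c q has_vector_derivative 0) (at t)"
        by (rule has_vector_derivative_transform_within_open[OF has_vector_derivative_const I t]) (use False out in auto)
      ultimately show ?thesis by simp
    qed
  qed (use S out cc in auto)
qed

section \<open>Trigonometric polynomials as functions\<close>

text \<open>The modes are complex but \<open>v\<close> is real: each component is differentiated as
  a complex sum, and the imaginary part of the result vanishes because it is the derivative of
  0.\<close>

lemma fourier_has_derivative:
  fixes v :: "real^3 \<Rightarrow> real^3" and c :: "real^3 \<Rightarrow> complex^3"
  assumes v: "\<And>x. cvec (v x) = (\<Sum>n\<in>S. wave n x *s c n)"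
  obtains D where "(v has_derivative D) (at x)"
    "\<And>h. cvec (D h) = (\<Sum>n\<in>S. (\<i> * of_real (n \<bullet> h) * wave n x) *s c n)"
proof -
  define F where "F i y = (\<Sum>n\<in>S. wave n y * c n $ i)" for i y
  define D' where "D' i h = (\<Sum>n\<in>S. \<i> * of_real (n \<bullet> h) * wave n x * c n $ i)" for i h
  have Fv: "F i y = complex_of_real (v y $ i)" for i y
    using arg_cong[OF v[of y], of "\<lambda>u. u $ i"] by (simp add: F_def cvec_def sum_component)
  have W: "(wave n has_derivative (\<lambda>h. \<i> * of_real (n \<bullet> h) * wave n x)) (at x)" for n
  proof -
    have "((\<lambda>y. \<i> * complex_of_real (n \<bullet> y)) has_derivative (\<lambda>h. \<i> * complex_of_real (n \<bullet> h))) (at x)"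
      by (auto intro!: derivative_eq_intros)
    moreover have "(exp has_derivative (*) (exp z)) (at z)" for z :: complex
      using DERIV_exp[of z] by (simp add: has_field_derivative_def)
    ultimately have "((\<lambda>y. exp (\<i> * complex_of_real (n \<bullet> y))) has_derivative
      (\<lambda>h. exp (\<i> * complex_of_real (n \<bullet> x)) * (\<i> * complex_of_real (n \<bullet> h)))) (at x)"
      by (rule has_derivative_compose)
    then show ?thesis unfolding wave_def by (simp add: mult.commute)
  qed
  have F: "(F i has_derivative D' i) (at x)" for i
    unfolding F_def D'_def by (intro has_derivative_sum has_derivative_mult_left W)
  have Re: "((\<lambda>y. v y $ i) has_derivative (\<lambda>h. Re (D' i h))) (at x)" for i
  proof -
    have "((\<lambda>y. Re (F i y)) has_derivative (\<lambda>h. Re (D' i h))) (at x)" by (rule has_derivative_Re[OF F])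
    then show ?thesis by (simp add: Fv)
  qed
  have Im0: "Im (D' i h) = 0" for i h
  proof -
    have "((\<lambda>y. Im (F i y)) has_derivative (\<lambda>h. Im (D' i h))) (at x)" by (rule has_derivative_Im[OF F])
    then have "((\<lambda>y. 0) has_derivative (\<lambda>h. Im (D' i h))) (at x)" by (simp add: Fv)
    moreover have "((\<lambda>y. 0) has_derivative (\<lambda>h. 0)) (at x)" by simp
    ultimately have "(\<lambda>h. Im (D' i h)) = (\<lambda>h. 0)" by (rule has_derivative_unique)
    then show ?thesis by meson
  qed
  show thesis
  proof (rule that[of "\<lambda>h. \<chi> i. Re (D' i h)"])
    show "(v has_derivative (\<lambda>h. \<chi> i. Re (D' i h))) (at x)"
    proof -
      show ?thesis
        by (subst has_derivative_componentwise_within) (auto simp: Basis_vec_def inner_axis intro: Re)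
    qed
    show "cvec (\<chi> i. Re (D' i h)) = (\<Sum>n\<in>S. (\<i> * of_real (n \<bullet> h) * wave n x) *s c n)" for h
    proof -
      have "complex_of_real (Re (D' i h)) = D' i h" for i using Im0[of i h] by (simp add: complex_eq_iff)
      then show ?thesis by (simp add: vec_eq_iff cvec_def sum_component D'_def)
    qed
  qed
qed

lemma curl_fourier:
  assumes v: "\<And>x. cvec (v x) = (\<Sum>n\<in>S. wave n x *s c n)"
  shows "cvec (curl v x) = (\<Sum>n\<in>S. wave n x *s (\<i> *s ccross (cvec n) (c n)))"
proof -
  obtain D where D: "(v has_derivative D) (at x)"
    "\<And>h. cvec (D h) = (\<Sum>n\<in>S. (\<i> * of_real (n \<bullet> h) * wave n x) *s c n)"
    using fourier_has_derivative[OF v] by blast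
  have fd: "frechet_derivative v (at x) = D" using frechet_derivative_at[OF D(1)] by simp
  have p: "complex_of_real (partial j v x $ i) = (\<Sum>n\<in>S. \<i> * of_real (n $ j) * wave n x * c n $ i)" for i j
    using arg_cong[OF D(2)[of "axis j 1"], of "\<lambda>u. u $ i"]
    by (simp add: partial_def fd cvec_def sum_component inner_axis)
  show ?thesis
    unfolding vec_eq_iff forall_3 curl_def
    by (simp add: cvec_def ccross_def sum_component p sum_subtractf[symmetric] algebra_simps)
qed

text \<open>Summation over the support itself makes the function depend on the coefficients alone.
  An infinite support would give the default value 0, so finiteness accompanies its use.\<close>

definition trig :: "(real^3 \<Rightarrow> complex) \<Rightarrow> real^3 \<Rightarrow> complex" where
  "trig g x = (\<Sum>q | g q \<noteq> 0. g q * wave q x)"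

lemma trig_eq:
  assumes "finite A" "\<And>q. q \<notin> A \<Longrightarrow> g q = 0"
  shows "trig g x = (\<Sum>q\<in>A. g q * wave q x)"
  unfolding trig_def by (rule sum.mono_neutral_left) (use assms in auto)

lemma trig_inject:
  assumes "finite {q. g q \<noteq> 0}" "finite {q. h q \<noteq> 0}" "\<And>x. trig g x = trig h x"
  shows "g q = h q"
proof -
  let ?A = "insert q ({q. g q \<noteq> 0} \<union> {q. h q \<noteq> 0})"
  have fin: "finite ?A" using assms by simp
  have "(\<Sum>q\<in>?A. (g q - h q) * wave q x) = trig g x - trig h x" for x
    by (subst (1 2) trig_eq[of ?A]) (use fin in \<open>auto simp: sum_subtractf algebra_simps\<close>)
  then have "g q - h q = 0" using wave_independent[OF fin, of "\<lambda>q. g q - h q" q] assms(3) by simp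
  then show ?thesis by simp
qed

lemma trig_delta: "trig delta x = 1"
  by (subst trig_eq[of "{0}"]) (auto simp: delta_def)

lemma trig_mulop:
  assumes "finite T" "finite {q. g q \<noteq> 0}"
  shows "trig (mulop T b g) x = (\<Sum>n\<in>T. b n * wave n x) * trig g x"
proof -
  let ?A = "{q. g q \<noteq> 0}"
  let ?B = "(\<lambda>(n, p). n + p) ` (Sigma T (\<lambda>_. ?A))"
  have B: "finite ?B" using assms by auto
  have "mulop T b g q = 0" if q: "q \<notin> ?B" for q
    unfolding mulop_def
  proof (rule sum.neutral, rule ballI)
    fix n assume n: "n \<in> T"
    have "g (q - n) = 0"
    proof (rule ccontr)
      assume "g (q - n) \<noteq> 0"
      then have "n + (q - n) \<in> ?B" using n by (intro image_eqI[of _ _ "(n, q - n)"]) auto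
      then show False using q by simp
    qed
    then show "b n * g (q - n) = 0" by simp
  qed
  then have "trig (mulop T b g) x = (\<Sum>q\<in>?B. mulop T b g q * wave q x)" by (rule trig_eq[OF B])
  also have "\<dots> = (\<Sum>n\<in>T. \<Sum>q\<in>?B. b n * g (q - n) * wave q x)"
    unfolding mulop_def sum_distrib_right by (rule sum.swap)
  also have "\<dots> = (\<Sum>n\<in>T. b n * wave n x * trig g x)"
  proof (rule sum.cong[OF refl])
    fix n assume n: "n \<in> T"
    have "(\<Sum>q\<in>?B. b n * g (q - n) * wave q x) = (\<Sum>q\<in>(\<lambda>p. n + p) ` ?A. b n * g (q - n) * wave q x)"
    proof (rule sum.mono_neutral_right[OF B])
      show "(\<lambda>p. n + p) ` ?A \<subseteq> ?B"
      proof
        fix q assume "q \<in> (\<lambda>p. n + p) ` ?A"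
        then obtain p where "p \<in> ?A" "q = n + p" by blast
        then show "q \<in> ?B" using n by (intro image_eqI[of _ _ "(n, p)"]) auto
      qed
      show "\<forall>q\<in>?B - (\<lambda>p. n + p) ` ?A. b n * g (q - n) * wave q x = 0"
      proof
        fix q assume q: "q \<in> ?B - (\<lambda>p. n + p) ` ?A"
        have "g (q - n) = 0"
        proof (rule ccontr)
          assume "g (q - n) \<noteq> 0"
          then have "q \<in> (\<lambda>p. n + p) ` ?A" by (intro image_eqI[of _ _ "q - n"]) auto
          then show False using q by blast
        qed
        then show "b n * g (q - n) * wave q x = 0" by simp
      qed
    qed
    also have "\<dots> = (\<Sum>p\<in>?A. b n * g p * wave (n + p) x)"
      by (subst sum.reindex) (auto simp: inj_on_def)
    also have "\<dots> = b n * wave n x * trig g x"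
      unfolding trig_def sum_distrib_left by (rule sum.cong) (simp_all add: wave_mult[symmetric])
    finally show "(\<Sum>q\<in>?B. b n * g (q - n) * wave q x) = b n * wave n x * trig g x" .
  qed
  finally show ?thesis by (simp add: sum_distrib_right)
qed

lemma trig_mulop_power:
  assumes "finite T"
  shows "trig ((mulop T b ^^ k) delta) x = (\<Sum>n\<in>T. b n * wave n x) ^ k"
  by (induction k) (simp_all add: trig_delta trig_mulop[OF assms finite_support_mulop_power[OF assms]])

lemma finite_support_poly:
  assumes "finite T"
  shows "finite {q. (\<Sum>k<K. a k * (mulop T b ^^ k) delta q) \<noteq> 0}"
proof (rule finite_subset)
  show "{q. (\<Sum>k<K. a k * (mulop T b ^^ k) delta q) \<noteq> 0} \<subseteq> (\<Union>k<K. {q. (mulop T b ^^ k) delta q \<noteq> 0})"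
  proof
    fix q assume "q \<in> {q. (\<Sum>k<K. a k * (mulop T b ^^ k) delta q) \<noteq> 0}"
    then obtain k where "k \<in> {..<K}" "a k * (mulop T b ^^ k) delta q \<noteq> 0"
      by (auto elim: sum.not_neutral_contains_not_neutral)
    then show "q \<in> (\<Union>k<K. {q. (mulop T b ^^ k) delta q \<noteq> 0})" by auto
  qed
qed (use finite_support_mulop_power[OF assms] in blast)

lemma trig_poly:
  assumes "finite T"
  shows "trig (\<lambda>q. \<Sum>k<K. a k * (mulop T b ^^ k) delta q) x = (\<Sum>k<K. a k * (\<Sum>n\<in>T. b n * wave n x) ^ k)"
proof -
  let ?A = "\<Union>k<K. {q. (mulop T b ^^ k) delta q \<noteq> 0}"
  have A: "finite ?A" using finite_support_mulop_power[OF assms] by blast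
  have "trig (\<lambda>q. \<Sum>k<K. a k * (mulop T b ^^ k) delta q) x = (\<Sum>q\<in>?A. (\<Sum>k<K. a k * (mulop T b ^^ k) delta q) * wave q x)"
    by (rule trig_eq[OF A]) (auto intro!: sum.neutral)
  also have "\<dots> = (\<Sum>k<K. a k * (\<Sum>q\<in>?A. (mulop T b ^^ k) delta q * wave q x))"
    unfolding sum_distrib_right sum_distrib_left by (subst sum.swap) (simp add: mult.assoc)
  also have "\<dots> = (\<Sum>k<K. a k * trig ((mulop T b ^^ k) delta) x)"
  proof (rule sum.cong[OF refl])
    fix k assume "k \<in> {..<K}"
    then have "trig ((mulop T b ^^ k) delta) x = (\<Sum>q\<in>?A. (mulop T b ^^ k) delta q * wave q x)"
      by (intro trig_eq[OF A]) auto
    then show "a k * (\<Sum>q\<in>?A. (mulop T b ^^ k) delta q * wave q x) = a k * trig ((mulop T b ^^ k) delta) x" by simp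
  qed
  finally show ?thesis by (simp add: trig_mulop_power[OF assms])
qed

lemma zero_mode_eq_0:
  assumes "finite A" "0 \<notin> A" "\<And>x. complex_of_real (f x) = (\<Sum>n\<in>A. d n * wave n x)"
  shows "zero_mode f = 0"
  unfolding zero_mode_def
proof (rule the_equality)
  show "\<exists>T d. finite T \<and> 0 \<notin> T \<and> (\<forall>x. complex_of_real (f x) = complex_of_real 0 + (\<Sum>n\<in>T. d n * wave n x))"
    using assms by auto
  fix a assume "\<exists>T d. finite T \<and> 0 \<notin> T \<and> (\<forall>x. complex_of_real (f x) = complex_of_real a + (\<Sum>n\<in>T. d n * wave n x))"
  then obtain T d' where T: "finite T" "0 \<notin> T" "\<And>x. complex_of_real (f x) = complex_of_real a + (\<Sum>n\<in>T. d' n * wave n x)" by blast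
  define g where "g q = (if q \<in> A then d q else 0)" for q
  define h where "h q = (if q = 0 then complex_of_real a else if q \<in> T then d' q else 0)" for q
  have "trig g x = (\<Sum>n\<in>A. d n * wave n x)" for x
    by (subst trig_eq[OF assms(1)]) (auto simp: g_def)
  moreover have "trig h x = complex_of_real a + (\<Sum>n\<in>T. d' n * wave n x)" for x
  proof -
    have "trig h x = (\<Sum>n\<in>insert 0 T. h n * wave n x)" by (rule trig_eq) (use T in \<open>auto simp: h_def\<close>)
    also have "\<dots> = h 0 * wave 0 x + (\<Sum>n\<in>T. h n * wave n x)" using T by simp
    also have "(\<Sum>n\<in>T. h n * wave n x) = (\<Sum>n\<in>T. d' n * wave n x)"
      by (rule sum.cong) (use T in \<open>auto simp: h_def\<close>)
    also have "h 0 * wave 0 x = complex_of_real a" by (simp add: h_def)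
    finally show ?thesis .
  qed
  ultimately have "trig g x = trig h x" for x using assms(3) T(3) by metis
  moreover have "finite {q. g q \<noteq> 0}" by (rule finite_subset[OF _ assms(1)]) (auto simp: g_def)
  moreover have "finite {q. h q \<noteq> 0}" by (rule finite_subset[of _ "insert 0 T"]) (use T in \<open>auto simp: h_def split: if_splits\<close>)
  ultimately have "g 0 = h 0" using trig_inject by blast
  then show "a = 0" using assms(2) by (simp add: g_def h_def)
qed

lemma bracket_scale: "bracket e T (\<lambda>n. k * b n) g q = k * bracket e T b g q"
  unfolding bracket_def sum_distrib_left by (rule sum.cong) (simp_all only: mult_ac)

lemma circle_stream_scale:
  assumes "circle_stream e T b r" "k \<noteq> 0"
  shows "circle_stream e T (\<lambda>n. k * b n) r"
proof -
  interpret circle_stream e T b r by fact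
  show ?thesis by unfold_locales (use fin e1 r0 sym plane circle b0 spans assms(2) in auto)
qed

text \<open>Two nonparallel frequencies and their negatives are four distinct points.\<close>

lemma circle_stream_card:
  assumes "circle_stream e T b r"
  shows "card T \<ge> 4"
proof -
  interpret circle_stream e T b r by fact
  obtain n m where nm: "n \<in> T" "m \<in> T" "cr e n m \<noteq> 0" using spans by blast
  have cn: "cr e x (- y) = - cr e x y" for x y using cr_linear(6)[of e x "-1" y] by simp
  have self: "x \<noteq> - x" if "x \<in> T" for x
  proof
    assume "x = - x"
    then have "x \<bullet> x = (- x) \<bullet> x" by (rule arg_cong)
    then show False using nz[OF that] by simp
  qed
  have "n \<noteq> m" using nm by (auto simp: cr_linear)
  moreover have "n \<noteq> - m" using nm cn[of n n] by (auto simp: cr_linear)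
  ultimately have d: "n \<noteq> m" "n \<noteq> - m" "n \<noteq> - n" "m \<noteq> - m" using self nm by auto
  then have "card {n, - n, m, - m} = 4" by (auto simp: card_insert_if minus_equation_iff[of n] equation_minus_iff)
  moreover have "{n, - n, m, - m} \<subseteq> T" using nm minus_mem by blast
  ultimately show ?thesis using card_mono[OF fin] by metis
qed

section \<open>Classification of stationary flows\<close>

lemma planar_classification:
  fixes v :: "real^3 \<Rightarrow> real^3"
  assumes fe: "fourier_expansion v S U" and U0: "\<And>n. n \<notin> S \<Longrightarrow> U n = 0"
    and st: "\<And>q. q \<noteq> 0 \<Longrightarrow> leray q (euler_sum S U q) = 0"
    and e1: "norm e = 1" and plane: "\<And>n. n \<in> S \<Longrightarrow> e \<bullet> n = 0"
    and line: "\<nexists>w. S \<subseteq> range (\<lambda>t. t *\<^sub>R w)"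
  shows "perp_flow {x. e \<bullet> x = 0} v \<or> planar_circle_flow {x. e \<bullet> x = 0} v"
proof -
  have S: "finite S" "0 \<notin> S" "uminus ` S = S" and Unz: "\<And>n. n \<in> S \<Longrightarrow> U n \<noteq> 0"
    and cj: "\<And>n. n \<in> S \<Longrightarrow> U (- n) = cconj (U n)" and dv: "\<And>n. n \<in> S \<Longrightarrow> cdot (cvec n) (U n) = 0"
    and v: "\<And>x. cvec (v x) = (\<Sum>n\<in>S. wave n x *s U n)"
    using fe unfolding fourier_expansion_def by auto
  interpret planar_support S U e by unfold_locales (fact S e1 plane U0 dv)+
  define T where "T = {n\<in>S. b n \<noteq> 0}"
  have TS: "T \<subseteq> S" "finite T" "0 \<notin> T" using S by (auto simp: T_def)
  have bT: "b n \<noteq> 0 \<longleftrightarrow> n \<in> T" for n using parts_outside by (auto simp: T_def)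
  have ee: "e \<bullet> e = 1" using e1 by (simp add: dot_square_norm)
  have conj_b: "b (- n) = - cnj (b n)" if "n \<in> S" for n
    using cj[OF that] cdot_cconj[of "cvec (e \<times> n)" "U n"] by (simp add: par_part_def cvec_linear cdot_linear)
  have negT: "- n \<in> T" if "n \<in> T" for n
  proof -
    have "n \<in> S" "- n \<in> S" using that TS sym by auto
    then show ?thesis using conj_b[of n] that by (simp add: T_def)
  qed
  have symT: "uminus ` T = T"
  proof
    show "uminus ` T \<subseteq> T" using negT by blast
    show "T \<subseteq> uminus ` T"
    proof
      fix n assume "n \<in> T"
      then have "- (- n) \<in> uminus ` T" using negT by blast
      then show "n \<in> uminus ` T" by simp
    qed
  qed
  have brT: "bracket e S b g = bracket e T b g" for g
    by (rule bracket_support[OF S(1) TS(1)]) (use bT in blast)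
  have off: "bracket e S b g q = 0" if "q = 0 \<or> e \<bullet> q \<noteq> 0" "\<And>n. n \<notin> S \<Longrightarrow> g n = 0" for g q
    unfolding bracket_def
  proof (rule sum.neutral, rule ballI)
    fix n assume n: "n \<in> S"
    show "of_real (cr e n q) * b n * g (q - n) = 0"
    proof (cases "q = 0")
      case False
      then have "e \<bullet> (q - n) \<noteq> 0" using that(1) plane[OF n] by (simp add: inner_simps)
      then have "g (q - n) = 0" using plane that(2) by blast
      then show ?thesis by simp
    qed (simp add: cr_linear)
  qed
  have Lw: "bracket e T b w q = 0" for q
  proof (cases "q = 0 \<or> e \<bullet> q \<noteq> 0")
    case True
    then show ?thesis using off[of q w] parts_outside brT by simp
  next
    case False
    then have "cdot (cvec e) (leray q (euler_sum S U q)) = 2 * bracket e S b w q" by (intro leray_perp) auto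
    then show ?thesis using st False brT by (simp add: cdot_linear)
  qed
  have Lb: "bracket e T b (\<lambda>p. b p * of_real (p \<bullet> p)) q = 0" for q
  proof (cases "q = 0 \<or> e \<bullet> q \<noteq> 0")
    case True
    then show ?thesis using off[of q "\<lambda>p. b p * of_real (p \<bullet> p)"] parts_outside brT by simp
  next
    case False
    then have "cdot (cvec (e \<times> q)) (leray q (euler_sum S U q)) = 2 * bracket e S b (\<lambda>p. b p * of_real (p \<bullet> p)) q" by (intro leray_par) auto
    then show ?thesis using st False brT by (simp add: cdot_linear)
  qed
  have finw: "finite {q. w q \<noteq> 0}" by (rule finite_subset[OF _ S(1)]) (use parts_outside in blast)
  have planew: "e \<bullet> q = 0" if "w q \<noteq> 0" for q using parts_outside plane that by blast
  \<comment> \<open>For a steady field the first iterate is already zero. The claim is needed for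
    \<open>b\<close> and for its multiple \<open>b'\<close>, hence the parameter
    \<open>d\<close>.\<close>
  have orbit: "orbit_bounded e T d w" if d: "\<And>q. bracket e T d w q = 0" for d
  proof -
    have Lz: "bracket e T d w = (\<lambda>q. 0)" using d by blast
    have "(bracket e T d ^^ Suc j) w = (\<lambda>q. 0)" for j by (induction j) (simp_all add: Lz bracket_zero)
    then have z: "(bracket e T d ^^ j) w q \<noteq> 0 \<Longrightarrow> w q \<noteq> 0" for j q by (cases j) (simp_all del: funpow.simps(2))
    have "bounded {q. w q \<noteq> 0}" using finw by (rule finite_imp_bounded)
    then obtain B where "\<And>q. w q \<noteq> 0 \<Longrightarrow> norm q \<le> B" by (auto simp: bounded_iff)
    then show ?thesis unfolding orbit_bounded_def using z by blast
  qed
  have planeT: "e \<bullet> n = 0" if "n \<in> T" for n using TS plane that by blast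
  consider "T = {}" | n0 where "n0 \<in> T" "T \<subseteq> range (\<lambda>t. t *\<^sub>R n0)" | r where "circle_stream e T b r"
    using planar_shape[OF TS(2) symT TS(3) e1 planeT bT Lb] by blast
  then show ?thesis
  proof cases
    case 1
    then have bz: "b n = 0" for n using bT by blast
    have "perp_flow {x. e \<bullet> x = 0} v" unfolding perp_flow_def
    proof (intro allI ballI)
      fix x p assume p: "p \<in> {x. e \<bullet> x = 0}"
      have "cdot (cvec p) (U n) = 0" if "n \<in> S" for n
        using p by (subst decomposition[OF that]) (simp add: bz cdot_linear cdot_cvec inner_commute)
      then have "cdot (cvec p) (cvec (v x)) = 0" unfolding v by (simp add: cdot_sum cdot_linear)
      then show "orthogonal (v x) p" by (simp add: cdot_cvec orthogonal_def inner_commute)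
    qed
    then show ?thesis ..
  next
    case 2
    have n0: "n0 \<noteq> 0" "e \<bullet> n0 = 0" using 2 TS planeT by auto
    \<comment> \<open>If the planar part is a shear, \<open>w\<close> has its frequencies on the
      same line, so \<open>S\<close> would be contained in a line after all.\<close>
    have "S \<subseteq> range (\<lambda>t. t *\<^sub>R n0)"
    proof
      fix n assume n: "n \<in> S"
      show "n \<in> range (\<lambda>t. t *\<^sub>R n0)"
      proof (cases "n \<in> T")
        case False
        then have "b n = 0" using bT by blast
        then have "w n \<noteq> 0" using decomposition[OF n] Unz[OF n] by auto
        have "cr e n0 n = 0"
          by (rule shear_orbit_parallel[where S = T and b = b and g = w, OF TS(2) e1 2(1) n0(1) symT _ _ n0(2) finw planew orbit[OF Lw] \<open>w n \<noteq> 0\<close>])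
            (use 2 bT in auto)
        then show ?thesis using cr_eq_0_imp_parallel[OF e1 n0(2) plane[OF n] n0(1)] by blast
      qed (use 2 in blast)
    qed
    then show ?thesis using line by blast
  next
    case 3
    then have r: "r > 0" "\<And>n. n \<in> T \<Longrightarrow> norm n = r" by (auto simp: circle_stream_def)
    \<comment> \<open>The coefficients of \<omega>: the curl of the mode
      \<open>b n *s cvec (e \<times> n)\<close> is \<open>\<i> * b n * r\<^sup>2\<close> along
      \<open>e\<close>, and one factor \<open>r\<close> is split off by the normalisation of
      \<omega>.\<close>
    define b' where "b' n = \<i> * of_real r * b n" for n
    interpret C: circle_stream e T b' r
      unfolding b'_def using circle_stream_scale[OF 3, of "\<i> * of_real r"] r by simp
    have Lw': "bracket e T b' w q = 0" for q unfolding b'_def bracket_scale using Lw by simp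
    have "C.adm w" unfolding C.adm_def using finw planew orbit[OF Lw'] by blast
    then have "stream_poly T b' w" by (rule C.orbit_bounded_imp_stream_poly)
    then obtain a K where wp: "\<And>q. w q = (\<Sum>k<K. a k * (mulop T b' ^^ k) delta q)" unfolding stream_poly_def by blast
    define vpar where "vpar x = v x - (v x \<bullet> e) *\<^sub>R e" for x
    define cp where "cp n = b n *s cvec (e \<times> n)" for n
    have ve: "complex_of_real (v x \<bullet> e) = (\<Sum>n\<in>S. w n * wave n x)" for x
    proof -
      have "complex_of_real (v x \<bullet> e) = cdot (cvec e) (cvec (v x))" by (simp add: cdot_cvec inner_commute)
      also have "\<dots> = (\<Sum>n\<in>S. w n * wave n x)" unfolding v by (simp add: cdot_sum cdot_linear perp_part_def mult.commute)
      finally show ?thesis .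
    qed
    have vp: "cvec (vpar x) = (\<Sum>n\<in>T. wave n x *s cp n)" for x
    proof -
      have "cvec (vpar x) = (\<Sum>n\<in>S. wave n x *s U n) - (\<Sum>n\<in>S. w n * wave n x) *s cvec e"
        by (simp add: vpar_def cvec_linear v ve)
      also have "\<dots> = (\<Sum>n\<in>S. wave n x *s U n - (w n * wave n x) *s cvec e)"
        by (simp add: sum_subtractf vec.scale_sum_left)
      also have "\<dots> = (\<Sum>n\<in>S. wave n x *s cp n)"
      proof (rule sum.cong[OF refl])
        fix n assume "n \<in> S"
        then show "wave n x *s U n - (w n * wave n x) *s cvec e = wave n x *s cp n"
          by (subst decomposition) (simp_all add: cp_def vec_eq_iff algebra_simps)
      qed
      also have "\<dots> = (\<Sum>n\<in>T. wave n x *s cp n)"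
      proof (rule sum.mono_neutral_right[OF S(1) TS(1)])
        show "\<forall>i\<in>S - T. wave i x *s cp i = 0" using bT by (auto simp: cp_def)
      qed
      finally show ?thesis .
    qed
    have en: "(e \<times> n) \<bullet> (e \<times> n) = n \<bullet> n" if "n \<in> T" for n by (rule cross_e[OF e1 planeT[OF that]])
    have fpar: "fourier_expansion vpar T cp" unfolding fourier_expansion_def
    proof (intro conjI ballI allI)
      show "finite T" "0 \<notin> T" "uminus ` T = T" using TS symT by auto
      fix n assume n: "n \<in> T"
      have "e \<times> n \<noteq> 0" using en[OF n] n TS by auto
      then have "cvec (e \<times> n) \<noteq> 0" by (metis cvec_eq_iff cvec_linear(5))
      then show "cp n \<noteq> 0" using bT n by (simp add: cp_def)
      show "cp (- n) = cconj (cp n)" using conj_b n TS by (auto simp: cp_def cconj_linear cvec_linear)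
      show "cdot (cvec n) (cp n) = 0" by (simp add: cp_def cdot_linear cdot_cvec dot_cross_self)
    qed (rule vp)
    define om where "om x = (curl vpar x \<bullet> e) / r" for x
    have cu: "cvec (curl vpar x) = (of_real r * (\<Sum>n\<in>T. b' n * wave n x)) *s cvec e" for x
    proof -
      have "cvec (curl vpar x) = (\<Sum>n\<in>T. wave n x *s (\<i> *s ccross (cvec n) (cp n)))" by (rule curl_fourier[OF vp])
      also have "\<dots> = (\<Sum>n\<in>T. (of_real r * (b' n * wave n x)) *s cvec e)"
      proof (rule sum.cong[OF refl])
        fix n assume n: "n \<in> T"
        have "ccross (cvec n) (cp n) = (b n * of_real (r\<^sup>2)) *s cvec e"
          using cross_e(1)[OF e1 planeT[OF n]] r(2)[OF n]
          by (simp add: cp_def ccross_linear ccross_cvec cvec_linear vec.scale_scale dot_square_norm)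
        then show "wave n x *s (\<i> *s ccross (cvec n) (cp n)) = (of_real r * (b' n * wave n x)) *s cvec e"
          by (simp add: b'_def vec.scale_scale power2_eq_square mult_ac)
      qed
      also have "\<dots> = (of_real r * (\<Sum>n\<in>T. b' n * wave n x)) *s cvec e"
        by (simp add: vec.scale_sum_left[symmetric] sum_distrib_left)
      finally show ?thesis .
    qed
    have om: "complex_of_real (om x) = (\<Sum>n\<in>T. b' n * wave n x)" for x
    proof -
      have "complex_of_real (curl vpar x \<bullet> e) = cdot (cvec e) (cvec (curl vpar x))" by (simp add: cdot_cvec inner_commute)
      also have "\<dots> = of_real r * (\<Sum>n\<in>T. b' n * wave n x)" unfolding cu by (simp add: cdot_linear cdot_cvec ee)
      finally show ?thesis using r(1) by (simp add: om_def)
    qed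
    have curl: "curl vpar x = (r * om x) *\<^sub>R e" for x
    proof -
      have "cvec (curl vpar x) = cvec ((r * om x) *\<^sub>R e)" unfolding cu by (simp add: cvec_linear om)
      then show ?thesis by simp
    qed
    \<comment> \<open>Both \<open>v x \<bullet> e\<close> and \<open>om x\<close> are real, so
      taking real parts of the coefficients preserves the identity.\<close>
    define Q where "Q = (\<Sum>k<K. monom (Re (a k)) k)"
    have vQ: "v x \<bullet> e = poly Q (om x)" for x
    proof -
      have "complex_of_real (v x \<bullet> e) = trig w x"
        unfolding ve by (rule trig_eq[symmetric, OF S(1)]) (rule parts_outside)
      also have "\<dots> = trig (\<lambda>q. \<Sum>k<K. a k * (mulop T b' ^^ k) delta q) x" using wp by presburger
      also have "\<dots> = (\<Sum>k<K. a k * of_real (om x) ^ k)" unfolding trig_poly[OF TS(2)] om ..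
      finally have "Re (complex_of_real (v x \<bullet> e)) = Re (\<Sum>k<K. a k * of_real (om x) ^ k)" by (rule arg_cong)
      then have "v x \<bullet> e = Re (\<Sum>k<K. a k * of_real (om x ^ k))" by simp
      also have "\<dots> = (\<Sum>k<K. Re (a k) * om x ^ k)" by (simp del: of_real_power)
      also have "\<dots> = poly Q (om x)" by (simp add: Q_def poly_sum poly_monom)
      finally show ?thesis .
    qed
    \<comment> \<open>The mean is zero because 0 is not a frequency of \<open>v\<close>, so
      subtracting it changes nothing.\<close>
    have zm: "zero_mode (\<lambda>y. poly Q (om y)) = 0"
      by (rule zero_mode_eq_0[OF S(1,2), of _ w]) (simp only: vQ[symmetric] ve)
    have "planar_circle_flow {x. e \<bullet> x = 0} v" unfolding planar_circle_flow_def
    proof (intro exI conjI)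
      show "norm e = 1" by (rule e1)
      show "\<forall>p\<in>{x. e \<bullet> x = 0}. orthogonal e p" by (simp add: orthogonal_def)
      show "\<forall>x. v x = vpar x + (v x \<bullet> e) *\<^sub>R e" by (simp add: vpar_def)
      show "\<forall>x. vpar x \<in> {x. e \<bullet> x = 0}" using ee by (simp add: vpar_def inner_simps inner_commute)
      show "r > 0" by (rule r)
      show "fourier_support vpar T" using fpar unfolding fourier_support_def by blast
      show "T \<subseteq> {x. e \<bullet> x = 0} \<inter> sphere 0 r" using planeT r by auto
      show "4 \<le> card T" by (rule circle_stream_card[OF 3])
      show "\<forall>x. curl vpar x = (r * om x) *\<^sub>R e" using curl by blast
      show "\<forall>x. v x \<bullet> e = poly Q (om x) - zero_mode (\<lambda>y. poly Q (om y))" using vQ zm by simp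
    qed
    then show ?thesis ..
  qed
qed

lemma stationary_classification:
  assumes fe: "fourier_expansion v S U" and U0: "\<And>n. n \<notin> S \<Longrightarrow> U n = 0"
    and st: "\<And>q. q \<noteq> 0 \<Longrightarrow> leray q (euler_sum S U q) = 0"
  shows "case_line S \<or> case_plane S v \<or> case_sphere S v"
proof -
  have S: "finite S" "0 \<notin> S" "uminus ` S = S" and Unz: "\<And>n. n \<in> S \<Longrightarrow> U n \<noteq> 0"
    and dv: "\<And>n. n \<in> S \<Longrightarrow> cdot (cvec n) (U n) = 0"
    and v: "\<And>x. cvec (v x) = (\<Sum>n\<in>S. wave n x *s U n)"
    using fe unfolding fourier_expansion_def by auto
  consider w where "S \<subseteq> range (\<lambda>t. t *\<^sub>R w)" | "\<nexists>w. S \<subseteq> range (\<lambda>t. t *\<^sub>R w)" "span S \<noteq> UNIV" | "span S = UNIV" by blast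
  then show ?thesis
  proof cases
    case 1
    \<comment> \<open>\<open>w = 0\<close> is possible only for empty \<open>S\<close>; any line
      will do in that case.\<close>
    define w' :: "real^3" where "w' = (if w = 0 then axis 1 1 else w)"
    have w': "w' \<noteq> 0" by (simp add: w'_def axis_eq_0_iff)
    have "S \<subseteq> span {w'}"
    proof
      fix n assume n: "n \<in> S"
      then obtain t where t: "n = t *\<^sub>R w" using 1 by blast
      have "w \<noteq> 0" using t n S by auto
      then show "n \<in> span {w'}" by (simp add: t w'_def span_base span_mul)
    qed
    moreover have "dim (span {w'}) = 1" using w' by (simp add: dim_span)
    ultimately have "case_line S" unfolding case_line_def using subspace_span by blast
    then show ?thesis by blast
  next
    case 2
    then obtain a where a: "a \<noteq> 0" "\<And>x. x \<in> span S \<Longrightarrow> a \<bullet> x = 0" using span_not_UNIV_orthogonal[of S] by blast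
    define e where "e = (1 / norm a) *\<^sub>R a"
    have e: "norm e = 1" "\<And>n. n \<in> S \<Longrightarrow> e \<bullet> n = 0" using a span_base by (auto simp: e_def)
    have "e \<noteq> 0" using e by auto
    have "S \<noteq> {}" using 2 by auto
    then obtain n where n: "n \<in> S" by blast
    obtain m where m: "m \<in> S" "m \<notin> range (\<lambda>t. t *\<^sub>R n)" using 2 by blast
    have "n \<noteq> 0" using n S by auto
    moreover have "m \<notin> span {n}" using m by (auto simp: span_singleton)
    ultimately have "independent {m, n}" by (simp add: independent_insert)
    moreover have "m \<noteq> n" using m by (metis rangeI scaleR_one)
    ultimately have "has_independent_points 2 S" unfolding has_independent_points_def
      using n m by (intro exI[of _ "{m, n}"]) auto
    moreover have "subspace {x. e \<bullet> x = 0}" by (rule subspace_hyperplane)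
    moreover have "dim {x. e \<bullet> x = 0} = 2" using dim_hyperplane[OF \<open>e \<noteq> 0\<close>] by simp
    moreover have "perp_flow {x. e \<bullet> x = 0} v \<or> planar_circle_flow {x. e \<bullet> x = 0} v"
      by (rule planar_classification[OF fe U0 st e 2(1)])
    ultimately have "case_plane S v" unfolding case_plane_def using e(2) by (intro conjI exI[of _ "{x. e \<bullet> x = 0}"]) auto
    then show ?thesis by blast
  next
    case 3
    have "euler_support S U"
    proof unfold_locales
      show "leray q (euler_sum S U q) = 0" if "q \<notin> S" "q \<noteq> 0" for q using st[OF that(2)] .
    qed (fact S 3 U0 Unz dv)+
    then interpret euler_support S U .
    obtain r \<sigma> where r: "r > 0" and rs: "\<forall>n\<in>S. norm n = r \<and> ccross (cvec n) (U n) = (\<i> * of_real (\<sigma> * r)) *s U n"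
      using beltrami_sphere by (elim exE conjE bexE)
    obtain B where B: "B \<subseteq> S" "independent B" "card B = dim S" by (rule basis_exists)
    have "dim S = 3" using 3 dim_span[of S] by simp
    then have "has_independent_points 3 S" unfolding has_independent_points_def using B by auto
    moreover have "S \<subseteq> sphere 0 r" using rs by auto
    moreover have "beltrami v" unfolding beltrami_def
    proof (intro conjI exI allI)
      show "v \<in> \<H>" using fe by (auto simp: \<H>_def fourier_support_def)
      fix x
      have "cvec (curl v x) = (\<Sum>n\<in>S. wave n x *s (\<i> *s ccross (cvec n) (U n)))" by (rule curl_fourier[OF v])
      \<comment> \<open>The sign comes from the \<open>\<i>\<close> of the Fourier curl meeting the
        \<open>\<i>\<close> of the helical eigenvalue.\<close>
      also have "\<dots> = (\<Sum>n\<in>S. (- of_real (\<sigma> * r)) *s (wave n x *s U n))"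
      proof (rule sum.cong[OF refl])
        fix n assume "n \<in> S"
        then have e: "ccross (cvec n) (U n) = (\<i> * of_real (\<sigma> * r)) *s U n" using rs by blast
        have c: "wave n x * (\<i> * (\<i> * z)) = - z * wave n x" for z by simp
        show "wave n x *s (\<i> *s ccross (cvec n) (U n)) = (- of_real (\<sigma> * r)) *s (wave n x *s U n)"
          by (simp only: e vec.scale_scale c)
      qed
      also have "\<dots> = (- of_real (\<sigma> * r)) *s cvec (v x)" unfolding v by (simp only: vec.scale_sum_right)
      finally show "cvec (curl v x) = (- of_real (\<sigma> * r)) *s cvec (v x)" .
    qed
    ultimately have "case_sphere S v" unfolding case_sphere_def using r by blast
    then show ?thesis by blast
  qed
qed

section \<open>Converse: every listed field is stationary\<close>

lemma case_line_stationary: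
  assumes fe: "fourier_expansion v S U" and U0: "\<And>n. n \<notin> S \<Longrightarrow> U n = 0"
    and line: "case_line S" and q: "q \<noteq> 0"
  shows "leray q (euler_sum S U q) = 0"
proof -
  have S: "finite S" "0 \<notin> S" and dv: "\<And>n. n \<in> S \<Longrightarrow> cdot (cvec n) (U n) = 0"
    using fe unfolding fourier_expansion_def by auto
  obtain L where L: "subspace L" "dim L = 1" "S \<subseteq> L" using line unfolding case_line_def by blast
  obtain B where B: "B \<subseteq> L" "independent B" "L \<subseteq> span B" "card B = dim L" by (rule basis_exists)
  obtain x where x: "B = {x}" using B(4) L(2) card_1_singletonE by metis
  have par: "\<exists>t. n = t *\<^sub>R x" if "n \<in> S" for n using that L(3) B(3) x by (auto simp: span_singleton)
  show ?thesis
  proof (rule perpendicular_stationary[OF S(1) U0 dv _ q])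
    fix n m assume nm: "n \<in> S" "m \<in> S"
    obtain s t where st: "n = s *\<^sub>R x" "m = t *\<^sub>R x" using par nm by blast
    have "s \<noteq> 0" using st nm S by auto
    then have "m = (t / s) *\<^sub>R n" using st by simp
    then show "cdot (U n) (cvec m) = 0" using dv[OF nm(1)] by (simp add: cvec_linear cdot_linear cdot_commute)
  qed
qed

lemma perp_flow_stationary:
  assumes fe: "fourier_expansion v S U" and U0: "\<And>n. n \<notin> S \<Longrightarrow> U n = 0"
    and P: "S \<subseteq> P" "perp_flow P v" and q: "q \<noteq> 0"
  shows "leray q (euler_sum S U q) = 0"
proof -
  have S: "finite S" "0 \<notin> S" and dv: "\<And>n. n \<in> S \<Longrightarrow> cdot (cvec n) (U n) = 0"
    and v: "\<And>x. cvec (v x) = (\<Sum>n\<in>S. wave n x *s U n)"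
    using fe unfolding fourier_expansion_def by auto
  show ?thesis
  proof (rule perpendicular_stationary[OF S(1) U0 dv _ q])
    fix n m assume nm: "n \<in> S" "m \<in> S"
    show "cdot (U n) (cvec m) = 0"
    proof (rule wave_independent[OF S(1) _ nm(1)])
      fix x
      have "v x \<bullet> m = 0" using P nm by (auto simp: perp_flow_def orthogonal_def)
      then have "cdot (cvec (v x)) (cvec m) = 0" by (simp add: cdot_cvec)
      then show "(\<Sum>n\<in>S. cdot (U n) (cvec m) * wave n x) = 0"
        unfolding v by (simp add: cdot_sum cdot_linear mult.commute)
    qed
  qed
qed

lemma beltrami_flow_stationary:
  assumes fe: "fourier_expansion v S U" and U0: "\<And>n. n \<notin> S \<Longrightarrow> U n = 0"
    and bel: "beltrami v" and q: "q \<noteq> 0"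
  shows "leray q (euler_sum S U q) = 0"
proof -
  have S: "finite S" "0 \<notin> S" and dv: "\<And>n. n \<in> S \<Longrightarrow> cdot (cvec n) (U n) = 0"
    and v: "\<And>x. cvec (v x) = (\<Sum>n\<in>S. wave n x *s U n)"
    using fe unfolding fourier_expansion_def by auto
  obtain \<mu> where \<mu>: "\<And>x. cvec (curl v x) = \<mu> *s cvec (v x)" using bel unfolding beltrami_def by blast
  show ?thesis
  proof (rule beltrami_stationary[OF S(1) U0 dv _ q])
    fix n assume n: "n \<in> S"
    have "\<i> *s ccross (cvec n) (U n) - \<mu> *s U n = 0"
    proof (rule wave_independent_vec[OF S(1) _ n])
      fix x
      have "(\<Sum>n\<in>S. wave n x *s (\<i> *s ccross (cvec n) (U n) - \<mu> *s U n)) = cvec (curl v x) - \<mu> *s cvec (v x)"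
        unfolding curl_fourier[OF v] unfolding v
        by (simp add: vec.scale_right_diff_distrib sum_subtractf vec.scale_sum_right vec.scale_scale mult.commute)
      then show "(\<Sum>n\<in>S. wave n x *s (\<i> *s ccross (cvec n) (U n) - \<mu> *s U n)) = 0" using \<mu> by simp
    qed
    then have "\<i> *s ccross (cvec n) (U n) = \<mu> *s U n" by simp
    then have "(- \<i>) *s (\<i> *s ccross (cvec n) (U n)) = (- \<i>) *s (\<mu> *s U n)" by simp
    then show "ccross (cvec n) (U n) = (- \<i> * \<mu>) *s U n" by (simp add: vec.scale_scale)
  qed
qed

text \<open>The hypothesis speaks of functions of x; independence of characters turns it into
  statements on coefficients. The planar parts of \<open>U\<close> are those of \<open>vpar\<close>,
  and \<open>w\<close> is a polynomial in the coefficients of \<omega>, which are a multiple of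
  \<open>b\<close>, so it commutes with \<open>b\<close>.\<close>

lemma planar_circle_flow_stationary:
  assumes fe: "fourier_expansion v S U" and U0: "\<And>n. n \<notin> S \<Longrightarrow> U n = 0"
    and P: "S \<subseteq> P" "planar_circle_flow P v" and q: "q \<noteq> 0"
  shows "leray q (euler_sum S U q) = 0"
proof -
  have S: "finite S" "0 \<notin> S" "uminus ` S = S" and dv: "\<And>n. n \<in> S \<Longrightarrow> cdot (cvec n) (U n) = 0"
    and v: "\<And>x. cvec (v x) = (\<Sum>n\<in>S. wave n x *s U n)"
    using fe unfolding fourier_expansion_def by auto
  obtain e vpar vperp r T om Q where e1: "norm e = 1" and eP: "\<And>p. p \<in> P \<Longrightarrow> e \<bullet> p = 0"
    and vx: "\<And>x. v x = vpar x + vperp x *\<^sub>R e" and vparP: "\<And>x. vpar x \<in> P"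
    and r: "r > 0" and fs: "fourier_support vpar T" and TP: "T \<subseteq> P \<inter> sphere 0 r"
    and curl: "\<And>x. curl vpar x = (r * om x) *\<^sub>R e"
    and vp: "\<And>x. vperp x = poly Q (om x) - zero_mode (\<lambda>y. poly Q (om y))"
    using P(2) unfolding planar_circle_flow_def orthogonal_def by blast
  obtain cp where T: "finite T" "0 \<notin> T" and cpnz: "\<And>n. n \<in> T \<Longrightarrow> cp n \<noteq> 0"
    and dvp: "\<And>n. n \<in> T \<Longrightarrow> cdot (cvec n) (cp n) = 0"
    and vparx: "\<And>x. cvec (vpar x) = (\<Sum>n\<in>T. wave n x *s cp n)"
    using fs unfolding fourier_support_def fourier_expansion_def by blast
  have ee: "e \<bullet> e = 1" using e1 by (simp add: dot_square_norm)
  have planeS: "e \<bullet> n = 0" if "n \<in> S" for n using P eP that by blast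
  have planeT: "e \<bullet> n = 0" "norm n = r" if "n \<in> T" for n using TP eP that by auto
  interpret planar_support S U e by unfold_locales (fact S e1 planeS U0 dv)+
  have cpe: "cdot (cvec e) (cp n) = 0" if "n \<in> T" for n
  proof (rule wave_independent[OF T(1) _ that])
    fix x
    have "cdot (cvec e) (cvec (vpar x)) = 0" using eP[OF vparP] by (simp add: cdot_cvec)
    then show "(\<Sum>n\<in>T. cdot (cvec e) (cp n) * wave n x) = 0" unfolding vparx by (simp add: cdot_sum cdot_linear mult.commute)
  qed
  define cp' where "cp' n = (if n \<in> T then cp n else 0)" for n
  \<comment> \<open>Pairing with \<open>e \<times> m\<close> removes the component along
    \<open>e\<close>, so \<open>v\<close> and \<open>vpar\<close> become indistinguishable.
    Extension of \<open>cp\<close> by zero permits a comparison at all frequencies, and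
    \<open>T \<subseteq> S\<close> will follow from it.\<close>
  have dot_m: "cdot (cvec (e \<times> m)) (U n) = cdot (cvec (e \<times> m)) (cp' n)" for m n
  proof (rule trig_inject[where g = "\<lambda>n. cdot (cvec (e \<times> m)) (U n)" and h = "\<lambda>n. cdot (cvec (e \<times> m)) (cp' n)"])
    show "finite {q. cdot (cvec (e \<times> m)) (U q) \<noteq> 0}" by (rule finite_subset[OF _ S(1)]) (use U0 in \<open>force simp: cdot_linear\<close>)
    show "finite {q. cdot (cvec (e \<times> m)) (cp' q) \<noteq> 0}"
      by (rule finite_subset[OF _ T(1)]) (auto simp: cp'_def cdot_linear)
    fix x
    have "trig (\<lambda>n. cdot (cvec (e \<times> m)) (U n)) x = cdot (cvec (e \<times> m)) (cvec (v x))"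
      unfolding v by (subst trig_eq[OF S(1)]) (simp_all add: U0 cdot_sum cdot_linear mult.commute)
    also have "\<dots> = cdot (cvec (e \<times> m)) (cvec (vpar x))"
      by (simp add: vx cvec_linear cdot_linear cdot_cvec dot_cross_self)
    also have "\<dots> = (\<Sum>n\<in>T. cdot (cvec (e \<times> m)) (cp' n) * wave n x)"
      unfolding vparx cdot_sum by (rule sum.cong) (simp_all add: cp'_def cdot_linear mult.commute)
    also have "\<dots> = trig (\<lambda>n. cdot (cvec (e \<times> m)) (cp' n)) x"
      by (rule trig_eq[symmetric, OF T(1)]) (simp add: cp'_def cdot_linear)
    finally show "trig (\<lambda>n. cdot (cvec (e \<times> m)) (U n)) x = trig (\<lambda>n. cdot (cvec (e \<times> m)) (cp' n)) x" .
  qed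
  have bout: "b n = 0" if "n \<notin> T" for n using that by (simp add: par_part_def dot_m cp'_def cdot_linear)
  have bcp: "cdot (cvec (e \<times> n)) (cp n) = b n * of_real (n \<bullet> n)" if "n \<in> T" for n
  proof -
    have "n \<noteq> 0" using that T by auto
    then show ?thesis using that dot_m[of n n] by (simp add: par_part_def cp'_def)
  qed
  have bnz: "b n \<noteq> 0" if n: "n \<in> T" for n
  proof
    assume "b n = 0"
    then have "cdot (cvec (e \<times> n)) (cp n) = 0" using bcp[OF n] by simp
    moreover have "n \<noteq> 0" using n T by auto
    ultimately have "cp n = 0" using planar_frame[OF e1 planeT(1)[OF n] _ dvp[OF n] cpe[OF n]] by blast
    then show False using cpnz n by blast
  qed
  have TS: "T \<subseteq> S" using bnz parts_outside(2) by blast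
  have brT: "bracket e S b g = bracket e T b g" for g
    by (rule bracket_support[OF S(1) TS]) (use bout in blast)
  have Lb: "bracket e S b (\<lambda>p. b p * of_real (p \<bullet> p)) q = 0" for q
    unfolding brT by (rule bracket_circle[OF T(1) bout planeT(2)])
  define b' where "b' n = \<i> * of_real r * b n" for n
  have om: "complex_of_real (om x) = (\<Sum>n\<in>T. b' n * wave n x)" for x
  proof -
    have "of_real r * complex_of_real (om x) = cdot (cvec e) (cvec (curl vpar x))"
      unfolding curl by (simp add: cvec_linear cdot_linear cdot_cvec ee)
    also have "\<dots> = (\<Sum>n\<in>T. wave n x * (\<i> * cdot (cvec e) (ccross (cvec n) (cp n))))"
      unfolding curl_fourier[OF vparx] by (simp add: cdot_sum cdot_linear mult.assoc)
    also have "\<dots> = (\<Sum>n\<in>T. of_real r * (b' n * wave n x))"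
    proof (rule sum.cong[OF refl])
      fix n assume n: "n \<in> T"
      have "cdot (cvec e) (ccross (cvec n) (cp n)) = cdot (cp n) (cvec (e \<times> n))"
        by (subst cdot_ccross_rotate) (simp add: ccross_cvec)
      also have "\<dots> = b n * of_real (r\<^sup>2)" using bcp[OF n] planeT(2)[OF n] by (simp add: cdot_commute dot_square_norm)
      finally show "wave n x * (\<i> * cdot (cvec e) (ccross (cvec n) (cp n))) = of_real r * (b' n * wave n x)"
        by (simp add: b'_def power2_eq_square mult_ac)
    qed
    also have "\<dots> = of_real r * (\<Sum>n\<in>T. b' n * wave n x)" by (rule sum_distrib_left[symmetric])
    finally show ?thesis using r by simp
  qed
  define z where "z = zero_mode (\<lambda>y. poly Q (om y))"
  \<comment> \<open>The subtracted mean \<open>z\<close> is absorbed by the constant coefficient of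
    the polynomial.\<close>
  define a where "a k = complex_of_real (coeff Q k) - (if k = 0 then of_real z else 0)" for k
  define K where "K = Suc (degree Q)"
  define h where "h q = (\<Sum>k<K. a k * (mulop T b' ^^ k) delta q)" for q
  have wh: "w q = h q" for q
  proof (rule trig_inject)
    show "finite {q. w q \<noteq> 0}" by (rule finite_subset[OF _ S(1)]) (use parts_outside in blast)
    show "finite {q. h q \<noteq> 0}" unfolding h_def by (rule finite_support_poly[OF T(1)])
    fix x
    have "trig w x = cdot (cvec e) (cvec (v x))"
      unfolding v by (subst trig_eq[OF S(1)]) (simp_all add: U0 cdot_sum cdot_linear perp_part_def mult.commute)
    also have "\<dots> = complex_of_real (vperp x)"
      using eP[OF vparP, of x] by (simp add: vx cdot_cvec inner_simps ee)
    also have "\<dots> = (\<Sum>k<K. complex_of_real (coeff Q k) * of_real (om x) ^ k) - of_real z"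
      by (simp add: vp z_def K_def poly_altdef lessThan_Suc_atMost)
    also have "\<dots> = (\<Sum>k<K. a k * of_real (om x) ^ k)"
    proof -
      have "(\<Sum>k<K. a k * of_real (om x) ^ k) = (\<Sum>k<K. complex_of_real (coeff Q k) * of_real (om x) ^ k)
         - (\<Sum>k<K. if k = 0 then complex_of_real z else 0)"
        unfolding sum_subtractf[symmetric] by (rule sum.cong) (auto simp: a_def algebra_simps)
      then show ?thesis by (simp add: K_def)
    qed
    also have "\<dots> = trig h x" unfolding h_def trig_poly[OF T(1)] om ..
    finally show "trig w x = trig h x" .
  qed
  have "stream_poly T b' w" unfolding stream_poly_def using wh unfolding h_def by blast
  then have "bracket e T b' w q = 0" for q by (rule stream_poly_imp_bracket_0[OF T(1)])
  then have "bracket e T b w q = 0" for q unfolding b'_def bracket_scale using r by simp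
  then have "bracket e S b w q = 0" for q unfolding brT .
  then show ?thesis by (rule planar_stationary[OF _ Lb q])
qed

lemma cases_stationary:
  assumes fe: "fourier_expansion v S U" and U0: "\<And>n. n \<notin> S \<Longrightarrow> U n = 0"
    and cs: "case_line S \<or> case_plane S v \<or> case_sphere S v" and q: "q \<noteq> 0"
  shows "leray q (euler_sum S U q) = 0"
  using cs
proof (elim disjE)
  assume "case_line S"
  then show ?thesis using case_line_stationary[OF fe U0 _ q] by blast
next
  assume "case_plane S v"
  then obtain P where "S \<subseteq> P" "perp_flow P v \<or> planar_circle_flow P v" unfolding case_plane_def by blast
  then show ?thesis using perp_flow_stationary[OF fe U0 _ _ q] planar_circle_flow_stationary[OF fe U0 _ _ q] by blast
next
  assume "case_sphere S v"
  then show ?thesis unfolding case_sphere_def using beltrami_flow_stationary[OF fe U0 _ q] by blast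
qed

theorem theorem1p4:
  fixes I :: "real set"
    and u :: "real \<Rightarrow> real^3 \<Rightarrow> real^3"
    and S :: "(real^3) set"
    and c :: "real^3 \<Rightarrow> real \<Rightarrow> complex^3"
  assumes "open I" "is_interval I" "I \<noteq> {}"
    and "fourier_expansion_on I u S c"
  shows "euler_solution I S c \<longleftrightarrow>
    (\<exists>v. (\<forall>t\<in>I. u t = v) \<and> fourier_support v S \<and>
       (case_line S \<or> case_plane S v \<or> case_sphere S v))"
proof
  have S: "finite S" "0 \<notin> S" "uminus ` S = S" and out: "\<And>n t. n \<notin> S \<Longrightarrow> t \<in> I \<Longrightarrow> c n t = 0"
    and nz: "\<And>n. n \<in> S \<Longrightarrow> \<exists>t\<in>I. c n t \<noteq> 0"
    and cc: "\<And>n t. n \<in> S \<Longrightarrow> t \<in> I \<Longrightarrow> c (- n) t = cconj (c n t) \<and> cdot (cvec n) (c n t) = 0"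
    and ux: "\<And>t x. t \<in> I \<Longrightarrow> cvec (u t x) = (\<Sum>n\<in>S. wave n x *s c n t)"
    using assms(4) unfolding fourier_expansion_on_def by auto
  obtain t0 where t0: "t0 \<in> I" using assms(3) by blast
  {
    assume sol: "euler_solution I S c"
    have F: "euler_flow I S c" by (rule euler_flow_of_solution[OF assms(1,4) sol])
    define U where "U n = c n t0" for n
    have cU: "c n t = U n" if "t \<in> I" for n t
      unfolding U_def by (rule flow_constant[OF F assms(1,2) that t0])
    have "u t x = u t0 x" if "t \<in> I" for t x
    proof -
      have "cvec (u t x) = cvec (u t0 x)" using ux[OF that] ux[OF t0] cU that t0 by simp
      then show ?thesis by simp
    qed
    then have ut: "\<forall>t\<in>I. u t = u t0" by blast
    have fe: "fourier_expansion (u t0) S U" unfolding fourier_expansion_def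
    proof (intro conjI ballI allI)
      fix n assume n: "n \<in> S"
      show "U n \<noteq> 0" using nz[OF n] cU by auto
      show "U (- n) = cconj (U n)" "cdot (cvec n) (U n) = 0" using cc[OF n t0] by (auto simp: U_def)
    qed (use S ux[OF t0] in \<open>auto simp: U_def\<close>)
    have "case_line S \<or> case_plane S (u t0) \<or> case_sphere S (u t0)"
    proof (rule stationary_classification[OF fe])
      show "U n = 0" if "n \<notin> S" for n using out[OF that t0] by (simp add: U_def)
      show "leray q (euler_sum S U q) = 0" if "q \<noteq> 0" for q
        using flow_stationary[OF F assms(1) t0 that] unfolding U_def .
    qed
    then show "\<exists>v. (\<forall>t\<in>I. u t = v) \<and> fourier_support v S \<and> (case_line S \<or> case_plane S v \<or> case_sphere S v)"
      using ut fe unfolding fourier_support_def by blast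
  next
    assume "\<exists>v. (\<forall>t\<in>I. u t = v) \<and> fourier_support v S \<and> (case_line S \<or> case_plane S v \<or> case_sphere S v)"
    then obtain v where uv: "\<And>t. t \<in> I \<Longrightarrow> u t = v" and fs: "fourier_support v S"
      and cs: "case_line S \<or> case_plane S v \<or> case_sphere S v" by blast
    obtain U' where fe': "fourier_expansion v S U'" using fs unfolding fourier_support_def by blast
    \<comment> \<open>The coefficients of an expansion of \<open>v\<close> are arbitrary off
      \<open>S\<close>; after extension by zero, independence of characters identifies them with
      \<open>c\<close> at every time.\<close>
    define U where "U n = (if n \<in> S then U' n else 0)" for n
    have fe: "fourier_expansion v S U"
    proof -
      have "- n \<in> S" if "n \<in> S" for n using S(3) that by blast
      then show ?thesis using fe' unfolding fourier_expansion_def U_def by simp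
    qed
    have U0: "U n = 0" if "n \<notin> S" for n using that by (simp add: U_def)
    have cU: "c n t = U n" if t: "t \<in> I" for n t
    proof (cases "n \<in> S")
      case True
      have "c n t - U n = 0"
      proof (rule wave_independent_vec[OF S(1) _ True])
        fix x
        have "(\<Sum>n\<in>S. wave n x *s c n t) = (\<Sum>n\<in>S. wave n x *s U n)"
          using ux[OF t] uv[OF t] fe unfolding fourier_expansion_def by metis
        then show "(\<Sum>n\<in>S. wave n x *s (c n t - U n)) = 0"
          by (simp add: vec.scale_right_diff_distrib sum_subtractf)
      qed
      then show ?thesis by simp
    next
      case False
      then show ?thesis using out t U0 by simp
    qed
    show "euler_solution I S c" unfolding euler_solution_def
    proof (intro ballI conjI)
      fix n t assume n: "n \<in> S \<union> ({n1 + n2 |n1 n2. n1 \<in> S \<and> n2 \<in> S} - {0})" and t: "t \<in> I"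
      have n0: "n \<noteq> 0" using n S(2) by auto
      have d: "(c n has_vector_derivative 0) (at t)"
        by (rule has_vector_derivative_transform_within_open[OF has_vector_derivative_const assms(1) t]) (rule cU[symmetric])
      show "c n differentiable at t" using d by (rule differentiableI_vector)
      have "vector_derivative (c n) (at t) = 0" using d by (rule vector_derivative_at)
      moreover have "leray n (euler_sum S (\<lambda>m. c m t) n) = 0"
        unfolding cU[OF t] by (rule cases_stationary[OF fe U0 cs n0])
      ultimately show "vector_derivative (c n) (at t) + (\<i> / 2) *s leray n
            (\<Sum>(n1, n2) \<in> {(n1, n2). n1 \<in> S \<and> n2 \<in> S \<and> n1 + n2 = n}.
               cdot (c n1 t) (cvec n2) *s c n2 t + cdot (c n2 t) (cvec n1) *s c n1 t) = 0"
        by (simp add: euler_sum_def)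
    qed
  }
qed

end
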